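(* Let $G$ be a simply connected semisimple Lie group with Lie algebra $\mathfrak g$ and let $H$ be a compact connected subgroup with Lie algebra $\mathfrak h$ such that the pair $(G,H)$ is indecomposable. Assume the isotropy representation $\chi(G,H)$ of $G/H$ is polar. Then there is a Cartan decomposition $\mathfrak g=\mathfrak k+\mathfrak p$ such that $\mathfrak h\subseteq\mathfrak k$. Moreover, $\chi(G^*,H)$ is polar and the pair $(G^*,H)$ is indecomposable, where $\mathfrak g^*=\mathfrak k+i\mathfrak p$ and $G^*$ is the simply connected Lie group with Lie algebra $\mathfrak g^*$.
   Context: A pair $(G,H)$ with $H\subseteq G$ is decomposable if $G\cong G_1\times G_2$ as a direct product of non-trivial factors and $H=H_1\times H_2$ with $H_i\subseteq G_i$ for $i=1,2$; otherwise it is indecomposable. The isotropy representation is $\chi(G,H)=\mathrm{Ad}_G|_H\ominus\mathrm{Ad}_H$, the linear action of $H$ on $T_{eH}G/H\cong\mathfrak g/\mathfrak h$. A linear representation of a compact group on a finite-dimensional real vector space is polar if, with respect to an invariant scalar product, there is a linear subspace (section) meeting all orbits and meeting each orbit orthogonally at every intersection point (independent of the choice of invariant scalar product). $\mathfrak g^*=\mathfrak k+i\mathfrak p$ is the real subalgebra of the complexification of $\mathfrak g$, a compact semisimple Lie algebra. In $(G^*,H)$, the symbol $H$ denotes the connected subgroup of $G^*$ with Lie algebra $\mathfrak h\subseteq\mathfrak k\subseteq\mathfrak g^*$.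
   Formalization: Indecomposability of (G*,H) is asserted only for nontrivial H: for H={e} it can fail, e.g. G=SL(2,C) gives an indecomposable pair while G*=SU(2)×SU(2) splits. The Cartan decomposition and polarity of χ(G*,H) are asserted for all H. *)

theory Defs
  imports "HOL-Analysis.Analysis" "HOL-Algebra.Group"
begin

section \<open>Smooth maps between open subsets of finite-dimensional spaces\<close>

text \<open>Manifolds are modelled on linear subspaces of a Euclidean space, so that all dimensions,
  including 0, occur for one ambient type. In \<open>Ck_on V S f k\<close>, the set \<open>S\<close> is relatively open in the
  subspace \<open>V\<close>; the derivative within \<open>S\<close> is then determined only in the directions of \<open>V\<close>, and only
  these are differentiated further.\<close>

primrec Ck_on :: "'v::real_normed_vector set \<Rightarrow> 'v set \<Rightarrow> ('v \<Rightarrow> 'w::real_normed_vector) \<Rightarrow> nat \<Rightarrow> bool"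
where
  "Ck_on V S f 0 \<longleftrightarrow> continuous_on S f" for f
| "Ck_on V S f (Suc k) \<longleftrightarrow>
     (\<exists>f'. (\<forall>x\<in>S. (f has_derivative f' x) (at x within S)) \<and>
           (\<forall>v\<in>V. Ck_on V S (\<lambda>x. f' x v) k))" for f

definition smooth_on :: "'v::real_normed_vector set \<Rightarrow> 'v set \<Rightarrow> ('v \<Rightarrow> 'w::real_normed_vector) \<Rightarrow> bool"
where
  "smooth_on V S f \<longleftrightarrow> (\<forall>k. Ck_on V S f k)"


section \<open>Lie groups\<close>

record ('a, 'v) lie_structure = "'a monoid" +
  topo :: "'a topology"
  model :: "'v set"
  atlas :: "('a set \<times> ('a \<Rightarrow> 'v)) set"

definition smooth_manifold :: "('a, 'v::euclidean_space) lie_structure \<Rightarrow> bool" where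
  "smooth_manifold M \<longleftrightarrow>
     topspace (topo M) = carrier M \<and> Hausdorff_space (topo M) \<and> second_countable (topo M) \<and>
     subspace (model M) \<and>
     (\<Union>(U, \<phi>)\<in>atlas M. U) = carrier M \<and>
     (\<forall>(U, \<phi>)\<in>atlas M.
        openin (topo M) U \<and> openin (top_of_set (model M)) (\<phi> ` U) \<and>
        homeomorphic_map (subtopology (topo M) U) (top_of_set (\<phi> ` U)) \<phi>) \<and>
     (\<forall>(U, \<phi>)\<in>atlas M. \<forall>(W, \<psi>)\<in>atlas M.
        smooth_on (model M) (\<phi> ` (U \<inter> W)) (\<lambda>u. \<psi> (inv_into U \<phi> u)))"

definition smooth_map ::
  "('a, 'v::euclidean_space) lie_structure \<Rightarrow> ('b, 'w::euclidean_space) lie_structure \<Rightarrow> ('a \<Rightarrow> 'b) \<Rightarrow> bool"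
where
  "smooth_map M N f \<longleftrightarrow>
     continuous_map (topo M) (topo N) f \<and>
     (\<forall>(U, \<phi>)\<in>atlas M. \<forall>(W, \<psi>)\<in>atlas N.
        smooth_on (model M) (\<phi> ` {x \<in> U. f x \<in> W}) (\<lambda>u. \<psi> (f (inv_into U \<phi> u))))"

definition lie_prod ::
  "('a, 'v) lie_structure \<Rightarrow> ('b, 'w) lie_structure \<Rightarrow> ('a \<times> 'b, 'v \<times> 'w) lie_structure"
where
  "lie_prod G K =
     \<lparr>carrier = carrier (G \<times>\<times> K), mult = mult (G \<times>\<times> K), one = one (G \<times>\<times> K),
      topo = prod_topology (topo G) (topo K),
      model = model G \<times> model K,
      atlas = {(U \<times> W, map_prod \<phi> \<psi>) |U \<phi> W \<psi>. (U, \<phi>) \<in> atlas G \<and> (W, \<psi>) \<in> atlas K}\<rparr>"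

definition lie_group :: "('a, 'v::euclidean_space) lie_structure \<Rightarrow> bool" where
  "lie_group G \<longleftrightarrow>
     group G \<and> smooth_manifold G \<and>
     smooth_map (lie_prod G G) G (\<lambda>(x, y). x \<otimes>\<^bsub>G\<^esub> y) \<and>
     smooth_map G G (\<lambda>x. inv\<^bsub>G\<^esub> x)"

definition lie_iso ::
  "('a, 'v::euclidean_space) lie_structure \<Rightarrow> ('b, 'w::euclidean_space) lie_structure \<Rightarrow> ('a \<Rightarrow> 'b) \<Rightarrow> bool"
where
  "lie_iso G K f \<longleftrightarrow> f \<in> iso G K \<and> smooth_map G K f \<and> smooth_map K G (inv_into (carrier G) f)"

text \<open>The counterpart for abstract topologies of \<^const>\<open>simply_connected\<close>.\<close>

definition simply_connected_space :: "'a topology \<Rightarrow> bool" where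
  "simply_connected_space X \<longleftrightarrow>
     path_connected_space X \<and>
     (\<forall>p q. pathin X p \<and> p 1 = p 0 \<and> pathin X q \<and> q 1 = q 0 \<longrightarrow>
        homotopic_with (\<lambda>r. r 1 = r 0) (top_of_set {0..1}) X p q)"


section \<open>The Lie algebra of a Lie group\<close>

text \<open>The tangent space at the identity is identified with \<^const>\<open>model\<close> by means of a fixed chart
  around the identity; \<open>curve_at_one G X\<close> is a curve through the identity, defined near 0, whose
  velocity at 0 is \<open>X\<close>.\<close>

definition chart_at_one :: "('a, 'v::euclidean_space) lie_structure \<Rightarrow> 'a set \<times> ('a \<Rightarrow> 'v)" where
  "chart_at_one G = (SOME c. c \<in> atlas G \<and> \<one>\<^bsub>G\<^esub> \<in> fst c)"

definition curve_at_one :: "('a, 'v::euclidean_space) lie_structure \<Rightarrow> 'v \<Rightarrow> real \<Rightarrow> 'a" where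
  "curve_at_one G X t =
     (case chart_at_one G of (U, \<phi>) \<Rightarrow> inv_into U \<phi> (\<phi> \<one>\<^bsub>G\<^esub> + t *\<^sub>R X))"

text \<open>The differential at the identity of a map that sends identity to identity.\<close>

definition diff_at_one ::
  "('a, 'v::euclidean_space) lie_structure \<Rightarrow> ('b, 'w::euclidean_space) lie_structure \<Rightarrow> ('a \<Rightarrow> 'b) \<Rightarrow> 'v \<Rightarrow> 'w"
where
  "diff_at_one G K f X =
     vector_derivative (\<lambda>t. snd (chart_at_one K) (f (curve_at_one G X t))) (at 0)"

definition Ad :: "('a, 'v::euclidean_space) lie_structure \<Rightarrow> 'a \<Rightarrow> 'v \<Rightarrow> 'v" where
  "Ad G g = diff_at_one G G (\<lambda>x. g \<otimes>\<^bsub>G\<^esub> x \<otimes>\<^bsub>G\<^esub> inv\<^bsub>G\<^esub> g)"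

text \<open>The bracket is given by \<open>ad = d(Ad)\<close> at the identity. It is meaningful on \<^const>\<open>model\<close> only.\<close>

definition lie_bracket :: "('a, 'v::euclidean_space) lie_structure \<Rightarrow> 'v \<Rightarrow> 'v \<Rightarrow> 'v" where
  "lie_bracket G X Y = vector_derivative (\<lambda>t. Ad G (curve_at_one G X t) Y) (at 0)"

text \<open>Lie subgroups are immersed: \<open>H\<close> carries its own topology and atlas. Since the inclusion is a
  homomorphism, it is an immersion as soon as its differential at the identity is injective.\<close>

definition lie_subgroup ::
  "('a, 'v::euclidean_space) lie_structure \<Rightarrow> ('a, 'v) lie_structure \<Rightarrow> bool"
where
  "lie_subgroup G H \<longleftrightarrow>
     lie_group H \<and> (\<lambda>x. x) \<in> hom H G \<and> smooth_map H G (\<lambda>x. x) \<and>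
     inj_on (diff_at_one H G (\<lambda>x. x)) (model H)"

definition subgroup_algebra ::
  "('a, 'v::euclidean_space) lie_structure \<Rightarrow> ('a, 'v) lie_structure \<Rightarrow> 'v set"
where
  "subgroup_algebra G H = diff_at_one H G (\<lambda>x. x) ` model H"


section \<open>Semisimple Lie algebras, Cartan decompositions, duality\<close>

text \<open>A real Lie algebra is given by a subspace \<open>V\<close> and a bracket on it. As in Helgason's book,
  semisimple means that the Killing form is nondegenerate.\<close>

definition trace_on :: "'v::euclidean_space set \<Rightarrow> ('v \<Rightarrow> 'v) \<Rightarrow> real" where
  "trace_on V f =
     (let B = (SOME B. independent B \<and> span B = V) in \<Sum>b\<in>B. representation B (f b) b)"

definition killing_form :: "'v::euclidean_space set \<Rightarrow> ('v \<Rightarrow> 'v \<Rightarrow> 'v) \<Rightarrow> 'v \<Rightarrow> 'v \<Rightarrow> real" where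
  "killing_form V br X Y = trace_on V (\<lambda>Z. br X (br Y Z))"

definition semisimple :: "'v::euclidean_space set \<Rightarrow> ('v \<Rightarrow> 'v \<Rightarrow> 'v) \<Rightarrow> bool" where
  "semisimple V br \<longleftrightarrow> (\<forall>X\<in>V. (\<forall>Y\<in>V. killing_form V br X Y = 0) \<longrightarrow> X = 0)"

definition direct_sum :: "'v::real_vector set \<Rightarrow> 'v set \<Rightarrow> 'v set \<Rightarrow> bool" where
  "direct_sum V k p \<longleftrightarrow>
     subspace k \<and> subspace p \<and> k \<inter> p = {0} \<and> V = {X + Y |X Y. X \<in> k \<and> Y \<in> p}"

definition cartan_decomposition ::
  "'v::euclidean_space set \<Rightarrow> ('v \<Rightarrow> 'v \<Rightarrow> 'v) \<Rightarrow> 'v set \<Rightarrow> 'v set \<Rightarrow> bool"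
where
  "cartan_decomposition V br k p \<longleftrightarrow>
     direct_sum V k p \<and>
     (\<forall>X\<in>k. \<forall>Y\<in>k. br X Y \<in> k) \<and> (\<forall>X\<in>k. \<forall>Y\<in>p. br X Y \<in> p) \<and> (\<forall>X\<in>p. \<forall>Y\<in>p. br X Y \<in> k) \<and>
     (\<forall>X\<in>k. X \<noteq> 0 \<longrightarrow> killing_form V br X X < 0) \<and>
     (\<forall>X\<in>p. X \<noteq> 0 \<longrightarrow> killing_form V br X X > 0)"

text \<open>The complexification consists of pairs \<open>(X, Y)\<close>, standing for \<open>X + iY\<close>. Hence
  \<open>\<gg>\<^sup>* = \<kk> + i\<pp>\<close> is the subspace \<open>\<kk> \<times> \<pp>\<close>, and \<open>\<hh> \<subseteq> \<kk>\<close> becomes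
  \<open>\<hh> \<times> {0}\<close>.\<close>

definition complexified_bracket ::
  "('v::real_vector \<Rightarrow> 'v \<Rightarrow> 'v) \<Rightarrow> 'v \<times> 'v \<Rightarrow> 'v \<times> 'v \<Rightarrow> 'v \<times> 'v"
where
  "complexified_bracket br = (\<lambda>(X, Y) (X', Y'). (br X X' - br Y Y', br X Y' + br Y X'))"

definition lie_algebra_iso ::
  "'v::real_vector set \<Rightarrow> ('v \<Rightarrow> 'v \<Rightarrow> 'v) \<Rightarrow> 'w::real_vector set \<Rightarrow> ('w \<Rightarrow> 'w \<Rightarrow> 'w) \<Rightarrow> ('v \<Rightarrow> 'w) \<Rightarrow> bool"
where
  "lie_algebra_iso V br W br' F \<longleftrightarrow>
     linear F \<and> bij_betw F V W \<and> (\<forall>X\<in>V. \<forall>Y\<in>V. F (br X Y) = br' (F X) (F Y))"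


section \<open>Polar representations\<close>

text \<open>Velocities at \<open>x\<close> of curves in the orbit of \<open>x\<close>. The orbit of a compact group is an embedded
  submanifold, so this is its tangent space.\<close>

definition orbit_tangent :: "'a set \<Rightarrow> ('a \<Rightarrow> 'v \<Rightarrow> 'v) \<Rightarrow> 'v::real_normed_vector \<Rightarrow> 'v set" where
  "orbit_tangent H \<rho> x =
     {v. \<exists>\<gamma>. (\<forall>t. \<gamma> t \<in> (\<lambda>h. \<rho> h x) ` H) \<and> \<gamma> 0 = x \<and> (\<gamma> has_vector_derivative v) (at (0::real))}"

definition invariant_scalar_product ::
  "'a set \<Rightarrow> ('a \<Rightarrow> 'v \<Rightarrow> 'v) \<Rightarrow> 'v::real_vector set \<Rightarrow> ('v \<Rightarrow> 'v \<Rightarrow> real) \<Rightarrow> bool"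
where
  "invariant_scalar_product H \<rho> W B \<longleftrightarrow>
     bilinear B \<and> (\<forall>x\<in>W. \<forall>y\<in>W. B x y = B y x) \<and> (\<forall>x\<in>W. x \<noteq> 0 \<longrightarrow> B x x > 0) \<and>
     (\<forall>h\<in>H. \<forall>x\<in>W. \<forall>y\<in>W. B (\<rho> h x) (\<rho> h y) = B x y)"

definition polar_representation ::
  "'a set \<Rightarrow> ('a \<Rightarrow> 'v \<Rightarrow> 'v) \<Rightarrow> 'v::real_normed_vector set \<Rightarrow> bool"
where
  "polar_representation H \<rho> W \<longleftrightarrow>
     (\<exists>B S. invariant_scalar_product H \<rho> W B \<and>
        subspace S \<and> S \<subseteq> W \<and>
        (\<forall>x\<in>W. \<exists>h\<in>H. \<rho> h x \<in> S) \<and>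
        (\<forall>x\<in>S. \<forall>v\<in>orbit_tangent H \<rho> x. \<forall>y\<in>S. B v y = 0))"

text \<open>The isotropy representation \<open>Ad\<^sub>G|\<^sub>H \<ominus> Ad\<^sub>H\<close> on \<open>\<gg>/\<hh>\<close> is realised on an
  \<open>Ad(H)\<close>-invariant complement \<open>\<mm>\<close> of \<open>\<hh>\<close> in \<open>\<gg>\<close>; the projection
  \<open>\<mm> \<rightarrow> \<gg>/\<hh>\<close> is an equivalence, so the choice of \<open>\<mm>\<close> is immaterial.\<close>

definition polar_isotropy ::
  "('a, 'v::euclidean_space) lie_structure \<Rightarrow> ('a, 'v) lie_structure \<Rightarrow> bool"
where
  "polar_isotropy G H \<longleftrightarrow>
     (\<exists>m. direct_sum (model G) (subgroup_algebra G H) m \<and>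
          (\<forall>h\<in>carrier H. \<forall>x\<in>m. Ad G h x \<in> m) \<and>
          polar_representation (carrier H) (Ad G) m)"


section \<open>Decomposable pairs\<close>

text \<open>Requiring the factors to live on the same types as \<open>G\<close> is no restriction, since they are
  isomorphic to Lie subgroups of \<open>G\<close>. The subsets \<open>H1\<close>, \<open>H2\<close> may be trivial.\<close>

definition decomposable_pair :: "('a, 'v::euclidean_space) lie_structure \<Rightarrow> 'a set \<Rightarrow> bool" where
  "decomposable_pair G H \<longleftrightarrow>
     (\<exists>(G1 :: ('a, 'v) lie_structure) (G2 :: ('a, 'v) lie_structure) f H1 H2.
        lie_group G1 \<and> lie_group G2 \<and>
        carrier G1 \<noteq> {\<one>\<^bsub>G1\<^esub>} \<and> carrier G2 \<noteq> {\<one>\<^bsub>G2\<^esub>} \<and>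
        lie_iso G (lie_prod G1 G2) f \<and>
        H1 \<subseteq> carrier G1 \<and> H2 \<subseteq> carrier G2 \<and> f ` H = H1 \<times> H2)"

abbreviation indecomposable_pair :: "('a, 'v::euclidean_space) lie_structure \<Rightarrow> 'a set \<Rightarrow> bool" where
  "indecomposable_pair G H \<equiv> \<not> decomposable_pair G H"

end

theory Submission
 imports Defs
begin

text \<open>Let \<open>V\<close> be the space of pairs \<open>(m, S)\<close> of a bracket \<open>m\<close> and the inverse \<open>S\<close> of its Killing form, with the
 \<open>Ad H\<close>-invariant scalar product given by compactness. A vector of minimal norm in the orbit closure under
 the centralizer of \<open>Ad H\<close> in \<open>GL(\<gg>)\<close> has a transposition-closed adjoint algebra; as semisimple
 brackets are rigid, it lies in the orbit. Transposition is then a Cartan involution that commutes with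
 \<open>Ad H\<close>, whence \<open>\<hh> \<subseteq> \<kk>\<close>.

 As \<open>Ad H\<close> preserves \<open>\<kk>\<close> and \<open>\<pp>\<close>, the linear groups \<open>Ad H\<close> on \<open>\<gg>\<close> and on \<open>\<gg>\<^sup>*\<close> coincide, and so do the isotropy
 representations up to a linear isomorphism. A product decomposition of \<open>(G\<^sup>*, H)\<close> gives a projection of
 \<open>\<gg>\<^sup>*\<close> onto an ideal that preserves \<open>\<hh>\<close>. With its conjugate by the involution it yields such a projection of
 \<open>\<gg>\<close>, and as \<open>G\<close> is simply connected, the splitting of \<open>\<gg>\<close> integrates to one of \<open>(G, H)\<close>.\<close>

text \<open>Keeping the inverse \<open>S\<close> next to the bracket makes semisimplicity a closed
  condition: the equation between \<open>S\<close> and the Killing form survives limits,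
  nondegeneracy alone does not. Minimality is known only along the centralizer of
  \<open>Ad H\<close>; criticality in every direction follows because the gradient commutes with
  \<open>Ad H\<close>.

  The subgroup on the dual side shares with \<open>H\<close> only its Lie algebra and is not known
  to be compact. Everything is therefore compared through the linear maps \<open>Ad\<close>, and
  compactness of \<open>H\<close> has to work for both sides: the image of \<hh> under a projection
  of the dual group is recognized inside \<hh> by a limit argument in \<open>H\<close>.

  A splitting of \<gg> into commuting ideals is integrated without a subgroup theorem: the pointwise
  stabilizer of one ideal under \<open>Ad\<close> serves as the subgroup of the other.

  Indecomposability of the dual pair is claimed for nontrivial \<open>H\<close> only. For a complex
  simple algebra regarded as real, with \<hh> = 0, the dual algebra is a sum of two copies of the
  compact form.\<close>

notation has_vector_derivative (infix "hvd" 50)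
notation LIMSEQ ("((_)/ ----> (_))" [60, 60] 60)
lemmas hvd_transform = has_vector_derivative_transform_within_open
lemmas linear_bounded = linear_conv_bounded_linear[THEN iffD1]
lemmas group_hom_defs = group_hom_def group_hom_axioms_def

section \<open>Semisimple Lie algebras: the Casimir homotopy\<close>

text \<open>Both sides contract \<open>f\<close> with the tensor sum of \<open>A e\<close> and
  \<open>e\<close>, expanded once in the first slot and once in the second. Traces, orthogonal
  changes of basis and the Casimir tensor are all handled by this rule.\<close>

lemma sum_adjoint:
 fixes A :: "'v::euclidean_space => 'v" and f :: "'v => 'v => 'w::real_vector"
 assumes A: "linear A" and f: "bilinear f"
 shows "(SUM e:Basis. f (A e) e) = (SUM e:Basis. f e (adjoint A e))"
proof -
 have l: "linear (%x. f x y)" "linear (f y)" for y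
  using f by (auto simp: bilinear_def)
 have "f (A e) e = (SUM j:Basis. (A e \<bullet> j) *\<^sub>R f j e)" for e
  by (subst (1) euclidean_representation[symmetric])
   (simp add: linear_sum[OF l(1)] linear_scale[OF l(1)])
 moreover have "f j (adjoint A j) = (SUM e:Basis. (A e \<bullet> j) *\<^sub>R f j e)" for j
 proof -
  have "adjoint A j = (SUM e:Basis. (A e \<bullet> j) *\<^sub>R e)"
   using euclidean_representation[of "adjoint A j"]
   by (simp add: inner_commute[of "adjoint A j"] adjoint_works[OF A])
  then show ?thesis by (simp add: linear_sum[OF l(2)] linear_scale[OF l(2)])
 qed
 ultimately show ?thesis
  by simp (rule sum.swap)
qed

lemma trace_mult_commute:
 fixes A C :: "'v::euclidean_space => 'v"
 assumes "linear A" "linear C"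
 shows "(SUM e:Basis. A (C e) \<bullet> e) = (SUM e:Basis. C (A e) \<bullet> e)"
proof -
 have "bilinear (%x y. A x \<bullet> y)"
  using assms by (auto simp: bilinear_def linear_iff algebra_simps)
 from sum_adjoint[OF assms(2) this] show ?thesis
  by (simp add: adjoint_works[OF assms(2)] inner_commute)
qed

text \<open>The trace runs over the orthonormal basis of the ambient space. For a bracket with
  values in a subspace it equals the trace over that subspace, and no basis of the subspace has to
  be chosen.\<close>

definition kp :: "('v => 'v => 'v::euclidean_space) => 'v => 'v => real" where
 "kp m x y = (SUM e:Basis. m x (m y e) \<bullet> e)"

text \<open>The Lie algebra is the image of the orthogonal projection \<open>P\<close>, its bracket being extended by 0
 to the orthogonal complement; \<open>S\<close> is the inverse of the Killing form.\<close>

locale killing_alg =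
 fixes P S :: "'v::euclidean_space => 'v" and m :: "'v => 'v => 'v"
 assumes linP: "linear P" and symP: "P x \<bullet> y = x \<bullet> P y" and PP: "P (P x) = P x"
  and linS: "linear S" and PS: "P (S x) = S x" and SP: "S (P x) = S x"
  and bil: "bilinear m" and anti: "m x y = - m y x"
  and jac: "m x (m y z) = m (m x y) z + m y (m x z)"
  and mP: "m (P x) y = m x y" and Pm: "P (m x y) = m x y"
  and kS: "kp m (S x) y = P x \<bullet> y"
begin

lemma lin: "linear (m x)" "linear (%x. m x y)"
 using bil by (auto simp: bilinear_def)

lemmas ml = bilinear_ladd[OF bil] bilinear_radd[OF bil] bilinear_lmul[OF bil] bilinear_rmul[OF bil]
 bilinear_lneg[OF bil] bilinear_rneg[OF bil] bilinear_lzero[OF bil] bilinear_rzero[OF bil]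
 bilinear_lsub[OF bil] bilinear_rsub[OF bil]

lemma mP2: "m x (P y) = m x y"
 using mP anti by metis

lemma kp_sym: "kp m x y = kp m y x"
 unfolding kp_def by (rule trace_mult_commute[OF lin(1) lin(1)])

lemma kp_bilinear: "bilinear (kp m)"
 unfolding bilinear_def kp_def
 by (auto intro!: linearI simp: ml inner_add_left sum.distrib sum_distrib_left)

lemma kp_inv: "kp m (m x y) z = - kp m y (m x z)"
proof -
 have mm: "m (m x y) u = m x (m y u) - m y (m x u)" for x y u
  by (simp add: jac[of x y])
 have "kp m (m x y) z = (SUM e:Basis. m x (m y (m z e)) \<bullet> e) - (SUM e:Basis. m y (m x (m z e)) \<bullet> e)"
  unfolding kp_def mm by (simp add: inner_diff_left sum_subtractf)
 moreover have "kp m y (m x z) = (SUM e:Basis. m y (m x (m z e)) \<bullet> e) - (SUM e:Basis. m y (m z (m x e)) \<bullet> e)"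
  unfolding kp_def mm by (simp add: ml inner_diff_left sum_subtractf)
 moreover have "(SUM e:Basis. m x (m y (m z e)) \<bullet> e) = (SUM e:Basis. m y (m z (m x e)) \<bullet> e)"
  using trace_mult_commute[OF lin(1)[of x], of "%e. m y (m z e)"] linear_compose[OF lin(1)[of z] lin(1)[of y]]
  by (simp add: o_def)
 ultimately show ?thesis by linarith
qed

text \<open>With the inverse at hand, nondegeneracy is the evaluation of the form at
  \<open>S u\<close> and \<open>u\<close>, which gives the squared norm of \<open>u\<close>.\<close>

lemma kp_nondegenerate:
 assumes "!!z. kp m u z = 0" "P u = u" shows "u = 0"
proof -
 have "kp m (S u) u = P u \<bullet> u" by (rule kS)
 then show ?thesis using assms kp_sym by (metis inner_eq_zero_iff)
qed

text \<open>Dual to the invariance of the Killing form: \<open>S\<close>, regarded as a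
  contravariant 2-tensor, is annihilated by the derivations \<open>m x\<close>.\<close>

lemma ad_S: "m x (S y) = - S (adjoint (m x) y)"
proof -
 have "kp m (m x (S y) + S (adjoint (m x) y)) z = 0" for z
 proof -
  have "kp m (m x (S y)) z = - (P y \<bullet> m x z)" by (simp add: kp_inv kS)
  also have "... = - (y \<bullet> m x z)" by (simp add: symP Pm)
  moreover have "kp m (S (adjoint (m x) y)) z = m x (P z) \<bullet> y"
   by (simp add: kS symP inner_commute[of "adjoint (m x) y"] adjoint_works[OF lin(1)])
  ultimately show ?thesis by (simp add: bilinear_ladd[OF kp_bilinear] mP2 inner_commute)
 qed
 moreover have "P (m x (S y) + S (adjoint (m x) y)) = m x (S y) + S (adjoint (m x) y)"
  by (simp add: linear_add[OF linP] Pm PS)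
 ultimately have "m x (S y) + S (adjoint (m x) y) = 0" by (rule kp_nondegenerate)
 then show ?thesis by (simp add: eq_neg_iff_add_eq_0)
qed

text \<open>The tensor sum of \<open>e\<close> and \<open>S e\<close> is the Casimir tensor; its
  invariance is \<open>ad_S\<close> moved from one factor to the other by
  \<open>sum_adjoint\<close>.\<close>

lemma casimir_invariant:
 assumes "bilinear f"
 shows "(SUM e:Basis. f (m x e) (S e)) + (SUM e:Basis. f e (m x (S e))) = 0"
proof -
 have "bilinear (%u v. f u (S v))"
  using assms linS by (auto simp: bilinear_def linear_iff)
 from sum_adjoint[OF lin(1)[of x] this] show ?thesis
  by (simp add: ad_S bilinear_rneg[OF assms] sum_negf)
qed

text \<open>The Casimir element of the Killing form acts as the identity on the adjoint
  representation, since pairing the sum with \<open>y\<close> turns it into the trace of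
  \<open>m x\<close> composed with \<open>m y\<close>.\<close>

lemma casimir: "(SUM e:Basis. m e (m (S e) x)) = P x"
proof -
 let ?C = "SUM e:Basis. m e (m (S e) x)"
 have "kp m (m e (m (S e) x)) y = m x (m y e) \<bullet> e" for e y
 proof -
  have "kp m (m e (m (S e) x)) y = - kp m (m (S e) x) (m e y)" by (rule kp_inv)
  also have "... = kp m (m x (S e)) (m e y)" by (subst anti) (simp add: bilinear_lneg[OF kp_bilinear])
  also have "... = - (e \<bullet> m x (m e y))" by (simp add: kp_inv kS symP Pm)
  also have "... = m x (m y e) \<bullet> e" by (subst anti[of e y]) (simp add: ml inner_commute)
  finally show ?thesis .
 qed
 then have "kp m ?C y = kp m x y" for y
  using kp_bilinear by (simp add: bilinear_def linear_sum[of "%u. kp m u y"]) (simp add: kp_def)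
 then have "kp m (?C - P x) y = 0" for y
  by (simp add: bilinear_lsub[OF kp_bilinear]) (simp add: kp_def mP)
 moreover have "P (?C - P x) = ?C - P x"
  by (simp add: linear_diff[OF linP] linear_sum[OF linP] Pm PP)
 ultimately have "?C - P x = 0" by (rule kp_nondegenerate)
 then show ?thesis by simp
qed

text \<open>Contraction of a 2-cochain with the Casimir tensor: the homotopy behind the second
  Whitehead lemma for the adjoint representation. An explicit operator is wanted because its size
  and its equivariance can be read off.\<close>

definition hom1 :: "('v => 'v => 'v) => 'v => 'v" where
 "hom1 w x = (SUM e:Basis. m e (w (S e) x))"

text \<open>The Chevalley-Eilenberg differential of a 2-cochain with values in the adjoint
  representation.\<close>

definition d2 :: "('v => 'v => 'v) => 'v => 'v => 'v => 'v" where
 "d2 w x y z = m x (w y z) - m y (w x z) + m z (w x y) - w (m x y) z + w (m x z) y - w (m y z) x"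

text \<open>The homotopy formula: the coboundary of \<open>hom1 w\<close> plus the contraction of
  \<open>d2 w\<close> is the Casimir element applied to \<open>w\<close>, hence \<open>w\<close>
  itself. All other terms cancel by invariance of the Casimir tensor.\<close>

lemma hom1_identity:
 assumes w: "bilinear w" and aw: "!!x y. w x y = - w y x" and Pw: "!!x y. P (w x y) = w x y"
 shows "m x (hom1 w y) - m y (hom1 w x) - hom1 w (m x y) + (SUM e:Basis. m e (d2 w (S e) x y)) = w x y"
proof -
 have inv: "(SUM e:Basis. m e (w (m x (S e)) y)) = - (SUM e:Basis. m (m x e) (w (S e) y))" for x y
  unfolding eq_neg_iff_add_eq_0 by (subst add.commute, rule casimir_invariant)
   (use w in "auto simp: bilinear_def linear_iff ml")
 have mh: "m x (hom1 w y) = (SUM e:Basis. m (m x e) (w (S e) y)) + (SUM e:Basis. m e (m x (w (S e) y)))" for x y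
  unfolding hom1_def linear_sum[OF lin(1)] sum.distrib[symmetric] by (simp add: jac[of x])
 have flip: "m e (w (m (S e) x) y) = - m e (w (m x (S e)) y)" for e x y
  by (subst anti[of "S e" x]) (simp add: bilinear_lneg[OF w] ml)
 have "m e (d2 w (S e) x y) = m e (m (S e) (w x y)) - m e (m x (w (S e) y)) + m e (m y (w (S e) x))
   + m e (w (m x (S e)) y) - m e (w (m y (S e)) x) + m e (w (S e) (m x y))" for e
  unfolding d2_def aw[of "m x y" "S e"] using flip by (simp add: ml algebra_simps)
 then have "(SUM e:Basis. m e (d2 w (S e) x y)) = (SUM e:Basis. m e (m (S e) (w x y)))
   - (SUM e:Basis. m e (m x (w (S e) y))) + (SUM e:Basis. m e (m y (w (S e) x)))
   + (SUM e:Basis. m e (w (m x (S e)) y)) - (SUM e:Basis. m e (w (m y (S e)) x))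
   + hom1 w (m x y)"
  by (simp add: sum.distrib sum_subtractf hom1_def)
 then show ?thesis
  unfolding mh inv by (simp add: casimir Pw)
qed
end

section \<open>Rigidity of semisimple Lie algebras\<close>

text \<open>Linear and bilinear maps are handled through their values at basis vectors, so
  compactness of a bounded set of such maps is the extraction of one subsequence for finitely many
  sequences of vectors.\<close>

lemma finite_pointwise_subsequence:
 fixes f :: "nat => 'i => 'w::euclidean_space"
 assumes "finite I" "!!n i. i:I ==> norm (f n i) <= B"
 shows "EX r l. strict_mono (r :: nat => nat) & (ALL i:I. (%n. f (r n) i) ----> l i)"
 using assms
proof (induction I rule: finite_induct)
 case empty
 then show ?case by (intro exI[of _ id]) (auto simp: strict_mono_def)
next
 case (insert j I)
 then obtain r l where r: "strict_mono (r :: nat => nat)" "ALL i:I. (%n. f (r n) i) ----> l i"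
  by auto
 have "bounded (range (%n. f (r n) j))"
  using insert.prems by (auto simp: bounded_iff)
 then obtain y s where s: "strict_mono (s :: nat => nat)" "((%n. f (r n) j) \<circ> s) ----> y"
  using bounded_imp_convergent_subsequence by blast
 have "ALL i:insert j I. (%n. f ((r \<circ> s) n) i) ----> (l(j := y)) i"
  using s(2) insert.hyps LIMSEQ_subseq_LIMSEQ[OF _ s(1)] r(2) by (auto simp: o_def)
 then show ?case using strict_mono_o[OF r(1) s(1)] by blast
qed

section \<open>Norms and limits of linear and bilinear maps\<close>

definition nl :: "('v::euclidean_space => 'w::real_normed_vector) => real" where
 "nl A = (SUM i:Basis. norm (A i))"

definition nb :: "('v::euclidean_space => 'v => 'w::real_normed_vector) => real" where
 "nb w = (SUM i:Basis. nl (w i))"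

lemma nl_nonneg [simp]: "0 <= nl A" and nb_nonneg [simp]: "0 <= nb w"
 by (auto simp: nl_def nb_def intro!: sum_nonneg)

lemma norm_linear_le:
 assumes "linear A" shows "norm (A x) <= nl A * norm x"
proof -
 interpret linear A by fact
 have "A x = (SUM i:Basis. (x \<bullet> i) *\<^sub>R A i)"
  by (subst euclidean_representation[symmetric, of x]) (simp add: sum scale)
 then have "norm (A x) <= (SUM i:Basis. norm ((x \<bullet> i) *\<^sub>R A i))"
  by (metis norm_sum)
 also have "... <= (SUM i:Basis. norm x * norm (A i))"
  by (intro sum_mono) (auto simp: Basis_le_norm mult_right_mono)
 finally show ?thesis by (simp add: nl_def sum_distrib_left mult.commute)
qed

lemma norm_bilinear_le:
 assumes "bilinear w" shows "norm (w x y) <= nb w * norm x * norm y"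
proof -
 have l: "linear (w x)" "linear (%x. w x y)" for x y
  using assms by (auto simp: bilinear_def)
 have "norm (w x y) <= nl (%x. w x y) * norm x"
  by (rule norm_linear_le[OF l(2)])
 also have "nl (%x. w x y) <= nb w * norm y"
  unfolding nl_def[of "%x. w x y"] nb_def sum_distrib_right by (intro sum_mono norm_linear_le l)
 then have "nl (%x. w x y) * norm x <= nb w * norm y * norm x" by (simp add: mult_right_mono)
 finally show ?thesis by (simp add: mult_ac)
qed

lemma nl_le: "(!!i. i:Basis ==> norm (A i) <= c) ==> nl (A :: 'v::euclidean_space => _) <= DIM('v) * (c::real)"
 unfolding nl_def using sum_bounded_above[of Basis "%i. norm (A i)" c] by simp

lemma nb_le: "(!!i j. i:Basis ==> j:Basis ==> norm (w i j) <= c) ==> nb (w :: 'v::euclidean_space => _) <= DIM('v) * (DIM('v) * (c::real))"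
 unfolding nb_def using sum_bounded_above[of Basis "%i. nl (w i)" "DIM('v) * c"] nl_le[of "w i" c for i] by simp

lemma linear_tendsto:
 fixes k :: "'v::euclidean_space => 'w::euclidean_space"
 assumes "linear k" "(f \<longlongrightarrow> l) F" shows "((%n. k (f n)) \<longlongrightarrow> k l) F"
 by (rule bounded_linear.tendsto[OF linear_bounded[OF assms(1)] assms(2)])

lemma bilinear_tendsto:
 fixes w :: "'v::euclidean_space => 'u::euclidean_space => 'w::euclidean_space"
 assumes "bilinear w" "(f \<longlongrightarrow> a) F" "(g \<longlongrightarrow> b) F" shows "((%n. w (f n) (g n)) \<longlongrightarrow> w a b) F"
 using assms bilinear_conv_bounded_bilinear bounded_bilinear.tendsto by blast

lemma linear_pointwise_limit:
 fixes G :: "nat => 'v::euclidean_space => 'w::euclidean_space"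
 assumes "!!n. linear (G n)" "!!i. i:Basis ==> (%n. G n i) ----> l i"
 shows "EX L. linear L & (ALL x. (%n. G n x) ----> L x)"
proof (intro exI conjI allI)
 let ?L = "%x. SUM i:Basis. (x \<bullet> i) *\<^sub>R l i"
 show "linear ?L" by (auto intro!: linearI simp: inner_add_left sum.distrib scaleR_add_left scaleR_sum_right)
 fix x
 have "G n x = (SUM i:Basis. (x \<bullet> i) *\<^sub>R G n i)" for n
  by (subst euclidean_representation[symmetric, of x]) (simp add: linear_sum[OF assms(1)] linear_scale[OF assms(1)])
 then show "(%n. G n x) ----> ?L x" by (auto intro!: tendsto_intros assms(2))
qed

text \<open>Lower semicontinuity is asked for only along sequences on which \<open>N\<close>
  converges: one of the functions to be minimized is a supremum over a group.\<close>

lemma linear_minimum: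
 fixes \<G> :: "('v::euclidean_space => 'w::euclidean_space) set"
 assumes ne: "\<G> ~= {}" and lin: "!!G. G:\<G> ==> linear G" and bd: "!!G. G:\<G> ==> nl G <= B"
  and cl: "!!G L. (!!n::nat. G n:\<G>) ==> linear L ==> (!!x. (%n. G n x) ----> L x) ==> L:\<G>"
  and lsc: "!!G L a. (!!n::nat. G n:\<G>) ==> linear L ==> (!!x. (%n. G n x) ----> L x) ==>
   (%n. N (G n)) ----> a ==> N L <= a"
  and nn: "!!G. G:\<G> ==> (0::real) <= N G"
 shows "EX G:\<G>. ALL G':\<G>. N G <= N G'"
proof -
 let ?a = "INF G\<in>\<G>. N G"
 have bb: "bdd_below (N ` \<G>)" using nn by (auto intro!: bdd_belowI[of _ 0])
 have "EX G:\<G>. N G < ?a + 1 / Suc n" for n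
  using cINF_less_iff[OF ne bb, of "?a + 1 / Suc n"] by auto
 then obtain G where G: "G n:\<G>" "N (G n) < ?a + 1 / Suc n" for n by metis
 have lo: "?a <= N (G n)" for n using cINF_lower[OF bb G(1)] .
 have "norm (G n i) <= B" if "i:Basis" for n i
  using norm_linear_le[OF lin[OF G(1)], of n i] bd[OF G(1)[of n]] that by simp
 then obtain r l where r: "strict_mono (r :: nat => nat)" "!!i. i:Basis ==> (%n. G (r n) i) ----> l i"
  using finite_pointwise_subsequence[of Basis G B] by (metis finite_Basis)
 obtain L where L: "linear L" "!!x. (%n. G (r n) x) ----> L x"
  using linear_pointwise_limit[of "%n. G (r n)" l] r(2) lin[OF G(1)] by blast
 have "(%n. N (G n)) ----> ?a"
 proof (rule tendsto_sandwich[OF _ _ tendsto_const])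
  show "(%n. ?a + 1 / Suc n) ----> ?a"
   using tendsto_add[OF tendsto_const[of ?a] LIMSEQ_inverse_real_of_nat] by (simp add: inverse_eq_divide)
  show "\<forall>\<^sub>F n in sequentially. ?a <= N (G n)" "\<forall>\<^sub>F n in sequentially. N (G n) <= ?a + 1 / Suc n"
   using lo G(2) by (auto intro!: always_eventually less_imp_le)
 qed
 then have "(%n. N (G (r n))) ----> ?a"
  using LIMSEQ_subseq_LIMSEQ[OF _ r(1)] by (auto simp: o_def)
 then have "N L <= ?a" by (rule lsc[OF G(1) L])
 moreover have "L:\<G>" by (rule cl[OF G(1) L])
 ultimately show ?thesis using cINF_lower[OF bb] by (meson order_trans)
qed

text \<open>The perturbation moves every vector by at most half its norm, so norms change at most by
  a factor 2 in either direction.\<close>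

lemma near_identity:
 fixes G :: "'v::euclidean_space => 'v"
 assumes G: "linear G" and le: "nl (%x. G x - x) <= 1/2"
 shows "bij G" "linear (inv_into UNIV G)" "norm (G x) <= 2 * norm x" "norm (inv_into UNIV G x) <= 2 * norm x"
proof -
 have "linear (%x. G x - x)" using G by (auto simp: linear_iff algebra_simps)
 then have d: "norm (G x - x) <= norm x / 2" for x
  using norm_linear_le[of "%x. G x - x" x] mult_right_mono[OF le, of "norm x"] by simp
 have lo: "norm x <= 2 * norm (G x)" for x
  using d[of x] norm_triangle_ineq2[of x "x - G x"] by (simp add: norm_minus_commute)
 have "inj G" unfolding linear_injective_0[OF G] using lo by (metis norm_le_zero_iff norm_zero mult_zero_right)
 then show b: "bij G" using linear_injective_imp_surjective[OF G] by (simp add: bij_def)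
 show "linear (inv_into UNIV G)" by (rule inj_linear_imp_inv_linear[OF G bij_is_inj[OF b]])
 have "norm (G x) <= norm x + norm (G x - x)" using norm_triangle_ineq[of x "G x - x"] by simp
 then show "norm (G x) <= 2 * norm x" using d[of x] norm_ge_zero[of x] by linarith
 show "norm (inv_into UNIV G x) <= 2 * norm x"
  using lo[of "inv_into UNIV G x"] b by (simp add: bij_is_surj surj_f_inv_f)
qed

text \<open>Lie brackets on the image of \<open>P\<close>, extended by zero, for which
  \<open>K\<close> acts by automorphisms. Extended in this way all of them are bilinear maps on one
  space, so that their distance makes sense.\<close>

definition eq_lie :: "('v::real_vector => 'v) => ('v => 'v) set => ('v => 'v => 'v) => bool" where
 "eq_lie P K m \<longleftrightarrow> bilinear m & (ALL x y. m x y = - m y x) &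
   (ALL x y z. m x (m y z) = m (m x y) z + m y (m x z)) &
   (ALL x y. m (P x) y = m x y & P (m x y) = m x y) & (ALL k:K. ALL x y. m (k x) (k y) = k (m x y))"

lemma orthogonal_adjoint:
 fixes k :: "'v::euclidean_space => 'v"
 assumes "orthogonal_transformation k"
 shows "adjoint k (k x) = x" "k (adjoint k x) = x"
proof -
 have l: "linear k" using assms by (simp add: orthogonal_transformation_def)
 show 1: "adjoint k (k x) = x" for x
  by (rule vector_eq_rdot[THEN iffD1]) (use assms in "simp add: adjoint_clauses[OF l] orthogonal_transformation_def")
 obtain y where "x = k y" using orthogonal_transformation_surj[OF assms] by (metis surjD)
 then show "k (adjoint k x) = x" by (simp add: 1)
qed

lemma sum_orthogonal:
 fixes k :: "'v::euclidean_space => 'v" and f :: "'v => 'v => 'w::real_vector"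
 assumes k: "orthogonal_transformation k" and f: "bilinear f"
 shows "(SUM e:Basis. f e e) = (SUM e:Basis. f (k e) (k e))"
proof -
 have l: "linear k" using k by (simp add: orthogonal_transformation_def)
 have "bilinear (%u v. f u (k v))" using f l by (auto simp: bilinear_def linear_iff)
 from sum_adjoint[OF l this] show ?thesis by (simp add: orthogonal_adjoint[OF k])
qed

context killing_alg
begin

lemma norm_hom1:
 assumes w: "bilinear w"
 shows "norm (hom1 w x) <= DIM('v) * nb m * nl S * nb w * norm x"
proof -
 have "norm (m e (w (S e) x)) <= nb m * nl S * nb w * norm x" if "e:Basis" for e
 proof -
  have "norm (w (S e) x) <= nb w * (nl S * 1) * norm x"
   by (rule order_trans[OF norm_bilinear_le[OF w]])
   (use norm_linear_le[OF linS, of e] that in "auto intro!: mult_mono")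
  then have "nb m * norm e * norm (w (S e) x) <= nb m * norm e * (nb w * (nl S * 1) * norm x)"
   by (intro mult_left_mono) auto
  then show ?thesis using norm_bilinear_le[OF bil, of e "w (S e) x"] that by (simp add: mult_ac)
 qed
 then show ?thesis unfolding hom1_def
  using sum_norm_bound[of Basis "%e. m e (w (S e) x)" "nb m * nl S * nb w * norm x"] by (simp add: mult_ac)
qed

text \<open>If the bracket \<open>m + w\<close> satisfies the Jacobi identity, then the coboundary of \<open>w\<close> is quadratic in
 \<open>w\<close>. Thus \<open>w\<close> is the coboundary of \<open>hom1 w\<close> up to a quadratic error.\<close>

lemma deformation_error:
 assumes w: "bilinear w" and aw: "!!x y. w x y = - w y x" and Pw: "!!x y. P (w x y) = w x y"
  and j: "!!x y z. m x (m y z + w y z) + w x (m y z + w y z)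
   = m (m x y + w x y) z + w (m x y + w x y) z + (m y (m x z + w x z) + w y (m x z + w x z))"
  and W: "nb w <= 1" and b: "b = (%x. - hom1 w x)" and C: "C = DIM('v) * nb m * nl S"
 shows "norm (m (x + b x) (y + b y) + w (x + b x) (y + b y) - (m x y + b (m x y)))
   <= (5 * C + nb m * C^2 + C^2) * (nb w)^2 * norm x * norm y"
proof -
 let ?W = "nb w"
 have C0: "0 <= C" by (simp add: C)
 \<comment> \<open>The Jacobi identity of \<open>m + w\<close> minus that of \<open>m\<close>: the
   part linear in \<open>w\<close> is \<open>d2 w\<close>, so \<open>d2 w\<close> equals the
   quadratic part.\<close>
 have d2: "d2 w x y z = w (w x y) z + w y (w x z) - w x (w y z)" for x y z
  using j[of x y z] anti[of "w x y" z] aw[of x "m y z"] aw[of y "m x z"] jac[of x y z]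
  unfolding d2_def by (simp add: bilinear_ladd[OF w] bilinear_radd[OF w] ml) (simp add: algebra_simps)
 have nb: "norm (b x) <= C * ?W * norm x" for x
  using norm_hom1[OF w, of x] by (simp add: b C)
 have nw: "norm (w u v) <= ?W * U * V" if "norm u <= U" "norm v <= V" for u v U V
  using norm_bilinear_le[OF w, of u v] mult_mono[OF mult_left_mono[OF that(1), of "nb w"] that(2)]
   order_trans[OF norm_ge_zero that(1)] by force
 have nm: "norm (m u v) <= nb m * U * V" if "norm u <= U" "norm v <= V" for u v U V
  using norm_bilinear_le[OF bil, of u v] mult_mono[OF mult_left_mono[OF that(1), of "nb m"] that(2)]
   order_trans[OF norm_ge_zero that(1)] by force
 have E1: "norm (SUM e:Basis. m e (d2 w (S e) x y)) <= 3 * C * ?W^2 * norm x * norm y"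
 proof -
  have "norm (m e (d2 w (S e) x y)) <= nb m * 1 * (3 * nl S * ?W^2 * norm x * norm y)" if e: "e:Basis" for e
  proof (rule nm)
   have s: "norm (S e) <= nl S" using norm_linear_le[OF linS, of e] e by simp
   have "norm (w (w (S e) x) y) <= ?W * (?W * nl S * norm x) * norm y"
   "norm (w x (w (S e) y)) <= ?W * norm x * (?W * nl S * norm y)"
   "norm (w (S e) (w x y)) <= ?W * nl S * (?W * norm x * norm y)"
   by (intro nw order_refl s)+
   then have "norm (w (w (S e) x) y) <= nl S * ?W^2 * norm x * norm y"
   "norm (w x (w (S e) y)) <= nl S * ?W^2 * norm x * norm y"
   "norm (w (S e) (w x y)) <= nl S * ?W^2 * norm x * norm y"
   by (simp_all add: power2_eq_square mult_ac)
   moreover have "norm (p + q - r) <= norm p + norm q + norm r" for p q r :: 'v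
   using norm_triangle_ineq[of p q] norm_triangle_ineq4[of "p + q" r] by linarith
   note this[of "w (w (S e) x) y" "w x (w (S e) y)" "w (S e) (w x y)"]
   ultimately show "norm (d2 w (S e) x y) <= 3 * nl S * ?W^2 * norm x * norm y"
   unfolding d2 by linarith
  qed (use e in simp)
  then show ?thesis
   using sum_norm_bound[of Basis "%e. m e (d2 w (S e) x y)" "nb m * 1 * (3 * nl S * ?W^2 * norm x * norm y)"]
   by (simp add: C mult_ac)
 qed
 have E2: "norm (w (b x) y) <= ?W * (C * ?W * norm x) * norm y" "norm (w x (b y)) <= ?W * norm x * (C * ?W * norm y)"
  "norm (m (b x) (b y)) <= nb m * (C * ?W * norm x) * (C * ?W * norm y)"
  "norm (w (b x) (b y)) <= ?W * (C * ?W * norm x) * (C * ?W * norm y)"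
  by (intro nw nm order_refl nb)+
 have "?W * (C * ?W * norm x) * (C * ?W * norm y) <= 1 * (C * ?W * norm x) * (C * ?W * norm y)"
  by (intro mult_right_mono W) (auto simp: C0)
 with E2(4) have E3: "norm (w (b x) (b y)) <= C^2 * ?W^2 * norm x * norm y"
  by (simp add: power2_eq_square mult_ac)
 have eq: "m (x + b x) (y + b y) + w (x + b x) (y + b y) - (m x y + b (m x y))
   = (SUM e:Basis. m e (d2 w (S e) x y)) + w (b x) y + w x (b y) + m (b x) (b y) + w (b x) (b y)"
  using hom1_identity[OF w aw Pw, of x y] anti[of "b x" y]
  by (simp add: bilinear_ladd[OF w] bilinear_radd[OF w] ml b bilinear_lneg[OF w] bilinear_rneg[OF w] bilinear_lsub[OF w] bilinear_rsub[OF w]) (simp add: algebra_simps)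
 moreover have "norm (p + q + r + s + t) <= norm p + norm q + norm r + norm s + norm t" for p q r s t :: 'v
  using norm_triangle_ineq[of p q] norm_triangle_ineq[of "p + q" r] norm_triangle_ineq[of "p + q + r" s]
   norm_triangle_ineq[of "p + q + r + s" t] by linarith
 note this[of "SUM e:Basis. m e (d2 w (S e) x y)" "w (b x) y" "w x (b y)" "m (b x) (b y)" "w (b x) (b y)"]
 ultimately have "norm (m (x + b x) (y + b y) + w (x + b x) (y + b y) - (m x y + b (m x y))) <= 
   3 * C * ?W^2 * norm x * norm y + ?W * (C * ?W * norm x) * norm y + ?W * norm x * (C * ?W * norm y)
   + nb m * (C * ?W * norm x) * (C * ?W * norm y) + C^2 * ?W^2 * norm x * norm y"
  unfolding eq using E1 E2(1-3) E3 by linarith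
 \<comment> \<open>The constant collects three terms of \<open>d2 w\<close>, two mixed terms with
   one \<open>b\<close>, and the two terms with \<open>b\<close> in both arguments. The last of
   these is cubic in \<open>nb w\<close> and was reduced by \<open>nb w <= 1\<close>.\<close>
 also have "... = (5 * C + nb m * C^2 + C^2) * (nb w)^2 * norm x * norm y"
  by (simp add: power2_eq_square algebra_simps)
 finally show ?thesis .
qed

lemma kp_equivariant:
 assumes k: "orthogonal_transformation k" and mk: "!!x y. m (k x) (k y) = k (m x y)"
 shows "kp m (k x) (k y) = kp m x y"
proof -
 have "bilinear (%u v. m (k x) (m (k y) u) \<bullet> v)"
  by (auto simp: bilinear_def linear_iff ml algebra_simps)
 from sum_orthogonal[OF k this] show ?thesis
  using k by (simp add: kp_def mk orthogonal_transformation_def)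
qed

lemma S_equivariant:
 assumes k: "orthogonal_transformation k" and mk: "!!x y. m (k x) (k y) = k (m x y)"
  and Pk: "!!x. P (k x) = k (P x)"
 shows "S (k x) = k (S x)"
proof -
 have "kp m (S (k x) - k (S x)) z = 0" for z
 proof -
  obtain y where "z = k y" using orthogonal_transformation_surj[OF k] by (metis surjD)
  then show ?thesis
   using k by (simp add: bilinear_lsub[OF kp_bilinear] kS Pk kp_equivariant[OF k mk] orthogonal_transformation_def)
 qed
 moreover have "P (S (k x) - k (S x)) = S (k x) - k (S x)"
  by (simp add: linear_diff[OF linP] Pk PS)
 ultimately have "S (k x) - k (S x) = 0" by (rule kp_nondegenerate)
 then show ?thesis by simp
qed

text \<open>The homotopy involves only \<open>m\<close>, \<open>S\<close> and an orthonormal basis,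
  all compatible with \<open>k\<close>. This keeps the corrections used in the rigidity argument in
  the centralizer of \<open>K\<close>.\<close>

lemma hom1_equivariant:
 assumes k: "orthogonal_transformation k" and mk: "!!x y. m (k x) (k y) = k (m x y)"
  and Pk: "!!x. P (k x) = k (P x)" and w: "bilinear w" and wk: "!!x y. w (k x) (k y) = k (w x y)"
 shows "hom1 w (k x) = k (hom1 w x)"
proof -
 have "bilinear (%u v. m u (w (S v) (k x)))"
  using w linS by (auto simp: bilinear_def linear_iff ml)
 from sum_orthogonal[OF k this] show ?thesis
  using k by (simp add: hom1_def S_equivariant[OF k mk Pk] mk wk linear_sum orthogonal_transformation_def)
qed

text \<open>Newton's method is replaced by one minimization. \<open>Om\<close> adds to the error of
  \<open>G\<close> as a homomorphism a small multiple \<open>c\<close> of its distance to the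
  identity. If the minimizer still had an error, a single correction by \<open>hom1\<close> would
  make the error quadratic and raise the penalty by a small fraction of the old error only, so
  \<open>Om\<close> would drop.\<close>

theorem rigidity:
 assumes m: "eq_lie P K m" and K: "!!k. k:K ==> orthogonal_transformation k & (ALL x. P (k x) = k (P x))"
 shows "EX ep>0. ALL n. eq_lie P K n & nb (%x y. n x y - m x y) < ep -->
   (EX G. linear G & bij G & (ALL k:K. ALL x. G (k x) = k (G x)) & (ALL x. G (P x) = P (G x)) &
   (ALL x y. n (G x) (G y) = G (m x y)))"
proof -
 define D where "D = real DIM('v)"
 define C where "C = D * nb m * nl S"
 define C2 where "C2 = 5 * C + nb m * C^2 + C^2"
 define C3 where "C3 = D * (D * (2 * C2))"
 \<comment> \<open>The correction moves \<open>G\<close> by at most \<open>2 * D * C * W\<close>,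
   where \<open>W\<close> is the norm of the error to be removed; this \<open>c\<close> makes its
   penalty at most \<open>W / 8\<close>.\<close>
 define c where "c = 1 / (16 * D * C + 1)"
 \<comment> \<open>In the order of the arguments: \<open>c / 4\<close> keeps \<open>G\<close> within
   \<open>1/4\<close> of the identity, \<open>1/2\<close> gives \<open>nb w <= 1\<close>, the third
   makes \<open>C3 * nb w\<close> at most \<open>1/4\<close>, and the last leaves room for the
   correction within the radius \<open>1/2\<close>.\<close>
 define ep where "ep = min (c / 4) (min (1/2) (min (1 / (8 * C3 + 8)) (1 / (16 * D * C + 16))))"
 have D: "D >= 1" by (simp add: D_def DIM_positive Suc_leI)
 have C: "0 <= C" "0 <= C2" "0 <= C3" using D by (auto simp: C_def C2_def C3_def)
 have DC: "0 <= D * C" using C D by simp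
 then have c: "0 < c" "2 * D * C * c <= 1/8"
  by (simp_all add: c_def pos_divide_le_eq add_nonneg_pos)
 have ep: "0 < ep" "ep <= c / 4" "ep <= 1/2" "ep * (8 * C3 + 8) <= 1" "ep * (16 * D * C + 16) <= 1"
 proof -
  show "0 < ep" "ep <= c / 4" "ep <= 1/2" using c C DC by (auto simp: ep_def mult.assoc intro!: add_nonneg_pos)
  have "ep <= 1 / (8 * C3 + 8)" "ep <= 1 / (16 * D * C + 16)" by (auto simp: ep_def)
  then show "ep * (8 * C3 + 8) <= 1" "ep * (16 * D * C + 16) <= 1"
   using C DC by (simp_all add: pos_le_divide_eq add_nonneg_pos)
 qed
 show ?thesis
 proof (intro exI[of _ ep] conjI allI impI ep(1))
  fix n assume "eq_lie P K n & nb (%x y. n x y - m x y) < ep"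
  then have n: "eq_lie P K n" and near: "nb (%x y. n x y - m x y) < ep" by auto
  have bn: "bilinear n" and an: "!!x y. n x y = - n y x"
   and jn: "!!x y z. n x (n y z) = n (n x y) z + n y (n x z)"
   and nP: "!!x y. n (P x) y = n x y" and Pn: "!!x y. P (n x y) = n x y"
   and nk: "!!k x y. k:K ==> n (k x) (k y) = k (n x y)"
   using n unfolding eq_lie_def by blast+
  have nP2: "n x (P y) = n x y" for x y using an nP by metis
  have mk: "!!k x y. k:K ==> m (k x) (k y) = k (m x y)" using m unfolding eq_lie_def by blast
  define E where "E G = (%x y. n (G x) (G y) - G (m x y))" for G :: "'v => 'v"
  define Om where "Om G = nb (E G) + c * nl (%x. G x - x)" for G :: "'v => 'v"
  define \<G> where "\<G> = {G :: 'v => 'v. linear G & (ALL k:K. ALL x. G (k x) = k (G x)) & (ALL x. G (P x) = P (G x))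
   & nl (%x. G x - x) <= 1/2}"
  have id: "(%x. x):\<G>" by (auto simp: \<G>_def linear_id[unfolded id_def] nl_def)
  have "EX G:\<G>. ALL G':\<G>. Om G <= Om G'"
  proof (rule linear_minimum)
   show "\<G> ~= {}" using id by blast
   fix G assume "G:\<G>"
   then have G: "linear G" "nl (%x. G x - x) <= 1/2" by (auto simp: \<G>_def)
   then show "linear G" "nl G <= real DIM('v) * 2" "0 <= Om G"
   using near_identity(3)[OF G] c(1) by (auto simp: Om_def intro!: nl_le) (metis mult.right_neutral norm_Basis)
  next
   fix G :: "nat => 'v => 'v" and L :: "'v => 'v"
   assume G: "!!n. G n:\<G>" and L: "linear L" and lim: "!!x. (%n. G n x) ----> L x"
   have nl: "(%n. nl (%x. G n x - x)) ----> nl (%x. L x - x)"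
   unfolding nl_def by (intro tendsto_intros lim)
   show "L:\<G>"
   unfolding \<G>_def mem_Collect_eq
   proof (intro conjI ballI allI L)
   show "nl (%x. L x - x) <= 1/2"
   by (rule LIMSEQ_le_const2[OF nl]) (use G in "auto simp: \<G>_def")
   show "L (k x) = k (L x)" if "k:K" for k x
   proof (rule LIMSEQ_unique[OF lim])
   show "(%n. G n (k x)) ----> k (L x)"
   using linear_tendsto[of k, OF _ lim] K that G by (simp add: \<G>_def orthogonal_transformation_def)
   qed
   show "L (P x) = P (L x)" for x
   proof (rule LIMSEQ_unique[OF lim])
   show "(%n. G n (P x)) ----> P (L x)" using linear_tendsto[OF linP lim] G by (simp add: \<G>_def)
   qed
   qed
   fix a assume a: "(%n. Om (G n)) ----> a"
   have "(%n. Om (G n)) ----> Om L"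
   unfolding Om_def nb_def E_def
   by (intro tendsto_intros nl) (unfold nl_def, intro tendsto_intros bilinear_tendsto[OF bn] lim)
   then show "Om L <= a" using LIMSEQ_unique[OF a] by simp
  qed
  then obtain G where G: "G:\<G>" and min: "!!G'. G':\<G> ==> Om G <= Om G'" by blast
  have lG: "linear G" and Gk: "!!k x. k:K ==> G (k x) = k (G x)" and GP: "!!x. G (P x) = P (G x)"
   and nG: "nl (%x. G x - x) <= 1/2" using G by (auto simp: \<G>_def)
  note ni = near_identity[OF lG nG]
  define H where "H = inv_into UNIV G"
  have GH: "G (H x) = x" and HG: "H (G x) = x" for x
   using ni(1) by (simp_all add: H_def bij_is_surj surj_f_inv_f bij_is_inj)
  have lH: "linear H" using ni(2) by (simp add: H_def)
  have Hk: "H (k x) = k (H x)" if "k:K" for k x by (metis GH HG Gk that)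
  have HP: "H (P x) = P (H x)" for x by (metis GH HG GP)
  have small: "Om G < ep" using min[OF id] near by (simp add: Om_def E_def nl_def)
  have Ge: "nb (E G) < ep" and Gd: "nl (%x. G x - x) <= 1/4"
  proof -
   show "nb (E G) < ep" using small mult_nonneg_nonneg[OF less_imp_le[OF c(1)] nl_nonneg[of "%x. G x - x"]]
   unfolding Om_def by linarith
   have "c * nl (%x. G x - x) <= c * (1/4)" using small ep(2) nb_nonneg[of "E G"] unfolding Om_def by linarith
   then show "nl (%x. G x - x) <= 1/4" using c(1) by simp
  qed
  \<comment> \<open>The deviation from \<open>m\<close> of the bracket \<open>n\<close> pulled back
    along \<open>G\<close>; the pulled back bracket again satisfies the Jacobi identity.\<close>
  define w where "w x y = H (E G x y)" for x y
  have wdef: "w x y = H (n (G x) (G y)) - m x y" for x y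
   by (simp add: w_def E_def linear_diff[OF lH] HG)
  have bw: "bilinear w"
   unfolding wdef using bn lG lH bil by (auto simp: bilinear_def linear_iff algebra_simps)
  have nw: "nb w <= 2 * nb (E G)"
   unfolding nb_def nl_def sum_distrib_left by (intro sum_mono) (simp add: w_def H_def ni(4))
  define b where "b = (%x. - hom1 w x)"
  define G' where "G' x = G (x + b x)" for x
  have aw: "w x y = - w y x" for x y
   unfolding wdef an[of "G x" "G y"] anti[of x y] by (simp add: linear_neg[OF lH])
  have Pw: "P (w x y) = w x y" and wP: "w x (P y) = w x y" for x y
   unfolding wdef by (simp_all add: linear_diff[OF linP] Pm mP2 HP[symmetric] GP Pn nP2)
  have wk: "w (k x) (k y) = k (w x y)" if "k:K" for k x y
   using that K[OF that] unfolding wdef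
   by (simp add: Gk Hk nk mk linear_diff orthogonal_transformation_def)
  have lb: "linear b"
   unfolding b_def hom1_def
   using bw by (auto intro!: linearI simp: bilinear_def linear_iff ml sum.distrib scaleR_sum_right)
  have nbx: "norm (b x) <= C * nb w * norm x" for x
   using norm_hom1[OF bw, of x] by (simp add: b_def C_def D_def)
  have nGb: "nl (%x. G (b x)) <= D * (2 * (C * nb w))"
   unfolding D_def by (rule nl_le, rule order_trans[OF ni(3)]) (use nbx[of i for i] in "metis mult.right_neutral norm_Basis mult_left_mono zero_le_numeral")
  have W: "nb w <= 2 * ep" using nw Ge by simp
  have le: "nl (%x. G' x - x) <= nl (%x. G x - x) + nl (%x. G (b x))"
   unfolding nl_def sum.distrib[symmetric]
   by (intro sum_mono order_trans[OF eq_refl norm_triangle_ineq]) (simp add: G'_def linear_add[OF lG] algebra_simps)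
  have "D * (2 * (C * nb w)) <= D * (2 * (C * (2 * ep)))"
   using D C W by (intro mult_left_mono) auto
  also have "... <= 1/4" using ep(1,5) by (simp add: algebra_simps)
  finally have c1: "nl (%x. G' x - x) <= 1/2" using le Gd nGb by linarith
  have c2: "linear G'"
   unfolding G'_def using lG lb by (auto simp: linear_iff algebra_simps)
  have c3: "G' (k x) = k (G' x)" if that: "k:K" for k x
  proof -
   have ko: "orthogonal_transformation k" and kP: "!!x. P (k x) = k (P x)" using K[OF that] by auto
   then have lk: "linear k" by (simp add: orthogonal_transformation_def)
   have "b (k x) = k (b x)"
   unfolding b_def hom1_equivariant[where w = w and k = k, OF ko mk[OF that] kP bw wk[OF that]] by (simp add: linear_neg[OF lk])
   then have "G' (k x) = G (k (x + b x))" by (simp only: G'_def linear_add[OF lk])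
   also have "... = k (G' x)" by (simp only: G'_def Gk[OF that])
   finally show ?thesis .
  qed
  have c4: "ALL x. G' (P x) = P (G' x)"
  proof
   fix x
   have h1: "hom1 w (P x) = hom1 w x" by (simp only: hom1_def wP)
   have h2: "P (hom1 w x) = hom1 w x" by (simp only: hom1_def linear_sum[OF linP] Pm)
   have h3: "b (P x) = P (b x)" by (simp only: b_def h1 h2 linear_neg[OF linP])
   have "G' (P x) = G (P (x + b x))" by (simp only: G'_def h3 linear_add[OF linP])
   also have "... = P (G' x)" by (simp only: G'_def GP)
   finally show "G' (P x) = P (G' x)" .
  qed
  have G': "G':\<G>"
   unfolding \<G>_def mem_Collect_eq
  proof (intro conjI c1 c2 c4)
   show "ALL k:K. ALL x. G' (k x) = k (G' x)" using c3 by metis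
  qed
  show "EX G. linear G & bij G & (ALL k:K. ALL x. G (k x) = k (G x)) & (ALL x. G (P x) = P (G x)) &
   (ALL x y. n (G x) (G y) = G (m x y))"
  proof (cases "nb w = 0")
   case True
   then have "w x y = 0" for x y using norm_bilinear_le[OF bw, of x y] by simp
   then have "n (G x) (G y) = G (m x y)" for x y using wdef[of x y] GH[of "n (G x) (G y)"] by simp
   then show ?thesis using lG ni(1) Gk GP by blast
  next
   case False
   let ?W = "nb w"
   have W0: "0 < ?W" using False nb_nonneg[of w] by linarith
   have nG: "n (G x) (G y) = G (m x y + w x y)" for x y using wdef[of x y] GH[of "n (G x) (G y)"] by simp
   have j: "m x (m y z + w y z) + w x (m y z + w y z)
   = m (m x y + w x y) z + w (m x y + w x y) z + (m y (m x z + w x z) + w y (m x z + w x z))" for x y z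
   proof -
   have "n (G x) (n (G y) (G z)) = n (n (G x) (G y)) (G z) + n (G y) (n (G x) (G z))"
   by (rule jn)
   then have "G (m x (m y z + w y z) + w x (m y z + w y z))
   = G (m (m x y + w x y) z + w (m x y + w x y) z + (m y (m x z + w x z) + w y (m x z + w x z)))"
   by (simp only: nG linear_add[OF lG, symmetric])
   then show ?thesis using ni(1) by (simp add: bij_is_inj inj_eq)
   qed
   have "norm (E G' i j) <= 2 * C2 * ?W^2" if "i:Basis" "j:Basis" for i j
   proof -
   have "E G' i j = G (m (i + b i) (j + b j) + w (i + b i) (j + b j) - (m i j + b (m i j)))"
   by (simp add: E_def G'_def nG linear_diff[OF lG])
   also have "norm ... <= 2 * (C2 * ?W^2 * norm i * norm j)"
   using deformation_error[OF bw aw Pw j _ b_def C_def[unfolded D_def], of i j] W ep(3)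
   by (intro order_trans[OF ni(3)] mult_left_mono) (auto simp: C2_def)
   finally show ?thesis using that by simp
   qed
   then have E': "nb (E G') <= C3 * ?W^2"
   using nb_le[of "E G'" "2 * C2 * ?W^2"] by (simp add: C3_def D_def mult_ac)
   have "c * nl (%x. G' x - x) <= c * (nl (%x. G x - x) + D * (2 * (C * ?W)))"
   using c(1) le nGb by (intro mult_left_mono) auto
   then have "nb (E G) <= C3 * ?W^2 + (2 * D * C * c) * ?W"
   using min[OF G'] E' unfolding Om_def by (simp add: algebra_simps)
   also have "... <= C3 * ?W * ?W + 1/8 * ?W"
   using c(2) W0 by (intro add_mono mult_right_mono) (auto simp: power2_eq_square)
   \<comment> \<open>The error of \<open>G\<close> is at least half of \<open>?W\<close>, so
     division by \<open>?W\<close> leads to \<open>1/2 <= 1/4 + 1/8\<close>.\<close>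
   finally have "?W / 2 <= (C3 * ?W + 1/8) * ?W" using nw by (simp add: algebra_simps)
   then have "1/2 <= C3 * ?W + 1/8" using W0 by (simp add: field_simps)
   moreover have "C3 * ?W <= C3 * (2 * ep)" using C(3) W by (rule mult_left_mono[rotated])
   moreover have "C3 * (2 * ep) <= 1/4" using ep(1,4) by (simp add: algebra_simps)
   ultimately show ?thesis by linarith
  qed
 qed
qed
end

section \<open>Closure of the adjoint algebra under transposition\<close>

text \<open>The infinitesimal action of the general linear group on brackets, where a group element
  acts on the value and its inverse on both arguments.\<close>

definition gl2 :: "('v::real_vector => 'v) => ('v => 'v => 'v) => 'v => 'v => 'v" where
 "gl2 A m x y = A (m x y) - m (A x) y - m x (A y)"

text \<open>The infinitesimal action on \<open>S\<close> as a contravariant 2-tensor: a group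
  element acts on the left and its transpose on the right.\<close>

definition gl1 :: "('v::euclidean_space => 'v) => ('v => 'v) => 'v => 'v" where
 "gl1 A S x = A (S x) + S (adjoint A x)"

definition ip1 :: "('v::euclidean_space => 'v) => ('v => 'v) => real" where
 "ip1 S T = (SUM i:Basis. S i \<bullet> T i)"

definition ip2 :: "('v::euclidean_space => 'v => 'v) => ('v => 'v => 'v) => real" where
 "ip2 m n = (SUM i:Basis. SUM j:Basis. m i j \<bullet> n i j)"

lemma linear_comm:
 fixes f :: "'a::real_vector => 'b::real_vector"
 assumes "linear f"
 shows "f (x + y) = f x + f y" "f (x - y) = f x - f y" "f (c *\<^sub>R x) = c *\<^sub>R f x" "f (- x) = - f x" "f 0 = 0"
 using assms by (simp_all add: linear_add linear_diff linear_scale linear_neg linear_0)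

lemma bilinear_comm:
 assumes "bilinear h"
 shows "h (x + y) z = h x z + h y z" "h x (y + z) = h x y + h x z" "h (c *\<^sub>R x) y = c *\<^sub>R h x y"
  "h x (c *\<^sub>R y) = c *\<^sub>R h x y" "h (- x) y = - h x y" "h x (- y) = - h x y" "h 0 y = 0" "h x 0 = 0"
  "h (x - y) z = h x z - h y z" "h z (x - y) = h z x - h z y"
 using assms by (simp_all add: bilinear_ladd bilinear_radd bilinear_lmul bilinear_rmul bilinear_lneg
   bilinear_rneg bilinear_lzero bilinear_rzero bilinear_lsub bilinear_rsub)

lemma linear_expand:
 fixes f :: "'a::euclidean_space => 'b::real_vector"
 assumes "linear f" shows "f x = (SUM e:Basis. (x \<bullet> e) *\<^sub>R f e)"
 by (subst euclidean_representation[symmetric, of x]) (simp add: linear_sum[OF assms] linear_scale[OF assms])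

lemma gl2_bilinear: "linear A ==> bilinear m ==> bilinear (gl2 A m)"
 unfolding bilinear_def[of "gl2 A m"] gl2_def
 by (auto intro!: linearI simp: linear_comm bilinear_comm algebra_simps)

lemma gl1_linear: "linear A ==> linear S ==> linear (gl1 A S)"
 unfolding gl1_def using adjoint_linear[of A] by (auto intro!: linearI simp: linear_comm algebra_simps)

text \<open>The transposed matrix acts by the transposed operator. This compatibility of the scalar
  product with transposition is what makes minimal vectors useful.\<close>

lemma ip2_adjoint:
 assumes A: "linear A" and m: "bilinear m" and n: "bilinear n"
 shows "ip2 (gl2 A m) n = ip2 m (gl2 (adjoint A) n)"
proof -
 have 1: "(SUM i:Basis. m (A i) j \<bullet> n i j) = (SUM i:Basis. m i j \<bullet> n (adjoint A i) j)" for j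
  by (rule sum_adjoint[OF A]) (use m n in "auto simp: bilinear_def linear_iff algebra_simps")
 have 2: "(SUM j:Basis. m i (A j) \<bullet> n i j) = (SUM j:Basis. m i j \<bullet> n i (adjoint A j))" for i
  by (rule sum_adjoint[OF A]) (use m n in "auto simp: bilinear_def linear_iff algebra_simps")
 have 3: "(SUM i:Basis. SUM j:Basis. m (A i) j \<bullet> n i j) = (SUM i:Basis. SUM j:Basis. m i j \<bullet> n (adjoint A i) j)"
  by (subst (1 2) sum.swap) (simp add: 1)
 show ?thesis
  unfolding ip2_def gl2_def by (simp add: inner_diff_left inner_diff_right sum_subtractf 3 2 adjoint_works[OF A])
qed

lemma ip1_adjoint:
 assumes A: "linear A" and S: "linear S" and T: "linear T"
 shows "ip1 (gl1 A S) T = ip1 S (gl1 (adjoint A) T)"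
proof -
 have "(SUM i:Basis. S (adjoint A i) \<bullet> T i) = (SUM i:Basis. S i \<bullet> T (adjoint (adjoint A) i))"
  by (rule sum_adjoint[OF adjoint_linear[OF A]]) (use S T in "auto simp: bilinear_def linear_iff algebra_simps")
 then show ?thesis
  unfolding ip1_def gl1_def by (simp add: inner_add_left inner_add_right sum.distrib adjoint_works[OF A])
qed

text \<open>Riesz representation for the trace form on endomorphisms, with \<open>M\<close>
  assembled from the values of \<open>L\<close> on matrix units.\<close>

lemma functional_representation:
 fixes L :: "('v::euclidean_space => 'v) => real"
 assumes add: "!!A B. linear A ==> linear B ==> L (%x. A x + B x) = L A + L B"
  and sc: "!!A c. linear A ==> L (%x. c *\<^sub>R A x) = c * L A"
 shows "EX M. linear M & (ALL A. linear A --> L A = (SUM j:Basis. A j \<bullet> M j))"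
proof -
 have L0: "L (%x. 0) = 0" using sc[of "%x. 0" 0] by (simp add: linear_zero)
 have sum: "L (%x. SUM i:I. F i x) = (SUM i:I. L (F i))" if "finite I" "!!i. i:I ==> linear (F i)"
  for I :: "'v set" and F
  using that
 proof (induction I rule: finite_induct)
  case (insert i I)
  then show ?case using add[of "F i" "%x. SUM i:I. F i x"] by (simp add: linear_compose_sum)
 qed (simp add: L0)
 define E where "E i j = (%z :: 'v. (z \<bullet> j) *\<^sub>R i)" for i j :: 'v
 have E: "linear (E i j)" "linear (%z. c *\<^sub>R E i j z)" for i j c
  by (auto intro!: linearI simp: E_def inner_add_left algebra_simps)
 define c where "c j = (SUM i:Basis. L (E i j) *\<^sub>R i)" for j
 define M where "M = (%z. SUM j:Basis. (z \<bullet> j) *\<^sub>R c j)"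
 show ?thesis
 proof (intro exI[of _ M] conjI allI impI)
  show "linear M" unfolding M_def
   by (auto intro!: linearI simp: inner_add_left scaleR_add_left sum.distrib scaleR_sum_right)
  fix A :: "'v => 'v" assume A: "linear A"
  have "A = (%z. SUM j:Basis. SUM i:Basis. (A j \<bullet> i) *\<^sub>R E i j z)"
  proof
   fix z
   have "(SUM i:Basis. (A j \<bullet> i) *\<^sub>R E i j z) = (z \<bullet> j) *\<^sub>R A j" for j
   unfolding E_def scaleR_left_commute[of _ "z \<bullet> j"] scaleR_sum_right[symmetric] euclidean_representation ..
   then show "A z = (SUM j:Basis. SUM i:Basis. (A j \<bullet> i) *\<^sub>R E i j z)"
   by (subst linear_expand[OF A]) simp
  qed
  then have "L A = L (%z. SUM j:Basis. SUM i:Basis. (A j \<bullet> i) *\<^sub>R E i j z)" by simp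
  also have "... = (SUM j:Basis. SUM i:Basis. (A j \<bullet> i) * L (E i j))"
   by (simp add: sum linear_compose_sum E sc)
  also have "... = (SUM j:Basis. A j \<bullet> M j)"
  proof (rule sum.cong[OF refl])
   fix j :: 'v assume "j:Basis"
   then have "M j = (SUM i:Basis. L (E i j) *\<^sub>R i)"
   unfolding M_def c_def[symmetric] by (subst sum.remove[of _ j]) (auto simp: inner_Basis intro!: sum.neutral split: if_splits)
   then show "(SUM i:Basis. (A j \<bullet> i) * L (E i j)) = A j \<bullet> M j"
   by (simp add: inner_sum_right mult.commute)
  qed
  finally show "L A = (SUM j:Basis. A j \<bullet> M j)" .
 qed
qed

text \<open>The gradient \<open>M\<close> of an invariant functional commutes with \<open>K\<close>,
  so it is itself a direction in which \<open>L\<close> is known to vanish; the value of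
  \<open>L\<close> there is the squared norm of \<open>M\<close>.\<close>

lemma equivariant_functional_zero:
 fixes L :: "('v::euclidean_space => 'v) => real"
 assumes add: "!!A B. linear A ==> linear B ==> L (%x. A x + B x) = L A + L B"
  and sc: "!!A c. linear A ==> L (%x. c *\<^sub>R A x) = c * L A"
  and K: "!!k. k:K ==> orthogonal_transformation k"
  and inv: "!!k A. k:K ==> linear A ==> L (%x. k (A (adjoint k x))) = L A"
  and z: "!!A. linear A ==> (!!k x. k:K ==> A (k x) = k (A x)) ==> L A = 0"
  and A: "linear A"
 shows "L A = 0"
proof -
 obtain M where M: "linear M" "!!A. linear A ==> L A = (SUM j:Basis. A j \<bullet> M j)"
  using functional_representation[of L] add sc by auto
 have "M (k x) = k (M x)" if k: "k:K" for k x
 proof -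
  have lk: "linear k" "linear (adjoint k)"
   using K[OF k] by (simp_all add: orthogonal_transformation_def adjoint_linear)
  define B where "B = (%x. adjoint k (M (k x)) - M x)"
  have lB: "linear B" unfolding B_def using lk M(1) by (auto intro!: linearI simp: linear_comm algebra_simps)
  have "L (%x. k (B (adjoint k x))) = (SUM j:Basis. k (B (adjoint k j)) \<bullet> M j)"
   by (rule M(2)) (use lk lB in "auto intro!: linearI simp: linear_comm")
  also have "... = (SUM j:Basis. k (B (adjoint k (k j))) \<bullet> M (k j))"
   by (rule sum_orthogonal[OF K[OF k], of "%u v. k (B (adjoint k u)) \<bullet> M v"])
   (use lk lB M(1) in "auto intro!: linearI simp: bilinear_def linear_comm inner_add_left inner_add_right")
  also have "... = (SUM j:Basis. B j \<bullet> adjoint k (M (k j)))"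
   by (simp add: orthogonal_adjoint[OF K[OF k]] adjoint_works[OF lk(1)])
  finally have "(SUM j:Basis. B j \<bullet> adjoint k (M (k j))) = (SUM j:Basis. B j \<bullet> M j)"
   using inv[OF k lB] M(2)[OF lB] by simp
  then have "(SUM j:Basis. B j \<bullet> B j) = 0"
   by (simp add: B_def inner_diff_right sum_subtractf)
  then have "B j = 0" if "j:Basis" for j using that by (simp add: sum_nonneg_eq_0_iff)
  then have "B x = 0" using linear_eq_0_on_span[OF lB, of Basis x] by simp
  then show ?thesis by (metis B_def orthogonal_adjoint(2)[OF K[OF k]] eq_iff_diff_eq_0)
 qed
 then have "(SUM j:Basis. M j \<bullet> M j) = 0" using z[OF M(1)] M(2)[OF M(1)] by simp
 then have "M j = 0" if "j:Basis" for j using that by (simp add: sum_nonneg_eq_0_iff)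
 then show ?thesis using M(2)[OF A] by simp
qed

context killing_alg
begin

text \<open>The test direction is the commutator of \<open>D = m x\<close> with its transpose. As
  \<open>D\<close> annihilates \<open>m\<close> by the Jacobi identity and \<open>S\<close> by
  \<open>ad_S\<close>, criticality in this direction says that the transpose of \<open>D\<close>,
  acting on the pair, gives a vector of norm zero.\<close>

lemma transpose_derivation:
 assumes crit: "!!A. linear A ==> ip2 (gl2 A m) m + ip1 (gl1 A S) S = 0"
 shows "gl2 (adjoint (m x)) m y z = 0"
proof -
 define D where "D = m x"
 define D' where "D' = adjoint D"
 have lD: "linear D" "linear D'" by (simp_all add: D_def D'_def lin adjoint_linear)
 have aD: "adjoint D' = D" by (simp add: D'_def adjoint_adjoint lD)
 have D0: "gl2 D m = (%x y. 0)" "gl1 D S = (%x. 0)"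
  by (auto simp: fun_eq_iff gl2_def gl1_def D_def jac[of x] ad_S)
 define A where "A u = D (D' u) - D' (D u)" for u
 note lc = linear_comm[OF lD(1)] linear_comm[OF lD(2)]
 have w: "D x \<bullet> y = x \<bullet> D' y" "D' x \<bullet> y = x \<bullet> D y" for x y
  by (simp_all add: D'_def adjoint_clauses[OF lD(1)])
 have lA: "linear A" unfolding A_def by (auto intro!: linearI simp: lc algebra_simps)
 have aA: "adjoint A = A"
  by (intro adjoint_unique allI) (simp add: A_def inner_diff_left inner_diff_right w)
 have g2: "gl2 A m = (%u v. gl2 D (gl2 D' m) u v - gl2 D' (gl2 D m) u v)"
  unfolding gl2_def A_def fun_eq_iff by (simp add: lc ml algebra_simps)
 have g1: "gl1 A S = (%u. gl1 D (gl1 D' S) u - gl1 D' (gl1 D S) u)"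
  unfolding gl1_def aA aD D'_def[symmetric] unfolding A_def fun_eq_iff
  by (simp add: lc linear_comm[OF linS] algebra_simps)
 have z: "gl2 D' (%x y. 0) = (%u v. 0)" "gl1 D' (%x. 0) = (%u. 0)"
  by (simp_all add: fun_eq_iff gl2_def gl1_def lc)
 have "gl2 A m = gl2 D (gl2 D' m)" "gl1 A S = gl1 D (gl1 D' S)"
  by (simp_all add: g2 g1 D0 z)
 then have "ip2 (gl2 D' m) (gl2 D' m) + ip1 (gl1 D' S) (gl1 D' S) = 0"
  using crit[OF lA] ip2_adjoint[OF lD(1) gl2_bilinear[OF lD(2) bil] bil]
   ip1_adjoint[OF lD(1) gl1_linear[OF lD(2) linS] linS]
  by (simp add: D'_def[symmetric])
 moreover have "0 <= ip1 (gl1 D' S) (gl1 D' S)" "0 <= ip2 (gl2 D' m) (gl2 D' m)"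
  by (auto simp: ip1_def ip2_def intro!: sum_nonneg)
 ultimately have "ip2 (gl2 D' m) (gl2 D' m) = 0" by linarith
 then have "gl2 D' m i j = 0" if "i:Basis" "j:Basis" for i j
  using that by (simp add: ip2_def sum_nonneg_eq_0_iff sum_nonneg)
 then have "nb (gl2 D' m) = 0" by (simp add: nb_def nl_def)
 then show ?thesis
  using norm_bilinear_le[OF gl2_bilinear[OF lD(2) bil], of y z] by (simp add: D'_def D_def)
qed

text \<open>Nondegeneracy yields \<open>y\<close> such that \<open>E = D - m y\<close> is orthogonal
  to all \<open>m z\<close> for the trace form. Then \<open>kp m (E u) z\<close> is the trace of
  \<open>E\<close> composed with \<open>m (m u z)\<close>, hence zero.\<close>

lemma derivation_inner:
 assumes D: "linear D" and der: "!!y z. gl2 D m y z = 0" and PD: "!!x. P (D x) = D x"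
 shows "EX y. P y = y & D = m y"
proof -
 define c where "c = (SUM e:Basis. (SUM i:Basis. D (m e i) \<bullet> i) *\<^sub>R e)"
 define y where "y = S c"
 define E where "E u = D u - m y u" for u
 have tr: "linear (%z. SUM i:Basis. D (m z i) \<bullet> i)"
  by (auto intro!: linearI simp: ml linear_comm[OF D] inner_add_left sum.distrib sum_distrib_left)
 have c: "c \<bullet> z = (SUM i:Basis. D (m z i) \<bullet> i)" for z
  by (subst linear_expand[OF tr]) (simp add: c_def inner_sum_left inner_commute[of z] mult.commute)
 have kpy: "kp m y z = (SUM i:Basis. D (m z i) \<bullet> i)" for z
  using kS[of c z] c[of "P z"] by (simp add: y_def symP mP)
 have lE: "linear E" unfolding E_def by (auto intro!: linearI simp: linear_comm[OF D] ml algebra_simps)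
 have trE: "(SUM i:Basis. E (m z i) \<bullet> i) = 0" for z
  using kpy[of z] by (simp add: E_def inner_diff_left sum_subtractf kp_def)
 have derE: "E (m u v) = m (E u) v + m u (E v)" for u v
  using der[of u v] by (simp add: gl2_def E_def ml jac[of y] algebra_simps)
 have "kp m (E u) z = 0" for u z
 proof -
  have "m (E u) v = E (m u v) - m u (E v)" for v by (simp add: derE)
  then have "kp m (E u) z = (SUM i:Basis. E (m u (m z i)) \<bullet> i) - (SUM i:Basis. m u (E (m z i)) \<bullet> i)"
   by (simp add: kp_def inner_diff_left sum_subtractf)
  also have "(SUM i:Basis. m u (E (m z i)) \<bullet> i) = (SUM i:Basis. E (m z (m u i)) \<bullet> i)"
   by (rule trace_mult_commute[OF lin(1)]) (auto intro!: linearI simp: linear_comm[OF lE] ml)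
  also have "(SUM i:Basis. E (m u (m z i)) \<bullet> i) - (SUM i:Basis. E (m z (m u i)) \<bullet> i) = (SUM i:Basis. E (m (m u z) i) \<bullet> i)"
   by (simp add: jac[of u z] linear_comm[OF lE] sum.distrib inner_add_left)
  finally show ?thesis by (simp add: trE)
 qed
 moreover have "P (E u) = E u" for u by (simp add: E_def linear_comm[OF linP] PD Pm)
 ultimately have "E u = 0" for u by (rule kp_nondegenerate)
 then have "D = m y" by (auto simp: E_def fun_eq_iff)
 then show ?thesis by (intro exI[of _ y]) (simp add: y_def PS)
qed

lemma ad_inject: "P x = x ==> P y = y ==> m x = m y ==> x = y"
proof -
 assume "P x = x" "P y = y" "m x = m y"
 then have "x - y = 0"
  by (intro kp_nondegenerate) (simp_all add: bilinear_lsub[OF kp_bilinear] linear_diff[OF linP], simp add: kp_def)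
 then show ?thesis by simp
qed

text \<open>Minus transposition maps the adjoint algebra into itself, since the transposes are
  derivations and hence inner. The adjoint map is injective, so this defines \<open>t\<close>, and
  \<open>kp m x (t x)\<close> is minus the squared Hilbert-Schmidt norm of
  \<open>m x\<close>.\<close>

theorem cartan_involution:
 assumes crit: "!!A. linear A ==> ip2 (gl2 A m) m + ip1 (gl1 A S) S = 0"
  and K: "!!k. k:K ==> orthogonal_transformation k & (ALL x. P (k x) = k (P x)) & (ALL x y. m (k x) (k y) = k (m x y))"
 shows "EX t. linear t & (ALL x. P (t x) = t x & t (t x) = P x) & (ALL x y. t (m x y) = m (t x) (t y)) &
   (ALL k:K. ALL x. t (k x) = k (t x)) & (ALL x. P x ~= 0 --> kp m x (t x) < 0)"
proof -
 have "EX y. P y = y & m y = (%z. - adjoint (m x) z)" for x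
 proof -
  let ?D = "%z. - adjoint (m x) z"
  have la: "linear (adjoint (m x))" by (rule adjoint_linear[OF lin(1)])
  have a: "adjoint (m x) (P z) = adjoint (m x) z" "P (adjoint (m x) z) = adjoint (m x) z" for z
   by (rule vector_eq_rdot[THEN iffD1], simp add: adjoint_clauses[OF lin(1)] symP Pm mP2)+
  have "EX y. P y = y & ?D = m y"
  proof (rule derivation_inner)
   show "linear ?D" by (auto intro!: linearI simp: linear_comm[OF la])
   show "gl2 ?D m y z = 0" for y z
   using transpose_derivation[OF crit, of x y z] by (simp add: gl2_def ml algebra_simps)
  qed (simp_all add: linear_comm[OF linP] a)
  then show ?thesis by metis
 qed
 then obtain t where Pt: "!!x. P (t x) = t x" and t: "!!x. m (t x) = (%z. - adjoint (m x) z)" by metis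
 have eqI: "u = v" if "P u = u" "P v = v" "!!w z. m u w \<bullet> z = m v w \<bullet> z" for u v
  by (rule ad_inject[OF that(1,2)]) (auto simp: fun_eq_iff intro: vector_eq_rdot[THEN iffD1] that(3))
 have ti: "m (t x) w \<bullet> z = - (w \<bullet> m x z)" for x w z
  by (simp add: t adjoint_clauses[OF lin(1)])
 have ti': "w \<bullet> m (t x) z = - (m x w \<bullet> z)" for x w z
  by (simp add: t adjoint_clauses[OF lin(1)])
 have lt: "linear t"
  by (rule linearI; rule eqI) (simp_all add: Pt linear_comm[OF linP] ti ml inner_add_left inner_add_right)
 show ?thesis
 proof (intro exI[of _ t] conjI allI ballI impI lt Pt)
  show "t (t x) = P x" for x
   by (rule eqI) (simp_all add: Pt PP ti ti' mP)
  show "t (m x y) = m (t x) (t y)" for x y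
  proof (rule eqI)
   have mm: "m (m a b) c = m a (m b c) - m b (m a c)" for a b c by (simp add: jac[of a b])
   show "m (t (m x y)) w \<bullet> z = m (m (t x) (t y)) w \<bullet> z" for w z
   by (simp add: ti mm inner_diff_left inner_diff_right)
  qed (simp_all add: Pt Pm)
  show "t (k x) = k (t x)" if k: "k:K" for k x
  proof (rule eqI)
   have ko: "orthogonal_transformation k" and mk: "!!x y. m (k x) (k y) = k (m x y)" using K[OF k] by auto
   fix w z
   have "m (k (t x)) w \<bullet> z = m (k (t x)) (k (adjoint k w)) \<bullet> k (adjoint k z)" by (simp add: orthogonal_adjoint[OF ko])
   also have "... = m (t x) (adjoint k w) \<bullet> adjoint k z" using ko by (simp add: mk orthogonal_transformation_def)
   also have "... = - (k (adjoint k w) \<bullet> k (m x (adjoint k z)))" using ko by (simp add: ti orthogonal_transformation_def)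
   also have "... = m (t (k x)) w \<bullet> z" by (simp add: ti mk[symmetric] orthogonal_adjoint[OF ko])
   finally show "m (t (k x)) w \<bullet> z = m (k (t x)) w \<bullet> z" by simp
  qed (use K[OF k] Pt in auto)
  fix x assume x: "P x ~= 0"
  have "kp m x (t x) = - (SUM e:Basis. adjoint (m x) e \<bullet> adjoint (m x) e)"
   by (simp add: kp_def t ml sum_negf adjoint_clauses[OF lin(1)])
  moreover have "(SUM e:Basis. adjoint (m x) e \<bullet> adjoint (m x) e) ~= 0"
  proof
   assume "(SUM e:Basis. adjoint (m x) e \<bullet> adjoint (m x) e) = 0"
   then have "adjoint (m x) e = 0" if "e:Basis" for e using that by (simp add: sum_nonneg_eq_0_iff)
   then have "adjoint (m x) z = 0" for z
   using linear_eq_0_on_span[OF adjoint_linear[OF lin(1)[of x]], of Basis z] by simp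
   then have "m x w \<bullet> z = 0" for w z using adjoint_works[OF lin(1)[of x], of w z] by simp
   then have "m x w = 0" for w by (metis inner_eq_zero_iff)
   then have "P x = 0"
   by - (rule eqI, simp_all add: PP linear_comm[OF linP] mP ml)
   then show False using x by simp
  qed
  moreover have "(SUM e:Basis. adjoint (m x) e \<bullet> adjoint (m x) e) >= 0" by (intro sum_nonneg) simp
  ultimately show "kp m x (t x) < 0" by linarith
 qed
qed
end

section \<open>Minimal vectors in the closure of an orbit\<close>

definition LA :: "('v::euclidean_space => 'v) => ('v => 'v) set => ('v => 'v => 'v) => ('v => 'v) => bool" where
 "LA P K m S \<longleftrightarrow> killing_alg P S m & eq_lie P K m"

lemma bilinear_expand:
 fixes m :: "'v::euclidean_space => 'v => 'w::real_vector"
 assumes "bilinear m"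
 shows "m x y = (SUM i:Basis. SUM j:Basis. ((x \<bullet> i) * (y \<bullet> j)) *\<^sub>R m i j)"
proof -
 have l: "linear (m x)" "linear (%x. m x y)" for x y
  using assms by (auto simp: bilinear_def)
 show ?thesis
  by (subst linear_expand[OF l(2)], subst linear_expand[OF l(1)]) (simp add: scaleR_sum_right)
qed

lemma bilinear_pointwise_limit:
 fixes m :: "nat => 'v::euclidean_space => 'v => 'w::euclidean_space"
 assumes "!!n. bilinear (m n)" "!!i j. i:Basis ==> j:Basis ==> (%n. m n i j) ----> l i j"
 shows "EX L. bilinear L & (ALL x y (u :: nat => 'v) (v :: nat => 'v). u ----> x --> v ----> y --> (%n. m n (u n) (v n)) ----> L x y)"
proof (intro exI conjI allI impI)
 let ?L = "%x y. SUM i:Basis. SUM j:Basis. ((x \<bullet> i) * (y \<bullet> j)) *\<^sub>R l i j"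
 show "bilinear ?L"
  unfolding bilinear_def
  by (auto intro!: linearI simp: inner_add_left algebra_simps sum.distrib scaleR_sum_right)
 fix x y and u v :: "nat => 'v" assume "u ----> x" "v ----> y"
 then show "(%n. m n (u n) (v n)) ----> ?L x y"
  by (subst bilinear_expand[OF assms(1)]) (intro tendsto_intros assms(2))
qed

lemma linear_joint_limit:
 fixes S :: "nat => 'v::euclidean_space => 'w::euclidean_space"
 assumes "!!n. linear (S n)" "!!x. (%n. S n x) ----> L x" "linear L" "u ----> x"
 shows "(%n. S n (u n)) ----> L x"
proof -
 have exp: "T y = (SUM i:Basis. (y \<bullet> i) *\<^sub>R T i)" if "linear T" for T :: "'v => 'w" and y
  by (subst euclidean_representation[symmetric, of y]) (simp add: linear_sum[OF that] linear_scale[OF that])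
 show ?thesis
  by (subst exp[OF assms(1)], subst exp[OF assms(3)]) (intro tendsto_intros assms)
qed

text \<open>Each condition is an equation between continuous expressions, nondegeneracy included, as
  it is stated through \<open>S\<close>. So a limit of semisimple brackets whose inverse forms
  converge is again semisimple.\<close>

lemma LA_limit:
 fixes m :: "nat => 'v::euclidean_space => 'v => 'v"
 assumes LA: "!!n. LA P K (m n) (S n)" and M: "bilinear M"
  and m: "!!x y u v. u ----> x ==> v ----> y ==> (%n. m n (u n) (v n)) ----> M x y"
  and T: "linear T" and S: "!!x. (%n. S n x) ----> T x" and K: "!!k. k:K ==> linear k"
 shows "LA P K M T"
proof -
 have ka: "killing_alg P (S n) (m n)" and el: "eq_lie P K (m n)" for n using LA by (auto simp: LA_def)
 interpret k0: killing_alg P "S 0" "m 0" by (rule ka)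
 have lS: "linear (S n)" for n using ka[of n] by (simp add: killing_alg_def)
 have Ss: "(%n. S n (u n)) ----> T x" if "u ----> x" for u x
  by (rule linear_joint_limit[OF lS S T that])
 have Pl: "(%n. P (u n)) ----> P x" if "u ----> x" for u x by (rule linear_tendsto[OF k0.linP that])
 have eqI: "a = b" if "u ----> a" "v ----> b" "!!n. u n = v n" for a b :: "'b::t2_space" and u v
  using that LIMSEQ_unique by (metis ext)
 have n: "m n x y = - m n y x" "m n x (m n y z) = m n (m n x y) z + m n y (m n x z)"
  "m n (P x) y = m n x y" "P (m n x y) = m n x y" "P (S n x) = S n x" "S n (P x) = S n x"
  "kp (m n) (S n x) y = P x \<bullet> y" for n x y z
  by (rule killing_alg.anti[OF ka] killing_alg.jac[OF ka] killing_alg.mP[OF ka] killing_alg.Pm[OF ka]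
   killing_alg.PS[OF ka] killing_alg.SP[OF ka] killing_alg.kS[OF ka])+
 have nk: "m n (k x) (k y) = k (m n x y)" if "k:K" for n x y k using el[of n] that unfolding eq_lie_def by blast
 have e: "M x y = - M y x" "M x (M y z) = M (M x y) z + M y (M x z)" "M (P x) y = M x y" "P (M x y) = M x y"
  "P (T x) = T x" "T (P x) = T x" "kp M (T x) y = P x \<bullet> y" for x y z
 proof -
  show "M x y = - M y x"
   by (rule eqI[of "%n. m n x y" _ "%n. - m n y x"]) (intro m tendsto_intros, intro m tendsto_intros, rule n)
  show "M x (M y z) = M (M x y) z + M y (M x z)"
   by (rule eqI[of "%n. m n x (m n y z)" _ "%n. m n (m n x y) z + m n y (m n x z)"])
   (intro m tendsto_intros, intro m tendsto_intros, rule n)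
  show "M (P x) y = M x y"
   by (rule eqI[of "%n. m n (P x) y" _ "%n. m n x y"]) (intro m tendsto_intros, intro m tendsto_intros, rule n)
  show "P (M x y) = M x y"
   by (rule eqI[of "%n. P (m n x y)" _ "%n. m n x y"]) (intro Pl m tendsto_intros, intro m tendsto_intros, rule n)
  show "P (T x) = T x"
   by (rule eqI[of "%n. P (S n x)" _ "%n. S n x"]) (intro Pl S, rule S, rule n)
  show "T (P x) = T x"
   by (rule eqI[of "%n. S n (P x)" _ "%n. S n x"]) (rule S, rule S, rule n)
  show "kp M (T x) y = P x \<bullet> y"
   by (rule eqI[of "%n. kp (m n) (S n x) y" _ "%n. P x \<bullet> y"])
   (unfold kp_def, intro m S tendsto_intros, rule tendsto_const, rule n[unfolded kp_def])
 qed
 have "M (k x) (k y) = k (M x y)" if k: "k:K" for k x y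
  by (rule eqI[of "%n. m n (k x) (k y)" _ "%n. k (m n x y)"])
   (intro m tendsto_const, intro m linear_tendsto[OF K[OF k]] tendsto_const, rule nk[OF k])
 then show ?thesis
  unfolding LA_def eq_lie_def
  using e M T k0.linP k0.symP k0.PP by (intro conjI ballI allI killing_alg.intro) blast+
qed

text \<open>Transport of structure along \<open>g\<close>. Being contravariant, \<open>S\<close>
  transforms by \<open>g\<close> and its transpose, whereas the bracket needs the inverse
  \<open>h\<close>.\<close>

lemma LA_action:
 fixes m :: "'v::euclidean_space => 'v => 'v"
 assumes LA: "LA P K m S" and g: "linear g" "bij g" and gk: "!!k x. k:K ==> g (k x) = k (g x)"
  and gP: "!!x. g (P x) = P (g x)" and h: "h = inv_into UNIV g"
 shows "LA P K (%x y. g (m (h x) (h y))) (%x. g (S (adjoint g x)))"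
proof -
 interpret killing_alg P S m using LA by (simp add: LA_def)
 have mk: "m (k x) (k y) = k (m x y)" if "k:K" for k x y using LA that unfolding LA_def eq_lie_def by blast
 have gh: "g (h x) = x" "h (g x) = x" for x
  using g(2) by (simp_all add: h bij_is_surj surj_f_inv_f bij_is_inj)
 have lh: "linear h" unfolding h by (rule inj_linear_imp_inv_linear[OF g(1) bij_is_inj[OF g(2)]])
 have hk: "h (k x) = k (h x)" if "k:K" for k x by (metis gh gk that)
 have hP: "h (P x) = P (h x)" for x by (metis gh gP)
 have la: "linear (adjoint g)" by (rule adjoint_linear[OF g(1)])
 have aP: "adjoint g (P x) = P (adjoint g x)" for x
  by (rule vector_eq_rdot[THEN iffD1]) (simp add: adjoint_clauses[OF g(1)] symP gP[symmetric])
 let ?n = "%x y. g (m (h x) (h y))"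
 have bn: "bilinear ?n" by (auto intro!: linearI simp: bilinear_def linear_comm[OF g(1)] linear_comm[OF lh] ml)
 have an: "?n x y = - ?n y x" for x y using anti[of "h x" "h y"] by (simp add: linear_comm[OF g(1)])
 have jn: "?n x (?n y z) = ?n (?n x y) z + ?n y (?n x z)" for x y z
  by (simp add: gh jac[of "h x" "h y"] linear_comm[OF g(1)])
 have Pn: "?n (P x) y = ?n x y" "P (?n x y) = ?n x y" for x y by (simp_all add: hP mP gP[symmetric] Pm)
 have nk: "?n (k x) (k y) = k (?n x y)" if "k:K" for k x y
  using that by (simp add: hk mk gk)
 have "kp ?n (g x) y = kp m x (h y)" for x y
 proof -
  have "kp ?n (g x) y = (SUM e:Basis. g (m x (m (h y) (h e))) \<bullet> e)" by (simp add: kp_def gh)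
  also have "... = (SUM e:Basis. m x (m (h y) (h (g e))) \<bullet> e)"
   by (rule trace_mult_commute[OF g(1)]) (auto intro!: linearI simp: ml linear_comm[OF lh])
  finally show ?thesis by (simp add: kp_def gh)
 qed
 then have kn: "kp ?n (g (S (adjoint g x))) y = P x \<bullet> y" for x y
  by (simp add: kS symP aP adjoint_clauses[OF g(1)] gP hP gh)
 have "killing_alg P (%x. g (S (adjoint g x))) ?n"
 proof (rule killing_alg.intro)
  show "linear (%x. g (S (adjoint g x)))" by (auto intro!: linearI simp: linear_comm[OF g(1)] linear_comm[OF la] linear_comm[OF linS])
 qed (fact linP symP PP bn an jn Pn kn | simp add: aP SP gP[symmetric] PS)+
 moreover have "eq_lie P K ?n"
  unfolding eq_lie_def by (intro conjI allI ballI bn) (rule an jn Pn nk | assumption)+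
 ultimately show ?thesis by (simp add: LA_def)
qed

text \<open>At the point where the factor \<open>s\<close> vanishes, continuity of \<open>F\<close>
  suffices for the product rule.\<close>

lemma has_vector_derivative_scaleR_at_0:
 fixes F :: "real => 'a::real_normed_vector"
 assumes "isCont F 0"
 shows "((%s. s *\<^sub>R F s) hvd F 0) (at 0)"
proof -
 have "(%h. norm (h *\<^sub>R F h - h *\<^sub>R F 0) / norm h) \<midarrow>0\<rightarrow> 0"
 proof (rule Lim_transform_eventually)
  show "(%h. norm (F h - F 0)) \<midarrow>0\<rightarrow> 0"
   using assms by (simp add: isCont_def LIM_zero tendsto_norm_zero)
  show "\<forall>\<^sub>F h in at 0. norm (F h - F 0) = norm (h *\<^sub>R F h - h *\<^sub>R F 0) / norm h"
   unfolding scaleR_diff_right[symmetric] norm_scaleR by (auto simp: eventually_at intro!: exI[of _ 1])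
 qed
 then show ?thesis
  by (simp add: has_vector_derivative_def has_derivative_at bounded_linear_scaleR_left)
qed

text \<open>\<open>g s\<close> is the inverse of the identity plus \<open>s\<close> times
  \<open>A\<close>. The resolvent equation \<open>g s z = z - s *\<^sub>R A (g s z)\<close> makes it
  differentiable at 0 as soon as it is bounded.\<close>

lemma has_vector_derivative_inverse_family:
 fixes A :: "'v::euclidean_space => 'v"
 assumes A: "linear A" and d: "0 < d"
  and g: "!!s z. \<bar>s\<bar> < d ==> g s z + s *\<^sub>R A (g s z) = z" "!!s z. \<bar>s\<bar> < d ==> norm (g s z) <= 2 * norm z"
  and w: "(w hvd w') (at 0)"
 shows "((%s. g s (w s)) hvd (w' - A (w 0))) (at (0::real))"
proof -
 have ev: "\<forall>\<^sub>F s in at 0. \<bar>s\<bar> < d" using d by (auto simp: eventually_at dist_real_def)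
 have g0: "g 0 z = z" for z using g(1)[of 0 z] d by simp
 have eq: "g s (w s) = w s - s *\<^sub>R A (g s (w s))" if "\<bar>s\<bar> < d" for s using g(1)[OF that, of "w s"] by (simp add: algebra_simps)
 have wc: "w \<midarrow>0\<rightarrow> w 0" using has_vector_derivative_continuous[OF w] by (simp add: isCont_def)
 have "(%s. s *\<^sub>R A (g s (w s))) \<midarrow>0\<rightarrow> 0"
 proof (rule Lim_null_comparison)
  show "\<forall>\<^sub>F s in at 0. norm (s *\<^sub>R A (g s (w s))) <= \<bar>s\<bar> * (nl A * (2 * norm (w s)))"
   using ev
  proof eventually_elim
   case (elim s)
   have "norm (A (g s (w s))) <= nl A * (2 * norm (w s))"
   by (rule order_trans[OF norm_linear_le[OF A]]) (simp add: g(2)[OF elim] mult_left_mono)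
   then show ?case by (simp add: mult_left_mono)
  qed
  show "(%s. \<bar>s\<bar> * (nl A * (2 * norm (w s)))) \<midarrow>0\<rightarrow> 0"
   by (rule tendsto_eq_intros wc refl | simp)+
 qed
 then have "(%s. w s - s *\<^sub>R A (g s (w s))) \<midarrow>0\<rightarrow> w 0"
  using tendsto_diff[OF wc] by fastforce
 then have gc: "(%s. g s (w s)) \<midarrow>0\<rightarrow> w 0"
  by (rule Lim_transform_eventually) (use ev eq in "auto elim!: eventually_mono")
 have "isCont (%s. A (g s (w s))) 0"
  unfolding isCont_def g0 by (rule linear_tendsto[OF A gc])
 from has_vector_derivative_diff[OF w has_vector_derivative_scaleR_at_0[OF this]]
 have "((%s. w s - s *\<^sub>R A (g s (w s))) hvd w' - A (w 0)) (at 0)"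
  by (simp add: g0)
 then show ?thesis
  by (rule has_vector_derivative_transform_within[of _ _ _ _ d]) (use d eq in "auto simp: dist_real_def")
qed

lemma DERIV_inner_self:
 fixes u :: "real => 'a::real_inner"
 assumes "(u hvd u') (at 0)"
 shows "((%s. u s \<bullet> u s) has_real_derivative 2 * (u' \<bullet> u 0)) (at 0)"
 using bounded_bilinear.has_vector_derivative[OF bounded_bilinear_inner assms assms]
 unfolding has_real_derivative_iff_has_vector_derivative by (simp add: inner_commute[of "u 0" u'])

text \<open>The variation runs along the inverses of \<open>x + s *\<^sub>R A x\<close> instead of
  exponentials; they commute with every linear map that commutes with \<open>A\<close>, so the
  centralizer is never left.\<close>

lemma critical_point:
 fixes m :: "'v::euclidean_space => 'v => 'v"
 assumes m: "bilinear m" and S: "linear S" and A: "linear A"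
  and min: "!!g h s. linear g ==> bij g ==> h = (%x. x + s *\<^sub>R A x) ==> (!!x. g (h x) = x) ==> (!!x. h (g x) = x) ==>
   ip2 m m + ip1 S S <= ip2 (%x y. g (m (h x) (h y))) (%x y. g (m (h x) (h y)))
   + ip1 (%x. g (S (adjoint g x))) (%x. g (S (adjoint g x)))"
 shows "ip2 (gl2 A m) m + ip1 (gl1 A S) S = 0"
proof -
 define d where "d = 1 / (2 * nl A + 2)"
 have d: "0 < d" using nl_nonneg[of A] by (simp add: d_def add_nonneg_pos)
 define h where "h s x = x + s *\<^sub>R A x" for s x
 define g where "g s = inv_into UNIV (h s)" for s
 have lh: "linear (h s)" for s by (auto intro!: linearI simp: h_def linear_comm[OF A] algebra_simps)
 have small: "nl (%x. h s x - x) <= 1/2" if "\<bar>s\<bar> < d" for s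
 proof -
  have "nl (%x. h s x - x) = \<bar>s\<bar> * nl A" by (simp add: nl_def h_def sum_distrib_left)
  also have "... <= d * nl A" using that by (intro mult_right_mono) auto
  also have "... <= 1/2" using nl_nonneg[of A] by (simp add: d_def divide_le_eq add_nonneg_pos)
  finally show ?thesis .
 qed
 note ni = near_identity[OF lh small]
 have gh: "g s (h s x) = x" "h s (g s x) = x" if "\<bar>s\<bar> < d" for s x
  using ni(1)[OF that] by (simp_all add: g_def bij_is_surj surj_f_inv_f bij_is_inj)
 have lg: "linear (g s)" if "\<bar>s\<bar> < d" for s using ni(2)[OF that] by (simp add: g_def)
 have bg: "bij (g s)" if "\<bar>s\<bar> < d" for s using ni(1)[OF that] by (simp add: g_def bij_imp_bij_inv)
 have ng: "norm (g s z) <= 2 * norm z" if "\<bar>s\<bar> < d" for s z using ni(4)[OF that] by (simp add: g_def)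
 have geq: "g s z + s *\<^sub>R A (g s z) = z" if "\<bar>s\<bar> < d" for s z using gh(2)[OF that, of z] by (simp add: h_def)
 let ?g' = "%s. adjoint (g s)"
 have aeq: "?g' s z + s *\<^sub>R adjoint A (?g' s z) = z" if s: "\<bar>s\<bar> < d" for s z
 proof -
  have "(?g' s z + s *\<^sub>R adjoint A (?g' s z)) \<bullet> y = z \<bullet> y" for y
  proof -
   have "z \<bullet> g s (h s y) = z \<bullet> y" by (simp add: gh(1)[OF s])
   then show ?thesis
   by (simp add: h_def linear_comm[OF lg[OF s]] inner_add_left inner_add_right adjoint_clauses[OF A] adjoint_clauses[OF lg[OF s]])
  qed
  then show ?thesis using vector_eq_rdot by blast
 qed
 have na: "norm (?g' s z) <= 2 * norm z" if s: "\<bar>s\<bar> < d" for s z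
 proof -
  have "norm (?g' s z) * norm (?g' s z) = ?g' s z \<bullet> ?g' s z" by (simp add: dot_square_norm power2_eq_square)
  also have "... = z \<bullet> g s (?g' s z)" by (rule adjoint_clauses(2)[OF lg[OF s]])
  also have "... <= norm z * (2 * norm (?g' s z))"
   by (rule order_trans[OF norm_cauchy_schwarz]) (simp add: ng[OF s] mult_left_mono)
  finally have "norm (?g' s z) * norm (?g' s z) <= (2 * norm z) * norm (?g' s z)" by simp
  then show ?thesis by (cases "norm (?g' s z) = 0") (auto simp: mult_le_cancel_right)
 qed
 have g0: "g 0 z = z" "?g' 0 z = z" "h 0 z = z" for z using geq[of 0 z] aeq[of 0 z] d by (auto simp: h_def)
 have D2: "((%s. g s (m (h s i) (h s j))) hvd - gl2 A m i j) (at 0)" for i j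
 proof -
  have "((%s. m i j + s *\<^sub>R (m (A i) j + m i (A j) + s *\<^sub>R m (A i) (A j))) hvd
   (0 + (m (A i) j + m i (A j) + 0 *\<^sub>R m (A i) (A j)))) (at 0)"
   by (intro has_vector_derivative_add has_vector_derivative_const has_vector_derivative_scaleR_at_0) (intro continuous_intros)
  then have "((%s. m (h s i) (h s j)) hvd m (A i) j + m i (A j)) (at 0)"
   by (simp add: h_def bilinear_comm[OF m] algebra_simps)
  from has_vector_derivative_inverse_family[OF A d geq ng this] show ?thesis
   by (simp add: g0 gl2_def algebra_simps)
 qed
 have D1: "((%s. g s (S (?g' s i))) hvd - gl1 A S i) (at 0)" for i
 proof -
  have "((%s. ?g' s i) hvd (0 - adjoint A i)) (at 0)"
   by (rule has_vector_derivative_inverse_family[OF adjoint_linear[OF A] d aeq na]) auto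
  from bounded_linear.has_vector_derivative[OF linear_bounded[OF S] this]
  have "((%s. S (?g' s i)) hvd - S (adjoint A i)) (at 0)" by (simp add: linear_comm[OF S])
  moreover have "- gl1 A S i = - S (adjoint A i) - A (S i)" by (simp add: gl1_def)
  ultimately show ?thesis
   using has_vector_derivative_inverse_family[OF A d geq ng, of "%s. S (?g' s i)" "- S (adjoint A i)"] by (simp add: g0)
 qed
 define N where "N s = ip2 (%x y. g s (m (h s x) (h s y))) (%x y. g s (m (h s x) (h s y)))
   + ip1 (%x. g s (S (?g' s x))) (%x. g s (S (?g' s x)))" for s
 have "(N has_real_derivative (SUM i:Basis. SUM j:Basis. 2 * (- gl2 A m i j \<bullet> g 0 (m (h 0 i) (h 0 j))))
   + (SUM i:Basis. 2 * (- gl1 A S i \<bullet> g 0 (S (?g' 0 i))))) (at 0)"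
  unfolding N_def ip2_def ip1_def
  by (intro DERIV_add DERIV_sum DERIV_inner_self D1 D2)
 then have "(N has_real_derivative - 2 * (ip2 (gl2 A m) m + ip1 (gl1 A S) S)) (at 0)"
  by (simp add: g0 ip1_def ip2_def sum_negf sum_distrib_left algebra_simps)
 then have "- 2 * (ip2 (gl2 A m) m + ip1 (gl1 A S) S) = 0"
 proof (rule DERIV_local_min[OF _ d])
  show "ALL s. \<bar>0 - s\<bar> < d --> N 0 <= N s"
  proof (intro allI impI)
   fix s :: real assume "\<bar>0 - s\<bar> < d"
   then have s: "\<bar>s\<bar> < d" by simp
   have "N 0 = ip2 m m + ip1 S S" by (simp add: N_def g0)
   also have "... <= N s" unfolding N_def
   by (rule min[OF lg[OF s] bg[OF s], of _ s]) (use gh[OF s] in "auto simp: h_def")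
   finally show "N 0 <= N s" .
  qed
 qed
 then show ?thesis by simp
qed

lemma adjoint_linear_ops:
 fixes A B :: "'v::euclidean_space => 'v"
 assumes "linear A" "linear B"
 shows "adjoint (%x. A x + B x) = (%x. adjoint A x + adjoint B x)"
  "adjoint (%x. c *\<^sub>R A x) = (%x. c *\<^sub>R adjoint A x)"
  "adjoint (%x. A (B x)) = (%x. adjoint B (adjoint A x))"
proof -
 note c = inner_add_left inner_add_right adjoint_clauses[OF assms(1)] adjoint_clauses[OF assms(2)]
 show "adjoint (%x. A x + B x) = (%x. adjoint A x + adjoint B x)"
  by (rule adjoint_unique) (simp add: c)
 show "adjoint (%x. c *\<^sub>R A x) = (%x. c *\<^sub>R adjoint A x)"
  by (rule adjoint_unique) (simp add: c)
 show "adjoint (%x. A (B x)) = (%x. adjoint B (adjoint A x))"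
  by (rule adjoint_unique) (simp add: c)
qed

lemma kp_iso:
 fixes h :: "'v::euclidean_space => 'v"
 assumes m: "bilinear m" and h: "linear h" "bij h" and iso: "!!x y. h (m x y) = M (h x) (h y)"
 shows "kp M (h x) (h y) = kp m x y"
proof -
 define g where "g = inv_into UNIV h"
 have gh: "h (g x) = x" "g (h x) = x" for x
  using h(2) by (simp_all add: g_def bij_is_surj surj_f_inv_f bij_is_inj)
 have lg: "linear g" unfolding g_def by (rule inj_linear_imp_inv_linear[OF h(1) bij_is_inj[OF h(2)]])
 have "kp M (h x) (h y) = (SUM e:Basis. h (m x (m y (g e))) \<bullet> e)"
  unfolding kp_def by (intro sum.cong refl) (metis iso gh(1))
 also have "... = (SUM e:Basis. m x (m y (g (h e))) \<bullet> e)"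
  by (rule trace_mult_commute[OF h(1)]) (auto intro!: linearI simp: linear_comm[OF lg] bilinear_comm[OF m])
 finally show ?thesis by (simp add: kp_def gh)
qed

definition is_cartan_involution ::
 "('v::euclidean_space => 'v) => ('v => 'v) set => ('v => 'v => 'v) => ('v => 'v) => bool" where
 "is_cartan_involution P K m t \<longleftrightarrow> linear t & (ALL x. P (t x) = t x & t (t x) = P x) &
   (ALL x y. t (m x y) = m (t x) (t y)) & (ALL k:K. ALL x. t (k x) = k (t x)) & (ALL x. P x ~= 0 --> kp m x (t x) < 0)"

lemma cartan_involution_transfer:
 fixes h :: "'v::euclidean_space => 'v"
 assumes t: "is_cartan_involution Q L M t"
  and m: "bilinear m" and h: "linear h" "bij h" and iso: "!!x y. h (m x y) = M (h x) (h y)"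
  and PQ: "!!x. h (P x) = Q (h x)" and K: "!!k. k:K ==> EX l:L. ALL x. h (k x) = l (h x)"
 shows "is_cartan_involution P K m (%x. inv_into UNIV h (t (h x)))"
proof -
 define g where "g = inv_into UNIV h"
 have gh: "h (g x) = x" "g (h x) = x" for x
  using h(2) by (simp_all add: g_def bij_is_surj surj_f_inv_f bij_is_inj)
 have lg: "linear g" unfolding g_def by (rule inj_linear_imp_inv_linear[OF h(1) bij_is_inj[OF h(2)]])
 have giso: "g (M x y) = m (g x) (g y)" for x y by (metis iso gh)
 have gQ: "g (Q x) = P (g x)" for x by (metis PQ gh)
 have gQh: "g (Q (h x)) = P x" for x by (simp add: gQ gh)
 have T: "linear t" "!!x. Q (t x) = t x" "!!x. t (t x) = Q x" "!!x y. t (M x y) = M (t x) (t y)"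
  "!!x. Q x ~= 0 ==> kp M x (t x) < 0"
  using t unfolding is_cartan_involution_def by blast+
 have tl: "t (l x) = l (t x)" if "l:L" for l x using t that unfolding is_cartan_involution_def by blast
 have "is_cartan_involution P K m (%x. g (t (h x)))"
  unfolding is_cartan_involution_def
 proof (intro conjI allI ballI impI)
  show "linear (%x. g (t (h x)))"
   by (auto intro!: linearI simp: linear_comm[OF lg] linear_comm[OF h(1)] linear_comm[OF T(1)])
  show "g (t (h (k x))) = k (g (t (h x)))" if k: "k:K" for k x
  proof -
   obtain l where l: "l:L" "!!x. h (k x) = l (h x)" using K[OF k] by blast
   then show ?thesis by (metis tl gh)
  qed
  fix x assume x: "P x ~= 0"
  have "Q (h x) ~= 0" using x gQ[of "h x"] gh(2) linear_0[OF lg] by metis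
  then have "kp M (h x) (t (h x)) < 0" by (rule T(5))
  then show "kp m x (g (t (h x))) < 0"
   using kp_iso[where h = h and m = m and M = M, OF m h iso, of x "g (t (h x))"] by (simp add: gh)
 qed (simp_all add: gQ[symmetric] gQh T gh PQ iso giso)
 then show ?thesis by (simp add: g_def)
qed

lemma ip_nonneg: "0 <= ip2 m m + ip1 S S"
 by (auto simp: ip1_def ip2_def intro!: add_nonneg_nonneg sum_nonneg)

text \<open>A point of minimal norm in the closure of the orbit of \<open>(m, S)\<close> is a critical point, hence its
 adjoint algebra is closed under transposition; rigidity shows that it belongs to the orbit.\<close>

theorem cartan_involution_orthogonal:
 fixes m :: "'v::euclidean_space => 'v => 'v"
 assumes LA: "LA P K m S" and K: "!!k. k:K ==> orthogonal_transformation k & (ALL x. P (k x) = k (P x))"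
  and eps: "(%x. 2 *\<^sub>R P x - x):K"
 shows "EX t. is_cartan_involution P K m t"
proof -
 define N where "N = (%(m :: 'v => 'v => 'v, S :: 'v => 'v). ip2 m m + ip1 S S)"
 define comm where "comm = (%g :: 'v => 'v. ALL k:K. ALL x. g (k x) = k (g x))"
 have commD: "g (k x) = k (g x)" if "comm g" "k:K" for g k x
  using that unfolding comm_def by blast
 \<comment> \<open>Only the bracket is required to be a translate of \<open>m\<close>; the second
   component is then determined by the bracket through \<open>LA\<close>.\<close>
 define \<O> where "\<O> = {(m', S'). LA P K m' S' & (EX g. linear g & bij g & comm g & (ALL x y. g (m x y) = m' (g x) (g y)))}"
 interpret m: killing_alg P S m using LA by (simp add: LA_def)
 have lK: "linear k" if "k:K" for k using K[OF that] by (simp add: orthogonal_transformation_def)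
 \<comment> \<open>\<open>K\<close> contains the reflection in the image of \<open>P\<close>, so
   commuting with \<open>K\<close> entails commuting with \<open>P\<close>.\<close>
 have commP: "g (P x) = P (g x)" if "linear g" "comm g" for g x
 proof -
  have "g (2 *\<^sub>R P x - x) = 2 *\<^sub>R P (g x) - g x" using commD[OF that(2) eps] .
  then have "2 *\<^sub>R g (P x) = 2 *\<^sub>R P (g x)" by (simp add: linear_comm[OF that(1)])
  then show ?thesis by simp
 qed
 have act: "(%x y. g (m' (h x) (h y)), %x. g (S' (adjoint g x))):\<O>"
  if O: "(m', S'):\<O>" and g: "linear g" "bij g" "comm g" and h: "h = inv_into UNIV g" for m' S' g h
 proof -
  obtain f where f: "LA P K m' S'" "linear f" "bij f" "comm f" "!!x y. f (m x y) = m' (f x) (f y)"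
   using O unfolding \<O>_def by blast
  have hg: "h (g x) = x" for x using g(2) by (simp add: h bij_is_inj)
  have "LA P K (%x y. g (m' (h x) (h y))) (%x. g (S' (adjoint g x)))"
   by (rule LA_action[OF f(1) g(1,2) _ _ h]) (use commD[OF g(3)] commP[OF g(1,3)] in auto)
  moreover have "linear (g \<circ> f)" "bij (g \<circ> f)" by (auto intro: linear_compose bij_comp f g)
  moreover have "comm (g \<circ> f)" unfolding comm_def using commD[OF g(3)] commD[OF f(4)] by simp
  moreover have "(g \<circ> f) (m x y) = g (m' (h ((g \<circ> f) x)) (h ((g \<circ> f) y)))" for x y by (simp add: f(5) hg)
  ultimately show ?thesis unfolding \<O>_def by blast
 qed
 have start: "(m, S):\<O>"
  unfolding \<O>_def using LA bij_id linear_id by (auto simp: comm_def intro!: exI[of _ id])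
 let ?a = "INF z\<in>\<O>. N z"
 have bb: "bdd_below (N ` \<O>)" using ip_nonneg by (auto intro!: bdd_belowI[of _ 0] simp: N_def)
 have lo: "?a <= N z" if "z:\<O>" for z by (rule cINF_lower[OF bb that])
 have "EX z:\<O>. N z < ?a + 1 / Suc n" for n
  using cINF_less_iff[OF _ bb, of "?a + 1 / Suc n"] start by auto
 then obtain z where z: "z n:\<O>" "N (z n) < ?a + 1 / Suc n" for n by metis
 define u where "u n = fst (z n)" for n
 define T where "T n = snd (z n)" for n
 have zO: "(u n, T n):\<O>" for n using z(1)[of n] by (simp add: u_def T_def)
 have N: "N (u n, T n) < ?a + 1 / Suc n" for n using z(2)[of n] by (simp add: u_def T_def)
 have LAn: "LA P K (u n) (T n)" for n using zO[of n] by (simp add: \<O>_def)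
 have bu: "bilinear (u n)" and lT: "linear (T n)" for n
  using LAn[of n] by (simp_all add: LA_def killing_alg_def)
 have N1: "N (u n, T n) <= ?a + 1" for n 
 proof -
  have "1 / real (Suc n) <= 1" by simp
  then show ?thesis using N[of n] by linarith
 qed
 have sq: "norm x <= ?a + 2" if "x \<bullet> x <= ?a + 1" for x :: 'v
 proof -
  have "0 <= (norm x - 1)^2" by simp
  then have "2 * norm x <= x \<bullet> x + 1" by (simp add: power2_diff power2_norm_eq_inner)
  then show ?thesis using that norm_ge_zero[of x] by linarith
 qed
 have bdu: "norm (u n i j) <= ?a + 2" if "i:Basis" "j:Basis" for n i j
 proof (rule sq)
  have "u n i j \<bullet> u n i j <= (SUM j:Basis. u n i j \<bullet> u n i j)" by (rule member_le_sum[of j Basis "%j. u n i j \<bullet> u n i j"]) (use that in auto)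
  also have "... <= ip2 (u n) (u n)" unfolding ip2_def
   by (rule member_le_sum[of i Basis "%i. SUM j:Basis. u n i j \<bullet> u n i j"]) (use that in "auto intro!: sum_nonneg")
  also have "... <= N (u n, T n)" by (auto simp: N_def ip1_def intro!: sum_nonneg)
  finally show "u n i j \<bullet> u n i j <= ?a + 1" using N1[of n] by linarith
 qed
 have bdT: "norm (T n i) <= ?a + 2" if "i:Basis" for n i
 proof (rule sq)
  have "T n i \<bullet> T n i <= ip1 (T n) (T n)" unfolding ip1_def by (rule member_le_sum[of i Basis "%i. T n i \<bullet> T n i"]) (use that in auto)
  also have "... <= N (u n, T n)" by (auto simp: N_def ip2_def intro!: sum_nonneg)
  finally show "T n i \<bullet> T n i <= ?a + 1" using N1[of n] by linarith
 qed
 have "EX r l. strict_mono (r :: nat => nat) & (ALL p:Basis \<times> Basis. (%n. u (r n) (fst p) (snd p)) ----> l p)"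
  by (rule finite_pointwise_subsequence[where B = "?a + 2"]) (auto simp: bdu)
 then obtain r l where r: "strict_mono (r :: nat => nat)"
  and l: "!!p. p:Basis \<times> Basis ==> (%n. u (r n) (fst p) (snd p)) ----> l p"
  by blast
 have "EX r' l'. strict_mono (r' :: nat => nat) & (ALL i:Basis. (%n. T (r (r' n)) i) ----> l' i)"
  by (rule finite_pointwise_subsequence[where B = "?a + 2"]) (auto simp: bdT)
 then obtain r' l' where r': "strict_mono (r' :: nat => nat)" and l': "!!i. i:Basis ==> (%n. T (r (r' n)) i) ----> l' i"
  by blast
 define s where "s = r \<circ> r'"
 have s: "strict_mono s" unfolding s_def by (rule strict_mono_o[OF r r'])
 have ul: "(%n. u (s n) i j) ----> l (i, j)" if "i:Basis" "j:Basis" for i j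
  using LIMSEQ_subseq_LIMSEQ[OF l[of "(i, j)"] r'] that by (simp add: s_def o_def)
 obtain M where M: "bilinear M" "!!x y v w. v ----> x ==> w ----> y ==> (%n. u (s n) (v n) (w n)) ----> M x y"
  using bilinear_pointwise_limit[of "%n. u (s n)" "%i j. l (i, j)"] bu ul by blast
 obtain T' where T': "linear T'" "!!x. (%n. T (s n) x) ----> T' x"
  using linear_pointwise_limit[of "%n. T (s n)" l'] lT l' by (auto simp: s_def)
 have LAM: "LA P K M T'"
  by (rule LA_limit[of P K "%n. u (s n)" "%n. T (s n)"]) (use LAn M T' lK in auto)
 have Ns: "(%n. N (%x y. g (u (s n) (h x) (h y)), %x. g (T (s n) (adjoint g x))))
   ----> N (%x y. g (M (h x) (h y)), %x. g (T' (adjoint g x)))" if "linear g" for g h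
  unfolding N_def ip1_def ip2_def prod.case by (intro tendsto_intros linear_tendsto[OF that] M(2) T'(2))
 have "(%n. N (u n, T n)) ----> ?a"
 proof (rule tendsto_sandwich[OF _ _ tendsto_const])
  show "(%n. ?a + 1 / Suc n) ----> ?a"
   using tendsto_add[OF tendsto_const[of ?a] LIMSEQ_inverse_real_of_nat] by (simp add: inverse_eq_divide)
  show "\<forall>\<^sub>F n in sequentially. ?a <= N (u n, T n)" "\<forall>\<^sub>F n in sequentially. N (u n, T n) <= ?a + 1 / Suc n"
   using lo[OF zO] N by (auto intro!: always_eventually less_imp_le)
 qed
 then have "(%n. N (u (s n), T (s n))) ----> ?a" using LIMSEQ_subseq_LIMSEQ[OF _ s] by (auto simp: o_def)
 moreover have "(%n. N (u (s n), T (s n))) ----> N (M, T')"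
 proof -
  have "adjoint (%x :: 'v. x) = (%x. x)" by (rule adjoint_unique) simp
  then show ?thesis using Ns[of "%x. x" "%x. x"] by (simp add: linear_ident)
 qed
 ultimately have NM: "N (M, T') = ?a" using LIMSEQ_unique by blast
 interpret M: killing_alg P T' M using LAM by (simp add: LA_def)
 have Mk: "M (k x) (k y) = k (M x y)" if "k:K" for k x y using LAM that unfolding LA_def eq_lie_def by blast
 define L where "L A = ip2 (gl2 A M) M + ip1 (gl1 A T') T'" for A
 \<comment> \<open>Minimality of the limit \<open>(M, T')\<close> is available only for maps
   commuting with \<open>K\<close>; the invariance of \<open>L\<close> under \<open>K\<close>
   extends criticality to all \<open>A\<close>.\<close>
 have crit: "L A = 0" if A: "linear A" for A
 proof (rule equivariant_functional_zero[of L K])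
  show "L (%x. A x + B x) = L A + L B" if "linear A" "linear B" for A B
   unfolding L_def gl1_def gl2_def ip1_def ip2_def adjoint_linear_ops[OF that]
   by (simp add: M.ml linear_comm[OF T'(1)] inner_add_left inner_diff_left sum.distrib sum_subtractf algebra_simps)
  show "L (%x. c *\<^sub>R A x) = c * L A" if "linear A" for A c
   unfolding L_def gl1_def gl2_def ip1_def ip2_def adjoint_linear_ops[OF that that]
   by (simp add: M.ml linear_comm[OF T'(1)] inner_add_left inner_diff_left sum_distrib_left algebra_simps sum.distrib sum_subtractf)
  show "orthogonal_transformation k" if "k:K" for k using K[OF that] by blast
  show "L (%x. k (A (adjoint k x))) = L A" if k: "k:K" and A: "linear A" for k A
  proof -
   have ko: "orthogonal_transformation k" and lk: "linear k" and kP: "!!x. P (k x) = k (P x)"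
   using K[OF k] lK[OF k] by auto
   have la: "linear (adjoint k)" by (rule adjoint_linear[OF lk])
   let ?A = "%x. k (A (adjoint k x))"
   have lA: "linear ?A" by (auto intro!: linearI simp: linear_comm[OF lk] linear_comm[OF la] linear_comm[OF A])
   have aA: "adjoint ?A = (%x. k (adjoint A (adjoint k x)))"
   using adjoint_linear_ops(3)[OF lk, of "%x. A (adjoint k x)"] adjoint_linear_ops(3)[OF A la]
   linear_compose[OF la A] by (simp add: o_def adjoint_adjoint[OF lk])
   have kk: "k x \<bullet> k y = x \<bullet> y" for x y using ko by (simp add: orthogonal_transformation_def)
   have g2: "gl2 ?A M (k x) (k y) = k (gl2 A M x y)" for x y
   by (simp add: gl2_def orthogonal_adjoint[OF ko] Mk[OF k] linear_comm[OF lk])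
   have g1: "gl1 ?A T' (k x) = k (gl1 A T' x)" for x
   by (simp add: gl1_def aA orthogonal_adjoint[OF ko] M.S_equivariant[where k = k, OF ko Mk[OF k] kP] linear_comm[OF lk])
   have b2: "bilinear (gl2 ?A M)" by (rule gl2_bilinear[OF lA M(1)])
   have l1: "linear (gl1 ?A T')" by (rule gl1_linear[OF lA T'(1)])
   have "ip2 (gl2 ?A M) M = (SUM i:Basis. SUM j:Basis. gl2 ?A M i (k j) \<bullet> M i (k j))"
   unfolding ip2_def by (intro sum.cong refl sum_orthogonal[OF ko])
   (auto intro!: linearI simp: bilinear_def bilinear_comm[OF b2] M.ml inner_add_left inner_add_right)
   also have "... = (SUM j:Basis. SUM i:Basis. gl2 ?A M i (k j) \<bullet> M i (k j))" by (rule sum.swap)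
   also have "... = (SUM j:Basis. SUM i:Basis. gl2 ?A M (k i) (k j) \<bullet> M (k i) (k j))"
   by (intro sum.cong refl sum_orthogonal[OF ko])
   (auto intro!: linearI simp: bilinear_def bilinear_comm[OF b2] M.ml inner_add_left inner_add_right)
   also have "... = ip2 (gl2 A M) M" unfolding ip2_def g2 Mk[OF k] kk by (rule sum.swap)
   finally have i2: "ip2 (gl2 ?A M) M = ip2 (gl2 A M) M" .
   have "ip1 (gl1 ?A T') T' = (SUM i:Basis. gl1 ?A T' (k i) \<bullet> T' (k i))"
   unfolding ip1_def by (rule sum_orthogonal[OF ko])
   (auto intro!: linearI simp: bilinear_def linear_comm[OF l1] linear_comm[OF T'(1)] inner_add_left inner_add_right)
   also have "... = ip1 (gl1 A T') T'"
   unfolding g1 M.S_equivariant[where k = k, OF ko Mk[OF k] kP] kk ip1_def ..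
   finally show ?thesis using i2 by (simp add: L_def)
  qed
  show "L A = 0" if A: "linear A" and Ak: "!!k x. k:K ==> A (k x) = k (A x)" for A
   unfolding L_def
  proof (rule critical_point[OF M(1) T'(1) A])
   fix g h s assume g: "linear g" "bij g" and h: "h = (%x. x + s *\<^sub>R A x)" and gh: "!!x. g (h x) = x" "!!x. h (g x) = x"
   have hi: "h = inv_into UNIV g" by (rule ext) (metis gh(1) gh(2) g(2) bij_is_inj inv_into_f_f UNIV_I)
   have "comm h" unfolding comm_def h using Ak by (auto simp: linear_comm[OF lK])
   then have cg: "comm g" unfolding comm_def by (metis gh)
   \<comment> \<open>The limit need not lie in the orbit. Its translate by \<open>g\<close> is the
     limit of the translates of the minimizing sequence, which do, and the lower bound passes to the
     limit.\<close>
   have "?a <= N (%x y. g (M (h x) (h y)), %x. g (T' (adjoint g x)))"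
   by (rule LIMSEQ_le_const[OF Ns[OF g(1)]]) (use lo[OF act[OF zO g cg hi]] in auto)
   then show "ip2 M M + ip1 T' T' <= ip2 (%x y. g (M (h x) (h y))) (%x y. g (M (h x) (h y)))
   + ip1 (%x. g (T' (adjoint g x))) (%x. g (T' (adjoint g x)))"
   using NM by (simp add: N_def)
  qed
 qed fact
 have "EX t. is_cartan_involution P K M t"
  unfolding is_cartan_involution_def
  by (rule M.cartan_involution) (use crit K Mk in "auto simp: L_def")
 then obtain t where t: "is_cartan_involution P K M t" ..
 obtain ep where ep: "ep > 0" and rig: "!!n. eq_lie P K n ==> nb (%x y. n x y - M x y) < ep ==>
   EX G. linear G & bij G & (ALL k:K. ALL x. G (k x) = k (G x)) & (ALL x. G (P x) = P (G x)) &
   (ALL x y. n (G x) (G y) = G (M x y))"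
  using M.rigidity[of K] LAM K unfolding LA_def by blast
 have "(%n. nb (%x y. u (s n) x y - M x y)) ----> nb (%x y. M x y - M x y)"
  unfolding nb_def nl_def by (intro tendsto_intros M(2))
 then have "(%n. nb (%x y. u (s n) x y - M x y)) ----> 0" by (simp add: nb_def nl_def)
 from order_tendstoD(2)[OF this ep] obtain n where n: "nb (%x y. u (s n) x y - M x y) < ep"
  by (auto simp: eventually_sequentially)
 obtain G where G: "linear G" "bij G" "comm G" "!!x y. u (s n) (G x) (G y) = G (M x y)"
  using rig[OF _ n] LAn[of "s n"] unfolding LA_def comm_def by blast
 obtain g where g: "linear g" "bij g" "comm g" "!!x y. g (m x y) = u (s n) (g x) (g y)"
  using zO[of "s n"] unfolding \<O>_def by blast
 define H where "H = inv_into UNIV G"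
 have GH: "G (H x) = x" "H (G x) = x" for x
  using G(2) by (simp_all add: H_def bij_is_surj surj_f_inv_f bij_is_inj)
 have lH: "linear H" unfolding H_def by (rule inj_linear_imp_inv_linear[OF G(1) bij_is_inj[OF G(2)]])
 have cH: "comm H" unfolding comm_def using commD[OF G(3)] GH by metis
 have bH: "bij H" unfolding H_def by (rule bij_imp_bij_inv[OF G(2)])
 let ?h = "%x. H (g x)"
 have lh: "linear ?h" using linear_compose[OF g(1) lH] by (simp add: o_def)
 have bh: "bij ?h" using bij_comp[OF g(2) bH] by (simp add: o_def)
 have isoh: "?h (m x y) = M (?h x) (?h y)" for x y by (metis g(4) G(4) GH)
 have hP: "?h (P x) = P (?h x)" for x using commP[OF g(1,3)] commP[OF lH cH] by simp
 have hK: "EX l:K. ALL x. ?h (k x) = l (?h x)" if "k:K" for k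
  by (rule bexI[of _ k]) (simp_all add: commD[OF g(3) that] commD[OF cH that] that)
 show ?thesis
 proof (rule exI)
  show "is_cartan_involution P K m (%x. inv_into UNIV ?h (t (?h x)))"
   by (rule cartan_involution_transfer[where h = ?h and M = M and L = K and Q = P, OF t m.bil lh bh])
   (rule isoh, rule hP, rule hK, assumption)
 qed
qed

section \<open>Invariant scalar products and Cartan decompositions\<close>

text \<open>Gram-Schmidt for the form given by \<open>R\<close>, after which \<open>T\<close>
  carries the resulting basis to the standard one. This is a square root of \<open>R\<close> up to
  rotation, obtained without spectral theory.\<close>

lemma orthonormalization:
 fixes R :: "'v::euclidean_space => 'v"
 assumes R: "linear R" and sym: "!!x y. R x \<bullet> y = x \<bullet> R y" and pos: "!!x. x ~= 0 ==> 0 < R x \<bullet> x"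
 shows "EX T :: 'v => 'v. linear T & (ALL x y. T x \<bullet> T y = R x \<bullet> y)"
proof -
 have "EX E. finite E & card E = card F & span E = span F & (ALL a:E. ALL b:E. R a \<bullet> b = (if a = b then 1 else 0))"
  if "finite F" "independent F" for F
  using that
 proof (induction F rule: finite_induct)
  case (insert b F)
  then obtain E where E: "finite E" "card E = card F" "span E = span F"
   and on: "!!a c. a:E ==> c:E ==> R a \<bullet> c = (if a = c then 1 else 0)"
   using independent_mono[of "insert b F" F] by blast
  define p where "p = (SUM e:E. (R b \<bullet> e) *\<^sub>R e)"
  define u where "u = b - p"
  have pE: "p:span E" unfolding p_def by (intro span_sum span_scale span_base)
  have bE: "b~:span E" using insert.prems insert.hyps E(3) by (simp add: independent_insert)
  then have u0: "u ~= 0" using pE by (auto simp: u_def)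
  have ue: "R u \<bullet> e = 0" if e: "e:E" for e
  proof -
   have "R p \<bullet> e = (SUM a:E. (R b \<bullet> a) * (if a = e then 1 else 0))"
   using on e by (simp add: p_def linear_sum[OF R] linear_scale[OF R] inner_sum_left)
   also have "... = R b \<bullet> e" by (subst sum.remove[OF E(1) e]) (auto intro!: sum.neutral)
   finally show ?thesis by (simp add: u_def linear_diff[OF R] inner_diff_left)
  qed
  define c where "c = 1 / sqrt (R u \<bullet> u)"
  have c: "c > 0" "c * c * (R u \<bullet> u) = 1"
   using pos[OF u0] by (auto simp: c_def)
  define v where "v = c *\<^sub>R u"
  have vv: "R v \<bullet> v = 1" using c by (simp add: v_def linear_scale[OF R] mult.assoc)
  have ve: "R v \<bullet> e = 0" "R e \<bullet> v = 0" if "e:E" for e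
   using ue[OF that] sym[of e u] by (auto simp: v_def linear_scale[OF R] inner_commute)
  have vE: "v~:E" using ve(1)[of v] vv by auto
  have "span (insert v E) = span (insert b E)"
  proof (rule span_eq[THEN iffD2], intro conjI)
   show "insert v E <= span (insert b E)"
   using span_mono[of E "insert b E"] pE unfolding v_def u_def
   by (auto intro!: span_scale span_diff intro: span_base)
   have "b = (1 / c) *\<^sub>R v + p" using c(1) by (simp add: v_def u_def)
   moreover have "(1 / c) *\<^sub>R v + p:span (insert v E)"
   using span_mono[of E "insert v E"] pE by (auto intro!: span_add span_scale intro: span_base)
   ultimately show "insert b E <= span (insert v E)" by (auto intro: span_base)
  qed
  also have "... = span (insert b F)" using E(3) by (auto simp: span_insert)
  finally have "span (insert v E) = span (insert b F)" .
  moreover have "card (insert v E) = card (insert b F)" using insert.hyps E vE by simp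
  ultimately show ?case using E(1) on ve vv vE by (intro exI[of _ "insert v E"]) auto
 qed auto
 from this[OF finite_Basis independent_Basis] obtain E where E: "finite E" "card E = card (Basis :: 'v set)" "span E = (UNIV :: 'v set)"
  and on: "!!a c. a:E ==> c:E ==> R a \<bullet> c = (if a = c then 1 else 0)" by auto
 obtain f where f: "bij_betw f E (Basis :: 'v set)" using E(1,2) finite_same_card_bij by (metis finite_Basis)
 define T where "T x = (SUM e:E. (R x \<bullet> e) *\<^sub>R f e)" for x
 show ?thesis
 proof (intro exI[of _ T] conjI allI)
  show "linear T" unfolding T_def
   by (auto intro!: linearI simp: linear_add[OF R] linear_scale[OF R] inner_add_left algebra_simps sum.distrib scaleR_sum_right)
  fix x y
  have y: "y = (SUM e:E. (R y \<bullet> e) *\<^sub>R e)"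
  proof -
   obtain q where q: "y = (SUM e:E. q e *\<^sub>R e)" using E(1,3) span_finite[of E] by auto
   have "R y \<bullet> e = q e" if e: "e:E" for e
   proof -
   have "R y \<bullet> e = (SUM a:E. q a * (if a = e then 1 else 0))"
   using on e by (simp add: q linear_sum[OF R] linear_scale[OF R] inner_sum_left)
   also have "... = q e" by (subst sum.remove[OF E(1) e]) (auto intro!: sum.neutral)
   finally show ?thesis .
   qed
   then show ?thesis by (simp add: q)
  qed
  have fd: "f a \<bullet> f e = (if a = e then 1 else 0)" if "a:E" "e:E" for a e
   using f that unfolding bij_betw_def by (metis image_eqI inj_on_eq_iff inner_Basis)
  have "T x \<bullet> T y = (SUM a:E. SUM e:E. (R x \<bullet> a) * (R y \<bullet> e) * (f a \<bullet> f e))"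
   by (simp add: T_def inner_sum_left inner_sum_right mult.assoc sum_distrib_left) (subst sum.swap, simp add: mult.left_commute)
  also have "... = (SUM a:E. SUM e:E. (R x \<bullet> a) * (R y \<bullet> e) * (if a = e then 1 else 0))"
   by (intro sum.cong refl) (simp add: fd)
  also have "... = (SUM a:E. (R x \<bullet> a) * (R y \<bullet> a))"
   using E(1) by (intro sum.cong refl) (simp add: if_distrib sum.delta cong: if_cong)
  also have "... = R x \<bullet> (SUM e:E. (R y \<bullet> e) *\<^sub>R e)" by (simp add: inner_sum_right mult.commute)
  finally show "T x \<bullet> T y = R x \<bullet> y" using y by simp
 qed
qed

text \<open>The squared Hilbert-Schmidt norm; that it comes from a scalar product supplies the
  parallelogram identity.\<close>

definition hs :: "('v::euclidean_space => 'v) => real" where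
 "hs Q = (SUM e:Basis. Q e \<bullet> Q e)"

text \<open>The invariant form is the center of the orbit of the standard one: the unique minimum of the
 strictly convex invariant function \<open>N\<close>.\<close>

lemma bounded_group_orthogonal:
 fixes K :: "('v::euclidean_space => 'v) set"
 assumes lin: "!!k. k:K ==> linear k" and id: "(%x. x):K"
  and mult: "!!k l. k:K ==> l:K ==> (%x. k (l x)):K"
  and inverse: "!!k. k:K ==> EX l:K. ALL x. k (l x) = x & l (k x) = x"
  and bounded: "!!k x. k:K ==> norm (k x) <= C * norm x"
 shows "EX T :: 'v => 'v. linear T & bij T & (ALL k:K. orthogonal_transformation (%x. T (k (inv_into UNIV T x))))"
proof -
 define D where "D = max C 1"
 have D1: "1 <= D" by (simp add: D_def)
 have bd: "norm (k x) <= D * norm x" if "k:K" for k x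
  using bounded[OF that, of x] mult_right_mono[of C D "norm x"] by (simp add: D_def)
 have ak: "adjoint k y \<bullet> x = y \<bullet> k x" "x \<bullet> adjoint k y = k x \<bullet> y" if "k:K" for k x y
  using adjoint_clauses[OF lin[OF that]] by auto
 have la: "linear (adjoint k)" if "k:K" for k by (rule adjoint_linear[OF lin[OF that]])
 have nak: "norm (adjoint k y) <= D * norm y" if k: "k:K" for k y
 proof -
  have "norm (adjoint k y) * norm (adjoint k y) = y \<bullet> k (adjoint k y)"
   using ak(1)[OF k, of y "adjoint k y"] by (simp add: dot_square_norm power2_eq_square)
  also have "... <= norm y * (D * norm (adjoint k y))"
   by (rule order_trans[OF norm_cauchy_schwarz]) (simp add: bd[OF k] mult_left_mono)
  finally have "norm (adjoint k y) * norm (adjoint k y) <= (D * norm y) * norm (adjoint k y)" by (simp add: mult_ac)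
  then show ?thesis using D1 by (cases "norm (adjoint k y) = 0") (auto simp: mult_le_cancel_right)
 qed
 define cj where "cj k R = (%x. adjoint k (R (k x)))" for k R :: "'v => 'v"
 \<comment> \<open>\<open>D ^ 4\<close> bounds the squared norm of \<open>cj k (%x. x)\<close> at a
   unit vector, so the standard form belongs to the set \<open>\<G>\<close>.\<close>
 define B where "B = DIM('v) * D ^ 4"
 define N where "N R = (SUP k\<in>K. hs (cj k R))" for R :: "'v => 'v"
 \<comment> \<open>The lower bound on \<open>R (k x) \<bullet> k x\<close> is a closed version of
   positive definiteness and prevents the minimizer from degenerating.\<close>
 define \<G> where "\<G> = {R :: 'v => 'v. linear R & (ALL x y. R x \<bullet> y = x \<bullet> R y) &
   (ALL k:K. ALL x. (norm x)^2 <= D^2 * (R (k x) \<bullet> k x)) & (ALL k:K. hs (cj k R) <= B)}"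
 have hs_nn: "0 <= hs Q" for Q :: "'v => 'v" by (simp add: hs_def sum_nonneg)
 have hs_e: "norm (Q e) ^ 2 <= hs Q" if "e:Basis" for Q :: "'v => 'v" and e
  unfolding hs_def power2_norm_eq_inner by (rule member_le_sum) (use that in auto)
 have \<G>D: "linear R" "R x \<bullet> y = x \<bullet> R y" "k:K ==> (norm x)^2 <= D^2 * (R (k x) \<bullet> k x)" "k:K ==> hs (cj k R) <= B"
  if "R:\<G>" for R x y k using that unfolding \<G>_def by blast+
 have bdd: "bdd_above ((%k. hs (cj k R)) ` K)" if "R:\<G>" for R
  using \<G>D(4)[OF that] by (intro bdd_aboveI[of _ B]) auto
 have up: "hs (cj k R) <= N R" if "R:\<G>" "k:K" for R k
  unfolding N_def by (rule cSUP_upper[OF that(2) bdd[OF that(1)]])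
 have least: "N R <= b" if "!!k. k:K ==> hs (cj k R) <= b" for R b
  unfolding N_def by (rule cSUP_least) (use id that in auto)
 have start: "(%x. x):\<G>"
  unfolding \<G>_def mem_Collect_eq
 proof (intro conjI ballI allI)
  fix k assume k: "k:K"
  then obtain l where l: "l:K" "!!x. l (k x) = x" using inverse by blast
  show "(norm x)^2 <= D^2 * (k x \<bullet> k x)" for x
   using power_mono[OF bd[OF l(1), of "k x"], of 2] by (simp add: l(2) power_mult_distrib power2_norm_eq_inner[of "k x"])
  have "cj k (%x. x) e \<bullet> cj k (%x. x) e <= D ^ 4" if e: "e:Basis" for e
  proof -
   have "norm (cj k (%x. x) e) <= D * (D * norm e)"
   unfolding cj_def by (rule order_trans[OF nak[OF k] mult_left_mono[OF bd[OF k]]]) (use D1 in simp)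
   then have "norm (cj k (%x. x) e) ^ 2 <= (D * (D * 1)) ^ 2" using e by (intro power_mono) auto
   moreover have "(D * (D * 1)) ^ 2 = D ^ 4" by (simp add: power2_eq_square numeral_eq_Suc)
   ultimately show ?thesis by (simp only: power2_norm_eq_inner)
  qed
  then show "hs (cj k (%x. x)) <= B"
   unfolding hs_def B_def using sum_bounded_above[of Basis "%e. cj k (%x. x) e \<bullet> cj k (%x. x) e" "D^4"] by simp
 qed (auto simp: linear_id[unfolded id_def])
 have "EX R:\<G>. ALL R':\<G>. N R <= N R'"
 proof (rule linear_minimum)
  show "\<G> ~= {}" using start by blast
  fix R assume R: "R:\<G>"
  show "linear R" by (rule \<G>D(1)[OF R])
  show "0 <= N R" using up[OF R id] hs_nn[of "cj (%x. x) R"] by linarith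
  have "cj (%x. x) R = R" using ak[OF id] by (auto simp: cj_def fun_eq_iff intro: vector_eq_rdot[THEN iffD1])
  then have "norm (R e) ^ 2 <= B" if "e:Basis" for e using hs_e[OF that, of R] \<G>D(4)[OF R id] by simp
  then have "norm (R e) <= sqrt B" if "e:Basis" for e using that by (simp add: real_le_rsqrt)
  then show "nl R <= real DIM('v) * sqrt B" by (rule nl_le)
 next
  fix G :: "nat => 'v => 'v" and L
  assume G: "!!n. G n:\<G>" and L: "linear L" and lim: "!!x. (%n. G n x) ----> L x"
  have hl: "(%n. hs (cj k (G n))) ----> hs (cj k L)" if "k:K" for k
   unfolding hs_def cj_def by (intro tendsto_intros linear_tendsto[OF la[OF that]] lim)
  show "L:\<G>"
   unfolding \<G>_def mem_Collect_eq
  proof (intro conjI ballI allI L)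
   show "L x \<bullet> y = x \<bullet> L y" for x y
   proof (rule LIMSEQ_unique)
   show "(%n. G n x \<bullet> y) ----> L x \<bullet> y" by (intro tendsto_intros lim)
   show "(%n. G n x \<bullet> y) ----> x \<bullet> L y" unfolding \<G>D(2)[OF G] by (intro tendsto_intros lim)
   qed
   fix k assume k: "k:K"
   show "(norm x)^2 <= D^2 * (L (k x) \<bullet> k x)" for x
   by (rule LIMSEQ_le_const[of "%n. D^2 * (G n (k x) \<bullet> k x)"]) (intro tendsto_intros lim, use \<G>D(3)[OF G k] in auto)
   show "hs (cj k L) <= B"
   by (rule LIMSEQ_le_const2[OF hl[OF k]]) (use \<G>D(4)[OF G k] in auto)
  qed
  fix a assume a: "(%n. N (G n)) ----> a"
  show "N L <= a"
  proof (rule least)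
   fix k assume k: "k:K"
   show "hs (cj k L) <= a" by (rule LIMSEQ_le[OF hl[OF k] a]) (use up[OF G k] in auto)
  qed
 qed
 then obtain R where R: "R:\<G>" and min: "!!R'. R':\<G> ==> N R <= N R'" by blast
 note lR = \<G>D(1)[OF R]
 \<comment> \<open>If \<open>R\<close> differed from its translate \<open>R'\<close>, their midpoint
   \<open>M\<close> would have a smaller value of \<open>N\<close>.\<close>
 have inv: "adjoint l (R (l x)) = R x" if l: "l:K" for l x
 proof (rule ccontr)
  assume ne: "adjoint l (R (l x)) ~= R x"
  define R' where "R' = cj l R"
  define Q where "Q = (%x. R x - R' x)"
  define M where "M = (%x. (1/2) *\<^sub>R (R x + R' x))"
  have lR': "linear R'" unfolding R'_def cj_def
   by (auto intro!: linearI simp: linear_comm[OF la[OF l]] linear_comm[OF lin[OF l]] linear_comm[OF lR])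
  have lQ: "linear Q" unfolding Q_def by (auto intro!: linearI simp: linear_comm[OF lR] linear_comm[OF lR'] algebra_simps)
  have cjR': "cj k R' = cj (%x. l (k x)) R" if k: "k:K" for k
   by (auto simp: cj_def R'_def fun_eq_iff adjoint_linear_ops(3)[OF lin[OF l] lin[OF k]])
  have R': "R':\<G>"
   unfolding \<G>_def mem_Collect_eq
  proof (intro conjI ballI allI lR')
   show "R' x \<bullet> y = x \<bullet> R' y" for x y by (simp add: R'_def cj_def ak[OF l] \<G>D(2)[OF R])
   fix k assume k: "k:K"
   show "(norm x)^2 <= D^2 * (R' (k x) \<bullet> k x)" for x
   using \<G>D(3)[OF R mult[OF l k], of x] by (simp add: R'_def cj_def ak[OF l])
   show "hs (cj k R') <= B" unfolding cjR'[OF k] by (rule \<G>D(4)[OF R mult[OF l k]])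
  qed
  have par: "hs (cj k M) = (hs (cj k R) + hs (cj k R')) / 2 - hs (cj k Q) / 4" if k: "k:K" for k
  proof -
   have 1: "cj k M e = (1/2) *\<^sub>R (cj k R e + cj k R' e)" "cj k Q e = cj k R e - cj k R' e" for e
   by (simp_all add: cj_def M_def Q_def linear_comm[OF la[OF k]])
   have "((1/2) *\<^sub>R (a + b)) \<bullet> ((1/2) *\<^sub>R (a + b)) = (a \<bullet> a + b \<bullet> b) / 2 - ((a - b) \<bullet> (a - b)) / 4" for a b :: 'v
   by (simp add: inner_add_left inner_add_right inner_diff_left inner_diff_right inner_commute field_simps)
   then have 2: "cj k M e \<bullet> cj k M e = (cj k R e \<bullet> cj k R e + cj k R' e \<bullet> cj k R' e) / 2 - (cj k Q e \<bullet> cj k Q e) / 4" for e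
   unfolding 1 .
   show ?thesis unfolding hs_def 2 sum_subtractf sum_divide_distrib[symmetric] sum.distrib ..
  qed
  have M: "M:\<G>"
   unfolding \<G>_def mem_Collect_eq
  proof (intro conjI ballI allI)
   show "linear M" unfolding M_def by (auto intro!: linearI simp: linear_comm[OF lR] linear_comm[OF lR'] algebra_simps)
   show "M x \<bullet> y = x \<bullet> M y" for x y by (simp add: M_def inner_add_left inner_add_right \<G>D(2)[OF R] \<G>D(2)[OF R'])
   fix k assume k: "k:K"
   show "(norm x)^2 <= D^2 * (M (k x) \<bullet> k x)" for x
   using \<G>D(3)[OF R k, of x] \<G>D(3)[OF R' k, of x] by (simp add: M_def inner_add_left algebra_simps)
   show "hs (cj k M) <= B"
   proof -
   have "(x + y) / 2 - z / 4 <= b" if "x <= b" "y <= b" "0 <= z" for x y z b :: real using that by argo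
   then show ?thesis unfolding par[OF k] using \<G>D(4)[OF R k] \<G>D(4)[OF R' k] hs_nn[of "cj k Q"] by blast
   qed
  qed
  \<comment> \<open>\<open>N\<close> is a supremum over \<open>K\<close>, so the gain from the
    parallelogram identity must be uniform in \<open>k\<close>. Undoing \<open>k\<close> by its
    inverse \<open>k'\<close> bounds \<open>Q\<close> by \<open>cj k Q\<close>, with a constant that
    depends only on \<open>D\<close> and the dimension.\<close>
  define d where "d = (nl Q / (DIM('v) * D^2))^2 / DIM('v)"
  have low: "d <= hs (cj k Q)" if k: "k:K" for k
  proof -
   obtain k' where k': "k':K" "!!x. k (k' x) = x" using inverse[OF k] by blast
   have lc: "linear (cj k Q)" unfolding cj_def
   by (auto intro!: linearI simp: linear_comm[OF la[OF k]] linear_comm[OF lin[OF k]] linear_comm[OF lQ])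
   have "adjoint k' (cj k Q (k' x)) = Q x" for x
   by (rule vector_eq_rdot[THEN iffD1]) (simp add: cj_def ak[OF k] ak[OF k'(1)] k'(2))
   moreover have "norm (cj k Q (k' e)) <= nl (cj k Q) * (D * norm e)" for e
   by (rule order_trans[OF norm_linear_le[OF lc] mult_left_mono[OF bd[OF k'(1)] nl_nonneg]])
   then have "norm (adjoint k' (cj k Q (k' e))) <= D * (nl (cj k Q) * (D * norm e))" for e
   by (rule order_trans[OF nak[OF k'(1)] mult_left_mono]) (use D1 in simp)
   ultimately have "norm (Q e) <= D * (nl (cj k Q) * (D * norm e))" for e by simp
   then have "nl Q <= DIM('v) * (D^2 * nl (cj k Q))"
   by (intro nl_le) (metis (no_types, opaque_lifting) mult.assoc mult.commute mult.right_neutral norm_Basis power2_eq_square)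
   then have "nl Q / (DIM('v) * D^2) <= nl (cj k Q)" using D1 by (simp add: field_simps)
   then have "(nl Q / (DIM('v) * D^2))^2 <= (nl (cj k Q))^2" by (intro power_mono) (use D1 in auto)
   also have "... <= DIM('v) * hs (cj k Q)"
   unfolding nl_def hs_def power2_norm_eq_inner[symmetric] using sum_squared_le_sum_of_squares[of "%e. norm (cj k Q e)" Basis] by (simp add: mult.commute)
   finally show ?thesis by (simp add: d_def divide_le_eq mult.commute)
  qed
  have "nl Q ~= 0"
   using norm_linear_le[OF lQ, of x] ne by (auto simp: Q_def R'_def cj_def)
  then have d: "0 < d" using D1 nl_nonneg[of Q] by (simp add: d_def)
  have "N R' <= N R" by (rule least) (simp add: cjR' up[OF R mult[OF l]])
  then have "hs (cj k M) <= N R - d / 4" if k: "k:K" for k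
   using par[OF k] low[OF k] up[OF R k] up[OF R' k] by argo
  then have "N M <= N R - d / 4" by (rule least)
  then show False using min[OF M] d by linarith
 qed
 have pos: "0 < R x \<bullet> x" if "x ~= 0" for x
 proof -
  have "0 < (norm x)^2" using that by simp
  then have "0 < D^2 * (R x \<bullet> x)" using \<G>D(3)[OF R id, of x] by linarith
  then show ?thesis using D1 by (simp add: zero_less_mult_iff)
 qed
 obtain T :: "'v => 'v" where T: "linear T" "!!x y. T x \<bullet> T y = R x \<bullet> y"
  using orthonormalization[OF lR \<G>D(2)[OF R]] pos by blast
 have "inj T" unfolding linear_injective_0[OF T(1)] using T(2) pos by (metis inner_zero_left less_irrefl)
 then have b: "bij T" using linear_injective_imp_surjective[OF T(1)] by (simp add: bij_def)
 define g where "g = inv_into UNIV T"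
 have gh: "T (g x) = x" for x using b by (simp_all add: g_def bij_is_surj surj_f_inv_f)
 have lg: "linear g" unfolding g_def by (rule inj_linear_imp_inv_linear[OF T(1) bij_is_inj[OF b]])
 have "orthogonal_transformation (%x. T (k (g x)))" if k: "k:K" for k
  unfolding orthogonal_transformation_def
 proof (intro conjI allI)
  show "linear (%x. T (k (g x)))"
   by (auto intro!: linearI simp: linear_comm[OF T(1)] linear_comm[OF lg] linear_comm[OF lin[OF k]])
  fix v w
  have "T (k (g v)) \<bullet> T (k (g w)) = adjoint k (R (k (g v))) \<bullet> g w" by (simp add: T(2) ak[OF k])
  also have "... = T (g v) \<bullet> T (g w)" by (simp only: T(2) inv[OF k])
  finally show "T (k (g v)) \<bullet> T (k (g w)) = v \<bullet> w" by (simp add: gh)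
 qed
 then show ?thesis using T(1) b unfolding g_def by blast
qed

text \<open>The defining sum uses an arbitrary basis of \<open>V\<close>; expanding
  \<open>f e\<close> in it and contracting with the ambient orthonormal basis gives the same
  value.\<close>

lemma trace_on_eq:
 fixes f :: "'v::euclidean_space => 'v"
 assumes V: "subspace V" and f: "linear f" and fV: "!!x. f x:V"
 shows "trace_on V f = (SUM e:Basis. f e \<bullet> e)"
proof -
 define B where "B = (SOME B. independent B & span B = V)"
 have "EX B. independent B & span B = V"
  using basis_exists[of V] span_subspace[OF _ _ V] by metis
 then have B: "independent B" "span B = V" using someI_ex[of "%B. independent B & span B = V"] unfolding B_def by blast+
 have fin: "finite B" using B(1) by (rule independent_imp_finite)
 have l: "linear (%x. representation B (f x) b)" for b
  using fV by (auto intro!: linearI simp: linear_comm[OF f] representation_add[OF B(1)] representation_scale[OF B(1)] B(2))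
 have "f e = (SUM b:B. representation B (f e) b *\<^sub>R b)" for e
  using sum_representation_eq[OF B(1) _ fin subset_refl, of "f e"] fV B(2) by simp
 then have "(SUM e:Basis. f e \<bullet> e) = (SUM e:Basis. SUM b:B. representation B (f e) b * (b \<bullet> e))"
  by (metis (no_types, lifting) inner_scaleR_left inner_sum_left sum.cong)
 also have "... = (SUM b:B. SUM e:Basis. (b \<bullet> e) * representation B (f e) b)"
  by (subst sum.swap) (simp add: mult.commute)
 also have "... = (SUM b:B. representation B (f b) b)"
 proof (rule sum.cong[OF refl])
  show "(SUM e:Basis. (b \<bullet> e) * representation B (f e) b) = representation B (f b) b" for b
   using linear_expand[OF l[of b], of b] by (simp only: real_scaleR_def)
 qed
 finally show ?thesis by (simp add: trace_on_def B_def[symmetric])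
qed

section \<open>The Killing form of a bracket on a subspace, and its inverse\<close>

lemma killing_form_eq_kp:
 fixes m :: "'v::euclidean_space => 'v => 'v"
 assumes V: "subspace V" and m: "bilinear m" and mV: "!!x y. m x y:V"
  and br: "!!x y. x:V ==> y:V ==> br x y = m x y" and xy: "x:V" "y:V"
 shows "killing_form V br x y = kp m x y"
proof -
 have eq: "trace_on V f = trace_on V g" if "!!z. z:V ==> f z = g z" for f g :: "'v => 'v"
 proof -
  have "EX B. independent B & span B = V" using basis_exists[of V] span_subspace[OF _ _ V] by metis
  then have "span (SOME B. independent B & span B = V) = V"
   using someI_ex[of "%B. independent B & span B = V"] by blast
  then have "b:V" if "b:(SOME B. independent B & span B = V)" for b using span_base that by blast
  then show ?thesis using that by (simp add: trace_on_def Let_def)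
 qed
 have "killing_form V br x y = trace_on V (%z. m x (m y z))"
  unfolding killing_form_def by (rule eq) (simp add: br xy mV)
 also have "... = kp m x y"
  unfolding kp_def by (rule trace_on_eq[OF V]) (auto intro!: linearI simp: bilinear_comm[OF m] mV)
 finally show ?thesis .
qed

text \<open>The Gram operator \<open>kap\<close> of the form is completed by the identity on the
  kernel of \<open>P\<close> to an invertible map \<open>A\<close> of the whole space;
  \<open>S\<close> is its inverse applied after \<open>P\<close>.\<close>

lemma killing_alg_exists:
 fixes P :: "'v::euclidean_space => 'v"
 assumes P: "linear P" "!!x y. P x \<bullet> y = x \<bullet> P y" "!!x. P (P x) = P x"
  and m: "bilinear m" "!!x y. m x y = - m y x" "!!x y z. m x (m y z) = m (m x y) z + m y (m x z)"
   "!!x y. m (P x) y = m x y" "!!x y. P (m x y) = m x y"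
  and nd: "!!u. P u = u ==> (!!z. kp m u z = 0) ==> u = 0"
 shows "EX S. killing_alg P S m"
proof -
 have kb: "bilinear (kp m)"
  unfolding bilinear_def kp_def
  by (auto intro!: linearI simp: bilinear_comm[OF m(1)] inner_add_left sum.distrib sum_distrib_left)
 have kP: "kp m (P x) y = kp m x y" "kp m x (P y) = kp m x y" for x y by (simp_all add: kp_def m(4))
 define kap where "kap x = (SUM e:Basis. kp m x e *\<^sub>R e)" for x
 have kap: "kap x \<bullet> y = kp m x y" for x y
  using linear_expand[of "kp m x" y] kb by (simp add: bilinear_def kap_def inner_sum_left inner_commute[of y] mult.commute)
 have lkap: "linear kap" unfolding kap_def
  by (auto intro!: linearI simp: bilinear_comm[OF kb] sum.distrib scaleR_add_left scaleR_sum_right)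
 have kapP: "kap (P x) = kap x" "P (kap x) = kap x" for x
  by (rule vector_eq_rdot[THEN iffD1], simp add: kap kP P(2))+
 define A where "A x = kap x + (x - P x)" for x
 have lA: "linear A" unfolding A_def by (auto intro!: linearI simp: linear_comm[OF lkap] linear_comm[OF P(1)] algebra_simps)
 have PA: "P (A x) = kap x" and AP: "A (P x) = kap x" for x by (simp_all add: A_def linear_comm[OF P(1)] P(3) kapP)
 have "x = 0" if "A x = 0" for x
 proof -
  have k0: "kap x = 0" using PA[of x] that by (simp add: linear_comm[OF P(1)])
  then have "x = P x" using that by (simp add: A_def)
  moreover have "kp m x z = 0" for z using kap[of x z] k0 by simp
  ultimately show ?thesis using nd[of x] by simp
 qed
 then have "inj A" unfolding linear_injective_0[OF lA] by blast
 then have b: "bij A" using linear_injective_imp_surjective[OF lA] by (simp add: bij_def)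
 define C where "C = inv_into UNIV A"
 have AC: "A (C x) = x" "C (A x) = x" for x
  using b by (simp_all add: C_def bij_is_surj surj_f_inv_f bij_is_inj)
 have lC: "linear C" unfolding C_def by (rule inj_linear_imp_inv_linear[OF lA bij_is_inj[OF b]])
 have CP: "C (P x) = P (C x)" for x by (metis AC PA AP)
 have "killing_alg P (%x. C (P x)) m"
 proof (rule killing_alg.intro)
  show "linear (%x. C (P x))" by (auto intro!: linearI simp: linear_comm[OF lC] linear_comm[OF P(1)])
  show "kp m (C (P x)) y = P x \<bullet> y" for x y
  proof -
   have "kap (C (P x)) = P x" by (metis AC(1) AP CP P(3))
   then show ?thesis using kap[of "C (P x)" y] by simp
  qed
 qed (fact P m | simp add: CP[symmetric] P(3))+
 then show ?thesis by blast
qed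

text \<open>Reduction to an orthogonal group and an orthogonal projection. The reflection
  \<open>ep\<close> commutes with \<open>K\<close> and is adjoined to it; a change of coordinates
  \<open>T\<close> makes the enlarged group orthogonal, and then the projection is orthogonal
  because its reflection is.\<close>

theorem cartan_involution_exists:
 fixes m :: "'v::euclidean_space => 'v => 'v" and P :: "'v => 'v"
 assumes V: "subspace V" and P: "linear P" "!!x. P x:V" "!!x. x:V ==> P x = x"
  and m: "bilinear m" "!!x y. m x y:V" "!!x y. m (P x) y = m x y" "!!x y. m x (P y) = m x y"
  and leib: "!!x y z. m x (m y z) = m (m x y) z + m y (m x z)"
  and ss: "semisimple V m"
  and lin: "!!k. k:K ==> linear k" and id: "(%x. x):K"
  and mult: "!!k l. k:K ==> l:K ==> (%x. k (l x)):K"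
  and inverse: "!!k. k:K ==> EX l:K. ALL x. k (l x) = x & l (k x) = x"
  and bounded: "!!k x. k:K ==> norm (k x) <= C * norm x"
  and kP: "!!k x. k:K ==> k (P x) = P (k x)" and km: "!!k x y. k:K ==> m (k x) (k y) = k (m x y)"
 shows "m x y = - m y x" "EX t. is_cartan_involution P K m t"
proof -
 have PP: "P (P x) = P x" for x by (simp add: P)
 have kf: "killing_form V m x y = kp m x y" if "x:V" "y:V" for x y
  by (rule killing_form_eq_kp[OF V m(1,2) refl that])
 have nd: "u = 0" if "P u = u" "!!z. kp m u z = 0" for u
 proof -
  have "u:V" using P(2)[of u] that(1) by simp
  then show ?thesis using ss that(2) kf unfolding semisimple_def by simp
 qed
 \<comment> \<open>Adding the Leibniz rules for \<open>x, y\<close> and for \<open>y, x\<close>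
   shows that \<open>m x y + m y x\<close> acts as zero, so nondegeneracy removes it.\<close>
 have anti: "m x y = - m y x" for x y
 proof -
  have "m (m x y + m y x) z = 0" for z
   using leib[of x y z] leib[of y x z] by (simp add: bilinear_comm[OF m(1)] algebra_simps)
  then have "m x y + m y x = 0"
   by (intro nd) (simp_all add: kp_def P m subspace_add[OF V])
  then show ?thesis by (simp add: eq_neg_iff_add_eq_0)
 qed
 then show "m x y = - m y x" .
 define ep where "ep = (%x. 2 *\<^sub>R P x - x)"
 have lep: "linear ep" unfolding ep_def by (auto intro!: linearI simp: linear_comm[OF P(1)] algebra_simps)
 have epep: "ep (ep x) = x" for x by (simp add: ep_def linear_comm[OF P(1)] PP algebra_simps scaleR_2)
 have kep: "k (ep x) = ep (k x)" if "k:K" for k x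
  by (simp add: ep_def linear_comm[OF lin[OF that]] kP[OF that])
 define K' where "K' = K Un (%k x. k (ep x)) ` K"
 have K'E: "EX l:K. k = l \<or> k = (%x. l (ep x))" if "k:K'" for k using that by (auto simp: K'_def)
 have K'I: "l:K'" "(%x. l (ep x)):K'" if "l:K" for l using that by (auto simp: K'_def)
 define c where "c = 2 * nl P + 1"
 have nep: "norm (ep x) <= c * norm x" for x
  using norm_triangle_ineq4[of "2 *\<^sub>R P x" x] norm_linear_le[OF P(1), of x] by (simp add: ep_def c_def algebra_simps)
 have "EX T :: 'v => 'v. linear T & bij T & (ALL k:K'. orthogonal_transformation (%x. T (k (inv_into UNIV T x))))"
 proof (rule bounded_group_orthogonal)
  show "(%x. x):K'" by (rule K'I(1)[OF id])
  fix k assume "k:K'"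
  then obtain l where l: "l:K" and kl: "k = l \<or> k = (%x. l (ep x))" using K'E by blast
  show "linear k" using kl lin[OF l] linear_compose[OF lep lin[OF l]] by (auto simp: o_def)
  obtain l' where l': "l':K" "!!x. l (l' x) = x" "!!x. l' (l x) = x" using inverse[OF l] by blast
  show "EX j:K'. ALL x. k (j x) = x & j (k x) = x"
   using kl
  proof
   assume "k = l" then show ?thesis using l' K'I(1)[OF l'(1)] by auto
  next
   assume "k = (%x. l (ep x))"
   moreover have "ep (l' (ep x)) = l' x" "ep (l (ep x)) = l x" for x
   by (simp_all add: kep[OF l'(1)] kep[OF l] epep)
   ultimately show ?thesis by (intro bexI[OF _ K'I(2)[OF l'(1)]]) (simp add: l')
  qed
  show "norm (k x) <= (\<bar>C\<bar> * (c + 1)) * norm x" for x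
  proof -
   have n: "norm (l y) <= \<bar>C\<bar> * norm y" for y
   by (rule order_trans[OF bounded[OF l] mult_right_mono]) auto
   have c: "0 <= c" by (simp add: c_def add_nonneg_nonneg)
   show ?thesis using kl
   proof
   assume "k = l"
   moreover have "\<bar>C\<bar> * norm x <= (\<bar>C\<bar> * (c + 1)) * norm x"
   using c by (intro mult_right_mono) (auto simp: mult_le_cancel_left1)
   ultimately show ?thesis using n[of x] by simp
   next
   assume k: "k = (%x. l (ep x))"
   have "norm (k x) <= \<bar>C\<bar> * (c * norm x)"
   unfolding k by (rule order_trans[OF n mult_left_mono[OF nep]]) simp
   also have "... <= \<bar>C\<bar> * ((c + 1) * norm x)" by (intro mult_left_mono mult_right_mono) auto
   finally show ?thesis by (simp add: mult.assoc)
   qed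
  qed
  fix j assume "j:K'"
  then obtain i where i: "i:K" and ji: "j = i \<or> j = (%x. i (ep x))" using K'E by blast
  show "(%x. k (j x)):K'"
   using K'I[OF mult[OF l i]] kl ji by (auto simp: kep[OF i] epep)
 qed
 then obtain T :: "'v => 'v" where T: "linear T" "bij T"
  and orth: "!!k. k:K' ==> orthogonal_transformation (%x. T (k (inv_into UNIV T x)))" by blast
 define g where "g = inv_into UNIV T"
 have gT: "T (g x) = x" "g (T x) = x" for x
  using T(2) by (simp_all add: g_def bij_is_surj surj_f_inv_f bij_is_inj)
 have lg: "linear g" unfolding g_def by (rule inj_linear_imp_inv_linear[OF T(1) bij_is_inj[OF T(2)]])
 define L where "L = (%k x. T (k (g x))) ` K'"
 define n where "n x y = T (m (g x) (g y))" for x y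
 define Q where "Q x = T (P (g x))" for x
 have lL: "orthogonal_transformation l" if "l:L" for l using that orth unfolding L_def g_def by blast
 have bn: "bilinear n" by (auto intro!: linearI simp: n_def bilinear_def linear_comm[OF T(1)] linear_comm[OF lg] bilinear_comm[OF m(1)])
 have iso: "T (m x y) = n (T x) (T y)" for x y by (simp add: n_def gT)
 have kpn: "kp n (T x) (T y) = kp m x y" for x y
  by (rule kp_iso[where h = T and m = m and M = n, OF m(1) T iso])
 have epL: "(%x. 2 *\<^sub>R Q x - x) = (%x. T (ep (g x)))" by (auto simp: Q_def ep_def linear_comm[OF T(1)] gT)
 have epinL: "(%x. 2 *\<^sub>R Q x - x):L" unfolding epL L_def using K'I(2)[OF id] by blast
 \<comment> \<open>An orthogonal involution is symmetric, and \<open>Q\<close> is the mean of the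
   identity and such an involution.\<close>
 have symQ: "Q x \<bullet> y = x \<bullet> Q y" for x y
 proof -
  let ?e = "%x. 2 *\<^sub>R Q x - x"
  have QQ: "Q (Q x) = Q x" and lQ: "linear Q" for x
   by (auto simp: Q_def gT PP intro!: linearI simp: linear_comm[OF T(1)] linear_comm[OF lg] linear_comm[OF P(1)])
  have "Q (?e x) = Q x" for x by (simp add: linear_diff[OF lQ] linear_scale[OF lQ] QQ) (simp add: scaleR_2)
  then have ee: "?e (?e x) = x" for x by simp
  have "?e x \<bullet> y = ?e (?e x) \<bullet> ?e y" using lL[OF epinL] by (simp only: orthogonal_transformation_def)
  then have "?e x \<bullet> y = x \<bullet> ?e y" by (simp only: ee)
  then show ?thesis by (simp add: inner_diff_left inner_diff_right)
 qed
 have Qf: "linear Q" "!!x. Q (Q x) = Q x"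
  by (auto simp: Q_def gT PP intro!: linearI simp: linear_comm[OF T(1)] linear_comm[OF lg] linear_comm[OF P(1)])
 have n1: "n x y = - n y x" for x y using anti[of "g x" "g y"] by (simp add: n_def linear_comm[OF T(1)])
 have nf: "n x y = - n y x" "n x (n y z) = n (n x y) z + n y (n x z)" "n (Q x) y = n x y" "Q (n x y) = n x y" for x y z
  by (rule n1) (simp_all add: n_def Q_def gT linear_comm[OF T(1)] leib[of "g x"] m P)
 have "EX S. killing_alg Q S n"
 proof (rule killing_alg_exists[OF Qf(1) symQ Qf(2) bn nf])
  fix u assume u: "Q u = u" "!!z. kp n u z = 0"
  have "g u = 0"
  proof (rule nd)
   show "P (g u) = g u" using u(1) by (metis Q_def gT(2))
   show "kp m (g u) z = 0" for z using u(2)[of "T z"] kpn[of "g u" z] by (simp add: gT)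
  qed
  then show "u = 0" by (metis gT(1) linear_0[OF T(1)])
 qed
 then obtain S where S: "killing_alg Q S n" ..
 have nL: "n (l x) (l y) = l (n x y)" and QL: "Q (l x) = l (Q x)" if lL: "l:L" for l x y
 proof -
  obtain k where k: "k:K'" and l: "l = (%x. T (k (g x)))" using lL by (auto simp: L_def)
  obtain j where j: "j:K" and kj: "k = j \<or> k = (%x. j (ep x))" using K'E[OF k] by blast
  have mep: "m (ep x) (ep y) = m x y" "ep (m x y) = m x y" for x y
   by (simp_all add: ep_def bilinear_comm[OF m(1)] m P scaleR_2 algebra_simps)
  have Pep: "P (ep x) = ep (P x)" for x by (simp add: ep_def linear_comm[OF P(1)])
  show "n (l x) (l y) = l (n x y)" using kj by (auto simp: l n_def gT km[OF j] mep)
  show "Q (l x) = l (Q x)" using kj by (auto simp: l Q_def gT kP[OF j] Pep[symmetric])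
 qed
 have "eq_lie Q L n" unfolding eq_lie_def using nL bn nf by (intro conjI allI ballI) (assumption | rule nf nL)+
 then have "LA Q L n S" using S by (simp add: LA_def)
 then obtain t where t: "is_cartan_involution Q L n t"
  using cartan_involution_orthogonal[of Q L n S] lL QL epinL by blast
 show "EX t. is_cartan_involution P K m t"
 proof (rule exI)
  show "is_cartan_involution P K m (%x. inv_into UNIV T (t (T x)))"
  proof (rule cartan_involution_transfer[where h = T and M = n and L = L and Q = Q, OF t m(1) T])
   show "T (m x y) = n (T x) (T y)" for x y by (rule iso)
   show "T (P x) = Q (T x)" for x by (simp add: Q_def gT)
   show "EX l:L. ALL x. T (k x) = l (T x)" if "k:K" for k
   using K'I(1)[OF that] unfolding L_def by (intro bexI[of _ "%x. T (k (g x))"]) (auto simp: gT)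
  qed
 qed
qed

section \<open>Calculus of smooth maps on relatively open sets\<close>

abbreviation opn :: "'v::real_normed_vector set => 'v set => bool" where
 "opn V S \<equiv> openin (top_of_set V) S"

section \<open>Rules for finite order of differentiability\<close>

lemma Ck_on_cong: "(!!x. x:S ==> f x = g x) ==> Ck_on V S f k = Ck_on V S g k"
proof (cases k)
 case 0
 then show "(!!x. x:S ==> f x = g x) ==> ?thesis" by (auto cong: continuous_on_cong)
next
 case (Suc k)
 assume eq: "!!x. x:S ==> f x = g x"
 have "(f has_derivative d) (at x within S) \<longleftrightarrow> (g has_derivative d) (at x within S)" if "x:S" for x d
  using has_derivative_transform[OF that, of g f d] has_derivative_transform[OF that, of f g d] eq by metis
 then show ?thesis unfolding Suc by (simp cong: ball_cong)
qed

lemma Ck_on_decr: "Ck_on V S f (Suc k) ==> Ck_on V S f k"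
proof (induction k arbitrary: f)
 case 0
 then show ?case using has_derivative_continuous by (fastforce simp: continuous_on_eq_continuous_within)
next
 case (Suc k)
 then obtain f' where f': "ALL x:S. (f has_derivative f' x) (at x within S)"
   "!!v. v:V ==> Ck_on V S (%x. f' x v) (Suc k)"
  by (auto simp del: Ck_on.simps simp: Ck_on.simps(2)[of _ _ _ "Suc k"])
 show ?case unfolding Ck_on.simps(2) using f' Suc.IH by blast
qed

lemma Ck_on_subset: "Ck_on V S f k ==> T <= S ==> W <= V ==> Ck_on W T f k"
proof (induction k arbitrary: f)
 case 0
 then show ?case by (auto intro: continuous_on_subset)
next
 case (Suc k)
 then obtain f' where f': "ALL x:S. (f has_derivative f' x) (at x within S)"
   "!!v. v:V ==> Ck_on V S (%x. f' x v) k" by auto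
 have "(f has_derivative f' x) (at x within T)" if "x:T" for x
  using f'(1) that Suc.prems(2) by (blast intro: has_derivative_subset)
 then show ?case unfolding Ck_on.simps using Suc.IH[OF f'(2) Suc.prems(2,3)] Suc.prems(3) by blast
qed

lemma Ck_on_const: "Ck_on V S (%x. c) k"
 by (induction k arbitrary: c) (auto intro!: exI[of _ "%x v. 0"])

lemma Ck_on_bounded_linear: "bounded_linear L ==> Ck_on V S L k"
proof (cases k)
 case (Suc j)
 assume "bounded_linear L"
 then show ?thesis unfolding Suc
  by (auto intro!: exI[of _ "%x. L"] Ck_on_const bounded_linear_imp_has_derivative)
qed (auto simp: linear_continuous_on)

lemma Ck_on_add: "Ck_on V S f k ==> Ck_on V S g k ==> Ck_on V S (%x. f x + g x) k"
proof (induction k arbitrary: f g)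
 case (Suc k)
 then obtain f' g' where f': "ALL x:S. (f has_derivative f' x) (at x within S)" "!!v. v:V ==> Ck_on V S (%x. f' x v) k"
   and g': "ALL x:S. (g has_derivative g' x) (at x within S)" "!!v. v:V ==> Ck_on V S (%x. g' x v) k" by auto
 show ?case unfolding Ck_on.simps
  by (intro exI[of _ "%x v. f' x v + g' x v"]) (use f' g' Suc.IH in "auto intro: has_derivative_add")
qed (auto intro: continuous_on_add)

lemma Ck_on_bilinear:
 assumes h: "bounded_bilinear h"
 shows "Ck_on V S f k ==> Ck_on V S g k ==> Ck_on V S (%x. h (f x) (g x)) k"
proof (induction k arbitrary: f g)
 case 0
 then show ?case by (simp add: bounded_bilinear.continuous_on[OF h])
next
 case (Suc k)
 then obtain f' g' where f': "ALL x:S. (f has_derivative f' x) (at x within S)" "!!v. v:V ==> Ck_on V S (%x. f' x v) k"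
   and g': "ALL x:S. (g has_derivative g' x) (at x within S)" "!!v. v:V ==> Ck_on V S (%x. g' x v) k" by auto
 show ?case unfolding Ck_on.simps
  by (intro exI[of _ "%x v. h (f x) (g' x v) + h (f' x v) (g x)"])
   (use f' g' Suc.IH Ck_on_decr[OF Suc.prems(1)] Ck_on_decr[OF Suc.prems(2)] in
   \<open>auto intro!: Ck_on_add bounded_bilinear.FDERIV[OF h]\<close>)
qed

lemma Ck_on_linear_comp: "bounded_linear L ==> Ck_on V S f k ==> Ck_on V S (%x. L (f x)) k"
proof (induction k arbitrary: f)
 case 0
 then show ?case by (simp add: bounded_linear.continuous_on)
next
 case (Suc k)
 then obtain f' where f': "ALL x:S. (f has_derivative f' x) (at x within S)" "!!v. v:V ==> Ck_on V S (%x. f' x v) k" by auto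
 show ?case unfolding Ck_on.simps
  by (intro exI[of _ "%x v. L (f' x v)"]) (use f' Suc in "auto intro: bounded_linear.has_derivative")
qed

lemma Ck_on_sum: "finite I ==> (!!i. i:I ==> Ck_on V S (f i) k) ==> Ck_on V S (%x. SUM i:I. f i x) k"
 by (induction I rule: finite_induct) (auto intro: Ck_on_const Ck_on_add)

lemma Ck_on_Pair:
 fixes f :: "_ => 'a::real_normed_vector" and g :: "_ => 'b::real_normed_vector"
 assumes "Ck_on V S f k" "Ck_on V S g k" shows "Ck_on V S (%x. (f x, g x)) k"
proof -
 have "Ck_on V S (%x. (f x, 0 :: 'b) + (0 :: 'a, g x)) k"
  by (intro Ck_on_add Ck_on_linear_comp[OF _ assms(1)] Ck_on_linear_comp[OF _ assms(2)])
   (auto intro: bounded_linear_Pair bounded_linear_ident bounded_linear_zero)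
 then show ?thesis by simp
qed

text \<open>Some linear projection onto \<open>V\<close>, not necessarily orthogonal. Composition
  with it extends data from the model subspace to the ambient space, where theorems about open sets
  apply.\<close>

definition proj :: "'v::euclidean_space set => 'v => 'v" where
 "proj V = (SOME P. linear P & range P <= V & (ALL x:V. P x = x))"

lemma proj:
 assumes "subspace V"
 shows "linear (proj V)" "proj V x:V" "x:V ==> proj V x = x"
proof -
 have "EX P. linear P & range P <= V & (ALL x:V. P x = x)"
  using linear_exists_left_inverse_on[of "%x. x" V] assms by (auto simp: linear_ident)
 from someI_ex[OF this] show "linear (proj V)" "proj V x:V" "x:V ==> proj V x = x"
  unfolding proj_def by auto
qed

lemma derivative_in_subspace:
 fixes c :: "real => 'v::euclidean_space"
 assumes d: "(c hvd d) (at t)" and ev: "\<forall>\<^sub>F s in at t. c s:W" and W: "subspace W" and ct: "c t:W"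
 shows "d:W"
proof -
 have P: "linear (proj W)" "proj W x:W" "x:W ==> proj W x = x" for x using proj[OF W] by auto
 have "((%s. proj W (c s)) hvd proj W d) (at t)"
  by (rule bounded_linear.has_vector_derivative[OF _ d]) (use P(1) linear_conv_bounded_linear in blast)
 then have "(c hvd proj W d) (at t)"
  unfolding has_vector_derivative_def
  by (rule has_derivative_transform_eventually) (use ev P(3) ct in "auto elim: eventually_mono")
 then have "d = proj W d" using d by (rule vector_derivative_unique_at[rotated])
 then show ?thesis using P(2) by metis
qed

text \<open>The derivative within \<open>S\<close> is pinned down only along \<open>V\<close>; there
  it is the velocity of the image of a line, which also gives its uniqueness.\<close>

lemma directional_derivative:
 fixes f :: "'v::euclidean_space => 'w::real_normed_vector"
 assumes V: "subspace V" and S: "opn V S" and x: "x:S" and v: "v:V"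
  and f: "(f has_derivative f') (at x within S)"
 shows "((%t. f (x + t *\<^sub>R v)) hvd f' v) (at 0)" "\<forall>\<^sub>F t in at 0. x + t *\<^sub>R v:S"
proof -
 obtain O' where O': "open O'" "S = V Int O'" using S by (auto simp: openin_open)
 let ?c = "%t :: real. x + t *\<^sub>R v"
 have T: "open (?c -` O')" by (intro open_vimage O'(1)) (auto intro!: continuous_intros)
 have 0: "0:?c -` O'" using x O' by simp
 have im: "?c t:S" if "t:?c -` O'" for t
  using that O' x v V by (auto simp: subspace_add subspace_scale)
 show "\<forall>\<^sub>F t in at 0. ?c t:S"
  using eventually_at_in_open'[OF T 0] by eventually_elim (rule im)
 have "(?c has_derivative (%h. h *\<^sub>R v)) (at 0 within ?c -` O')"
  by (auto intro!: derivative_eq_intros)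
 moreover have "(f has_derivative f') (at (?c 0) within ?c ` (?c -` O'))"
  by (rule has_derivative_subset[of _ _ _ S]) (use f im in auto)
 ultimately have d: "((%t. f (?c t)) has_derivative (%h. f' (h *\<^sub>R v))) (at 0 within ?c -` O')"
  by (rule has_derivative_in_compose)
 have l: "linear f'" using f by (rule has_derivative_linear)
 show "((%t. f (?c t)) hvd f' v) (at 0)"
  using d unfolding has_vector_derivative_def at_within_open[OF 0 T] linear_scale[OF l] .
qed

lemma derivative_unique_on:
 fixes f :: "'v::euclidean_space => 'w::real_normed_vector"
 assumes "subspace V" "opn V S" "x:S" "v:V"
  "(f has_derivative f') (at x within S)" "(f has_derivative f'') (at x within S)"
 shows "f' v = f'' v"
 using directional_derivative(1)[OF assms(1-5)] directional_derivative(1)[OF assms(1-4,6)]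
 by (rule vector_derivative_unique_at)

lemma Ck_on_compose:
 fixes f :: "'v::euclidean_space => 'w::euclidean_space" and g :: "'w => 'u::real_normed_vector"
 assumes V: "subspace V" "opn V S" and W: "subspace W" "T <= W" and fT: "f ` S <= T"
 shows "Ck_on V S f k ==> Ck_on W T g k ==> Ck_on V S (%x. g (f x)) k"
proof (induction k arbitrary: g)
 case 0
 then show ?case using fT by (auto intro: continuous_on_compose2)
next
 case (Suc k)
 obtain f' where f': "ALL x:S. (f has_derivative f' x) (at x within S)" "!!v. v:V ==> Ck_on V S (%x. f' x v) k"
  using Suc.prems(1) by auto
 obtain g' where g': "ALL x:T. (g has_derivative g' x) (at x within T)" "!!v. v:W ==> Ck_on W T (%x. g' x v) k"
  using Suc.prems(2) by auto
 note p = proj[OF W(1)]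
 \<comment> \<open>The chain rule evaluates \<open>g'\<close> in a direction that varies with the
   point, whereas \<open>Ck_on\<close> differentiates in fixed directions; the expansion over
   \<open>proj W b\<close> separates the two.\<close>
 have ex: "w = (SUM b:Basis. (w \<bullet> b) *\<^sub>R proj W b)" if "w:W" for w
  using linear_expand[OF p(1), of w] p(3)[OF that] by simp
 have fW: "f' x v:W" if "x:S" "v:V" for x v
 proof (rule derivative_in_subspace)
  note dd = directional_derivative[OF V that bspec[OF f'(1) that(1)]]
  show "((%t. f (x + t *\<^sub>R v)) hvd f' x v) (at 0)" by (rule dd(1))
  show "\<forall>\<^sub>F t in at 0. f (x + t *\<^sub>R v):W" using dd(2) by eventually_elim (use fT W(2) in auto)
  show "f (x + 0 *\<^sub>R v):W" using that fT W(2) by auto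
 qed (rule W(1))
 have "Ck_on V S (%x. g' (f x) (f' x v)) k" if v: "v:V" for v
 proof -
  have c: "Ck_on V S (%x. SUM b:Basis. (f' x v \<bullet> b) *\<^sub>R g' (f x) (proj W b)) k"
  proof (intro Ck_on_sum finite_Basis Ck_on_bilinear[OF bounded_bilinear_scaleR])
   fix b :: 'w
   show "Ck_on V S (%x. f' x v \<bullet> b) k"
   by (rule Ck_on_linear_comp[OF bounded_linear_inner_left f'(2)[OF v]])
   show "Ck_on V S (%x. g' (f x) (proj W b)) k"
   by (rule Suc.IH[OF Ck_on_decr[OF Suc.prems(1)] g'(2)[OF p(2)]])
  qed
  have e: "(SUM b:Basis. (f' x v \<bullet> b) *\<^sub>R g' (f x) (proj W b)) = g' (f x) (f' x v)" if x: "x:S" for x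
  proof -
   have l: "linear (g' (f x))" using g'(1) fT x by (auto intro: has_derivative_linear)
   show ?thesis
   by (subst (2) ex[OF fW[OF x v]]) (simp add: linear_sum[OF l] linear_scale[OF l])
  qed
  show ?thesis by (rule Ck_on_cong[THEN iffD1, rotated, OF c e])
 qed
 moreover have "((%x. g (f x)) has_derivative (%v. g' (f x) (f' x v))) (at x within S)" if "x:S" for x
  using that f'(1) g'(1) fT by (intro has_derivative_in_compose2[of T g g' f S]) auto
 ultimately show ?case unfolding Ck_on.simps by (intro exI[of _ "%x v. g' (f x) (f' x v)"]) blast
qed

lemma at_within_opn:
 assumes "opn V T" "x:T" "T <= S" "S <= V"
 shows "at x within S = at x within T"
proof -
 obtain U where "open U" "T = V Int U" using assms(1) by (auto simp: openin_open)
 then show ?thesis using assms by (intro at_within_nhd[of x U]) auto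
qed

lemma Ck_on_local:
 fixes f :: "'v::euclidean_space => 'w::real_normed_vector"
 assumes V: "subspace V" "S <= V"
 shows "(!!x. x:S ==> EX T. opn V T & x:T & T <= S & Ck_on V T f k) ==> Ck_on V S f k"
proof (induction k arbitrary: f)
 case 0
 show ?case unfolding Ck_on.simps continuous_on_eq_continuous_within
 proof
  fix x assume "x:S"
  then obtain T where T: "opn V T" "x:T" "T <= S" "continuous_on T f" using 0 by auto
  then show "continuous (at x within S) f"
   using at_within_opn[OF T(1-3) V(2)] by (simp add: continuous_on_eq_continuous_within)
 qed
next
 case (Suc k)
 then obtain T where T: "opn V (T x)" "x:T x" "T x <= S" "Ck_on V (T x) f (Suc k)" if "x:S" for x by metis
 have "EX d. (ALL y:T x. (f has_derivative d y) (at y within T x)) & (ALL v:V. Ck_on V (T x) (%y. d y v) k)" if "x:S" for x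
  using T(4)[OF that] by simp
 then obtain d where d: "y:T x ==> (f has_derivative d x y) (at y within T x)" "v:V ==> Ck_on V (T x) (%y. d x y v) k"
  if "x:S" for x y v by metis
 have der: "(f has_derivative d x y) (at y within S)" if "x:S" "y:T x" for x y
  using d(1)[OF that] at_within_opn[OF T(1)[OF that(1)] that(2) T(3)[OF that(1)] V(2)] by simp
 have S: "opn V S"
 proof -
  have "S = (UN x:S. T x)" using T(2,3) by blast
  then show ?thesis using openin_Union[of "T ` S" "top_of_set V"] T(1) by auto
 qed
 \<comment> \<open>At each point the derivative chosen for that very point is taken; uniqueness
   identifies it with the one chosen at a nearby point.\<close>
 have "Ck_on V S (%x. d x x v) k" if v: "v:V" for v
 proof (rule Suc.IH)
  fix x assume x: "x:S"
  have "d y y v = d x y v" if "y:T x" for y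
  proof -
   have y: "y:S" using T(3)[OF x] that by auto
   show ?thesis by (rule derivative_unique_on[OF V(1) S y v der[OF y T(2)[OF y]] der[OF x that]])
  qed
  then have "Ck_on V (T x) (%y. d y y v) k"
   using d(2)[OF x v] Ck_on_cong[of "T x" "%y. d y y v" "%y. d x y v"] by blast
  then show "EX T. opn V T & x:T & T <= S & Ck_on V T (%y. d y y v) k" using T(1-3)[OF x] by blast
 qed
 then show ?case unfolding Ck_on.simps using der T(2) by (intro exI[of _ "%x. d x x"]) blast
qed

section \<open>Rules for smooth maps\<close>

lemma smooth_on_cong: "(!!x. x:S ==> f x = g x) ==> smooth_on V S f = smooth_on V S g"
 unfolding smooth_on_def using Ck_on_cong by metis

lemma smooth_on_subset: "smooth_on V S f ==> T <= S ==> W <= V ==> smooth_on W T f"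
 unfolding smooth_on_def using Ck_on_subset by blast

lemma smooth_on_const: "smooth_on V S (%x. c)"
 by (simp add: smooth_on_def Ck_on_const)

lemma smooth_on_linear: "bounded_linear L ==> smooth_on V S L"
 by (simp add: smooth_on_def Ck_on_bounded_linear)

lemma smooth_on_id: "smooth_on V S (%x. x)"
 by (rule smooth_on_linear[OF bounded_linear_ident])

lemma smooth_on_add: "smooth_on V S f ==> smooth_on V S g ==> smooth_on V S (%x. f x + g x)"
 by (simp add: smooth_on_def Ck_on_add)

lemma smooth_on_linear_comp: "bounded_linear L ==> smooth_on V S f ==> smooth_on V S (%x. L (f x))"
 by (simp add: smooth_on_def Ck_on_linear_comp)

lemma smooth_on_Pair: "smooth_on V S f ==> smooth_on V S g ==> smooth_on V S (%x. (f x, g x))"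
 by (simp add: smooth_on_def Ck_on_Pair)

lemma smooth_on_compose:
 fixes f :: "'v::euclidean_space => 'w::euclidean_space" and g :: "'w => 'u::real_normed_vector"
 assumes "subspace V" "opn V S" "subspace W" "T <= W" "f ` S <= T" "smooth_on V S f" "smooth_on W T g"
 shows "smooth_on V S (%x. g (f x))"
 using assms Ck_on_compose[of V S W T f] unfolding smooth_on_def by blast

lemma smooth_on_local:
 fixes f :: "'v::euclidean_space => 'w::real_normed_vector"
 assumes "subspace V" "S <= V" "!!x. x:S ==> EX T. opn V T & x:T & T <= S & smooth_on V T f"
 shows "smooth_on V S f"
 unfolding smooth_on_def
proof
 fix k
 show "Ck_on V S f k"
  by (rule Ck_on_local[OF assms(1,2)]) (use assms(3) in \<open>auto simp: smooth_on_def\<close>, metis)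
qed

lemma smooth_on_continuous: "smooth_on V S f ==> continuous_on S f"
 unfolding smooth_on_def using Ck_on.simps(1) by blast

text \<open>Each order of differentiability comes with its own derivative; uniqueness along
  \<open>V\<close> merges them into one.\<close>

lemma smooth_on_derivative:
 fixes f :: "'v::euclidean_space => 'w::real_normed_vector"
 assumes V: "subspace V" "opn V S" and f: "smooth_on V S f"
 obtains f' where "!!x. x:S ==> (f has_derivative f' x) (at x within S)" "!!v. v:V ==> smooth_on V S (%x. f' x v)"
proof -
 have "EX d. (ALL x:S. (f has_derivative d x) (at x within S)) & (ALL v:V. Ck_on V S (%x. d x v) k)" for k
  using f Ck_on.simps(2)[of V S f k] unfolding smooth_on_def by blast
 then obtain d where d: "!!k x. x:S ==> (f has_derivative d k x) (at x within S)" "!!k v. v:V ==> Ck_on V S (%x. d k x v) k"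
  by metis
 have "smooth_on V S (%x. d 0 x v)" if v: "v:V" for v
  unfolding smooth_on_def
 proof
  fix k
  have "d 0 x v = d k x v" if "x:S" for x
   by (rule derivative_unique_on[OF V that v d(1)[OF that] d(1)[OF that]])
  then show "Ck_on V S (%x. d 0 x v) k"
   using d(2)[OF v, of k] Ck_on_cong[of S "%x. d 0 x v" "%x. d k x v"] by blast
 qed
 then show ?thesis using that d(1) by blast
qed

text \<open>A product rule with a factor \<open>c\<close> that is merely continuous, possible
  because the other factor vanishes at \<open>x\<close>.\<close>

lemma has_derivative_scaleR_vanishing:
 assumes c: "continuous (at x within S) c" and d: "(d has_derivative D) (at x within S)" and d0: "d x = 0"
 shows "((%y. c y *\<^sub>R d y) has_derivative (%h. c x *\<^sub>R D h)) (at x within S)"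
proof -
 obtain K where K: "!!h. norm (D h) <= norm h * K" using has_derivative_bounded_linear[OF d] bounded_linear.bounded by blast
 obtain e where e: "e > 0" "!!y. y:S ==> norm (y - x) < e ==> norm (d y - D (y - x)) <= 1 * norm (y - x)"
  using d d0 unfolding has_derivative_within_alt by (metis diff_zero zero_less_one)
 have "((%y. (c y - c x) *\<^sub>R d y) has_derivative (%h. 0)) (at x within S)"
 proof (rule has_derivativeI_sandwich[OF e(1)])
  fix y assume y: "y:S" "y ~= x" "dist y x < e"
  have "norm (d y) <= norm (D (y - x)) + norm (d y - D (y - x))" using norm_triangle_sub[of "d y" "D (y - x)"] by simp
  also have "... <= (K + 1) * norm (y - x)" using K[of "y - x"] e(2)[OF y(1)] y(3) by (simp add: dist_norm algebra_simps)
  finally have "\<bar>c y - c x\<bar> * norm (d y) <= \<bar>c y - c x\<bar> * ((K + 1) * norm (y - x))" by (rule mult_left_mono) simp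
  then show "norm ((c y - c x) *\<^sub>R d y - (c x - c x) *\<^sub>R d x - 0) / norm (y - x) <= \<bar>c y - c x\<bar> * (K + 1)"
   using y(2) by (simp add: divide_le_eq mult.assoc)
 next
  have "((%y. \<bar>c y - c x\<bar> * (K + 1)) \<longlongrightarrow> \<bar>c x - c x\<bar> * (K + 1)) (at x within S)"
   using c by (intro tendsto_intros) (simp add: continuous_within)
  then show "((%y. \<bar>c y - c x\<bar> * (K + 1)) \<longlongrightarrow> 0) (at x within S)" by simp
 qed simp
 from has_derivative_add[OF this has_derivative_scaleR_right[OF d, of "c x"]]
 show ?thesis by (simp add: algebra_simps)
qed

text \<open>The identity \<open>B y u = B x u - B x (A y (B y u) - A x (B y u))\<close> turns
  continuity of \<open>B\<close> into differentiability, and the resulting derivative is built from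
  \<open>B\<close> and the derivative of \<open>A\<close>, which drives the induction.\<close>

lemma Ck_on_inverse_operator:
 fixes A B :: "'x::euclidean_space => 'v::euclidean_space => 'v"
 assumes lA: "!!x. x:S ==> linear (A x)" and lB: "!!x. x:S ==> linear (B x)"
  and AB: "!!x u. x:S ==> A x (B x u) = u" and BA: "!!x u. x:S ==> B x (A x u) = u"
  and nB: "!!x u. x:S ==> norm (B x u) <= 2 * norm u"
 shows "(!!u. Ck_on V S (%x. A x u) k) ==> Ck_on V S (%x. B x u) k"
proof (induction k arbitrary: u)
 case 0
 show ?case unfolding Ck_on.simps continuous_on_eq_continuous_within continuous_within
 proof
  fix x assume x: "x:S"
  have "((%y. B y u - B x u) \<longlongrightarrow> 0) (at x within S)"
  proof (rule Lim_null_comparison)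
   show "\<forall>\<^sub>F y in at x within S. norm (B y u - B x u) <= 2 * norm (A x (B x u) - A y (B x u))"
   unfolding eventually_at_filter
   proof (rule always_eventually, intro allI impI)
   fix y assume y: "y:S"
   have "B y u - B x u = B y (A x (B x u) - A y (B x u))"
   by (simp add: linear_comm[OF lB[OF y]] AB[OF x] BA[OF y])
   then show "norm (B y u - B x u) <= 2 * norm (A x (B x u) - A y (B x u))" using nB[OF y] by simp
   qed
   have "((%y. A y (B x u)) \<longlongrightarrow> A x (B x u)) (at x within S)"
   using 0[of "B x u"] x by (simp add: continuous_on_eq_continuous_within continuous_within)
   then have "((%y. 2 * norm (A x (B x u) - A y (B x u))) \<longlongrightarrow> 2 * norm (A x (B x u) - A x (B x u))) (at x within S)"
   by (intro tendsto_intros)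
   then show "((%y. 2 * norm (A x (B x u) - A y (B x u))) \<longlongrightarrow> 0) (at x within S)" by simp
  qed
  then show "((%y. B y u) \<longlongrightarrow> B x u) (at x within S)" by (rule LIM_zero_cancel)
 qed
next
 case (Suc k)
 have Bk: "Ck_on V S (%x. B x u) k" for u by (rule Suc.IH[OF Ck_on_decr[OF Suc.prems]])
 have "Ck_on V S (%x. B x u) 0" using Bk[of u] by (induction k) (auto dest: Ck_on_decr simp del: Ck_on.simps)
 then have cB: "continuous (at x within S) (%x. B x u)" if "x:S" for x
  using that by (simp add: continuous_on_eq_continuous_within)
 have "EX d. (ALL x:S. ((%x. A x e) has_derivative d x) (at x within S)) & (ALL v:V. Ck_on V S (%x. d x v) k)" for e
  using Suc.prems[of e] by simp
 then obtain d where d: "!!e x. x:S ==> ((%x. A x e) has_derivative d e x) (at x within S)"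
  "!!e v. v:V ==> Ck_on V S (%x. d e x v) k" by metis
 let ?D = "%x h. - B x (SUM e:Basis. (B x u \<bullet> e) *\<^sub>R d e x h)"
 show ?case unfolding Ck_on.simps
 proof (intro exI[of _ ?D] conjI ballI)
  fix x assume x: "x:S"
  have "((%y. SUM e:Basis. (B y u \<bullet> e) *\<^sub>R (A y e - A x e)) has_derivative
   (%h. SUM e:Basis. (B x u \<bullet> e) *\<^sub>R d e x h)) (at x within S)"
  proof (intro has_derivative_sum has_derivative_scaleR_vanishing)
   show "continuous (at x within S) (%y. B y u \<bullet> e)" for e by (intro continuous_intros cB[OF x])
   show "((%y. A y e - A x e) has_derivative d e x) (at x within S)" for e
   using has_derivative_diff[OF d(1)[OF x] has_derivative_const] by simp
  qed simp
  from bounded_linear.has_derivative[OF linear_bounded[OF lB[OF x]] this]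
  have "((%y. B x u - B x (SUM e:Basis. (B y u \<bullet> e) *\<^sub>R (A y e - A x e))) has_derivative (%h. 0 - B x (SUM e:Basis. (B x u \<bullet> e) *\<^sub>R d e x h))) (at x within S)"
   by (intro has_derivative_diff has_derivative_const)
  then have "((%y. B x u - B x (SUM e:Basis. (B y u \<bullet> e) *\<^sub>R (A y e - A x e))) has_derivative ?D x) (at x within S)" by simp
  then show "((%x. B x u) has_derivative ?D x) (at x within S)"
  proof (rule has_derivative_transform[OF x, rotated])
   fix y assume y: "y:S"
   have "(SUM e:Basis. (B y u \<bullet> e) *\<^sub>R (A y e - A x e)) = A y (B y u) - A x (B y u)"
   using linear_expand[OF lA[OF y], of "B y u"] linear_expand[OF lA[OF x], of "B y u"]
   by (simp add: sum_subtractf scaleR_diff_right)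
   then show "B y u = B x u - B x (SUM e:Basis. (B y u \<bullet> e) *\<^sub>R (A y e - A x e))"
   by (simp add: AB[OF y] BA[OF x] linear_comm[OF lB[OF x]])
  qed
 next
  fix v assume v: "v:V"
  have c: "Ck_on V S (%x. (-1) *\<^sub>R (SUM e:Basis. (B x u \<bullet> e) *\<^sub>R (SUM i:Basis. (d e x v \<bullet> i) *\<^sub>R B x i))) k"
   by (intro Ck_on_linear_comp[OF bounded_linear_scaleR_right] Ck_on_sum finite_Basis
   Ck_on_bilinear[OF bounded_bilinear_scaleR] Ck_on_linear_comp[OF bounded_linear_inner_left] Bk d(2)[OF v])
  have e: "(-1) *\<^sub>R (SUM e:Basis. (B x u \<bullet> e) *\<^sub>R (SUM i:Basis. (d e x v \<bullet> i) *\<^sub>R B x i)) = ?D x v" if "x:S" for x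
   by (simp add: linear_expand[OF lB[OF that], symmetric] linear_sum[OF lB[OF that]] linear_scale[OF lB[OF that]])
  show "Ck_on V S (%x. ?D x v) k" by (rule Ck_on_cong[THEN iffD1, rotated, OF c e])
 qed
qed

text \<open>\<open>f\<close> is extended to the ambient space by the identity on the kernel of the
  projection, and the inverse function theorem is applied to the extension \<open>F\<close>. Since
  \<open>F x\<close> lies in \<open>V\<close> exactly when \<open>x\<close> does, the inverse
  restricts to \<open>V\<close>.\<close>

theorem smooth_local_inverse:
 fixes f :: "'v::euclidean_space => 'v"
 assumes V: "subspace V" and S: "opn V S" and f: "smooth_on V S f" and fV: "f ` S <= V" and x0: "x0:S"
  and d0: "(f has_derivative d0) (at x0 within S)" "!!v. v:V ==> d0 v = v"
 obtains S0 T g where "opn V S0" "x0:S0" "S0 <= S" "opn V T" "f ` S0 = T" "g ` T = S0"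
  "!!x. x:S0 ==> g (f x) = x" "smooth_on V T g"
proof -
 note P = proj[OF V]
 let ?P = "proj V"
 have bP: "bounded_linear ?P" using P(1) linear_conv_bounded_linear by blast
 have SV: "S <= V" using S by (auto simp: openin_open)
 obtain f' where f': "!!x. x:S ==> (f has_derivative f' x) (at x within S)" "!!v. v:V ==> smooth_on V S (%x. f' x v)"
  by (rule smooth_on_derivative[OF V S f]) blast
 define F where "F x = f (?P x) + (x - ?P x)" for x
 define F' where "F' x u = f' (?P x) (?P u) + (u - ?P u)" for x u
 define U where "U = ?P -` S"
 obtain O' where O': "open O'" "S = V Int O'" using S by (auto simp: openin_open)
 have "U = ?P -` O'" using O' P(2) by (auto simp: U_def)
 then have oU: "open U" using O'(1) by (simp add: open_vimage linear_continuous_on bP)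
 have lF': "linear (F' x)" if "x:U" for x
  using has_derivative_linear[OF f'(1)] that unfolding F'_def U_def
  by (auto intro!: linearI simp: linear_comm[OF P(1)] linear_add linear_scale algebra_simps)
 have dF: "(F has_derivative F' x) (at x)" if x: "x:U" for x
 proof -
  have "((%x. f (?P x)) has_derivative (%u. f' (?P x) (?P u))) (at x within U)"
   by (rule has_derivative_in_compose2[of S f f' ?P U x ?P])
   (use f'(1) x bP in "auto simp: U_def intro: bounded_linear_imp_has_derivative")
  then have "((%x. f (?P x) + (x - ?P x)) has_derivative (%u. f' (?P x) (?P u) + (u - ?P u))) (at x within U)"
   by (intro has_derivative_add has_derivative_diff has_derivative_ident bounded_linear_imp_has_derivative[OF bP])
  then show ?thesis using at_within_open[OF x oU] by (simp add: F_def[abs_def] F'_def[abs_def])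
 qed
 have cF': "continuous_on U (%x. F' x u)" for u
 proof -
  have "continuous_on U (%x. f' (?P x) (?P u))"
   by (rule continuous_on_compose2[OF smooth_on_continuous[OF f'(2)[OF P(2)]]])
   (auto simp: U_def linear_continuous_on bP)
  then show ?thesis unfolding F'_def by (intro continuous_intros)
 qed
 \<comment> \<open>Within \<open>1/2\<close> of the identity the derivatives have inverses of norm
   at most 2, the bound that \<open>Ck_on_inverse_operator\<close> asks for.\<close>
 define U1 where "U1 = {x:U. nl (%u. F' x u - u) < 1/2}"
 have "continuous_on U (%x. nl (%u. F' x u - u))" unfolding nl_def by (intro continuous_intros cF')
 then have oU1: "open U1"
  unfolding U1_def using continuous_open_preimage[OF _ oU, of "%x. nl (%u. F' x u - u)" "{..<1/2}"]
  by (simp add: vimage_def Int_def)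
 have U1U: "U1 <= U" by (auto simp: U1_def)
 have near: "nl (%u. F' x u - u) <= 1/2" if "x:U1" for x using that by (simp add: U1_def)
 have x0V: "x0:V" using x0 SV by auto
 have F'0: "F' x0 u = u" for u
  using derivative_unique_on[OF V S x0 P(2)[of u] f'(1)[OF x0] d0(1)] d0(2)[OF P(2)[of u]] by (simp add: F'_def P(3)[OF x0V])
 have x0U1: "x0:U1" using x0 by (simp add: U1_def U_def P(3)[OF x0V] F'0 nl_def)
 define fb where "fb x = Blinfun (F' x)" for x
 have fb: "blinfun_apply (fb x) = F' x" if "x:U1" for x
  unfolding fb_def by (rule bounded_linear_Blinfun_apply) (use lF' that U1U linear_conv_bounded_linear in blast)
 have "continuous_on U1 fb"
 proof (rule continuous_on_blinfun_componentwise)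
  fix i :: 'v assume "i:Basis"
  show "continuous_on U1 (%x. blinfun_apply (fb x) i)"
   using continuous_on_subset[OF cF' U1U] by (simp add: fb cong: continuous_on_cong)
 qed
 moreover have "id_blinfun o\<^sub>L fb x0 = id_blinfun"
  by (rule blinfun_eqI) (simp add: fb[OF x0U1] F'0)
 moreover have "(F has_derivative blinfun_apply (fb x)) (at x)" if "x:U1" for x
  using dF that U1U by (auto simp: fb[OF that])
 ultimately obtain U' V' g g' where g: "open U'" "U' <= U1" "x0:U'" "open V'" "F x0:V'" "homeomorphism U' V' F g"
  "!!y. y:V' ==> (g has_derivative g' y) (at y)" "!!y. y:V' ==> g' y = inv_into UNIV (blinfun_apply (fb (g y)))"
  using inverse_function_theorem[OF oU1 _ _ x0U1, of F fb id_blinfun] by metis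
 have gF: "x:U' ==> g (F x) = x" and Fg: "y:V' ==> F (g y) = y" and FU: "F ` U' = V'" and gV': "g ` V' = U'" for x y
  using g(6) by (auto simp: homeomorphism_def)
 have FV: "F x:V \<longleftrightarrow> x:V" if "x:U" for x
 proof -
  have "f (?P x):V" using that fV by (auto simp: U_def)
  moreover have "x = ?P x + (F x - f (?P x))" by (simp add: F_def)
  ultimately show ?thesis using P(2)[of x] P(3)[of x] subspace_add[OF V] subspace_diff[OF V] by (metis F_def add_diff_cancel_left' diff_self add.right_neutral)
 qed
 have Ff: "F x = f x" if "x:V" for x using P(3)[OF that] by (simp add: F_def)
 define T where "T = V' Int V"
 have U'U: "U' <= U" using g(2) U1U by blast
 have gT: "g y:U' Int V" if "y:T" for y
 proof -
  have y: "y:V'" "F (g y):V" using that Fg by (auto simp: T_def)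
  then have "g y:U'" using gV' by blast
  then show ?thesis using FV[of "g y"] y(2) U'U by blast
 qed
 have U'S: "U' Int V <= S" using U'U P(3) by (auto simp: U_def)
 \<comment> \<open>The derivative of \<open>g\<close> at \<open>y\<close> is the inverse of
   \<open>F' (g y)\<close>, so each order of differentiability of \<open>g\<close> gives the
   next.\<close>
 have Ck: "Ck_on V T g k" for k
 proof (induction k)
  case 0
  show ?case using g(6) by (auto simp: homeomorphism_def T_def intro: continuous_on_subset)
 next
  case (Suc k)
  have ni: "linear (F' (g y))" "nl (%u. F' (g y) u - u) <= 1/2" "g' y = inv_into UNIV (F' (g y))" if "y:T" for y
   using gT[OF that] g(2,8) lF' near U1U that fb by (auto simp: T_def)
  note ne = near_identity[OF ni(1,2)]
  have "Ck_on V T (%y. g' y v) k" if v: "v:V" for v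
  proof (rule Ck_on_inverse_operator[where A = "%y. F' (g y)"])
   fix y assume y: "y:T"
   show "linear (F' (g y))" "linear (g' y)" "norm (g' y u) <= 2 * norm u" "F' (g y) (g' y u) = u" "g' y (F' (g y) u) = u" for u
   using ni[OF y] ne[OF y y] by (simp_all add: bij_is_surj surj_f_inv_f bij_is_inj)
  next
   fix u
   have "Ck_on V T (%y. f' (g y) (?P u)) k"
   by (rule Ck_on_compose[OF V _ V SV _ Suc]) (use gT U'S g(4) V f'(2)[OF P(2)] in "auto simp: smooth_on_def T_def Int_commute[of V'] intro: openin_open_Int")
   then have "Ck_on V T (%y. f' (g y) (?P u) + (u - ?P u)) k" by (intro Ck_on_add Ck_on_const)
   then show "Ck_on V T (%y. F' (g y) u) k"
   using Ck_on_cong[of T "%y. F' (g y) u" "%y. f' (g y) (?P u) + (u - ?P u)"] gT P(3) by (auto simp: F'_def)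
  qed
  moreover have "(g has_derivative g' y) (at y within T)" if "y:T" for y
   using g(7)[of y] that by (auto simp: T_def intro: has_derivative_at_withinI)
  ultimately show ?case by (auto intro!: exI[of _ g'])
 qed
 show ?thesis
 proof (rule that[of "U' Int V" T g])
  show "opn V (U' Int V)" "opn V T" using g(1,4) by (auto simp: T_def openin_open Int_commute)
  show "x0:U' Int V" using g(3) x0V by blast
  show "U' Int V <= S" by (rule U'S)
  show "f ` (U' Int V) = T"
  proof
   show "f ` (U' Int V) <= T"
   proof (rule image_subsetI)
   fix x assume x: "x:U' Int V"
   then have "f x:V" "F x:V'" using U'S fV FU by blast+
   then show "f x:T" using Ff[of x] x by (simp add: T_def)
   qed
   show "T <= f ` (U' Int V)" using gT Fg Ff unfolding T_def by (metis Int_iff image_eqI subsetI)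
  qed
  show gf: "g (f x) = x" if "x:U' Int V" for x using gF Ff that by (metis IntE)
  show "g ` T = U' Int V" using gT gf \<open>f ` (U' Int V) = T\<close> by (metis (no_types, lifting) image_eqI image_subsetI subsetI subset_antisym)
  show "smooth_on V T g" using Ck by (simp add: smooth_on_def)
 qed
qed

text \<open>Banach's fixed point theorem is applied to bounded continuous functions on the whole
  line; \<open>cl\<close> freezes the time outside \<open>{-d..d}\<close>, so that the integral
  operator acts on them.\<close>

lemma picard:
 fixes F :: "'v::euclidean_space => 'v"
 assumes L: "!!x y. norm (F x - F y) <= L * norm (x - y)" and M: "!!x. norm (F x) <= M" and r: "0 < r"
 obtains d u where "0 < d" "u 0 = x0" "!!t. \<bar>t\<bar> < d ==> (u hvd F (u t)) (at t)"
  "!!t. \<bar>t\<bar> < d ==> norm (u t - x0) <= r"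
proof -
 define K where "K = max L M + 1"
 have M0: "0 <= M" using M[of x0] norm_ge_zero[of "F x0"] by linarith
 have K: "K > 0" "M <= K" "L <= K" using M0 by (auto simp: K_def)
 have LK: "norm (F x - F y) <= K * norm (x - y)" for x y
  by (rule order_trans[OF L mult_right_mono[OF K(3)]]) simp
 \<comment> \<open>\<open>4 * d * K <= 1/2\<close> makes the operator a contraction and
   \<open>4 * d * K <= r\<close> confines the solution to the ball. The factor 4 comes from two
   integrals over intervals of length at most \<open>2 * d\<close>.\<close>
 define d where "d = min (1 / (8 * K)) (r / (4 * K))"
 have d: "0 < d" "4 * d * K <= 1/2" "4 * d * K <= r"
  using K(1) r by (auto simp: d_def min_def field_simps)
 have contF: "continuous_on A F" for A
  by (rule lipschitz_on_continuous_on[of K]) (auto simp: lipschitz_on_def dist_norm LK K(1) less_imp_le)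
 define cl where "cl t = max (- d) (min d t)" for t :: real
 have cl: "cl t:{-d..d}" "t:{-d..d} ==> cl t = t" for t using d(1) by (auto simp: cl_def)
 have ccl: "continuous_on A cl" for A unfolding cl_def by (intro continuous_intros)
 \<comment> \<open>Integration starts at \<open>-d\<close>; subtracting \<open>I w 0\<close>
   afterwards places the initial value at time 0.\<close>
 define I where "I w t = integral {-d..t} (%s. F (apply_bcontfun w s))" for w :: "real \<Rightarrow>\<^sub>C 'v" and t
 have cw: "continuous_on A (%s. F (apply_bcontfun w s))" for w :: "real \<Rightarrow>\<^sub>C 'v" and A
  by (intro continuous_on_compose2[OF contF[of UNIV]] continuous_on_apply_bcontfun continuous_on_id) auto
 have cI: "continuous_on {-d..d} (I w)" for w
  unfolding I_def by (rule indefinite_integral_continuous_1) (intro integrable_continuous_interval cw)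
 have nI: "norm (I w t) <= K * (2 * d)" if "t:{-d..d}" for w t
 proof -
  have "norm (I w t) <= K * (t - - d)" unfolding I_def
   by (rule integral_bound) (use that cw M K(2) in "auto intro: order_trans")
  also have "... <= K * (2 * d)" using that K(1) by (intro mult_left_mono) auto
  finally show ?thesis .
 qed
 have dI: "norm (I w t - I v t) <= K * dist w v * (2 * d)" if "t:{-d..d}" for w v t
 proof -
  have "I w t - I v t = integral {-d..t} (%s. F (apply_bcontfun w s) - F (apply_bcontfun v s))"
   unfolding I_def by (rule integral_diff[symmetric]) (intro integrable_continuous_interval cw)+
  also have "norm ... <= K * dist w v * (t - - d)"
  proof (rule integral_bound)
   show "norm (F (apply_bcontfun w s) - F (apply_bcontfun v s)) <= K * dist w v" for s
   using order_trans[OF LK[of "apply_bcontfun w s" "apply_bcontfun v s", folded dist_norm] mult_left_mono[OF dist_bounded[of w s v], of K]] K(1) by (simp add: dist_norm)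
  qed (use that in "auto intro!: continuous_intros cw")
  also have "... <= K * dist w v * (2 * d)" using that K(1) by (intro mult_left_mono) auto
  finally show ?thesis .
 qed
 define Ph where "Ph w = (%t. x0 + (I w (cl t) - I w 0))" for w
 have bc: "Ph w:bcontfun" for w
  unfolding bcontfun_def
 proof (intro CollectI conjI)
  have "continuous_on UNIV (%t. I w (cl t))"
   by (rule continuous_on_compose2[OF cI ccl]) (use cl(1) in auto)
  then show "continuous_on UNIV (Ph w)" unfolding Ph_def by (intro continuous_intros)
  have "norm (Ph w t) <= norm x0 + (K * (2 * d) + K * (2 * d))" for t
   unfolding Ph_def
   by (intro norm_triangle_le add_left_mono order_trans[OF norm_triangle_ineq4] add_mono nI order_trans[OF norm_triangle_ineq]) (use cl(1) d(1) in auto)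
  then show "bounded (range (Ph w))" by (auto simp: bounded_iff)
 qed
 have ap: "apply_bcontfun (Bcontfun (Ph w)) = Ph w" for w by (rule Bcontfun_inverse[OF bc])
 have "EX! w. Bcontfun (Ph w) = w"
 proof (rule banach_fix_type[of "1/2"])
  show "ALL w v. dist (Bcontfun (Ph w)) (Bcontfun (Ph v)) <= 1/2 * dist w v"
  proof (intro allI)
   fix w v
   show "dist (Bcontfun (Ph w)) (Bcontfun (Ph v)) <= 1/2 * dist w v"
  proof (rule dist_bound)
   fix t
   have "norm (Ph w t - Ph v t) = norm ((I w (cl t) - I v (cl t)) - (I w 0 - I v 0))" by (simp add: Ph_def algebra_simps)
   also have "... <= K * dist w v * (2 * d) + K * dist w v * (2 * d)"
   by (rule order_trans[OF norm_triangle_ineq4 add_mono[OF dI dI]]) (use cl(1) d(1) in auto)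
   also have "... = (4 * d * K) * dist w v" by simp
   also have "... <= 1/2 * dist w v" by (rule mult_right_mono[OF d(2)]) simp
   finally show "dist (apply_bcontfun (Bcontfun (Ph w)) t) (apply_bcontfun (Bcontfun (Ph v)) t) <= 1/2 * dist w v"
   by (simp add: ap dist_norm)
  qed
  qed
 qed auto
 then obtain w where w: "Bcontfun (Ph w) = w" by auto
 define u where "u = apply_bcontfun w"
 have u: "u t = x0 + (I w t - I w 0)" if "\<bar>t\<bar> <= d" for t
 proof -
  have "u t = Ph w t" using ap[of w] by (simp add: w u_def)
  then show ?thesis using cl(2)[of t] that by (simp add: Ph_def abs_le_iff)
 qed
 show ?thesis
 proof
  show "0 < d" "u 0 = x0" using d(1) u[of 0] by auto
  fix t assume t: "\<bar>t\<bar> < d"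
  then have tI: "t:{-d..d}" and ti: "t:interior {-d..d}" by (auto simp: interior_atLeastAtMost_real)
  have "norm (u t - x0) <= K * (2 * d) + K * (2 * d)"
   using u[of t] t norm_triangle_ineq4[of "I w t" "I w 0"] nI[OF tI, of w] nI[of 0 w] d(1) by simp
  then show "norm (u t - x0) <= r" using d(3) by (simp add: mult_ac)
  have "(I w hvd F (u t)) (at t within {-d..d})"
   unfolding I_def u_def by (rule integral_has_vector_derivative[OF cw tI])
  then have "(I w hvd F (u t)) (at t)" using at_within_interior[OF ti] by simp
  then have "((%t. x0 + (I w t - I w 0)) hvd F (u t)) (at t)"
   by (auto intro!: derivative_eq_intros)
  then show "(u hvd F (u t)) (at t)"
   by (rule hvd_transform[of _ _ _ "{-d<..<d}"]) (use t u in auto)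
 qed
qed

text \<open>Composition with the nearest point map of a ball, which is 1-Lipschitz, makes the
  extended field globally Lipschitz and bounded without changing it near \<open>x0\<close>.
  Smoothness of the solution is bootstrapped from the equation.\<close>

theorem flow_exists:
 fixes X :: "'v::euclidean_space => 'v"
 assumes V: "subspace V" and S: "opn V S" and X: "smooth_on V S X" and XV: "X ` S <= V" and x0: "x0:S"
 obtains d u where "0 < d" "u 0 = x0" "!!t. \<bar>t\<bar> < d ==> u t:S"
  "!!t. \<bar>t\<bar> < d ==> (u hvd X (u t)) (at t)" "smooth_on UNIV {-d<..<d} u"
proof -
 note P = proj[OF V]
 let ?P = "proj V"
 have bP: "bounded_linear ?P" using P(1) linear_conv_bounded_linear by blast
 have SV: "S <= V" using S by (auto simp: openin_open)
 obtain X' where X': "!!x. x:S ==> (X has_derivative X' x) (at x within S)" "!!v. v:V ==> smooth_on V S (%x. X' x v)"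
  by (rule smooth_on_derivative[OF V S X]) blast
 define U where "U = ?P -` S"
 obtain O' where O': "open O'" "S = V Int O'" using S by (auto simp: openin_open)
 have "U = ?P -` O'" using O' P(2) by (auto simp: U_def)
 then have oU: "open U" using O'(1) by (simp add: open_vimage linear_continuous_on bP)
 define F where "F x = X (?P x)" for x
 define F' where "F' x u = X' (?P x) (?P u)" for x u
 have dF: "(F has_derivative F' x) (at x)" if x: "x:U" for x
 proof -
  have "((%x. X (?P x)) has_derivative (%u. X' (?P x) (?P u))) (at x within U)"
   by (rule has_derivative_in_compose2[of S X X' ?P U x ?P])
   (use X'(1) x bP in "auto simp: U_def intro: bounded_linear_imp_has_derivative")
  then show ?thesis using at_within_open[OF x oU] by (simp add: F_def[abs_def] F'_def[abs_def])
 qed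
 have cF': "continuous_on U (%x. nl (F' x))"
  unfolding nl_def F'_def
  by (intro continuous_intros continuous_on_compose2[OF smooth_on_continuous[OF X'(2)[OF P(2)]], of _ ?P])
   (auto simp: U_def linear_continuous_on bP)
 have cF: "continuous_on U F" using dF by (meson continuous_at_imp_continuous_on has_derivative_continuous)
 have x0V: "x0:V" using x0 SV by auto
 have "x0:U" using x0 by (simp add: U_def P(3)[OF x0V])
 then obtain r where r: "0 < r" "cball x0 r <= U" using oU open_contains_cball by blast
 let ?B = "cball x0 r"
 have "bounded ((%x. nl (F' x)) ` ?B)" "bounded (F ` ?B)"
  using cF' cF r(2) by (auto intro!: compact_imp_bounded compact_continuous_image intro: continuous_on_subset)
 then obtain L M where LM: "ALL y:(%x. nl (F' x)) ` ?B. norm y <= L" "ALL y:F ` ?B. norm y <= M"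
  unfolding bounded_iff by blast
 then have L: "nl (F' x) <= L" and M: "norm (F x) <= M" if "x:?B" for x using that by (auto dest: abs_le_D1)
 have lip: "norm (F x - F y) <= L * norm (x - y)" if "x:?B" "y:?B" for x y
 proof (rule differentiable_bound[of ?B F F'])
  fix z assume z: "z:?B"
  then show "(F has_derivative F' z) (at z within ?B)" using dF r(2) by (blast intro: has_derivative_at_withinI)
  show "onorm (F' z) <= L"
   by (rule onorm_le) (rule order_trans[OF norm_linear_le[OF has_derivative_linear[OF dF]] mult_right_mono[OF L[OF z]]],
   use z r(2) in auto)
 qed (use that in auto)
 define c where "c = closest_point ?B"
 have cB: "c x:?B" "x:?B ==> c x = x" for x
  unfolding c_def by (rule closest_point_in_set closest_point_self; use r(1) in auto)+
 have L0: "0 <= L" using L[of x0] r(1) nl_nonneg[of "F' x0"] by (meson centre_in_cball less_imp_le order_trans)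
 have "norm (F (c x) - F (c y)) <= L * norm (x - y)" for x y
 proof -
  have "norm (c x - c y) <= norm (x - y)"
   using closest_point_lipschitz[of ?B x y] r(1) by (simp add: c_def dist_norm)
  then show ?thesis using order_trans[OF lip[OF cB(1) cB(1)] mult_left_mono[OF _ L0]] by blast
 qed
 moreover have "norm (F (c x)) <= M" for x by (rule M[OF cB(1)])
 ultimately obtain d w where d: "0 < d" and w: "w 0 = x0" "!!t. \<bar>t\<bar> < d ==> (w hvd F (c (w t))) (at t)"
  "!!t. \<bar>t\<bar> < d ==> norm (w t - x0) <= r"
  using picard[of "%x. F (c x)" L M r x0] r(1) by metis
 define u where "u t = ?P (w t)" for t
 have wB: "w t:?B" if "\<bar>t\<bar> < d" for t using w(3)[OF that] by (simp add: dist_norm norm_minus_commute)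
 have uS: "u t:S" if "\<bar>t\<bar> < d" for t using wB[OF that] r(2) by (auto simp: u_def U_def)
 have du: "(u hvd X (u t)) (at t)" if t: "\<bar>t\<bar> < d" for t
 proof -
  have "(u hvd ?P (F (c (w t)))) (at t)"
   unfolding u_def by (rule bounded_linear.has_vector_derivative[OF bP w(2)[OF t]])
  moreover have "?P (F (c (w t))) = X (u t)"
   using XV uS[OF t] by (simp add: cB(2)[OF wB[OF t]] F_def u_def P(3) image_subset_iff)
  ultimately show ?thesis by simp
 qed
 have "Ck_on UNIV {-d<..<d} u k" for k
 proof (induction k)
  case 0
  have "isCont u t" if "t:{-d<..<d}" for t
   by (rule has_vector_derivative_continuous[OF du]) (use that in auto)
  then show ?case by (simp add: continuous_at_imp_continuous_on)
 next
  case (Suc k)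
  have o: "opn UNIV {-d<..<d}" by (simp add: open_openin[symmetric])
  have u: "u ` {-d<..<d} <= S" using uS by auto
  have Xk: "Ck_on V S X k" using X by (simp add: smooth_on_def)
  have "Ck_on UNIV {-d<..<d} (%t. X (u t)) k"
   by (rule Ck_on_compose[OF subspace_UNIV o V SV u Suc Xk])
  then have "Ck_on UNIV {-d<..<d} (%t. h *\<^sub>R X (u t)) k" for h
   by (rule Ck_on_linear_comp[OF bounded_linear_scaleR_right])
  moreover have "(u has_derivative (%h. h *\<^sub>R X (u t))) (at t within {-d<..<d})" if "t:{-d<..<d}" for t
   using du[of t] that by (auto simp: has_vector_derivative_def intro: has_derivative_at_withinI)
  ultimately show ?case by (auto intro!: exI[of _ "%t h. h *\<^sub>R X (u t)"])
 qed
 then show ?thesis using that[of d u] d uS du w(1) by (simp add: smooth_on_def u_def P(3)[OF x0V])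
qed

section \<open>Plots of a manifold\<close>

text \<open>A plot is a smooth map from a relatively open subset of a Euclidean space to a manifold. Smooth maps
 are handled through their action on plots.\<close>

definition pre_manifold :: "('a, 'v::euclidean_space) lie_structure => bool" where
 "pre_manifold M \<longleftrightarrow>
   topspace (topo M) = carrier M & subspace (model M) & (UN (U, ph):atlas M. U) = carrier M &
   (ALL (U, ph):atlas M. openin (topo M) U & opn (model M) (ph ` U) &
   homeomorphic_map (subtopology (topo M) U) (top_of_set (ph ` U)) ph) &
   (ALL (U, ph):atlas M. ALL (W, psi):atlas M. smooth_on (model M) (ph ` (U Int W)) (%u. psi (inv_into U ph u)))"

lemma smooth_manifold_pre: "smooth_manifold M ==> pre_manifold M"
 unfolding smooth_manifold_def pre_manifold_def by blast

definition plot :: "('a, 'v::euclidean_space) lie_structure => 'e::euclidean_space set => 'e set => ('e => 'a) => bool" where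
 "plot M V S p \<longleftrightarrow> subspace V & opn V S & p ` S <= carrier M &
   (ALL (U, ph):atlas M. opn V {x:S. p x:U} & smooth_on V {x:S. p x:U} (%x. ph (p x)))"

lemma plotD:
 assumes "plot M V S p"
 shows "subspace V" "opn V S" "S <= V" "x:S ==> p x:carrier M"
  "(U, ph):atlas M ==> opn V {x:S. p x:U}" "(U, ph):atlas M ==> smooth_on V {x:S. p x:U} (%x. ph (p x))"
 using assms unfolding plot_def by (auto simp: openin_open)

lemma plotI:
 assumes "subspace V" "opn V S" "!!x. x:S ==> p x:carrier M"
  "!!U ph. (U, ph):atlas M ==> opn V {x:S. p x:U}"
  "!!U ph. (U, ph):atlas M ==> smooth_on V {x:S. p x:U} (%x. ph (p x))"
 shows "plot M V S p"
 using assms unfolding plot_def by auto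

lemma plot_chart:
 assumes "plot M V S p" "(U, ph):atlas M" "p ` S <= U" shows "smooth_on V S (%x. ph (p x))"
proof -
 have "{x:S. p x:U} = S" using assms(3) by auto
 then show ?thesis using plotD(6)[OF assms(1,2)] by simp
qed

lemma opn_local: "(!!x. x:A ==> EX T. opn V T & x:T & T <= A) ==> opn V A"
 by (subst openin_subopen) blast

lemma opn_Int: "opn V A ==> opn V B ==> opn V (A Int B)"
 by (rule openin_Int)

lemma opn_preimage:
 assumes "continuous_on S f" "opn V S" "opn W T" "f ` S <= W"
 shows "opn V {x:S. f x:T}"
proof -
 obtain O' where O': "open O'" "T = W Int O'" using assms(3) by (auto simp: openin_open)
 have "{x:S. f x:T} = S Int f -` O'" using assms(4) O'(2) by auto
 then show ?thesis using continuous_openin_preimage_gen[OF assms(1) O'(1)] openin_trans assms(2) by metis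
qed

lemma plot_cong:
 assumes eq: "!!x. x:S ==> p x = q x" and p: "plot M V S p" shows "plot M V S q"
proof (rule plotI[OF plotD(1,2)[OF p]])
 show "q x:carrier M" if "x:S" for x using plotD(4)[OF p that] eq[OF that] by simp
 fix U ph assume c: "(U, ph):atlas M"
 have e: "{x:S. q x:U} = {x:S. p x:U}" using eq by auto
 show "opn V {x:S. q x:U}" unfolding e by (rule plotD(5)[OF p c])
 show "smooth_on V {x:S. q x:U} (%x. ph (q x))"
  unfolding e using plotD(6)[OF p c] smooth_on_cong[of "{x:S. p x:U}" "%x. ph (p x)" "%x. ph (q x)"] eq by auto
qed

lemma plot_subset:
 assumes p: "plot M V S p" and T: "opn V T" "T <= S"
 shows "plot M V T p"
proof (rule plotI)
 fix U ph assume c: "(U, ph):atlas M"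
 have "{x:T. p x:U} = T Int {x:S. p x:U}" using T(2) by auto
 then show "opn V {x:T. p x:U}" using opn_Int[OF T(1) plotD(5)[OF p c]] by simp
 show "smooth_on V {x:T. p x:U} (%x. ph (p x))"
  by (rule smooth_on_subset[OF plotD(6)[OF p c]]) (use T(2) in auto)
qed (use plotD[OF p] T in auto)

lemma plot_local:
 assumes V: "subspace V" and loc: "!!x. x:S ==> EX T. x:T & T <= S & plot M V T p"
 shows "plot M V S p"
proof (rule plotI[OF V])
 have loc': "EX T. opn V T & x:T & T <= S" if "x:S" for x
  using loc[OF that] plotD(2)[of M V _ p] by auto
 show S: "opn V S" by (rule opn_local[OF loc'])
 show "p x:carrier M" if "x:S" for x using loc[OF that] plotD(4)[of M V _ p] by auto
 fix U ph assume c: "(U, ph):atlas M"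
 have *: "EX T. opn V T & x:T & T <= {x:S. p x:U} & smooth_on V T (%x. ph (p x))"
  if "x:{x:S. p x:U}" for x
 proof -
  have "x:S" using that by simp
  from loc[OF this] obtain T where T: "x:T" "T <= S" "plot M V T p" by (elim exE conjE)
  have "x:{x:T. p x:U}" "{x:T. p x:U} <= {x:S. p x:U}" using T(1,2) that by auto
  with plotD(5,6)[OF T(3) c] show ?thesis by (intro exI[of _ "{x:T. p x:U}"] conjI)
 qed
 show "opn V {x:S. p x:U}"
 proof (rule opn_local)
  show "EX T. opn V T & x:T & T <= {x:S. p x:U}" if "x:{x:S. p x:U}" for x
   using *[OF that] by (elim exE conjE) (intro exI conjI)
 qed
 show "smooth_on V {x:S. p x:U} (%x. ph (p x))"
  by (rule smooth_on_local[OF V _ *]) (use S in "auto simp: openin_open")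
qed

lemma plot_compose:
 assumes p: "plot M V S p" and V': "subspace V'" "opn V' S'" and f: "smooth_on V' S' f" "f ` S' <= S"
 shows "plot M V' S' (%x. p (f x))"
proof (rule plotI[OF V'])
 show "p (f x):carrier M" if "x:S'" for x using plotD(4)[OF p] f(2) that by blast
 fix U ph assume c: "(U, ph):atlas M"
 have eq: "{x:S'. p (f x):U} = {x:S'. f x:{y:S. p y:U}}" using f(2) by auto
 show o: "opn V' {x:S'. p (f x):U}" unfolding eq
  by (rule opn_preimage[OF smooth_on_continuous[OF f(1)] V'(2) plotD(5)[OF p c]]) (use f(2) plotD(3)[OF p] in auto)
 show "smooth_on V' {x:S'. p (f x):U} (%x. ph (p (f x)))"
  by (rule smooth_on_compose[OF V'(1) o plotD(1)[OF p] _ _ smooth_on_subset[OF f(1)] plotD(6)[OF p c]])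
   (use plotD(3)[OF p] f(2) in auto)
qed

locale manifold =
 fixes M :: "('a, 'v::euclidean_space) lie_structure"
 assumes M: "pre_manifold M"
begin

lemma topspace: "topspace (topo M) = carrier M" and model: "subspace (model M)"
 using M by (auto simp: pre_manifold_def)

lemma chart_exists: "x:carrier M ==> EX U ph. (U, ph):atlas M & x:U"
 using M unfolding pre_manifold_def by blast

lemma chart:
 assumes "(U, ph):atlas M"
 shows "openin (topo M) U" "U <= carrier M" "opn (model M) (ph ` U)" "ph ` U <= model M"
  "homeomorphic_map (subtopology (topo M) U) (top_of_set (ph ` U)) ph" "inj_on ph U"
  "(W, psi):atlas M ==> smooth_on (model M) (ph ` (U Int W)) (%u. psi (inv_into U ph u))"
proof -
 show U: "openin (topo M) U" "opn (model M) (ph ` U)"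
  and h: "homeomorphic_map (subtopology (topo M) U) (top_of_set (ph ` U)) ph"
  and "(W, psi):atlas M ==> smooth_on (model M) (ph ` (U Int W)) (%u. psi (inv_into U ph u))"
  using M assms unfolding pre_manifold_def by blast+
 show "U <= carrier M" using openin_subset[OF U(1)] topspace by simp
 then show "inj_on ph U" using homeomorphic_imp_injective_map[OF h] topspace by (simp add: Int_absorb1)
 show "ph ` U <= model M" using U(2) by (auto simp: openin_open)
qed

lemma chart_inv:
 assumes "(U, ph):atlas M"
 shows "x:U ==> inv_into U ph (ph x) = x" "u:ph ` U ==> ph (inv_into U ph u) = u" "u:ph ` U ==> inv_into U ph u:U"
 using chart(6)[OF assms] by (auto simp: f_inv_into_f inv_into_into)

lemma chart_image_open:
 assumes c: "(U, ph):atlas M" and W: "openin (topo M) W"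
 shows "opn (model M) (ph ` (U Int W))"
proof -
 have "openin (subtopology (topo M) U) (U Int W)" using W by (auto simp: openin_subtopology_Int2)
 then have "openin (top_of_set (ph ` U)) (ph ` (U Int W))"
  using homeomorphic_imp_open_map[OF chart(5)[OF c]] by (simp add: open_map_def)
 then show ?thesis using chart(3)[OF c] openin_trans by blast
qed

lemma plot_preimage:
 assumes p: "plot M V S p" and W: "openin (topo M) W"
 shows "opn V {x:S. p x:W}"
proof (rule opn_local)
 fix x assume x: "x:{x:S. p x:W}"
 then obtain U ph where c: "(U, ph):atlas M" "p x:U" using chart_exists plotD(4)[OF p] by blast
 have "opn V {y:{y:S. p y:U}. ph (p y):ph ` (U Int W)}"
  by (rule opn_preimage[OF smooth_on_continuous[OF plotD(6)[OF p c(1)]] plotD(5)[OF p c(1)] chart_image_open[OF c(1) W]])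
   (use chart(4)[OF c(1)] in auto)
 moreover have "{y:{y:S. p y:U}. ph (p y):ph ` (U Int W)} <= {x:S. p x:W}"
  using chart(6)[OF c(1)] by (auto simp: inj_on_def)
 ultimately show "EX T. opn V T & x:T & T <= {x:S. p x:W}"
  using x c(2) by (intro exI[of _ "{y:{y:S. p y:U}. ph (p y):ph ` (U Int W)}"]) auto
qed

lemma plot_continuous: "plot M V S p ==> continuous_map (top_of_set S) (topo M) p"
 unfolding continuous_map_def
proof (intro conjI allI impI)
 assume p: "plot M V S p"
 show "p:topspace (top_of_set S) \<rightarrow> topspace (topo M)" using plotD(4)[OF p] by (auto simp: topspace)
 fix W assume "openin (topo M) W"
 then have "opn V {x:S. p x:W}" by (rule plot_preimage[OF p])
 then have "opn S {x:S. p x:W}" by (rule openin_subset_trans) (use plotD(3)[OF p] in auto)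
 then show "openin (top_of_set S) {x:topspace (top_of_set S). p x:W}" by simp
qed

text \<open>One chart around each point decides; the transition maps take care of the
  others.\<close>

lemma plot_by_charts:
 assumes V: "subspace V" "opn V S" and p: "!!x. x:S ==> p x:carrier M"
  and loc: "!!x. x:S ==> EX U ph T. (U, ph):atlas M & opn V T & x:T & T <= S & p ` T <= U & smooth_on V T (%x. ph (p x))"
 shows "plot M V S p"
proof (rule plot_local[OF V(1)])
 fix x assume "x:S"
 then obtain U ph T where c: "(U, ph):atlas M" and T: "opn V T" "x:T" "T <= S" "p ` T <= U" and s: "smooth_on V T (%x. ph (p x))"
  using loc by blast
 have "plot M V T p"
 proof (rule plotI[OF V(1) T(1)])
  show "p x:carrier M" if "x:T" for x using p T(3) that by blast
  fix W psi assume c': "(W, psi):atlas M"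
  have eq: "{x:T. p x:W} = {x:T. ph (p x):ph ` (U Int W)}"
   using T(4) chart(6)[OF c] by (auto simp: inj_on_def)
  show o: "opn V {x:T. p x:W}" unfolding eq
   by (rule opn_preimage[OF smooth_on_continuous[OF s] T(1) chart_image_open[OF c chart(1)[OF c']]]) (use T(4) chart(4)[OF c] in auto)
  have "smooth_on V {x:T. p x:W} (%x. psi (inv_into U ph (ph (p x))))"
   by (rule smooth_on_compose[OF V(1) o model _ _ smooth_on_subset[OF s] chart(7)[OF c c']]) (use chart(4)[OF c] T(4) in auto)
  then show "smooth_on V {x:T. p x:W} (%x. psi (p x))"
   using T(4) by (subst smooth_on_cong[of _ _ "%x. psi (inv_into U ph (ph (p x)))"]) (auto simp: chart_inv[OF c])
 qed
 then show "EX T. x:T & T <= S & plot M V T p" using T by blast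
qed

lemma plot_chart_inverse:
 assumes c: "(U, ph):atlas M" shows "plot M (model M) (ph ` U) (inv_into U ph)"
proof (rule plot_by_charts[OF model chart(3)[OF c]])
 show "inv_into U ph x:carrier M" if "x:ph ` U" for x using chart_inv(3)[OF c that] chart(2)[OF c] by blast
 have "smooth_on (model M) (ph ` U) (%x. ph (inv_into U ph x))"
  using smooth_on_id[of "model M" "ph ` U"] smooth_on_cong[of "ph ` U" "%x. ph (inv_into U ph x)" "%x. x"] chart_inv(2)[OF c] by blast
 then show "EX U' ph' T. (U', ph'):atlas M & opn (model M) T & x:T & T <= ph ` U & inv_into U ph ` T <= U' &
   smooth_on (model M) T (%x. ph' (inv_into U ph x))" if "x:ph ` U" for x
  using c chart(3)[OF c] that chart_inv(3)[OF c] by (intro exI[of _ U] exI[of _ ph] exI[of _ "ph ` U"]) auto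
qed

lemma plot_const:
 assumes "subspace V" "opn V S" "g:carrier M" shows "plot M V S (%x. g)"
proof (rule plotI)
 show "opn V {x:S. g:U}" for U using assms(2) by (cases "g:U") simp_all
qed (simp_all add: assms smooth_on_const)
end

section \<open>Smooth maps and products by way of plots\<close>

lemma plot_smooth_map:
 assumes M: "pre_manifold M" and N: "pre_manifold N" and f: "smooth_map M N f" and p: "plot M V S p"
 shows "plot N V S (%x. f (p x))"
proof -
 interpret M: manifold M by standard (rule M)
 interpret N: manifold N by standard (rule N)
 have fc: "continuous_map (topo M) (topo N) f" using f by (simp add: smooth_map_def)
 show ?thesis
 proof (rule plotI[OF plotD(1,2)[OF p]])
  show "f (p x):carrier N" if "x:S" for x
   using fc plotD(4)[OF p that] M.topspace N.topspace by (auto simp: continuous_map_def)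
  fix W psi assume c: "(W, psi):atlas N"
  have o1: "openin (topo M) {x:carrier M. f x:W}"
   using openin_continuous_map_preimage[OF fc N.chart(1)[OF c]] by (simp add: M.topspace)
  have "{x:S. f (p x):W} = {x:S. p x:{x:carrier M. f x:W}}" using plotD(4)[OF p] by auto
  then show o: "opn V {x:S. f (p x):W}" using M.plot_preimage[OF p o1] by simp
  show "smooth_on V {x:S. f (p x):W} (%x. psi (f (p x)))"
  proof (rule smooth_on_local[OF plotD(1)[OF p]])
   show "{x:S. f (p x):W} <= V" using plotD(3)[OF p] by auto
   fix x assume x: "x:{x:S. f (p x):W}"
   then obtain U ph where c': "(U, ph):atlas M" "p x:U" using M.chart_exists plotD(4)[OF p] by blast
   let ?T = "{x:S. f (p x):W} Int {x:S. p x:U}"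
   have T: "opn V ?T" by (rule opn_Int[OF o plotD(5)[OF p c'(1)]])
   have e: "ph ` {x:U. f x:W} <= model M" using M.chart(4)[OF c'(1)] by auto
   have "smooth_on V ?T (%x. psi (f (inv_into U ph (ph (p x)))))"
   by (rule smooth_on_compose[OF plotD(1)[OF p] T M.model e _ smooth_on_subset[OF plotD(6)[OF p c'(1)]]])
   (use f c c' in "auto simp: smooth_map_def")
   then have "smooth_on V ?T (%x. psi (f (p x)))"
   by (subst smooth_on_cong[of _ _ "%x. psi (f (inv_into U ph (ph (p x))))"]) (auto simp: M.chart_inv[OF c'(1)])
   then show "EX T. opn V T & x:T & T <= {x:S. f (p x):W} & smooth_on V T (%x. psi (f (p x)))"
   using T x c'(2) by (intro exI[of _ ?T]) auto
  qed
 qed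
qed

text \<open>Inverse charts are themselves plots, so testing on them suffices. Together with
  \<open>plot_smooth_map\<close> this characterizes smooth maps as those that carry plots to
  plots.\<close>

lemma smooth_mapI:
 assumes M: "pre_manifold M" and N: "pre_manifold N" and f: "!!x. x:carrier M ==> f x:carrier N"
  and plot: "!!U ph. (U, ph):atlas M ==> plot N (model M) (ph ` U) (%u. f (inv_into U ph u))"
 shows "smooth_map M N f"
proof -
 interpret M: manifold M by standard (rule M)
 interpret N: manifold N by standard (rule N)
 have "continuous_map (topo M) (topo N) f"
  unfolding continuous_map_def
 proof (intro conjI allI impI)
  show "f:topspace (topo M) \<rightarrow> topspace (topo N)" using f by (auto simp: M.topspace N.topspace)
  fix W assume W: "openin (topo N) W"
  show "openin (topo M) {x:topspace (topo M). f x:W}"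
  proof (subst openin_subopen, intro ballI)
   fix x assume "x:{x:topspace (topo M). f x:W}"
   then have x: "x:carrier M" "f x:W" by (auto simp: M.topspace)
   obtain U ph where c: "(U, ph):atlas M" "x:U" using M.chart_exists[OF x(1)] by blast
   let ?A = "{u:ph ` U. f (inv_into U ph u):W}"
   have "opn (ph ` U) ?A"
   by (rule openin_subset_trans[OF N.plot_preimage[OF plot[OF c(1)] W]]) (use M.chart(4)[OF c(1)] in auto)
   then have "openin (subtopology (topo M) U) {x:topspace (subtopology (topo M) U). ph x:?A}"
   by (rule openin_continuous_map_preimage[OF homeomorphic_imp_continuous_map[OF M.chart(5)[OF c(1)]]])
   moreover have "{x:topspace (subtopology (topo M) U). ph x:?A} = {x:U. f x:W}"
   using M.chart(2)[OF c(1)] by (auto simp: M.topspace M.chart_inv(1)[OF c(1)] dest: inj_onD[OF M.chart(6)[OF c(1)]])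
   ultimately have "openin (topo M) {x:U. f x:W}"
   using openin_trans_full[OF _ M.chart(1)[OF c(1)]] by simp
   then show "EX T. openin (topo M) T & x:T & T <= {x:topspace (topo M). f x:W}"
   using x c M.chart(2)[OF c(1)] by (intro exI[of _ "{x:U. f x:W}"]) (auto simp: M.topspace)
  qed
 qed
 moreover have "smooth_on (model M) (ph ` {x:U. f x:W}) (%u. psi (f (inv_into U ph u)))"
  if c: "(U, ph):atlas M" "(W, psi):atlas N" for U ph W psi
  by (rule smooth_on_subset[OF plotD(6)[OF plot[OF c(1)] c(2)]]) (auto simp: M.chart_inv[OF c(1)])
 ultimately show ?thesis by (auto simp: smooth_map_def)
qed

lemma pre_manifold_prod:
 assumes M: "pre_manifold M" and N: "pre_manifold N"
 shows "pre_manifold (lie_prod M N)"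
proof -
 interpret M: manifold M by standard (rule M)
 interpret N: manifold N by standard (rule N)
 have h: "homeomorphic_map (subtopology (topo (lie_prod M N)) (U \<times> W)) (top_of_set (map_prod ph psi ` (U \<times> W))) (map_prod ph psi)"
  if c: "(U, ph):atlas M" "(W, psi):atlas N" for U ph W psi
 proof -
  obtain g where g: "homeomorphic_maps (subtopology (topo M) U) (top_of_set (ph ` U)) ph g"
   using M.chart(5)[OF c(1)] homeomorphic_map_maps by blast
  obtain k where k: "homeomorphic_maps (subtopology (topo N) W) (top_of_set (psi ` W)) psi k"
   using N.chart(5)[OF c(2)] homeomorphic_map_maps by blast
  have "homeomorphic_maps (prod_topology (subtopology (topo M) U) (subtopology (topo N) W))
   (prod_topology (top_of_set (ph ` U)) (top_of_set (psi ` W))) (%(x, y). (ph x, psi y)) (%(x, y). (g x, k y))"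
   using g k unfolding homeomorphic_maps_prod by blast
  then have "homeomorphic_map (prod_topology (subtopology (topo M) U) (subtopology (topo N) W))
   (prod_topology (top_of_set (ph ` U)) (top_of_set (psi ` W))) (%(x, y). (ph x, psi y))"
   using homeomorphic_map_maps by blast
  then show ?thesis
   by (simp add: lie_prod_def subtopology_Times map_prod_def map_prod_image flip: prod_topology_subtopology_eu)
   (simp add: map_prod_def[symmetric] map_prod_image)
 qed
 have inv: "inv_into (U \<times> W) (map_prod ph psi) u = (inv_into U ph (fst u), inv_into W psi (snd u))"
  if c: "(U, ph):atlas M" "(W, psi):atlas N" and u: "u:map_prod ph psi ` (U \<times> W)" for U ph W psi u
  using u by (intro inv_into_f_eq[OF map_prod_inj_on[OF M.chart(6)[OF c(1)] N.chart(6)[OF c(2)]]])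
   (auto simp: M.chart_inv[OF c(1)] N.chart_inv[OF c(2)])
 have sm: "smooth_on (model M \<times> model N) (map_prod ph psi ` (U \<times> W Int U' \<times> W')) (%u. map_prod ph' psi' (inv_into (U \<times> W) (map_prod ph psi) u))"
  if c: "(U, ph):atlas M" "(W, psi):atlas N" and c': "(U', ph'):atlas M" "(W', psi'):atlas N" for U ph W psi U' ph' W' psi'
 proof -
  let ?A = "map_prod ph psi ` (U \<times> W Int U' \<times> W')"
  have A: "?A = ph ` (U Int U') \<times> psi ` (W Int W')" by (auto simp: Times_Int_Times map_prod_image)
  have sub: "ph ` (U Int U') <= model M" "psi ` (W Int W') <= model N" using M.chart(4)[OF c(1)] N.chart(4)[OF c(2)] by auto
  have oA: "opn (model M \<times> model N) ?A" unfolding A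
   by (rule openin_Times[OF M.chart_image_open[OF c(1) M.chart(1)[OF c'(1)]] N.chart_image_open[OF c(2) N.chart(1)[OF c'(2)]]])
  have V: "subspace (model M \<times> model N)" by (rule subspace_Times[OF M.model N.model])
  have "smooth_on (model M \<times> model N) ?A (%u. (ph' (inv_into U ph (fst u)), psi' (inv_into W psi (snd u))))"
   by (intro smooth_on_Pair smooth_on_compose[OF V oA M.model sub(1) _ smooth_on_linear[OF bounded_linear_fst] M.chart(7)[OF c(1) c'(1)]]
   smooth_on_compose[OF V oA N.model sub(2) _ smooth_on_linear[OF bounded_linear_snd] N.chart(7)[OF c(2) c'(2)]]) (auto simp: A)
  then show ?thesis
  proof (rule iffD2[OF smooth_on_cong, rotated])
   fix u assume "u:?A"
   then have "u:map_prod ph psi ` (U \<times> W)" by blast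
   then show "map_prod ph' psi' (inv_into (U \<times> W) (map_prod ph psi) u) = (ph' (inv_into U ph (fst u)), psi' (inv_into W psi (snd u)))"
   by (simp only: inv[OF c] map_prod_simp)
  qed
 qed
 have cov: "(UN (U, ph):atlas (lie_prod M N). U) = carrier (lie_prod M N)"
 proof
  show "(UN (U, ph):atlas (lie_prod M N). U) <= carrier (lie_prod M N)"
   using M.chart(2) N.chart(2) by (fastforce simp: lie_prod_def)
  show "carrier (lie_prod M N) <= (UN (U, ph):atlas (lie_prod M N). U)"
  proof
   fix z assume "z:carrier (lie_prod M N)"
   then obtain U ph W psi where "(U, ph):atlas M" "fst z:U" "(W, psi):atlas N" "snd z:W"
   using M.chart_exists[of "fst z"] N.chart_exists[of "snd z"] by (auto simp: lie_prod_def DirProd_def mem_Times_iff)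
   then have "(U \<times> W, map_prod ph psi):atlas (lie_prod M N)" "z:U \<times> W" by (auto simp: lie_prod_def mem_Times_iff)
   then show "z:(UN (U, ph):atlas (lie_prod M N). U)" by blast
  qed
 qed
 have op: "openin (topo (lie_prod M N)) (U \<times> W)" "opn (model M \<times> model N) (map_prod ph psi ` (U \<times> W))"
  if c: "(U, ph):atlas M" "(W, psi):atlas N" for U ph W psi
  using M.chart[OF c(1)] N.chart[OF c(2)]
  by (auto simp: lie_prod_def openin_prod_Times_iff map_prod_image intro!: openin_Times)
 show ?thesis
  unfolding pre_manifold_def
 proof (intro conjI cov)
  show "topspace (topo (lie_prod M N)) = carrier (lie_prod M N)"
   by (simp add: lie_prod_def M.topspace N.topspace DirProd_def)
  show "subspace (model (lie_prod M N))" by (simp add: lie_prod_def subspace_Times M.model N.model)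
 qed (use h sm op in "auto simp: lie_prod_def")
qed

lemma plot_Pair:
 assumes p: "plot M V S p" and q: "plot N V S q"
 shows "plot (lie_prod M N) V S (%x. (p x, q x))"
proof (rule plotI[OF plotD(1,2)[OF p]])
 show "(p x, q x):carrier (lie_prod M N)" if "x:S" for x
  using plotD(4)[OF p that] plotD(4)[OF q that] by (simp add: lie_prod_def DirProd_def)
 fix A ta assume "(A, ta):atlas (lie_prod M N)"
 then obtain U ph W psi where c: "(U, ph):atlas M" "(W, psi):atlas N" and A: "A = U \<times> W" "ta = map_prod ph psi"
  by (auto simp: lie_prod_def)
 have eq: "{x:S. (p x, q x):A} = {x:S. p x:U} Int {x:S. q x:W}" by (auto simp: A)
 show "opn V {x:S. (p x, q x):A}" unfolding eq by (rule opn_Int[OF plotD(5)[OF p c(1)] plotD(5)[OF q c(2)]])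
 show "smooth_on V {x:S. (p x, q x):A} (%x. ta (p x, q x))"
  unfolding eq by (simp add: A) (intro smooth_on_Pair smooth_on_subset[OF plotD(6)[OF p c(1)]] smooth_on_subset[OF plotD(6)[OF q c(2)]]; auto)
qed

lemma plot_fst_snd:
 assumes M: "pre_manifold M" and N: "pre_manifold N" and p: "plot (lie_prod M N) V S p"
 shows "plot M V S (%x. fst (p x))" "plot N V S (%x. snd (p x))"
proof -
 interpret M: manifold M by standard (rule M)
 interpret N: manifold N by standard (rule N)
 have car: "fst (p x):carrier M" "snd (p x):carrier N" if "x:S" for x
  using plotD(4)[OF p that] by (auto simp: lie_prod_def DirProd_def mem_Times_iff)
 have *: "EX U ph W psi T. (U, ph):atlas M & (W, psi):atlas N & opn V T & x:T & T <= S & (ALL y:T. fst (p y):U & snd (p y):W)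
   & smooth_on V T (%x. (ph (fst (p x)), psi (snd (p x))))" if x: "x:S" for x
 proof -
  obtain U ph where U: "(U, ph):atlas M" "fst (p x):U" using M.chart_exists[OF car(1)[OF x]] by blast
  obtain W psi where W: "(W, psi):atlas N" "snd (p x):W" using N.chart_exists[OF car(2)[OF x]] by blast
  have c: "(U \<times> W, map_prod ph psi):atlas (lie_prod M N)" using U W by (auto simp: lie_prod_def)
  have "x:{y:S. p y:U \<times> W}" using U(2) W(2) x by (simp add: mem_Times_iff)
  moreover have "(%x. map_prod ph psi (p x)) = (%x. (ph (fst (p x)), psi (snd (p x))))"
   by (simp add: map_prod_def split_beta)
  ultimately show ?thesis
   using U(1) W(1) plotD(5,6)[OF p c]
   by (intro exI[of _ U] exI[of _ ph] exI[of _ W] exI[of _ psi] exI[of _ "{y:S. p y:U \<times> W}"] conjI)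
   (simp_all add: mem_Times_iff)
 qed
 show "plot M V S (%x. fst (p x))"
 proof (rule M.plot_by_charts[OF plotD(1,2)[OF p] car(1)])
  fix x assume "x:S"
  from *[OF this] obtain U ph W psi T where c: "(U, ph):atlas M" "(W, psi):atlas N" and T: "opn V T" "x:T" "T <= S"
   and m: "ALL y:T. fst (p y):U & snd (p y):W" and sm: "smooth_on V T (%x. (ph (fst (p x)), psi (snd (p x))))"
   by (elim exE conjE)
  have "smooth_on V T (%x. ph (fst (p x)))" using smooth_on_linear_comp[OF bounded_linear_fst sm] by simp
  moreover have "(%x. fst (p x)) ` T <= U" using m by auto
  ultimately show "EX U ph T. (U, ph):atlas M & opn V T & x:T & T <= S & (%x. fst (p x)) ` T <= U & smooth_on V T (%x. ph (fst (p x)))"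
   using c T by (intro exI conjI)
 qed
 show "plot N V S (%x. snd (p x))"
 proof (rule N.plot_by_charts[OF plotD(1,2)[OF p] car(2)])
  fix x assume "x:S"
  from *[OF this] obtain U ph W psi T where c: "(U, ph):atlas M" "(W, psi):atlas N" and T: "opn V T" "x:T" "T <= S"
   and m: "ALL y:T. fst (p y):U & snd (p y):W" and sm: "smooth_on V T (%x. (ph (fst (p x)), psi (snd (p x))))"
   by (elim exE conjE)
  have "smooth_on V T (%x. psi (snd (p x)))" using smooth_on_linear_comp[OF bounded_linear_snd sm] by simp
  moreover have "(%x. snd (p x)) ` T <= W" using m by auto
  ultimately show "EX U ph T. (U, ph):atlas N & opn V T & x:T & T <= S & (%x. snd (p x)) ` T <= U & smooth_on V T (%x. ph (snd (p x)))"
   using c T by (intro exI conjI)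
 qed
qed

section \<open>The Lie algebra of a Lie group\<close>

lemma vector_derivative_chain:
 fixes F :: "'v::euclidean_space => 'w::real_normed_vector" and u :: "real => 'v"
 assumes F: "(F has_derivative F') (at (u t) within T)" and u: "(u hvd X) (at t)"
  and ev: "\<forall>\<^sub>F s in at t. u s:T"
 shows "((%s. F (u s)) hvd F' X) (at t)"
proof -
 obtain d where d: "d > 0" "!!s. s ~= t ==> dist s t < d ==> u s:T" using ev by (auto simp: eventually_at)
 let ?T = "insert (u t) T"
 have F2: "(F has_derivative F') (at (u t) within ?T)" using F by (simp add: at_within_def)
 have im: "u ` ball t d <= ?T" using d(2) by (force simp: dist_commute)
 have "((%s. F (u s)) has_derivative (%h. F' (h *\<^sub>R X))) (at t within ball t d)"
  by (rule has_derivative_in_compose[OF _ has_derivative_subset[OF F2 im]])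
   (use u in "auto simp: has_vector_derivative_def intro: has_derivative_at_withinI")
 moreover have "at t within ball t d = at t" using d(1) by (intro at_within_open) auto
 ultimately show ?thesis
  unfolding has_vector_derivative_def linear_scale[OF has_derivative_linear[OF F]] by simp
qed

lemma opn_line:
 assumes "opn UNIV I" "(0::real):I" obtains d where "0 < d" "{-d<..<d} <= I"
proof -
 have "open I" using assms(1) by simp
 then obtain d where "0 < d" "ball 0 d <= I" using assms(2) open_contains_ball by blast
 moreover have "ball 0 d = {-d<..<d}" by (auto simp: dist_real_def)
 ultimately show ?thesis using that[of d] by simp
qed

lemma opn_ball: "opn UNIV {-d<..<d :: real}"
 by simp

text \<open>The velocity at time 0 is the partial derivative in the direction \<open>(0, 1)\<close>,
  hence smooth in the parameter.\<close>

lemma smooth_velocity: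
 fixes q :: "'e::euclidean_space \<times> real => 'a"
 assumes q: "plot M (V \<times> UNIV) (S \<times> {-d<..<d}) q" and V: "subspace V" "opn V S" and c: "(U, ph):atlas M" and d: "0 < d"
  and q0: "!!x. x:S ==> q (x, 0):U"
 obtains D where "smooth_on V S D" "!!x. x:S ==> ((%t. ph (q (x, t))) hvd D x) (at 0)"
proof -
 let ?T = "{z:S \<times> {-d<..<d}. q z:U}"
 have T: "opn (V \<times> UNIV) ?T" and s: "smooth_on (V \<times> UNIV) ?T (%z. ph (q z))" and W: "subspace (V \<times> (UNIV :: real set))"
  using plotD(5,6)[OF q c] plotD(1)[OF q] by auto
 obtain f' where f': "!!z. z:?T ==> ((%z. ph (q z)) has_derivative f' z) (at z within ?T)"
  "!!v. v:V \<times> UNIV ==> smooth_on (V \<times> UNIV) ?T (%z. f' z v)"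
  by (rule smooth_on_derivative[OF W T s]) blast
 have v: "(0, 1 :: real):V \<times> UNIV" using subspace_0[OF V(1)] by simp
 have xT: "(x, 0):?T" if "x:S" for x using that q0 d by auto
 have "smooth_on V S (%x. f' (x, 0) (0, 1))"
  by (rule smooth_on_compose[OF V W _ _ smooth_on_linear f'(2)[OF v]])
   (use xT V plotD(3)[OF q] in "auto intro: bounded_linear_Pair bounded_linear_ident bounded_linear_zero")
 moreover have "((%t. ph (q (x, t))) hvd f' (x, 0) (0, 1)) (at 0)" if "x:S" for x
  using directional_derivative(1)[OF W T xT[OF that] v f'(1)[OF xT[OF that]]] by simp
 ultimately show ?thesis using that by blast
qed

section \<open>Velocities at the identity, the adjoint representation and the bracket\<close>

locale lie = group G for G :: "('a, 'v::euclidean_space) lie_structure" (structure) +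
 assumes lie: "lie_group G"
begin

sublocale manifold G
 by standard (use lie in "auto simp: lie_group_def intro: smooth_manifold_pre")

lemma plot_mult:
 assumes "plot G V S p" "plot G V S q" shows "plot G V S (%x. p x \<otimes> q x)"
proof -
 have "smooth_map (lie_prod G G) G (%(x, y). x \<otimes> y)" using lie by (simp add: lie_group_def)
 from plot_smooth_map[OF pre_manifold_prod[OF M M] M this plot_Pair[OF assms]] show ?thesis by simp
qed

lemma plot_inv: "plot G V S p ==> plot G V S (%x. inv (p x))"
 by (rule plot_smooth_map[OF M M]) (use lie in "simp_all add: lie_group_def")

definition U1 :: "'a set" where "U1 = fst (chart_at_one G)"
definition ch :: "'a => 'v" where "ch = snd (chart_at_one G)"
definition th :: "'v => 'a" where "th = inv_into U1 ch"
definition P :: "'v => 'v" where "P = proj (model G)"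

lemma chart1: "(U1, ch):atlas G" and one_U1: "\<one>:U1"
proof -
 have "EX c. c:atlas G & \<one>:fst c" using chart_exists[OF one_closed] by force
 from someI_ex[OF this] show "(U1, ch):atlas G" "\<one>:U1"
  by (auto simp: U1_def ch_def chart_at_one_def)
qed

lemma U1_carrier: "x:U1 ==> x:carrier G"
 using chart(2)[OF chart1] by blast

lemma th: "x:U1 ==> th (ch x) = x" "u:ch ` U1 ==> ch (th u) = u" "u:ch ` U1 ==> th u:U1"
  "plot G (model G) (ch ` U1) th" "opn (model G) (ch ` U1)" "ch \<one>:ch ` U1" "ch \<one>:model G" "ch ` U1 <= model G"
 using chart_inv[OF chart1] plot_chart_inverse[OF chart1] chart(3,4)[OF chart1] one_U1 by (auto simp: th_def)

lemma P: "linear P" "P x:model G" "x:model G ==> P x = x"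
 using proj[OF model] by (auto simp: P_def)

text \<open>Only the germ of \<open>c\<close> at 0 matters; elsewhere the curve is arbitrary.
  Velocities are read in the same chart as in \<open>diff_at_one\<close>, so they are elements of
  the Lie algebra.\<close>

definition gvel :: "(real => 'a) => 'v => bool" where
 "gvel c X \<longleftrightarrow> (EX d>0. plot G UNIV {-d<..<d} c) & c 0 = \<one> & ((%t. ch (c t)) hvd X) (at 0)"

lemma gvelD:
 assumes "gvel c X"
 obtains d where "0 < d" "plot G UNIV {-d<..<d} c" "c ` {-d<..<d} <= U1"
proof -
 obtain d where d: "d > 0" "plot G UNIV {-d<..<d} c" and c0: "c 0 = \<one>" using assms by (auto simp: gvel_def)
 obtain e where e: "0 < e" "{-e<..<e} <= {t:{-d<..<d}. c t:U1}"
  using opn_line[OF plotD(5)[OF d(2) chart1]] d(1) c0 one_U1 by auto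
 show ?thesis by (rule that[OF e(1) plot_subset[OF d(2)]]) (use e(2) in auto)
qed

lemma gvel_unique: "gvel c X ==> gvel c Y ==> X = Y"
 by (auto simp: gvel_def intro: vector_derivative_unique_at)

lemma gvel_transform:
 assumes c: "gvel c X" and d: "0 < d" "!!t. \<bar>t\<bar> < d ==> c' t = c t"
 shows "gvel c' X"
 unfolding gvel_def
proof (intro conjI)
 obtain e where e: "0 < e" "plot G UNIV {-e<..<e} c" using c by (auto simp: gvel_def)
 have "plot G UNIV {-min d e<..<min d e} c"
  by (rule plot_subset[OF e(2)]) auto
 then have "plot G UNIV {-min d e<..<min d e} c'" by (rule plot_cong[rotated]) (use d(2) in auto)
 then show "EX d>0. plot G UNIV {-d<..<d} c'" using d(1) e(1) by (intro exI[of _ "min d e"]) auto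
 show "c' 0 = \<one>" using d c by (simp add: gvel_def)
 have "((%t. ch (c t)) hvd X) (at 0)" using c by (simp add: gvel_def)
 then show "((%t. ch (c' t)) hvd X) (at 0)"
  by (rule hvd_transform[of _ _ _ "{-d<..<d}"]) (use d in auto)
qed

lemma gvel_model:
 assumes "gvel c X" shows "X:model G"
proof (rule gvelD[OF assms])
 fix d :: real assume d: "0 < d" "c ` {-d<..<d} <= U1"
 show ?thesis
 proof (rule derivative_in_subspace[OF _ _ model])
  show "((%t. ch (c t)) hvd X) (at 0)" using assms by (simp add: gvel_def)
  show "\<forall>\<^sub>F t in at 0. ch (c t):model G"
   using d th(8) by (auto simp: eventually_at dist_real_def image_subset_iff abs_less_iff intro!: exI[of _ d])
  show "ch (c 0):model G" using assms th(7) by (simp add: gvel_def)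
 qed
qed

lemma curve_at_one_eq: "curve_at_one G X t = th (ch \<one> + t *\<^sub>R X)"
 by (simp add: curve_at_one_def th_def U1_def ch_def split_beta)

lemma gvel_curve:
 assumes X: "X:model G" shows "gvel (curve_at_one G X) X"
proof -
 have "(%t. ch \<one> + t *\<^sub>R X) ` UNIV <= model G" using X th(7) model by (auto simp: subspace_add subspace_scale)
 then have "opn UNIV {t :: real:UNIV. ch \<one> + t *\<^sub>R X:ch ` U1}"
  by (intro opn_preimage[OF _ _ th(5)]) (auto intro!: continuous_intros)
 then obtain d where d: "0 < d" "!!t. \<bar>t\<bar> < d ==> ch \<one> + t *\<^sub>R X:ch ` U1"
  using th(6) by (elim opn_line) (auto simp: subset_iff abs_less_iff)
 have "plot G UNIV {-d<..<d} (%t. th (ch \<one> + t *\<^sub>R X))"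
  by (rule plot_compose[OF th(4) _ opn_ball])
   (use d(2) in "auto intro!: smooth_on_add[OF smooth_on_const smooth_on_linear] bounded_linear_scaleR_left")
 moreover have "((%t. ch \<one> + t *\<^sub>R X) hvd X) (at 0)" by (auto intro!: derivative_eq_intros)
 then have "((%t. ch (th (ch \<one> + t *\<^sub>R X))) hvd X) (at 0)"
  by (rule hvd_transform[of _ _ _ "{-d<..<d}"]) (use d th(2) in auto)
 ultimately show ?thesis using d(1) th(1)[OF one_U1] by (auto simp: gvel_def curve_at_one_eq[abs_def])
qed

lemma gvel_const: "gvel (%t. \<one>) 0"
 unfolding gvel_def by (auto intro!: exI[of _ 1] plot_const)
end

text \<open>The differential in the form used from here on: a linear map of the ambient space that
  acts on the velocities of arbitrary curves, not only of \<open>curve_at_one\<close>.\<close>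

lemma gvel_map:
 assumes "lie G" "lie K" and f: "smooth_map G K f" "f \<one>\<^bsub>G\<^esub> = \<one>\<^bsub>K\<^esub>"
 obtains A where "linear A" "!!c X. lie.gvel G c X ==> lie.gvel K (%t. f (c t)) (A X)"
  "!!X. X:model G ==> diff_at_one G K f X = A X"
proof -
 interpret G: lie G by fact
 interpret K: lie K by fact
 have q: "plot K (model G) (G.ch ` G.U1) (%u. f (G.th u))" by (rule plot_smooth_map[OF G.M K.M f(1) G.th(4)])
 let ?T = "{u:G.ch ` G.U1. f (G.th u):K.U1}"
 have T: "opn (model G) ?T" and s: "smooth_on (model G) ?T (%u. K.ch (f (G.th u)))" using plotD(5,6)[OF q K.chart1] by auto
 obtain F' where F': "!!u. u:?T ==> ((%u. K.ch (f (G.th u))) has_derivative F' u) (at u within ?T)"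
  by (rule smooth_on_derivative[OF G.model T s]) blast
 have o: "G.ch \<one>\<^bsub>G\<^esub>:?T" using G.th(6) G.th(1)[OF G.one_U1] f(2) K.one_U1 by auto
 let ?A = "F' (G.ch \<one>\<^bsub>G\<^esub>)"
 have vel: "K.gvel (%t. f (c t)) (?A X)" if c: "G.gvel c X" for c X
 proof (rule G.gvelD[OF c])
  fix d :: real assume d: "0 < d" "plot G UNIV {-d<..<d} c" "c ` {-d<..<d} <= G.U1"
  have fp: "plot K UNIV {-d<..<d} (%t. f (c t))" by (rule plot_smooth_map[OF G.M K.M f(1) d(2)])
  have c0: "c 0 = \<one>\<^bsub>G\<^esub>" using c by (simp add: G.gvel_def)
  obtain e where e: "0 < e" "{-e<..<e} <= {t:{-d<..<d}. f (c t):K.U1}"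
   using opn_line[OF plotD(5)[OF fp K.chart1]] d(1) c0 f(2) K.one_U1 by auto
  have "((%t. K.ch (f (G.th (G.ch (c t))))) hvd ?A X) (at 0)"
  proof (rule vector_derivative_chain[where u = "%t. G.ch (c t)" and T = ?T])
   show "((%u. K.ch (f (G.th u))) has_derivative ?A) (at (G.ch (c 0)) within ?T)" using F'[OF o] c0 by simp
   show "((%t. G.ch (c t)) hvd X) (at 0)" using c by (simp add: G.gvel_def)
   have "G.ch (c s):?T" if "dist s 0 < e" for s
   proof -
   have s: "s:{-e<..<e}" using that by (auto simp: dist_real_def)
   then have "s:{-d<..<d}" "f (c s):K.U1" using e(2) by blast+
   then have "c s:G.U1" "f (c s):K.U1" using d(3) by blast+
   then show ?thesis by (auto simp: G.th(1))
   qed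
   then show "\<forall>\<^sub>F s in at 0. G.ch (c s):?T" using e(1) by (auto simp: eventually_at intro!: exI[of _ e])
  qed
  then have "((%t. K.ch (f (c t))) hvd ?A X) (at 0)"
   by (rule hvd_transform[of _ _ _ "{-d<..<d}"]) (use d G.th(1) in "auto simp: image_subset_iff")
  then show "K.gvel (%t. f (c t)) (?A X)" using d(1) fp c0 f(2) by (auto simp: K.gvel_def)
 qed
 show ?thesis
 proof (rule that)
  show "linear ?A" by (rule has_derivative_linear[OF F'[OF o]])
  show "diff_at_one G K f X = ?A X" if "X:model G" for X
   using vel[OF G.gvel_curve[OF that]] by (auto simp: diff_at_one_def K.gvel_def K.ch_def intro: vector_derivative_at)
 qed (rule vel)
qed

context lie
begin

text \<open>The derivative of the multiplication at the identity is linear, and the constant curve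
  gives its values on \<open>(X, 0)\<close> and \<open>(0, Y)\<close>.\<close>

lemma gvel_mult:
 assumes c: "gvel c X" and e: "gvel e Y" shows "gvel (%t. c t \<otimes> e t) (X + Y)"
proof -
 let ?V = "model G \<times> model G" and ?W = "ch ` U1 \<times> ch ` U1"
 have V: "subspace ?V" "opn ?V ?W" by (intro subspace_Times model openin_Times th(5))+
 have "plot G ?V ?W (%z. th (fst z))" "plot G ?V ?W (%z. th (snd z))"
  by (rule plot_compose[OF th(4) V smooth_on_linear]; auto intro: bounded_linear_fst bounded_linear_snd)+
 then have q: "plot G ?V ?W (%z. th (fst z) \<otimes> th (snd z))" by (rule plot_mult)
 let ?T = "{z:?W. th (fst z) \<otimes> th (snd z):U1}"
 let ?F = "%z. ch (th (fst z) \<otimes> th (snd z))"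
 have T: "opn ?V ?T" and s: "smooth_on ?V ?T ?F" using plotD(5,6)[OF q chart1] by auto
 obtain F' where F': "!!z. z:?T ==> (?F has_derivative F' z) (at z within ?T)"
  by (rule smooth_on_derivative[OF V(1) T s]) blast
 let ?o = "(ch \<one>, ch \<one>)"
 have o: "?o:?T" using th(6) th(1)[OF one_U1] one_U1 by auto
 have lF: "linear (F' ?o)" by (rule has_derivative_linear[OF F'[OF o]])
 have main: "EX d>0. plot G UNIV {-d<..<d} (%t. a t \<otimes> b t)" "((%t. ch (a t \<otimes> b t)) hvd F' ?o (A, B)) (at 0)"
  if a: "gvel a A" and b: "gvel b B" for a b A B
 proof -
  obtain d where d: "0 < d" "plot G UNIV {-d<..<d} a" "a ` {-d<..<d} <= U1" using gvelD[OF a] by metis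
  obtain d' where d': "0 < d'" "plot G UNIV {-d'<..<d'} b" "b ` {-d'<..<d'} <= U1" using gvelD[OF b] by metis
  define m where "m = min d d'"
  have m: "0 < m" "{-m<..<m} <= {-d<..<d}" "{-m<..<m} <= {-d'<..<d'}" using d d' by (auto simp: m_def)
  have p: "plot G UNIV {-m<..<m} (%t. a t \<otimes> b t)"
   by (rule plot_mult[OF plot_subset[OF d(2) opn_ball m(2)] plot_subset[OF d'(2) opn_ball m(3)]])
  then show "EX d>0. plot G UNIV {-d<..<d} (%t. a t \<otimes> b t)" using m(1) by blast
  have ab0: "a 0 = \<one>" "b 0 = \<one>" using a b by (auto simp: gvel_def)
  obtain e where e: "0 < e" "{-e<..<e} <= {t:{-m<..<m}. a t \<otimes> b t:U1}"
   using opn_line[OF plotD(5)[OF p chart1]] m(1) ab0 one_U1 by auto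
  have thab: "th (ch (a s)) = a s" "th (ch (b s)) = b s" if "s:{-m<..<m}" for s
   using that m d(3) d'(3) th(1) by (auto simp: image_subset_iff subset_iff)
  have "((%t. ?F (ch (a t), ch (b t))) hvd F' ?o (A, B)) (at 0)"
  proof (rule vector_derivative_chain[where F = ?F and u = "%t. (ch (a t), ch (b t))" and T = ?T])
   show "(?F has_derivative F' ?o) (at (ch (a 0), ch (b 0)) within ?T)" using F'[OF o] by (simp add: ab0)
   show "((%t. (ch (a t), ch (b t))) hvd (A, B)) (at 0)"
   using a b by (auto simp: gvel_def intro!: has_vector_derivative_Pair)
   have "(ch (a s), ch (b s)):?T" if "dist s 0 < e" for s
   proof -
   have "s:{-e<..<e}" using that by (auto simp: dist_real_def)
   then have s: "s:{-m<..<m}" "a s \<otimes> b s:U1" using e(2) by blast+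
   then have "a s:U1" "b s:U1" using m(2,3) d(3) d'(3) by blast+
   then show ?thesis using s by (auto simp: thab)
   qed
   then show "\<forall>\<^sub>F s in at 0. (ch (a s), ch (b s)):?T" using e(1) by (auto simp: eventually_at intro!: exI[of _ e])
  qed
  then show "((%t. ch (a t \<otimes> b t)) hvd F' ?o (A, B)) (at 0)"
   by (rule hvd_transform[of _ _ _ "{-m<..<m}"]) (use m(1) thab in auto)
 qed
 have l: "F' ?o (X, 0) = X" "F' ?o (0, Y) = Y"
 proof -
  have cc: "c t \<otimes> \<one> = c t" "\<one> \<otimes> e t = e t" if "\<bar>t\<bar> < d" "plot G UNIV {-d<..<d} c" "plot G UNIV {-d<..<d} e" for t d
   using plotD(4)[OF that(2), of t] plotD(4)[OF that(3), of t] that(1) by (auto simp: abs_less_iff)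
  obtain d where d: "0 < d" "plot G UNIV {-d<..<d} c" using c by (auto simp: gvel_def)
  have "((%t. ch (c t)) hvd F' ?o (X, 0)) (at 0)"
   by (rule hvd_transform[OF main(2)[OF c gvel_const], of "{-d<..<d}"])
   (use d plotD(4)[OF d(2)] in auto)
  then show "F' ?o (X, 0) = X" using c by (auto simp: gvel_def intro: vector_derivative_unique_at)
  obtain d where d: "0 < d" "plot G UNIV {-d<..<d} e" using e by (auto simp: gvel_def)
  have "((%t. ch (e t)) hvd F' ?o (0, Y)) (at 0)"
   by (rule hvd_transform[OF main(2)[OF gvel_const e], of "{-d<..<d}"])
   (use d plotD(4)[OF d(2)] in auto)
  then show "F' ?o (0, Y) = Y" using e by (auto simp: gvel_def intro: vector_derivative_unique_at)
 qed
 have "F' ?o (X, Y) = X + Y" using linear_add[OF lF, of "(X, 0)" "(0, Y)"] l by simp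
 then show ?thesis using main[OF c e] c e by (simp add: gvel_def)
qed

lemma smooth_conj: "g:carrier G ==> smooth_map G G (%x. g \<otimes> x \<otimes> inv g)"
proof (rule smooth_mapI[OF M M])
 fix U ph assume g: "g:carrier G" and c: "(U, ph):atlas G"
 show "plot G (model G) (ph ` U) (%u. g \<otimes> inv_into U ph u \<otimes> inv g)"
  by (intro plot_mult plot_chart_inverse[OF c] plot_const model chart(3)[OF c]) (use g in auto)
qed auto

lemma Ad_linear:
 assumes g: "g:carrier G"
 shows "gvel c X ==> gvel (%t. g \<otimes> c t \<otimes> inv g) (Ad G g X)" "linear (%X. Ad G g (P X))" "X:model G ==> Ad G g X:model G"
proof -
 have l: "lie G" by (rule lie_axioms)
 have g1: "g \<otimes> \<one> \<otimes> inv g = \<one>" using g by simp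
 obtain A where A: "linear A" "!!c X. gvel c X ==> gvel (%t. g \<otimes> c t \<otimes> inv g) (A X)" "!!X. X:model G ==> Ad G g X = A X"
  unfolding Ad_def by (rule gvel_map[OF l l smooth_conj[OF g] g1]) blast
 show v: "gvel (%t. g \<otimes> c t \<otimes> inv g) (Ad G g X)" if "gvel c X" for c X using A(2,3) gvel_model that by metis
 show "linear (%X. Ad G g (P X))" using A(1) P by (auto intro!: linearI simp: A(3) linear_comm[OF A(1)] linear_comm[OF P(1)])
 show "Ad G g X:model G" if "X:model G" using gvel_model[OF v[OF gvel_curve[OF that]]] .
qed

lemmas gvel_conj = Ad_linear(1) and Ad_model = Ad_linear(3)

lemma Ad_add:
 assumes "g:carrier G" "X:model G"
 shows "Y:model G ==> Ad G g (X + Y) = Ad G g X + Ad G g Y" "Ad G g (r *\<^sub>R X) = r *\<^sub>R Ad G g X"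
 using linear_add[OF Ad_linear(2)[OF assms(1)], of X Y] linear_scale[OF Ad_linear(2)[OF assms(1)], of r X] assms(2) P(3) model
 by (simp_all add: subspace_add subspace_scale)

lemma Ad_mult:
 assumes g: "g:carrier G" "h:carrier G" and X: "X:model G"
 shows "Ad G (g \<otimes> h) X = Ad G g (Ad G h X)"
proof (rule gvel_unique)
 have c: "gvel (curve_at_one G X) X" by (rule gvel_curve[OF X])
 obtain d where d: "0 < d" "plot G UNIV {-d<..<d} (curve_at_one G X)" using c by (auto simp: gvel_def)
 show "gvel (%t. (g \<otimes> h) \<otimes> curve_at_one G X t \<otimes> inv (g \<otimes> h)) (Ad G (g \<otimes> h) X)" using gvel_conj c g by simp
 show "gvel (%t. (g \<otimes> h) \<otimes> curve_at_one G X t \<otimes> inv (g \<otimes> h)) (Ad G g (Ad G h X))"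
 proof (rule gvel_transform[OF gvel_conj[OF g(1) gvel_conj[OF g(2) c]] d(1)])
  fix t :: real assume "\<bar>t\<bar> < d"
  then have "curve_at_one G X t:carrier G" using plotD(4)[OF d(2), of t] by (auto simp: abs_less_iff)
  then show "g \<otimes> h \<otimes> curve_at_one G X t \<otimes> inv (g \<otimes> h) = g \<otimes> (h \<otimes> curve_at_one G X t \<otimes> inv h) \<otimes> inv g"
   using g by (simp add: m_assoc inv_mult_group)
 qed
qed

lemma Ad_one: "X:model G ==> Ad G \<one> X = X"
proof (rule gvel_unique)
 assume X: "X:model G"
 have c: "gvel (curve_at_one G X) X" by (rule gvel_curve[OF X])
 obtain d where d: "0 < d" "plot G UNIV {-d<..<d} (curve_at_one G X)" using c by (auto simp: gvel_def)
 show "gvel (curve_at_one G X) X" by (rule c)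
 show "gvel (curve_at_one G X) (Ad G \<one> X)"
  by (rule gvel_transform[OF gvel_conj[OF one_closed c] d(1)]) (use plotD(4)[OF d(2)] in "auto simp: abs_less_iff")
qed

lemma Ad_inv:
 assumes "g:carrier G" "X:model G"
 shows "Ad G g (Ad G (inv g) X) = X" "Ad G (inv g) (Ad G g X) = X"
 using Ad_mult[of g "inv g" X] Ad_mult[of "inv g" g X] Ad_one assms by auto

lemma Ad_smooth:
 assumes p: "plot G V S p" and X: "X:model G"
 shows "smooth_on V S (%x. Ad G (p x) X)"
proof -
 have c: "gvel (curve_at_one G X) X" by (rule gvel_curve[OF X])
 obtain d where d: "0 < d" "plot G UNIV {-d<..<d} (curve_at_one G X)" using c by (auto simp: gvel_def)
 note V = plotD(1,2)[OF p]
 have V2: "subspace (V \<times> (UNIV :: real set))" "opn (V \<times> UNIV) (S \<times> {-d<..<d})"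
  by (auto intro!: subspace_Times V openin_Times)
 have q: "plot G (V \<times> UNIV) (S \<times> {-d<..<d}) (%z. p (fst z) \<otimes> curve_at_one G X (snd z) \<otimes> inv (p (fst z)))"
  by (intro plot_mult plot_inv plot_compose[OF p V2 smooth_on_linear] plot_compose[OF d(2) V2 smooth_on_linear])
   (auto intro: bounded_linear_fst bounded_linear_snd)
 obtain D where D: "smooth_on V S D" "!!x. x:S ==> ((%t. ch (p (fst (x, t)) \<otimes> curve_at_one G X (snd (x, t)) \<otimes> inv (p (fst (x, t))))) hvd D x) (at 0)"
  by (rule smooth_velocity[OF q V chart1 d(1)]) (use c plotD(4)[OF p] one_U1 in "auto simp: gvel_def")
 have "D x = Ad G (p x) X" if "x:S" for x
  using D(2)[OF that] gvel_conj[OF plotD(4)[OF p that] c] by (auto simp: gvel_def intro: vector_derivative_unique_at)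
 then show ?thesis using D(1) smooth_on_cong[of S D "%x. Ad G (p x) X"] by blast
qed

lemma Ad_derivative_linear:
 assumes Y: "Y:model G"
 obtains A where "linear A" "!!c X. gvel c X ==> ((%t. Ad G (c t) Y) hvd A X) (at 0)"
  "!!X. X:model G ==> lie_bracket G X Y = A X"
proof -
 have s: "smooth_on (model G) (ch ` U1) (%u. Ad G (th u) Y)" by (rule Ad_smooth[OF th(4) Y])
 obtain F' where F': "!!u. u:ch ` U1 ==> ((%u. Ad G (th u) Y) has_derivative F' u) (at u within ch ` U1)"
  by (rule smooth_on_derivative[OF model th(5) s]) blast
 let ?A = "F' (ch \<one>)"
 have vel: "((%t. Ad G (c t) Y) hvd ?A X) (at 0)" if c: "gvel c X" for c X
 proof (rule gvelD[OF c])
  fix d :: real assume d: "0 < d" "c ` {-d<..<d} <= U1"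
  have "((%t. Ad G (th (ch (c t))) Y) hvd ?A X) (at 0)"
  proof (rule vector_derivative_chain[where F = "%u. Ad G (th u) Y" and F' = ?A and X = X and u = "%t. ch (c t)" and T = "ch ` U1"])
   show "((%u. Ad G (th u) Y) has_derivative ?A) (at (ch (c 0)) within ch ` U1)" using F'[OF th(6)] c by (simp add: gvel_def)
   show "((%t. ch (c t)) hvd X) (at 0)" using c by (simp add: gvel_def)
   show "\<forall>\<^sub>F s in at 0. ch (c s):ch ` U1"
   using d by (auto simp: eventually_at dist_real_def image_subset_iff abs_less_iff intro!: exI[of _ d])
  qed
  then show "((%t. Ad G (c t) Y) hvd ?A X) (at 0)"
   by (rule hvd_transform[of _ _ _ "{-d<..<d}"]) (use d th(1) in "auto simp: image_subset_iff")
 qed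
 show ?thesis
 proof (rule that)
  show "linear ?A" by (rule has_derivative_linear[OF F'[OF th(6)]])
  show "lie_bracket G X Y = ?A X" if "X:model G" for X
   unfolding lie_bracket_def by (rule vector_derivative_at[OF vel[OF gvel_curve[OF that]]])
 qed (rule vel)
qed

lemma Ad_derivative:
 assumes "gvel c X" "Y:model G"
 shows "((%t. Ad G (c t) Y) hvd lie_bracket G X Y) (at 0)"
 using Ad_derivative_linear[OF assms(2)] assms gvel_model by metis

lemma gvel_carrier:
 assumes "gvel c X" obtains d where "0 < d" "!!t. \<bar>t\<bar> < d ==> c t:carrier G"
proof -
 obtain d where d: "0 < d" "plot G UNIV {-d<..<d} c" using assms by (auto simp: gvel_def)
 show ?thesis by (rule that[OF d(1) plotD(4)[OF d(2)]]) auto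
qed

lemma bracket_model: "X:model G ==> Y:model G ==> lie_bracket G X Y:model G"
proof (rule derivative_in_subspace[OF Ad_derivative[OF gvel_curve] _ model])
 assume X: "X:model G" and Y: "Y:model G"
 obtain d where d: "0 < d" "!!t. \<bar>t\<bar> < d ==> curve_at_one G X t:carrier G" using gvel_carrier[OF gvel_curve[OF X]] by blast
 show "\<forall>\<^sub>F s in at 0. Ad G (curve_at_one G X s) Y:model G"
  using d Ad_model[OF _ Y] by (auto simp: eventually_at dist_real_def intro!: exI[of _ d])
 show "Ad G (curve_at_one G X 0) Y:model G" using d Ad_model[OF _ Y] by simp
qed

text \<open>\<open>lie_bracket\<close> is meaningful on the model only; with \<open>P\<close> in
  both arguments it becomes a bilinear map of the ambient space, as the algebraic part
  requires.\<close>

definition br :: "'v => 'v => 'v" where "br X Y = lie_bracket G (P X) (P Y)"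

lemma br_eq: "X:model G ==> Y:model G ==> br X Y = lie_bracket G X Y"
 by (simp add: br_def P)

lemma br_model: "br X Y:model G" and br_P: "br (P X) Y = br X Y" "br X (P Y) = br X Y"
 by (simp_all add: br_def P bracket_model)

lemma br_bilinear: "bilinear br"
 unfolding bilinear_def
proof (intro conjI allI)
 show "linear (%X. br X Y)" for Y
 proof (rule Ad_derivative_linear[OF P(2)[of Y]])
  fix A assume A: "linear A" "!!X. X:model G ==> lie_bracket G X (P Y) = A X"
  show ?thesis unfolding br_def by (auto intro!: linearI simp: A(2) P linear_comm[OF A(1)] linear_comm[OF P(1)])
 qed
 fix X
 let ?c = "curve_at_one G (P X)"
 have c: "gvel ?c (P X)" by (rule gvel_curve[OF P(2)])
 obtain d where d: "0 < d" "!!t. \<bar>t\<bar> < d ==> ?c t:carrier G" using gvel_carrier[OF c] by blast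
 have D: "((%t. Ad G (?c t) (P Y)) hvd br X Y) (at 0)" for Y
  using Ad_derivative[OF c P(2)[of Y]] by (simp add: br_def)
 show "linear (br X)"
 proof (rule linearI)
  fix Y Z
  have "((%t. Ad G (?c t) (P Y) + Ad G (?c t) (P Z)) hvd br X Y + br X Z) (at 0)"
   by (intro has_vector_derivative_add D)
  then have "((%t. Ad G (?c t) (P (Y + Z))) hvd br X Y + br X Z) (at 0)"
   by (rule hvd_transform[of _ _ _ "{-d<..<d}"]) (use d P in "auto simp: linear_comm[OF P(1)] Ad_add")
  then show "br X (Y + Z) = br X Y + br X Z" using D vector_derivative_unique_at by blast
 next
  fix r Y
  have "((%t. r *\<^sub>R Ad G (?c t) (P Y)) hvd r *\<^sub>R br X Y) (at 0)"
   by (rule bounded_linear.has_vector_derivative[OF bounded_linear_scaleR_right D])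
  then have "((%t. Ad G (?c t) (P (r *\<^sub>R Y))) hvd r *\<^sub>R br X Y) (at 0)"
   by (rule hvd_transform[of _ _ _ "{-d<..<d}"]) (use d P in "auto simp: linear_comm[OF P(1)] Ad_add")
  then show "br X (r *\<^sub>R Y) = r *\<^sub>R br X Y" using D vector_derivative_unique_at by blast
 qed
qed

lemma Ad_linear_derivative:
 assumes g: "g:carrier G" and c: "(c hvd X) (at t)" and cm: "0 < d" "!!s. dist s t < d ==> c s:model G"
  and X: "X:model G"
 shows "((%s. Ad G g (c s)) hvd Ad G g X) (at t)"
proof -
 have "((%s. Ad G g (P (c s))) hvd Ad G g (P X)) (at t)"
  by (rule bounded_linear.has_vector_derivative[OF linear_bounded[OF Ad_linear(2)[OF g]] c])
 then show ?thesis
  unfolding P(3)[OF X]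
  by (rule hvd_transform[of _ _ _ "ball t d"]) (use cm P(3) in "auto simp: dist_commute")
qed

lemma Ad_br:
 assumes g: "g:carrier G" and X: "X:model G" and Y: "Y:model G"
 shows "Ad G g (br X Y) = br (Ad G g X) (Ad G g Y)"
proof -
 let ?c = "curve_at_one G X"
 have c: "gvel ?c X" by (rule gvel_curve[OF X])
 obtain d where d: "0 < d" "!!t. \<bar>t\<bar> < d ==> ?c t:carrier G" using gvel_carrier[OF c] by blast
 have "((%t. Ad G (g \<otimes> ?c t \<otimes> inv g) (Ad G g Y)) hvd lie_bracket G (Ad G g X) (Ad G g Y)) (at 0)"
  by (rule Ad_derivative[OF gvel_conj[OF g c] Ad_model[OF g Y]])
 then have "((%t. Ad G g (Ad G (?c t) Y)) hvd lie_bracket G (Ad G g X) (Ad G g Y)) (at 0)"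
  by (rule hvd_transform[of _ _ _ "{-d<..<d}"]) (use d g Y in "auto simp: Ad_mult Ad_model Ad_inv")
 moreover have "((%t. Ad G g (Ad G (?c t) Y)) hvd Ad G g (lie_bracket G X Y)) (at 0)"
  by (rule Ad_linear_derivative[OF g Ad_derivative[OF c Y] d(1)]) (use d(2) Ad_model Y X bracket_model in auto)
 ultimately have "lie_bracket G (Ad G g X) (Ad G g Y) = Ad G g (lie_bracket G X Y)" by (rule vector_derivative_unique_at)
 then show ?thesis using br_eq[OF X Y] br_eq[OF Ad_model[OF g X] Ad_model[OF g Y]] by simp
qed

lemma bilinear_derivative:
 fixes h :: "'v => 'v => 'v"
 assumes "bilinear h" "(f hvd f') (at t)" "(g hvd g') (at t)"
 shows "((%s. h (f s) (g s)) hvd h (f t) g' + h f' (g t)) (at t)"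
 by (rule bounded_bilinear.has_vector_derivative[OF bilinear_conv_bounded_bilinear[THEN iffD1, OF assms(1)] assms(2,3)])

text \<open>The automorphism property \<open>Ad_br\<close>, differentiated along a curve through the
  identity. This form of the Jacobi identity does not presuppose antisymmetry, which is drawn from
  nondegeneracy of the Killing form.\<close>

lemma leibniz: "br X (br Y Z) = br (br X Y) Z + br Y (br X Z)"
proof -
 have *: "br X (br Y Z) = br (br X Y) Z + br Y (br X Z)" if m: "X:model G" "Y:model G" "Z:model G" for X Y Z
 proof -
  let ?c = "curve_at_one G X"
  have c: "gvel ?c X" by (rule gvel_curve[OF m(1)])
  obtain d where d: "0 < d" "!!t. \<bar>t\<bar> < d ==> ?c t:carrier G" using gvel_carrier[OF c] by blast
  have D: "((%t. Ad G (?c t) W) hvd br X W) (at 0)" if "W:model G" for W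
   using Ad_derivative[OF c that] that m(1) by (simp add: br_eq)
  have "((%t. br (Ad G (?c t) Y) (Ad G (?c t) Z)) hvd br (Ad G (?c 0) Y) (br X Z) + br (br X Y) (Ad G (?c 0) Z)) (at 0)"
   by (rule bilinear_derivative[OF br_bilinear D[OF m(2)] D[OF m(3)]])
  then have "((%t. Ad G (?c t) (br Y Z)) hvd br (Ad G (?c 0) Y) (br X Z) + br (br X Y) (Ad G (?c 0) Z)) (at 0)"
   by (rule hvd_transform[of _ _ _ "{-d<..<d}"]) (use d m in "auto simp: Ad_br")
  then show ?thesis
   using vector_derivative_unique_at[OF D[OF br_model[of Y Z]]] c m by (simp add: gvel_def Ad_one add.commute)
 qed
 show ?thesis using *[OF P(2) P(2) P(2), of X Y Z] by (simp add: br_P)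
qed
end

section \<open>Integral curves\<close>

lemma vector_derivative_shift:
 "((%s. u (t + s)) hvd X) (at 0) \<longleftrightarrow> (u hvd X) (at (t :: real))"
proof -
 have "((%s. t + s) hvd 1) (at 0)" "((%s. s - t) hvd 1) (at t)"
  by (auto intro!: derivative_eq_intros simp: has_vector_derivative_def)
 then show ?thesis
  using vector_diff_chain_at[of "%s. t + s" 1 0 u X] vector_diff_chain_at[of "%s. s - t" 1 t "%s. u (t + s)" X]
  by (auto simp: o_def)
qed

context lie
begin

text \<open>An integral curve of the left-invariant field of \<open>X\<close>, stated by translating
  the velocity back to the identity. Such curves, defined on an interval only, take the place of the
  exponential map.\<close>

definition intcurve :: "'v => real => (real => 'a) => bool" where
 "intcurve X d c \<longleftrightarrow> 0 < d & plot G UNIV {-d<..<d} c & c 0 = \<one> &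
   (ALL t. \<bar>t\<bar> < d --> gvel (%s. inv (c t) \<otimes> c (t + s)) X)"

lemma intcurveD:
 assumes "intcurve X d c"
 shows "0 < d" "plot G UNIV {-d<..<d} c" "c 0 = \<one>" "\<bar>t\<bar> < d ==> gvel (%s. inv (c t) \<otimes> c (t + s)) X"
 using assms unfolding intcurve_def by blast+

lemma intcurve_carrier: "intcurve X d c ==> \<bar>t\<bar> < d ==> c t:carrier G"
 by (auto simp: intcurve_def abs_less_iff intro!: plotD(4))

lemma intcurve_gvel: "intcurve X d c ==> gvel c X"
proof -
 assume c: "intcurve X d c"
 show ?thesis
 proof (rule gvel_transform)
  show "gvel (%s. inv (c 0) \<otimes> c (0 + s)) X" "0 < d"
   using intcurveD(4)[OF c, of 0] intcurveD(1)[OF c] by simp_all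
  show "c t = inv (c 0) \<otimes> c (0 + t)" if "\<bar>t\<bar> < d" for t
   using c intcurve_carrier[OF c that] by (simp add: intcurve_def)
 qed
qed

lemma intcurve_exists:
 assumes X: "X:model G" shows "EX d c. intcurve X d c"
proof -
 let ?g = "curve_at_one G X" and ?W = "ch ` U1"
 have g: "gvel ?g X" by (rule gvel_curve[OF X])
 obtain e where e: "0 < e" "plot G UNIV {-e<..<e} ?g" using g by (auto simp: gvel_def)
 have g0: "?g 0 = \<one>" using g by (simp add: gvel_def)
 have gc: "?g t:carrier G" if "\<bar>t\<bar> < e" for t using plotD(4)[OF e(2), of t] that by (auto simp: abs_less_iff)
 have V2: "subspace (model G \<times> (UNIV :: real set))" "opn (model G \<times> UNIV) (?W \<times> {-e<..<e})"
  by (auto intro!: subspace_Times model openin_Times th(5))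
 have q: "plot G (model G \<times> UNIV) (?W \<times> {-e<..<e}) (%z. th (fst z) \<otimes> ?g (snd z))"
  by (intro plot_mult plot_compose[OF th(4) V2 smooth_on_linear] plot_compose[OF e(2) V2 smooth_on_linear])
   (auto intro: bounded_linear_fst bounded_linear_snd)
 have q0: "th (fst (u, 0)) \<otimes> ?g (snd (u, 0 :: real)):U1" if "u:?W" for u
  using th(3)[OF that] U1_carrier g0 by simp
 obtain F where F: "smooth_on (model G) ?W F"
  "!!u. u:?W ==> ((%t. ch (th (fst (u, t)) \<otimes> ?g (snd (u, t)))) hvd F u) (at 0)"
  by (rule smooth_velocity[OF q model th(5) chart1 e(1) q0], assumption, rule that)
 have FV: "F u:model G" if u: "u:?W" for u
 proof (rule derivative_in_subspace[OF F(2)[OF u] _ model])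
  have "plot G UNIV {-e<..<e} (%t. th u \<otimes> ?g t)"
   by (intro plot_mult e(2) plot_const) (use th(3)[OF u] U1_carrier in auto)
  from opn_line[OF plotD(5)[OF this chart1]] obtain d where d: "0 < d" "{-d<..<d} <= {t:{-e<..<e}. th u \<otimes> ?g t:U1}"
   using e(1) th(3)[OF u] U1_carrier g0 by auto
  then show "\<forall>\<^sub>F t in at 0. ch (th (fst (u, t)) \<otimes> ?g (snd (u, t))):model G"
   using th(8) by (auto simp: eventually_at dist_real_def image_subset_iff subset_iff abs_less_iff intro!: exI[of _ d])
  show "ch (th (fst (u, 0)) \<otimes> ?g (snd (u, 0))):model G"
   using th(3)[OF u] U1_carrier g0 th(8) by auto
 qed
 obtain d u where d: "0 < d" and u: "u 0 = ch \<one>" "!!t. \<bar>t\<bar> < d ==> u t:?W"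
  "!!t. \<bar>t\<bar> < d ==> (u hvd F (u t)) (at t)" "smooth_on UNIV {-d<..<d} u"
  using flow_exists[OF model th(5) F(1) _ th(6)] FV by (metis image_subsetI)
 define c where "c t = th (u t)" for t
 have pc: "plot G UNIV {-d<..<d} c"
  unfolding c_def by (rule plot_compose[OF th(4) _ opn_ball u(4)]) (use u(2) in auto)
 have cU: "c t:U1" if "\<bar>t\<bar> < d" for t using th(3)[OF u(2)[OF that]] by (simp add: c_def)
 have "gvel (%s. inv (c t) \<otimes> c (t + s)) X" if t: "\<bar>t\<bar> < d" for t
 proof -
  have ct: "c t:carrier G" using cU[OF t] U1_carrier by blast
  have p: "plot G (model G) ?W (%v. inv (c t) \<otimes> th v)"
   by (intro plot_mult th(4) plot_const model th(5)) (use ct in auto)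
  let ?T = "{v:?W. inv (c t) \<otimes> th v:U1}"
  have T: "opn (model G) ?T" and s: "smooth_on (model G) ?T (%v. ch (inv (c t) \<otimes> th v))" using plotD(5,6)[OF p chart1] by auto
  obtain K' where K': "!!v. v:?T ==> ((%v. ch (inv (c t) \<otimes> th v)) has_derivative K' v) (at v within ?T)"
   by (rule smooth_on_derivative[OF model T s]) blast
  have o: "u t:?T" using u(2)[OF t] ct one_U1 by (simp add: c_def[symmetric])
  define r where "r = d - \<bar>t\<bar>"
  have r: "0 < r" "!!s. \<bar>s\<bar> < r ==> \<bar>t + s\<bar> < d" using t by (auto simp: r_def)
  have ps: "plot G UNIV {-r<..<r} (%s. c (t + s))"
   by (rule plot_compose[OF pc _ opn_ball])
   (auto intro!: smooth_on_add smooth_on_const smooth_on_id simp: r_def)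
  then have pl: "plot G UNIV {-r<..<r} (%s. inv (c t) \<otimes> c (t + s))" by (intro plot_mult plot_const) (use ct in auto)
  obtain r1 where r1: "0 < r1" "{-r1<..<r1} <= {s:{-r<..<r}. inv (c t) \<otimes> c (t + s):U1}"
   using opn_line[OF plotD(5)[OF pl chart1]] r(1) ct one_U1 by auto
  have v1: "((%s. ch (inv (c t) \<otimes> th (u (t + s)))) hvd K' (u t) (F (u t))) (at 0)"
  proof (rule vector_derivative_chain[where F = "%v. ch (inv (c t) \<otimes> th v)" and F' = "K' (u t)" and X = "F (u t)" and u = "%s. u (t + s)" and T = ?T])
   show "((%v. ch (inv (c t) \<otimes> th v)) has_derivative K' (u t)) (at (u (t + 0)) within ?T)" using K'[OF o] by simp
   show "((%s. u (t + s)) hvd F (u t)) (at 0)"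
   using vector_derivative_shift[of u t "F (u t)"] u(3)[OF t] by simp
   have "u (t + s):?T" if "dist s 0 < r1" for s
   proof -
   have "s:{-r1<..<r1}" using that by (auto simp: dist_real_def)
   then have "s:{-r<..<r}" "inv (c t) \<otimes> c (t + s):U1" using r1(2) by auto
   then show ?thesis using u(2)[OF r(2)[of s]] by (auto simp: c_def)
   qed
   then show "\<forall>\<^sub>F s in at 0. u (t + s):?T" using r1(1) by (auto simp: eventually_at intro!: exI[of _ r1])
  qed
  have pg: "plot G UNIV {-e<..<e} (%s. c t \<otimes> ?g s)" by (intro plot_mult e(2) plot_const) (use ct in auto)
  obtain r2 where r2: "0 < r2" "{-r2<..<r2} <= {s:{-e<..<e}. c t \<otimes> ?g s:U1}"
   using opn_line[OF plotD(5)[OF pg chart1]] e(1) ct cU[OF t] g0 by auto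
  obtain r3 where r3: "0 < r3" "{-r3<..<r3} <= {s:{-e<..<e}. ?g s:U1}"
   using opn_line[OF plotD(5)[OF e(2) chart1]] e(1) g0 one_U1 by auto
  \<comment> \<open>The value of \<open>K' (u t)\<close> on the field is computed a second time,
    along the curve \<open>c t \<otimes> ?g s\<close>; left translation turns this curve into
    \<open>?g s\<close>, so the value is \<open>X\<close>.\<close>
  have v2: "((%s. ch (inv (c t) \<otimes> th (ch (c t \<otimes> ?g s)))) hvd K' (u t) (F (u t))) (at 0)"
  proof (rule vector_derivative_chain[where F = "%v. ch (inv (c t) \<otimes> th v)" and F' = "K' (u t)" and X = "F (u t)" and u = "%s. ch (c t \<otimes> ?g s)" and T = ?T])
   have "ch (c t \<otimes> ?g 0) = u t" using ct g0 th(2)[OF u(2)[OF t]] by (simp add: c_def)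
   then show "((%v. ch (inv (c t) \<otimes> th v)) has_derivative K' (u t)) (at (ch (c t \<otimes> ?g 0)) within ?T)" using K'[OF o] by simp
   show "((%s. ch (c t \<otimes> ?g s)) hvd F (u t)) (at 0)" using F(2)[OF u(2)[OF t]] by (simp add: c_def)
   have "ch (c t \<otimes> ?g s):?T" if "dist s 0 < min r2 r3" for s
   proof -
   have "s:{-r2<..<r2}" "s:{-r3<..<r3}" using that by (auto simp: dist_real_def)
   then have "c t \<otimes> ?g s:U1" "?g s:U1" using r2(2) r3(2) by auto
   then show ?thesis using ct U1_carrier by (auto simp: th(1) m_assoc[symmetric])
   qed
   then show "\<forall>\<^sub>F s in at 0. ch (c t \<otimes> ?g s):?T" using r2(1) r3(1) by (auto simp: eventually_at intro!: exI[of _ "min r2 r3"])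
  qed
  have "((%s. ch (?g s)) hvd K' (u t) (F (u t))) (at 0)"
  proof (rule hvd_transform[OF v2, of "{-r2<..<r2}"])
   fix s assume "s:{-r2<..<r2}"
   then have "c t \<otimes> ?g s:U1" "\<bar>s\<bar> < e" using r2(2) by (auto simp: abs_less_iff)
   then show "ch (inv (c t) \<otimes> th (ch (c t \<otimes> ?g s))) = ch (?g s)" using ct gc by (simp add: th(1) m_assoc[symmetric])
  qed (use r2(1) in auto)
  then have "K' (u t) (F (u t)) = X" using g by (auto simp: gvel_def intro: vector_derivative_unique_at)
  then show ?thesis using v1 pl r(1) ct by (auto simp: gvel_def c_def)
 qed
 then have "intcurve X d c" using d pc th(1)[OF one_U1] by (auto simp: intcurve_def c_def u(1))
 then show ?thesis by blast
qed

lemma intcurve_Ad: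
 assumes c: "intcurve X d c" and t: "\<bar>t\<bar> < d" and Y: "Y:model G"
 shows "((%t. Ad G (c t) Y) hvd Ad G (c t) (br X Y)) (at t)"
proof -
 have ct: "c t:carrier G" by (rule intcurve_carrier[OF c t])
 have g: "gvel (%s. inv (c t) \<otimes> c (t + s)) X" using c t by (simp add: intcurve_def)
 have X: "X:model G" by (rule gvel_model[OF g])
 define r where "r = d - \<bar>t\<bar>"
 have r: "0 < r" "!!s. \<bar>s\<bar> < r ==> \<bar>t + s\<bar> < d" using t by (auto simp: r_def)
 have cs: "c (t + s):carrier G" if "\<bar>s\<bar> < r" for s by (rule intcurve_carrier[OF c r(2)[OF that]])
 have "((%s. Ad G (c t) (Ad G (inv (c t) \<otimes> c (t + s)) Y)) hvd Ad G (c t) (br X Y)) (at 0)"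
  by (rule Ad_linear_derivative[OF ct _ r(1)])
   (use Ad_derivative[OF g Y] cs ct X Y in "auto simp: br_eq Ad_model bracket_model dist_real_def")
 then have "((%s. Ad G (c (t + s)) Y) hvd Ad G (c t) (br X Y)) (at 0)"
 proof (rule hvd_transform[of _ _ _ "{-r<..<r}"])
  fix s assume "s:{-r<..<r}"
  then have "c (t + s):carrier G" using cs by auto
  then show "Ad G (c t) (Ad G (inv (c t) \<otimes> c (t + s)) Y) = Ad G (c (t + s)) Y"
   using Ad_mult[of "c t" "inv (c t) \<otimes> c (t + s)" Y] ct Y by (simp add: m_assoc[symmetric])
 qed (use r in auto)
 then show ?thesis using vector_derivative_shift[of "%s. Ad G (c s) Y"] by simp
qed
end

lemma intcurve_map:
 assumes "lie G" "lie K" and f: "smooth_map G K f" "f:hom G K" and c: "lie.intcurve G X d c"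
 shows "lie.intcurve K (diff_at_one G K f X) d (%t. f (c t))"
proof -
 interpret G: lie G by fact
 interpret K: lie K by fact
 interpret h: group_hom G K f using f(2) G.group_axioms K.group_axioms by (simp add: group_hom_defs)
 obtain A where A: "linear A" "!!c X. lie.gvel G c X ==> lie.gvel K (%t. f (c t)) (A X)"
  "!!X. X:model G ==> diff_at_one G K f X = A X"
  by (rule gvel_map[OF assms(1,2) f(1) h.hom_one]) blast
 have X: "X:model G" using G.gvel_model[OF G.intcurve_gvel[OF c]] .
 show ?thesis
  unfolding K.intcurve_def
 proof (intro conjI allI impI)
  show "0 < d" "f (c 0) = \<one>\<^bsub>K\<^esub>" using c by (auto simp: G.intcurve_def h.hom_one)
  show "plot K UNIV {-d<..<d} (%t. f (c t))"
   using c plot_smooth_map[OF G.M K.M f(1)] by (auto simp: G.intcurve_def)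
  fix t assume t: "\<bar>t\<bar> < d"
  have ct: "c t:carrier G" by (rule G.intcurve_carrier[OF c t])
  have g: "G.gvel (%s. inv\<^bsub>G\<^esub> (c t) \<otimes>\<^bsub>G\<^esub> c (t + s)) X" using c t by (simp add: G.intcurve_def)
  show "K.gvel (%s. inv\<^bsub>K\<^esub> (f (c t)) \<otimes>\<^bsub>K\<^esub> f (c (t + s))) (diff_at_one G K f X)"
  proof (rule K.gvel_transform)
   show "K.gvel (%s. f (inv\<^bsub>G\<^esub> (c t) \<otimes>\<^bsub>G\<^esub> c (t + s))) (diff_at_one G K f X)" using A(2)[OF g] A(3)[OF X] by simp
   show "0 < d - \<bar>t\<bar>" using t by simp
   fix s assume "\<bar>s\<bar> < d - \<bar>t\<bar>"
   then have "c (t + s):carrier G" by (intro G.intcurve_carrier[OF c]) auto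
   then show "inv\<^bsub>K\<^esub> (f (c t)) \<otimes>\<^bsub>K\<^esub> f (c (t + s)) = f (inv\<^bsub>G\<^esub> (c t) \<otimes>\<^bsub>G\<^esub> c (t + s))" using ct by simp
  qed
 qed
qed

section \<open>Extension of local homomorphisms\<close>

lemma (in lie) continuous_mult:
 assumes "continuous_map X (topo G) f" "continuous_map X (topo G) g"
 shows "continuous_map X (topo G) (%x. f x \<otimes> g x)"
proof -
 have "continuous_map (prod_topology (topo G) (topo G)) (topo G) (%(x, y). x \<otimes> y)"
  using lie by (simp add: lie_group_def smooth_map_def lie_prod_def)
 from continuous_map_compose[OF continuous_map_pairedI[OF assms] this] show ?thesis by (simp add: o_def)
qed

lemma (in lie) continuous_inv: "continuous_map X (topo G) f ==> continuous_map X (topo G) (%x. inv (f x))"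
 using continuous_map_compose[of X "topo G" f "topo G" "%x. inv x"] lie by (simp add: lie_group_def smooth_map_def o_def)

lemma (in lie) continuous_carrier: "continuous_map X (topo G) f ==> x:topspace X ==> f x:carrier G"
 using continuous_map_image_subset_topspace[of X "topo G" f] topspace by auto

lemma (in lie) continuous_id: "continuous_map (topo G) (topo G) (%x. x)"
 using continuous_map_id by (simp add: id_def)

lemma (in lie) open_translate:
 assumes "openin (topo G) W" "g:carrier G" shows "openin (topo G) {x:carrier G. g \<otimes> x:W}"
 using openin_continuous_map_preimage[OF continuous_mult[OF continuous_map_const[THEN iffD2] continuous_id] assms(1), of g] assms(2)
 by (simp add: topspace)

text \<open>\<open>N\<close> and its complement are both open, being unions of translates of
  \<open>W\<close> and of its inverse; connectedness does the rest.\<close>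

lemma (in lie) generated_by_neighborhood:
 assumes con: "connected_space (topo G)" and W: "openin (topo G) W" "\<one>:W"
  and N: "N <= carrier G" "\<one>:N" "!!x w. x:N ==> w:W ==> x \<otimes> w:N"
 shows "N = carrier G"
proof -
 have Wc: "W <= carrier G" using openin_subset[OF W(1)] topspace by simp
 have "openin (topo G) N"
 proof (subst openin_subopen, intro ballI)
  fix g assume g: "g:N"
  then have gc: "g:carrier G" using N(1) by blast
  have "{x:carrier G. inv g \<otimes> x:W} <= N"
  proof
   fix x assume "x:{x:carrier G. inv g \<otimes> x:W}"
   then show "x:N" using N(3)[OF g, of "inv g \<otimes> x"] gc by (simp add: m_assoc[symmetric])
  qed
  then show "EX T. openin (topo G) T & g:T & T <= N"
   using open_translate[OF W(1), of "inv g"] gc W(2) by (intro exI[of _ "{x:carrier G. inv g \<otimes> x:W}"]) auto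
 qed
 moreover have "openin (topo G) (carrier G - N)"
 proof (subst openin_subopen, intro ballI)
  fix g assume g: "g:carrier G - N"
  let ?T = "{x:carrier G. inv x \<otimes> g:W}"
  have "openin (topo G) ?T"
   using openin_continuous_map_preimage[OF continuous_mult[OF continuous_inv[OF continuous_id] continuous_map_const[THEN iffD2]] W(1), of g] g
   by (simp add: topspace)
  moreover have "?T <= carrier G - N"
  proof
   fix x assume x: "x:?T"
   have "x \<otimes> (inv x \<otimes> g) = g" using x g by (simp add: m_assoc[symmetric])
   then show "x:carrier G - N" using N(3)[of x "inv x \<otimes> g"] x g by auto
  qed
  ultimately show "EX T. openin (topo G) T & g:T & T <= carrier G - N" using g W(2) by (intro exI[of _ ?T]) auto
 qed
 ultimately show ?thesis
  using con N(1,2) unfolding connected_space_clopen_in closedin_def by (auto simp: topspace)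
qed

text \<open>A local homomorphism \<open>\<pi>\<close> is extended by lifting paths \<open>p\<close> from the identity to curves
 \<open>q\<close> with \<open>q t = q s \<otimes> \<pi> (p s\<inverse> \<otimes> p t)\<close> for nearby times; the lift of a loop ends where it
 started, because the set of loops with this property is open and closed along a homotopy.\<close>

locale local_hom = lie G + K: group K
 for G :: "('a, 'v::euclidean_space) lie_structure" (structure) and K :: "('b, 'c) monoid_scheme" and W :: "'a set" and \<pi> :: "'a => 'b" +
 assumes W: "openin (topo G) W" "\<one>:W"
  and W_path: "!!w. w:W ==> EX gm. pathin (topo G) gm & gm 0 = \<one> & gm 1 = w & (ALL t:{0..1}. gm t:W)"
  and \<pi>_carrier: "!!w. w:W ==> \<pi> w:carrier K"
  and \<pi>_mult: "!!v w. v:W ==> w:W ==> \<pi> (v \<otimes> w) = \<pi> v \<otimes>\<^bsub>K\<^esub> \<pi> w"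
begin

lemma \<pi>_one: "\<pi> \<one> = \<one>\<^bsub>K\<^esub>"
 using \<pi>_mult[OF W(2) W(2)] \<pi>_carrier[OF W(2)] K.r_cancel_one'[of "\<pi> \<one>" "\<pi> \<one>"] by simp

definition lift :: "(real => 'a) => (real => 'b) => bool" where
 "lift p q \<longleftrightarrow> pathin (topo G) p & (ALL t:{0..1}. q t:carrier K) &
   (ALL s:{0..1}. EX d>0. ALL t:{0..1}. \<bar>t - s\<bar> < d --> q t = q s \<otimes>\<^bsub>K\<^esub> \<pi> (inv (p s) \<otimes> p t))"

lemma liftD:
 assumes "lift p q" "s:{0..1}"
 obtains d where "d > 0" "ALL t:{0..1}. \<bar>t - s\<bar> < d --> q t = q s \<otimes>\<^bsub>K\<^esub> \<pi> (inv (p s) \<otimes> p t)"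
 using assms unfolding lift_def by meson

lemma path_carrier: "pathin (topo G) p ==> t:{0..1} ==> p t:carrier G"
 unfolding pathin_def by (rule continuous_carrier) auto

lemma path_close:
 assumes p: "pathin (topo G) p" and s: "s:{0..1}"
 shows "EX d>0. ALL t:{0..1}. \<bar>t - s\<bar> < d --> inv (p s) \<otimes> p t:W"
proof -
 have pc: "p s:carrier G" by (rule path_carrier[OF p s])
 have "openin (top_of_set {0..1}) {t:topspace (top_of_set {0..1}). inv (p s) \<otimes> p t:W}"
  by (intro openin_continuous_map_preimage[OF _ W(1)] continuous_mult continuous_map_const[THEN iffD2] p[unfolded pathin_def])
   (simp add: topspace pc)
 then have o: "openin (top_of_set {0..1}) {t:{0..1}. inv (p s) \<otimes> p t:W}" by simp
 have "s:{t:{0..1}. inv (p s) \<otimes> p t:W}" using s pc W(2) by simp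
 from o[unfolded openin_euclidean_subtopology_iff, THEN conjunct2, rule_format, OF this]
 show ?thesis by (auto simp: dist_real_def)
qed

text \<open>Pairs of endpoints of lifted paths that start at the identities; this turns out to be
  the graph of the extension.\<close>

definition Gm where
 "Gm = {(p 1, q 1) |p q. lift p q & p 0 = \<one> & q 0 = \<one>\<^bsub>K\<^esub>}"

lemma Gm_W: assumes "w:W" shows "(w, \<pi> w):Gm"
proof -
 obtain gm where g: "pathin (topo G) gm" "gm 0 = \<one>" "gm 1 = w" "!!t. t:{0..1} ==> gm t:W" using W_path[OF assms] by blast
 have "lift gm (%t. \<pi> (gm t))"
  unfolding lift_def
 proof (intro conjI ballI g(1) \<pi>_carrier g(4))
  fix s :: real assume s: "s:{0..1}"
  obtain d where d: "d > 0" "ALL t:{0..1}. \<bar>t - s\<bar> < d --> inv (gm s) \<otimes> gm t:W" using path_close[OF g(1) s] by blast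
  have "\<pi> (gm t) = \<pi> (gm s) \<otimes>\<^bsub>K\<^esub> \<pi> (inv (gm s) \<otimes> gm t)" if t: "t:{0..1}" "\<bar>t - s\<bar> < d" for t
  proof -
   have "inv (gm s) \<otimes> gm t:W" using d(2) t by blast
   from \<pi>_mult[OF g(4)[OF s] this] show ?thesis
   using path_carrier[OF g(1)] s t by (simp add: m_assoc[symmetric])
  qed
  with d(1) show "EX d>0. ALL t:{0..1}. \<bar>t - s\<bar> < d --> \<pi> (gm t) = \<pi> (gm s) \<otimes>\<^bsub>K\<^esub> \<pi> (inv (gm s) \<otimes> gm t)" by blast
 qed
 then show ?thesis using g \<pi>_one unfolding Gm_def by (intro CollectI exI[of _ gm] exI[of _ "%t. \<pi> (gm t)"]) simp
qed

text \<open>The second path is translated by the endpoint of the first and appended; the translate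
  of a lift is a lift of the translate.\<close>

lemma Gm_mult:
 assumes "(g, k):Gm" "(g', k'):Gm" shows "(g \<otimes> g', k \<otimes>\<^bsub>K\<^esub> k'):Gm"
proof -
 obtain p q where l: "lift p q" and p: "p 0 = \<one>" "q 0 = \<one>\<^bsub>K\<^esub>" "p 1 = g" "q 1 = k" using assms(1) by (auto simp: Gm_def)
 obtain p' q' where l': "lift p' q'" and p': "p' 0 = \<one>" "q' 0 = \<one>\<^bsub>K\<^esub>" "p' 1 = g'" "q' 1 = k'" using assms(2) by (auto simp: Gm_def)
 have pp: "pathin (topo G) p" "pathin (topo G) p'" using l l' by (auto simp: lift_def)
 have c: "p t:carrier G" "p' t:carrier G" "q t:carrier K" "q' t:carrier K" if "t:{0..1}" for t
  using that path_carrier[OF pp(1)] path_carrier[OF pp(2)] l l' by (auto simp: lift_def)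
 have gk: "g:carrier G" "k:carrier K" using c(1,3)[of 1] p by auto
 define P where "P t = (if t <= 1/2 then p (2 * t) else g \<otimes> p' (2 * t - 1))" for t
 define Q where "Q t = (if t <= 1/2 then q (2 * t) else k \<otimes>\<^bsub>K\<^esub> q' (2 * t - 1))" for t
 have P2: "P t = g \<otimes> p' (2 * t - 1)" "Q t = k \<otimes>\<^bsub>K\<^esub> q' (2 * t - 1)" if "t >= 1/2" for t
 proof -
  have "P t = g \<otimes> p' (2 * t - 1) & Q t = k \<otimes>\<^bsub>K\<^esub> q' (2 * t - 1)"
  proof (cases "t = 1/2")
   case True
   then show ?thesis unfolding P_def Q_def True using p p' gk by simp
  next
   case False
   then show ?thesis using that by (simp add: P_def Q_def)
  qed
  then show "P t = g \<otimes> p' (2 * t - 1)" "Q t = k \<otimes>\<^bsub>K\<^esub> q' (2 * t - 1)" by blast+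
 qed
 have "lift P Q"
  unfolding lift_def
 proof (intro conjI ballI)
  have "continuous_map (top_of_set {0..1}) (topo G) P"
   unfolding P_def
  proof (rule continuous_map_cases_le)
   have "continuous_map (subtopology (top_of_set {0..1}) {x:topspace (top_of_set {0..1}). x <= 1/2}) (top_of_set {0..1}) (%t::real. 2 * t)"
   by (auto simp: subtopology_subtopology intro!: continuous_intros)
   from continuous_map_compose[OF this pp(1)[unfolded pathin_def]]
   show "continuous_map (subtopology (top_of_set {0..1}) {x:topspace (top_of_set {0..1}). x <= 1/2}) (topo G) (%t. p (2 * t))" unfolding o_def .
   have "continuous_map (subtopology (top_of_set {0..1}) {x:topspace (top_of_set {0..1}). 1/2 <= x}) (top_of_set {0..1}) (%t::real. 2 * t - 1)"
   by (auto simp: subtopology_subtopology intro!: continuous_intros)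
   from continuous_map_compose[OF this pp(2)[unfolded pathin_def]]
   have "continuous_map (subtopology (top_of_set {0..1}) {x:topspace (top_of_set {0..1}). 1/2 <= x}) (topo G) (%t. p' (2 * t - 1))" unfolding o_def .
   then show "continuous_map (subtopology (top_of_set {0..1}) {x:topspace (top_of_set {0..1}). 1/2 <= x}) (topo G) (%t. g \<otimes> p' (2 * t - 1))"
   by (intro continuous_mult) (auto simp: topspace gk)
   show "p (2 * t) = g \<otimes> p' (2 * t - 1)" if "t:topspace (top_of_set {0..1})" "t = 1/2" for t
   unfolding that(2) using p p' gk by simp
  qed (auto intro!: continuous_intros)
  then show "pathin (topo G) P" by (simp add: pathin_def)
  show "Q t:carrier K" if "t:{0..1}" for t using that c gk by (auto simp: Q_def)
  fix s :: real assume s: "s:{0..1}"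
  \<comment> \<open>The two halves are treated separately, with a vacuous neighbourhood for the half
    that does not contain \<open>s\<close>; at the junction both are effective.\<close>
  have 1: "EX d>0. ALL t:{0..1}. \<bar>t - s\<bar> < d & t <= 1/2 --> Q t = Q s \<otimes>\<^bsub>K\<^esub> \<pi> (inv (P s) \<otimes> P t)"
  proof (cases "s <= 1/2")
   case True
   then have s2: "2 * s:{0..1}" using s by auto
   obtain d where d: "d > 0" "ALL t:{0..1}. \<bar>t - 2 * s\<bar> < d --> q t = q (2 * s) \<otimes>\<^bsub>K\<^esub> \<pi> (inv (p (2 * s)) \<otimes> p t)"
   by (rule liftD[OF l s2])
   have "Q t = Q s \<otimes>\<^bsub>K\<^esub> \<pi> (inv (P s) \<otimes> P t)" if "t:{0..1}" "\<bar>t - s\<bar> < d / 2" "t <= 1/2" for t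
   proof -
   have "\<bar>2 * t - 2 * s\<bar> < d" using that(2) by arith
   moreover have "2 * t:{0..1}" using that by simp
   ultimately show ?thesis using d(2) that(3) True unfolding P_def Q_def by simp
   qed
   then show ?thesis using d(1) by (intro exI[of _ "d / 2"]) auto
  next
   case False
   then show ?thesis by (intro exI[of _ "s - 1/2"]) auto
  qed
  have 2: "EX d>0. ALL t:{0..1}. \<bar>t - s\<bar> < d & t >= 1/2 --> Q t = Q s \<otimes>\<^bsub>K\<^esub> \<pi> (inv (P s) \<otimes> P t)"
  proof (cases "s >= 1/2")
   case True
   then have s2: "2 * s - 1:{0..1}" using s by auto
   have cs: "p' (2 * s - 1):carrier G" "q' (2 * s - 1):carrier K" using c(2,4)[OF s2] by auto
   obtain d where d: "d > 0" "ALL t:{0..1}. \<bar>t - (2 * s - 1)\<bar> < d --> q' t = q' (2 * s - 1) \<otimes>\<^bsub>K\<^esub> \<pi> (inv (p' (2 * s - 1)) \<otimes> p' t)"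
   by (rule liftD[OF l' s2])
   obtain e where e: "e > 0" "ALL t:{0..1}. \<bar>t - (2 * s - 1)\<bar> < e --> inv (p' (2 * s - 1)) \<otimes> p' t:W"
   using path_close[OF pp(2) s2] by blast
   have "Q t = Q s \<otimes>\<^bsub>K\<^esub> \<pi> (inv (P s) \<otimes> P t)" if t: "t:{0..1}" "\<bar>t - s\<bar> < min d e / 2" "t >= 1/2" for t
   proof -
   have m: "\<bar>t - s\<bar> < d / 2" "\<bar>t - s\<bar> < e / 2" using t(2) by auto
   have t2: "2 * t - 1:{0..1}" using t by simp
   have t3: "\<bar>2 * t - 1 - (2 * s - 1)\<bar> < d" "\<bar>2 * t - 1 - (2 * s - 1)\<bar> < e" using m by arith+
   let ?x = "inv (p' (2 * s - 1)) \<otimes> p' (2 * t - 1)"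
   have x: "\<pi> ?x:carrier K" using e(2) t2 t3(2) \<pi>_carrier by blast
   have "inv (P s) \<otimes> P t = ?x"
   using gk cs(1) c(2)[OF t2] by (simp add: P2[OF True] P2[OF t(3)] inv_mult_group m_assoc) (simp add: m_assoc[symmetric])
   then show ?thesis using d(2)[rule_format, OF t2 t3(1)] x gk cs by (simp add: P2[OF True] P2[OF t(3)] K.m_assoc)
   qed
   then show ?thesis using d(1) e(1) by (intro exI[of _ "min d e / 2"]) auto
  next
   case False
   then show ?thesis by (intro exI[of _ "1/2 - s"]) auto
  qed
  from 1 obtain d1 where d1: "d1 > 0" "ALL t:{0..1}. \<bar>t - s\<bar> < d1 & t <= 1/2 --> Q t = Q s \<otimes>\<^bsub>K\<^esub> \<pi> (inv (P s) \<otimes> P t)" by blast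
  from 2 obtain d2 where d2: "d2 > 0" "ALL t:{0..1}. \<bar>t - s\<bar> < d2 & t >= 1/2 --> Q t = Q s \<otimes>\<^bsub>K\<^esub> \<pi> (inv (P s) \<otimes> P t)" by blast
  have "Q t = Q s \<otimes>\<^bsub>K\<^esub> \<pi> (inv (P s) \<otimes> P t)" if "t:{0..1}" "\<bar>t - s\<bar> < min d1 d2" for t
   using d1(2) d2(2) that by (cases "t <= 1/2") auto
  then show "EX d>0. ALL t:{0..1}. \<bar>t - s\<bar> < d --> Q t = Q s \<otimes>\<^bsub>K\<^esub> \<pi> (inv (P s) \<otimes> P t)"
   using d1(1) d2(1) by (intro exI[of _ "min d1 d2"]) auto
 qed
 moreover have "P 0 = \<one>" "Q 0 = \<one>\<^bsub>K\<^esub>" "P 1 = g \<otimes> g'" "Q 1 = k \<otimes>\<^bsub>K\<^esub> k'" using p p' by (auto simp: P_def Q_def)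
 ultimately show ?thesis unfolding Gm_def by (intro CollectI exI[of _ P] exI[of _ Q]) simp
qed

definition closes where
 "closes p \<longleftrightarrow> (EX q. lift p q & q 0 = \<one>\<^bsub>K\<^esub> & q 1 = \<one>\<^bsub>K\<^esub>)"

text \<open>The lift of the nearby loop is the old one corrected by
  \<open>\<pi> (inv (p t) \<otimes> p' t)\<close>. As both paths are loops, this factor agrees at
  the two ends and is cancelled by \<open>u\<close>; the base point may move.\<close>

lemma closes_transfer:
 assumes "closes p" and p': "pathin (topo G) p'" and loop: "p 1 = p 0" "p' 1 = p' 0"
  and near: "!!t. t:{0..1} ==> inv (p t) \<otimes> p' t:W"
 shows "closes p'"
proof -
 obtain q where l: "lift p q" and q: "q 0 = \<one>\<^bsub>K\<^esub>" "q 1 = \<one>\<^bsub>K\<^esub>" using assms(1) by (auto simp: closes_def)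
 have p: "pathin (topo G) p" and qc: "q t:carrier K" if "t:{0..1}" for t using l that by (auto simp: lift_def)
 have p: "pathin (topo G) p" using l by (simp add: lift_def)
 define n where "n t = \<pi> (inv (p t) \<otimes> p' t)" for t
 have n: "n t:carrier K" if "t:{0..1}" for t unfolding n_def by (rule \<pi>_carrier[OF near[OF that]])
 define u where "u = inv\<^bsub>K\<^esub> (n 0)"
 have u: "u:carrier K" "u \<otimes>\<^bsub>K\<^esub> n 0 = \<one>\<^bsub>K\<^esub>" using n[of 0] by (auto simp: u_def)
 define q' where "q' t = u \<otimes>\<^bsub>K\<^esub> (q t \<otimes>\<^bsub>K\<^esub> n t)" for t
 have "lift p' q'"
  unfolding lift_def
 proof (intro conjI ballI p')
  show "q' t:carrier K" if "t:{0..1}" for t using u(1) qc[OF that] n[OF that] by (simp add: q'_def)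
  fix s :: real assume s: "s:{0..1}"
  obtain d where d: "d > 0" "ALL t:{0..1}. \<bar>t - s\<bar> < d --> q t = q s \<otimes>\<^bsub>K\<^esub> \<pi> (inv (p s) \<otimes> p t)" by (rule liftD[OF l s])
  obtain e where e: "e > 0" "ALL t:{0..1}. \<bar>t - s\<bar> < e --> inv (p s) \<otimes> p t:W" using path_close[OF p s] by blast
  obtain e' where e': "e' > 0" "ALL t:{0..1}. \<bar>t - s\<bar> < e' --> inv (p' s) \<otimes> p' t:W" using path_close[OF p' s] by blast
  have "q' t = q' s \<otimes>\<^bsub>K\<^esub> \<pi> (inv (p' s) \<otimes> p' t)" if t: "t:{0..1}" "\<bar>t - s\<bar> < min d (min e e')" for t
  proof -
   have a: "inv (p s) \<otimes> p t:W" "inv (p' s) \<otimes> p' t:W" using e(2) e'(2) t by auto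
   have c: "p s:carrier G" "p t:carrier G" "p' s:carrier G" "p' t:carrier G"
   using path_carrier[OF p] path_carrier[OF p'] s t by auto
   have "(inv (p s) \<otimes> p t) \<otimes> (inv (p t) \<otimes> p' t) = (inv (p s) \<otimes> p' s) \<otimes> (inv (p' s) \<otimes> p' t)"
   using c by (simp add: m_assoc) (simp add: m_assoc[symmetric])
   then have "\<pi> (inv (p s) \<otimes> p t) \<otimes>\<^bsub>K\<^esub> n t = n s \<otimes>\<^bsub>K\<^esub> \<pi> (inv (p' s) \<otimes> p' t)"
   unfolding n_def using \<pi>_mult[OF a(1) near[OF t(1)]] \<pi>_mult[OF near[OF s] a(2)] by simp
   then show ?thesis
   using d(2) t u(1) qc[OF s] n[OF s] n[OF t(1)] \<pi>_carrier[OF a(1)] \<pi>_carrier[OF a(2)] by (simp add: q'_def K.m_assoc)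
  qed
  then show "EX d>0. ALL t:{0..1}. \<bar>t - s\<bar> < d --> q' t = q' s \<otimes>\<^bsub>K\<^esub> \<pi> (inv (p' s) \<otimes> p' t)"
   using d(1) e(1) e'(1) by (intro exI[of _ "min d (min e e')"]) auto
 qed
 moreover have "n 1 = n 0" using loop by (simp add: n_def)
 then have "q' 0 = \<one>\<^bsub>K\<^esub>" "q' 1 = \<one>\<^bsub>K\<^esub>" using q u n[of 0] by (auto simp: q'_def)
 ultimately show ?thesis by (auto simp: closes_def)
qed

lemma lift_unique:
 assumes l: "lift p q" "lift p q'" and 0: "q 0 = q' 0" shows "q 1 = q' 1"
proof -
 have "(q 0 = q' 0) = (q 1 = q' 1)"
 proof (rule connected_local_const[of "{0..1::real}"])
  show "ALL s:{0..1}. eventually (%t. (q s = q' s) = (q t = q' t)) (at s within {0..1})"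
  proof
   fix s :: real assume s: "s:{0..1}"
   obtain d where d: "d > 0" "ALL t:{0..1}. \<bar>t - s\<bar> < d --> q t = q s \<otimes>\<^bsub>K\<^esub> \<pi> (inv (p s) \<otimes> p t)" by (rule liftD[OF l(1) s])
   obtain d' where d': "d' > 0" "ALL t:{0..1}. \<bar>t - s\<bar> < d' --> q' t = q' s \<otimes>\<^bsub>K\<^esub> \<pi> (inv (p s) \<otimes> p t)" by (rule liftD[OF l(2) s])
   obtain e where e: "e > 0" "ALL t:{0..1}. \<bar>t - s\<bar> < e --> inv (p s) \<otimes> p t:W" using path_close[OF _ s] l(1) unfolding lift_def by metis
   have "(q s = q' s) = (q t = q' t)" if t: "t:{0..1}" "\<bar>t - s\<bar> < min d (min d' e)" for t
   proof -
   have "\<pi> (inv (p s) \<otimes> p t):carrier K" using e(2) t \<pi>_carrier by auto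
   moreover have "q s:carrier K" "q' s:carrier K" using l s by (auto simp: lift_def)
   ultimately show ?thesis using d(2) d'(2) t by simp
   qed
   then show "eventually (%t. (q s = q' s) = (q t = q' t)) (at s within {0..1})"
   using d(1) d'(1) e(1) by (auto simp: eventually_at dist_real_def intro!: exI[of _ "min d (min d' e)"])
  qed
 qed auto
 then show ?thesis using 0 by simp
qed

text \<open>Along a homotopy of loops to a constant one, \<open>closes\<close> is locally constant
  in the parameter: the tube lemma makes neighbouring loops uniformly close, and
  \<open>closes_transfer\<close> compares them.\<close>

lemma Gm_one:
 assumes sc: "simply_connected_space (topo G)" and k: "(\<one>, k):Gm" shows "k = \<one>\<^bsub>K\<^esub>"
proof -
 obtain p q where l: "lift p q" and p: "p 0 = \<one>" "p 1 = \<one>" and q: "q 0 = \<one>\<^bsub>K\<^esub>" "q 1 = k" using k by (auto simp: Gm_def)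
 have pp: "pathin (topo G) p" using l by (simp add: lift_def)
 have cc: "pathin (topo G) (%t. \<one>)" by (simp add: pathin_def topspace)
 have "homotopic_with (%r. r 1 = r 0) (top_of_set {0..1}) (topo G) p (%t. \<one>)"
  using sc pp cc p unfolding simply_connected_space_def by auto
 then obtain h :: "real \<times> real => 'a" where
  h: "continuous_map (prod_topology (top_of_set {0..1}) (top_of_set {0..1})) (topo G) h"
   "!!x. h (0, x) = p x" "!!x. h (1, x) = \<one>" "!!t. t:{0..1} ==> h (t, 1) = h (t, 0)"
  unfolding homotopic_with_def by auto
 have hp: "pathin (topo G) (%t. h (s, t))" if "s:{0..1}" for s
  unfolding pathin_def
  using continuous_map_compose[OF continuous_map_pairedI h(1), of "top_of_set {0..1}" "%t. s" "%t. t"] that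
  by (simp add: o_def continuous_map_id_subt id_def[symmetric])
 have open_near: "openin (prod_topology (top_of_set {0..1}) (top_of_set {0..1})) {z:{0..1} \<times> {0..1}. f z:W}"
  if "continuous_map (prod_topology (top_of_set {0..1}) (top_of_set {0..1})) (topo G) f" for f :: "real \<times> real => 'a"
  using openin_continuous_map_preimage[OF that W(1)] by simp
 have "closes (%t. h (0, t)) = closes (%t. h (1, t))"
 proof (rule connected_local_const[of "{0..1::real}"])
  show "ALL s:{0..1}. eventually (%s'. closes (%t. h (s, t)) = closes (%t. h (s', t))) (at s within {0..1})"
  proof
   fix s :: real assume s: "s:{0..1}"
   let ?I = "top_of_set {0..1::real}"
   have c1: "continuous_map (prod_topology ?I ?I) (topo G) (%z. h (s, snd z))"
   using continuous_map_compose[OF continuous_map_snd hp[OF s, unfolded pathin_def], of ?I] by (simp add: o_def)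
   let ?A = "{z:{0..1} \<times> {0..1}. inv (h (s, snd z)) \<otimes> h z:W} Int {z:{0..1} \<times> {0..1}. inv (h z) \<otimes> h (s, snd z):W}"
   have oA: "openin (prod_topology ?I ?I) ?A"
   by (intro openin_Int open_near continuous_mult continuous_inv c1 h(1))
   have "{s} \<times> {0..1} <= ?A"
   using s W(2) continuous_carrier[OF h(1)] by (auto simp: subset_iff)
   then obtain U V where U: "openin ?I U" "s:U" and V: "{0..1} <= V" "U \<times> V <= ?A"
   using tube_lemma_right[OF oA, of "{0..1}" s] s by (auto simp: compactin_subtopology)
   have "closes (%t. h (s, t)) = closes (%t. h (s', t))" if s': "s':U" for s'
   proof -
   have sI: "s':{0..1}" using s' openin_subset[OF U(1)] by auto
   have n: "inv (h (s, t)) \<otimes> h (s', t):W" "inv (h (s', t)) \<otimes> h (s, t):W" if "t:{0..1}" for t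
   proof -
   have "(s', t):?A" using that V s' by blast
   then show "inv (h (s, t)) \<otimes> h (s', t):W" "inv (h (s', t)) \<otimes> h (s, t):W" by auto
   qed
   show ?thesis
   using closes_transfer[of "%t. h (s, t)" "%t. h (s', t)", OF _ hp[OF sI] h(4)[OF s] h(4)[OF sI] n(1)]
   closes_transfer[of "%t. h (s', t)" "%t. h (s, t)", OF _ hp[OF s] h(4)[OF sI] h(4)[OF s] n(2)] by blast
   qed
   note eq = this
   obtain T where T: "open T" "U = {0..1} Int T" using U(1) by (auto simp: openin_open)
   show "eventually (%s'. closes (%t. h (s, t)) = closes (%t. h (s', t))) (at s within {0..1})"
   unfolding eventually_at_topological
   proof (intro exI[of _ T] conjI ballI impI)
   show "open T" "s:T" using T U(2) by auto
   show "closes (%t. h (s, t)) = closes (%t. h (s', t))" if "s':{0..1}" "s':T" for s'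
   by (rule eq) (use that T(2) in blast)
   qed
  qed
 qed auto
 moreover have "closes (%t. h (1, t))"
  unfolding closes_def lift_def using hp[of 1] h(3) \<pi>_one by (intro exI[of _ "%t. \<one>\<^bsub>K\<^esub>"]) (auto intro: exI[of _ 1])
 ultimately obtain q' where "lift p q'" "q' 0 = \<one>\<^bsub>K\<^esub>" "q' 1 = \<one>\<^bsub>K\<^esub>" using h(2) by (auto simp: closes_def)
 then show ?thesis using lift_unique[OF l] q by simp
qed

text \<open>The domain of \<open>Gm\<close> contains \<open>W\<close> and is closed under
  multiplication, so every element is reached; uniqueness is reduced to \<open>Gm_one\<close> by
  multiplying with a pair over the inverse.\<close>

theorem local_hom_extension:
 assumes sc: "simply_connected_space (topo G)"
 obtains Ps where "Ps:hom G K" "!!w. w:W ==> Ps w = \<pi> w"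
proof -
 have con: "connected_space (topo G)" using sc path_connected_imp_connected_space by (auto simp: simply_connected_space_def)
 have Gmc: "g:carrier G" "k:carrier K" if "(g, k):Gm" for g k
  using that path_carrier by (auto simp: Gm_def lift_def)
 have "fst ` Gm = carrier G"
 proof (rule generated_by_neighborhood[OF con W])
  show "\<one>:fst ` Gm" using Gm_W[OF W(2)] by force
  fix x w assume "x:fst ` Gm" "w:W"
  then show "x \<otimes> w:fst ` Gm" using Gm_mult Gm_W by force
 qed (use Gmc in auto)
 then have ex: "EX k. (g, k):Gm" if "g:carrier G" for g using that by force
 have uniq: "k = k'" if kk: "(g, k):Gm" "(g, k'):Gm" for g k k'
 proof -
  have g: "g:carrier G" by (rule Gmc[OF kk(1)])
  obtain l where l: "(inv g, l):Gm" using ex[of "inv g"] g by auto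
  have "k \<otimes>\<^bsub>K\<^esub> l = \<one>\<^bsub>K\<^esub>" "k' \<otimes>\<^bsub>K\<^esub> l = \<one>\<^bsub>K\<^esub>"
   by (rule Gm_one[OF sc]; use Gm_mult[OF kk(1) l] Gm_mult[OF kk(2) l] g in simp)+
  then show ?thesis using Gmc[OF kk(1)] Gmc[OF kk(2)] Gmc[OF l] using K.right_cancel[of l k k'] by simp
 qed
 define Ps where "Ps g = (THE k. (g, k):Gm)" for g
 have Ps: "Ps g = k" if "(g, k):Gm" for g k unfolding Ps_def using that uniq by blast
 show ?thesis
 proof
  show "Ps w = \<pi> w" if "w:W" for w by (rule Ps[OF Gm_W[OF that]])
  show "Ps:hom G K"
  proof (rule homI)
   show "Ps g:carrier K" if "g:carrier G" for g using ex[OF that] Ps Gmc by metis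
   show "Ps (g \<otimes> h) = Ps g \<otimes>\<^bsub>K\<^esub> Ps h" if "g:carrier G" "h:carrier G" for g h
   using ex[OF that(1)] ex[OF that(2)] Ps Gm_mult by metis
  qed
 qed
qed
end

section \<open>Charts of the second kind\<close>

lemma (in manifold) open_chart_preimage:
 assumes c: "(U, ph):atlas M" and T: "opn (model M) T"
 shows "openin (topo M) {x:U. ph x:T}"
proof -
 have "continuous_map (subtopology (topo M) U) (top_of_set (ph ` U)) ph"
  using chart(5)[OF c] homeomorphic_imp_continuous_map by blast
 moreover have "openin (top_of_set (ph ` U)) (T Int ph ` U)"
  using T chart(4)[OF c] by (auto simp: openin_open)
 ultimately have "openin (subtopology (topo M) U) {x:topspace (subtopology (topo M) U). ph x:T Int ph ` U}"
  by (rule openin_continuous_map_preimage)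
 moreover have "{x:topspace (subtopology (topo M) U). ph x:T Int ph ` U} = {x:U. ph x:T}"
  using chart(2)[OF c] topspace by auto
 ultimately show ?thesis using openin_trans_full chart(1)[OF c] by metis
qed

context lie
begin

lemma gvel_scale:
 assumes c: "gvel c X" shows "gvel (%t. c (s * t)) (s *\<^sub>R X)"
proof -
 obtain d where d: "0 < d" "plot G UNIV {-d<..<d} c" using c by (auto simp: gvel_def)
 define r where "r = d / (\<bar>s\<bar> + 1)"
 have r: "0 < r" using d(1) by (simp add: r_def)
 have sr: "s * t:{-d<..<d}" if "t:{-r<..<r}" for t
 proof -
  have "\<bar>t\<bar> < r" using that by (simp add: abs_less_iff)
  then have "\<bar>s * t\<bar> <= \<bar>s\<bar> * r" unfolding abs_mult by (intro mult_left_mono) auto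
  also have "... < d" using d(1) by (simp add: r_def field_simps)
  finally show ?thesis by (simp add: abs_less_iff)
 qed
 have "plot G UNIV {-r<..<r} (%t. c (s * t))"
  by (rule plot_compose[OF d(2) subspace_UNIV opn_ball smooth_on_linear[OF bounded_linear_mult_right]])
   (use sr in blast)
 moreover have "((%t. s * t) hvd s) (at 0)" by (auto intro!: derivative_eq_intros simp: has_vector_derivative_def)
 then have "((%t. ch (c (s * t))) hvd s *\<^sub>R X) (at 0)"
  using vector_diff_chain_at[of "%t. s * t" s 0 "%t. ch (c t)" X] c by (simp add: gvel_def o_def)
 ultimately show ?thesis using c r by (auto simp: gvel_def)
qed

lemma opn_model_ball: "opn (model G) (ball 0 r Int model G)"
 by (auto simp: openin_open Int_commute)

text \<open>A product of curves, one for each vector of the list, with linear functionals as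
  parameters: coordinates of the second kind. Closure of \<open>A\<close> under multiplication keeps
  all values in \<open>A\<close>, and the velocities add up.\<close>

lemma curve_product_list:
 assumes "!!e. e:set es ==> gvel (c e) e & range (c e) <= A & linear (k e)" and A: "\<one>:A" "!!x y. x:A ==> y:A ==> x \<otimes> y:A"
 shows "EX al. (EX r>0. plot G (model G) (ball 0 r Int model G) al) & (ALL x. al x:A) & (ALL x y. (ALL e:set es. k e x = (k e y :: real)) --> al x = al y) &
   al 0 = \<one> & (ALL v:model G. gvel (%t. al (t *\<^sub>R v)) (\<Sum>e\<leftarrow>es. k e v *\<^sub>R e))"
 using assms(1)
proof (induction es)
 case Nil
 have "plot G (model G) (ball 0 1 Int model G) (%x. \<one>)" by (rule plot_const[OF model opn_model_ball one_closed])
 then show ?case using A gvel_const by (intro exI[of _ "%x. \<one>"]) (auto intro!: exI[of _ "1::real"])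
next
 case (Cons e es)
 then obtain al r where r: "0 < r" "plot G (model G) (ball 0 r Int model G) al" and al: "!!x. al x:A"
   "!!x y. (ALL e:set es. k e x = k e y) ==> al x = al y" "al 0 = \<one>" "!!v. v:model G ==> gvel (%t. al (t *\<^sub>R v)) (\<Sum>e\<leftarrow>es. k e v *\<^sub>R e)"
  by (auto simp: Ball_def)
 have c: "gvel (c e) e" "range (c e) <= A" and l: "linear (k e)" using Cons.prems[of e] by auto
 have bl: "bounded_linear (k e)" using l linear_conv_bounded_linear by blast
 obtain d where d: "0 < d" "plot G UNIV {-d<..<d} (c e)" using c by (auto simp: gvel_def)
 have "continuous (at 0) (k e)" using bl by (simp add: linear_continuous_at)
 then obtain r' where r': "0 < r'" "!!x. norm x < r' ==> \<bar>k e x\<bar> < d"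
  using d(1) linear_0[OF l] unfolding continuous_at_eps_delta by (metis dist_norm diff_zero real_norm_def)
 have kd: "k e x:{-d<..<d}" if "norm x < r'" for x using r'(2)[OF that] by (simp add: abs_less_iff)
 let ?S = "ball 0 (min r r') Int model G"
 have "plot G (model G) ?S (%x. c e (k e x))"
  by (rule plot_compose[OF d(2) model opn_model_ball smooth_on_linear[OF bl]]) (use kd in auto)
 moreover have "plot G (model G) ?S al" by (rule plot_subset[OF r(2) opn_model_ball]) auto
 ultimately have "plot G (model G) ?S (%x. c e (k e x) \<otimes> al x)" by (rule plot_mult)
 moreover have "gvel (%t. c e (k e (t *\<^sub>R v)) \<otimes> al (t *\<^sub>R v)) (\<Sum>e\<leftarrow>e # es. k e v *\<^sub>R e)" if "v:model G" for v
  using gvel_mult[OF gvel_scale[OF c(1), of "k e v"] al(4)[OF that]] linear_scale[OF l] by (simp add: mult.commute)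
 moreover have "c e (k e 0) \<otimes> al 0 = \<one>" using c(1) al(3) linear_0[OF l] by (simp add: gvel_def)
 moreover have "c e (k e x) \<otimes> al x:A" for x using c(2) al(1) A(2) by blast
 moreover have "c e (k e x) \<otimes> al x = c e (k e y) \<otimes> al y" if "ALL e:set (e # es). k e x = k e y" for x y
  using al(2)[of x y] that by simp
 moreover have "0 < min r r'" using r(1) r'(1) by simp
 ultimately show ?case by (intro exI[of _ "%x. c e (k e x) \<otimes> al x"] conjI allI ballI impI exI[of _ "min r r'"])
qed

lemma curve_product:
 assumes a: "subspace a" and Q: "linear Q" "!!x. Q x:a"
  and A: "\<one>:A" "!!x y. x:A ==> y:A ==> x \<otimes> y:A" and cA: "!!X. X:a ==> EX c. gvel c X & range c <= A"
 obtains al r where "0 < r" "plot G (model G) (ball 0 r Int model G) al" "!!x. al x:A" "!!x y. Q x = Q y ==> al x = al y"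
  "al 0 = \<one>" "!!v. v:model G ==> gvel (%t. al (t *\<^sub>R v)) (Q v)"
proof -
 obtain B where B: "B <= a" "independent B" "span B = a" using basis_subspace_exists[OF a] by metis
 have fB: "finite B" using B(2) independent_imp_finite by blast
 then obtain es where es: "set es = B" "distinct es" using finite_distinct_list by blast
 obtain c where c: "!!e. e:B ==> gvel (c e) e & range (c e) <= A" using cA B(1) by (metis subsetD)
 define k where "k e x = representation B (Q x) e" for e x
 have l: "linear (k e)" for e
  using Q B by (auto intro!: linearI simp: k_def linear_add[OF Q(1)] linear_scale[OF Q(1)] representation_add representation_scale)
 obtain al r where r: "0 < r" "plot G (model G) (ball 0 r Int model G) al" and al: "!!x. al x:A"
   "!!x y. (ALL e:set es. k e x = k e y) ==> al x = al y" "al 0 = \<one>" "!!v. v:model G ==> gvel (%t. al (t *\<^sub>R v)) (\<Sum>e\<leftarrow>es. k e v *\<^sub>R e)"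
  using curve_product_list[of es c A k, OF _ A] c l es(1) by auto
 have "(\<Sum>e\<leftarrow>es. k e v *\<^sub>R e) = Q v" for v
  using sum_representation_eq[OF B(2) _ fB subset_refl, of "Q v"] Q(2) B(3) es
  by (simp add: sum_list_distinct_conv_sum_set k_def)
 then show ?thesis using that[OF r al(1) al(2) al(3)] al(4) by (simp add: k_def)
qed

text \<open>\<open>A\<close> and \<open>B\<close> are not known to be Lie subgroups. What counts is
  that they are closed under multiplication and contain curves in all directions of \<open>a\<close>
  and of \<open>b\<close>; the product of the two parametrizations then has the identity as its
  derivative at 0.\<close>

theorem split_chart:
 assumes Q: "linear Qa" "linear Qb" "!!x. Qa x:a" "!!x. Qb x:b" "!!x. x:model G ==> Qa x + Qb x = x"
  and ab: "subspace a" "subspace b" "a <= model G" "b <= model G"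
  and A: "A <= carrier G" "\<one>:A" "!!x y. x:A ==> y:A ==> x \<otimes> y:A" and cA: "!!X. X:a ==> EX c. gvel c X & range c <= A"
  and B: "B <= carrier G" "\<one>:B" "!!x y. x:B ==> y:B ==> x \<otimes> y:B" and cB: "!!X. X:b ==> EX c. gvel c X & range c <= B"
 obtains al be ta r where "0 < r" "!!x. al x:A" "!!x. be x:B" "al 0 = \<one>" "be 0 = \<one>"
  "!!x y. Qa x = Qa y ==> al x = al y" "!!x y. Qb x = Qb y ==> be x = be y"
  "plot G (model G) {x:model G. norm (Qa x) < r & norm (Qb x) < r} al" "plot G (model G) {x:model G. norm (Qa x) < r & norm (Qb x) < r} be"
  "!!s. s <= r ==> openin (topo G) ((%x. al x \<otimes> be x) ` {x:model G. norm (Qa x) < s & norm (Qb x) < s})"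
  "!!x. x:model G ==> norm (Qa x) < r ==> norm (Qb x) < r ==> ta (al x \<otimes> be x) = x"
  "(%x. al x \<otimes> be x) ` {x:model G. norm (Qa x) < r & norm (Qb x) < r} <= U1"
  "smooth_on (model G) (ch ` (%x. al x \<otimes> be x) ` {x:model G. norm (Qa x) < r & norm (Qb x) < r}) (%u. ta (th u))"
proof -
 obtain al r1 where r1: "0 < r1" "plot G (model G) (ball 0 r1 Int model G) al" and al: "!!x. al x:A" "!!x y. Qa x = Qa y ==> al x = al y"
  "al 0 = \<one>" "!!v. v:model G ==> gvel (%t. al (t *\<^sub>R v)) (Qa v)"
  by (rule curve_product[OF ab(1) Q(1,3) A(2,3) cA], assumption+, rule that)
 obtain be r2 where r2: "0 < r2" "plot G (model G) (ball 0 r2 Int model G) be" and be: "!!x. be x:B" "!!x y. Qb x = Qb y ==> be x = be y"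
  "be 0 = \<one>" "!!v. v:model G ==> gvel (%t. be (t *\<^sub>R v)) (Qb v)"
  by (rule curve_product[OF ab(2) Q(2,4) B(2,3) cB], assumption+, rule that)
 define te where "te x = al x \<otimes> be x" for x
 let ?D = "ball 0 (min r1 r2) Int model G"
 have pa: "plot G (model G) ?D al" "plot G (model G) ?D be"
  by (rule plot_subset[OF r1(2) opn_model_ball] plot_subset[OF r2(2) opn_model_ball]; auto)+
 have pt: "plot G (model G) ?D te" unfolding te_def by (rule plot_mult[OF pa])
 let ?S = "{x:?D. te x:U1}"
 define f where "f x = ch (te x) - ch \<one>" for x
 have S: "opn (model G) ?S" by (rule plotD(5)[OF pt chart1])
 have sf: "smooth_on (model G) ?S f"
  unfolding f_def using smooth_on_add[OF plotD(6)[OF pt chart1] smooth_on_const[of _ _ "- ch \<one>"]] by simp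
 have fV: "f ` ?S <= model G" using th(7,8) model by (auto simp: f_def subspace_diff image_subset_iff)
 have t0: "te 0 = \<one>" using al(3) be(3) by (simp add: te_def)
 have o: "0:?S" using r1(1) r2(1) t0 one_U1 subspace_0[OF model] by simp
 obtain f' where f': "!!x. x:?S ==> (f has_derivative f' x) (at x within ?S)" by (rule smooth_on_derivative[OF model S sf]) blast
 have d0: "f' 0 v = v" if v: "v:model G" for v
 proof -
  have "gvel (%t. te (t *\<^sub>R v)) v" unfolding te_def using gvel_mult[OF al(4)[OF v] be(4)[OF v]] Q(5)[OF v] by simp
  then have "((%t. f (0 + t *\<^sub>R v)) hvd v) (at 0)"
   unfolding f_def gvel_def by (auto intro!: derivative_eq_intros)
  with directional_derivative(1)[OF model S o v f'[OF o]] show ?thesis by (rule vector_derivative_unique_at)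
 qed
 obtain S0 T g where S0: "opn (model G) S0" "0:S0" "S0 <= ?S" and T: "opn (model G) T" "f ` S0 = T" and g: "g ` T = S0"
  "!!x. x:S0 ==> g (f x) = x" "smooth_on (model G) T g"
  by (rule smooth_local_inverse[OF model S sf fV o f'[OF o] d0], assumption, rule that)
 obtain r0 where r0: "0 < r0" "ball 0 r0 Int model G <= S0" using S0(1,2) by (auto simp: openin_contains_ball)
 \<comment> \<open>As \<open>x = Qa x + Qb x\<close>, two components of norm below
   \<open>r0 / 2\<close> put \<open>x\<close> into the ball of radius \<open>r0\<close>.\<close>
 define r where "r = r0 / 2"
 define N where "N s = {x:model G. norm (Qa x) < s & norm (Qb x) < s}" for s
 have NS: "N s <= S0" if "s <= r" for s
 proof
  fix x assume x: "x:N s"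
  then have "norm (Qa x + Qb x) < r + r" using that norm_triangle_ineq[of "Qa x" "Qb x"] unfolding N_def by simp
  then show "x:S0" using x Q(5)[of x] r0(2) by (auto simp: N_def r_def)
 qed
 have bl: "continuous_on UNIV Qa" "continuous_on UNIV Qb" using Q(1,2) linear_conv_bounded_linear linear_continuous_on by blast+
 have N: "opn (model G) (N s)" for s
 proof -
  have "N s = model G Int {x. norm (Qa x) < s & norm (Qb x) < s}" by (auto simp: N_def)
  moreover have "open {x. norm (Qa x) < s & norm (Qb x) < s}"
   by (intro open_Collect_conj open_Collect_less continuous_intros bl)
  ultimately show ?thesis by (auto simp: openin_open)
 qed
 define ta where "ta x = g (ch x - ch \<one>)" for x
 have ta: "ta (te x) = x" if "x:S0" for x using g(2)[OF that] by (simp add: ta_def f_def)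
 have op: "openin (topo G) (te ` N s)" if s: "s <= r" for s
 proof -
  have *: "opn (model G) {v:T. g v:N s}"
   by (rule opn_preimage[OF smooth_on_continuous[OF g(3)] T(1) N]) (use g(1) S0 in "auto simp: openin_open")
  have "opn (model G) {u:model G. u - ch \<one>:{v:T. g v:N s}}"
   by (rule opn_preimage[OF _ _ *]) (use th(7) model in "auto simp: subspace_diff intro!: continuous_intros")
  from open_chart_preimage[OF chart1 this]
  have "openin (topo G) {x:U1. ch x:{u:model G. u - ch \<one>:{v:T. g v:N s}}}" .
  moreover have "{x:U1. ch x:{u:model G. u - ch \<one>:{v:T. g v:N s}}} = te ` N s" (is "?L = _")
  proof
   show "te ` N s <= ?L"
   proof
   fix y assume "y:te ` N s"
   then obtain x where x: "x:N s" "y = te x" by blast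
   then have xS: "x:S0" using NS[OF s] by blast
   then have "te x:U1" "f x:T" "g (f x):N s" using S0(3) T(2) g(2)[OF xS] x(1) by auto
   then show "y:?L" using x th(8) by (auto simp: f_def)
   qed
   show "?L <= te ` N s"
   proof
   fix y assume y: "y:?L"
   then obtain x where x: "x:S0" "ch y - ch \<one> = f x" using T(2) by auto
   then have "ch y = ch (te x)" "te x:U1" using S0(3) by (auto simp: f_def)
   then have "y = te x" using y inj_onD[OF chart(6)[OF chart1]] by blast
   moreover have "x:N s" using y x g(2)[OF x(1)] by auto
   ultimately show "y:te ` N s" by blast
   qed
  qed
  ultimately show ?thesis by simp
 qed
 have tU: "te ` N r <= U1" using NS[of r] S0(3) by blast
 have im: "(%u. u - ch \<one>) ` (ch ` te ` N r) <= T"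
  using NS[of r] T(2) by (auto simp: f_def)
 have oW: "opn (model G) (ch ` te ` N r)"
  using chart_image_open[OF chart1 op[OF order_refl]] tU by (simp add: Int_absorb1)
 have "smooth_on (model G) (ch ` te ` N r) (%u. u - ch \<one>)"
  using smooth_on_add[OF smooth_on_id smooth_on_const[of _ _ "- ch \<one>"]] by simp
 from smooth_on_compose[OF model oW model _ im this g(3)] T(1)
 have "smooth_on (model G) (ch ` te ` N r) (%u. g (u - ch \<one>))" by (auto simp: openin_open)
 moreover have "ta (th u) = g (u - ch \<one>)" if "u:ch ` te ` N r" for u
  using that tU th(2)[of u] by (auto simp: ta_def)
 ultimately have sm: "smooth_on (model G) (ch ` te ` N r) (%u. ta (th u))"
  by (subst smooth_on_cong)
 have ND: "N r <= ?D" using NS[of r] S0(3) by blast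
 show ?thesis
 proof (rule that[of r al be ta, folded N_def te_def])
  show "0 < r" using r0 by (simp add: r_def)
  show "plot G (model G) (N r) al" "plot G (model G) (N r) be" by (rule plot_subset[OF pa(1) N ND] plot_subset[OF pa(2) N ND])+
  show "ta (te x) = x" if "x:model G" "norm (Qa x) < r" "norm (Qb x) < r" for x
   using ta NS[of r] that by (auto simp: N_def)
 qed (fact al be op tU sm)+
qed

text \<open>The split chart with zero as second summand shows that \<open>N\<close> contains a
  neighbourhood of the identity.\<close>

lemma generated_by_curves:
 assumes con: "connected_space (topo G)" and N: "N <= carrier G" "\<one>:N" "!!x y. x:N ==> y:N ==> x \<otimes> y:N"
  and cN: "!!X. X:model G ==> EX c. gvel c X & range c <= N"
 shows "N = carrier G"
proof -
 have P0: "linear (%x. 0 :: 'v)" by (auto intro!: linearI)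
 have c0: "EX c. gvel c X & range c <= N" if "X:{0}" for X using cN subspace_0[OF model] that by auto
 have z: "(%x. 0 :: 'v) x:{0}" "x:model G ==> P x + (%x. 0) x = x" "subspace {0 :: 'v}" "{0} <= model G" for x
  using P(3) subspace_0[OF model] by (auto simp: subspace_def)
 obtain al be :: "'v => 'a" and r where r: "0 < r" and ab: "!!x. al x:N" "!!x. be x:N" "al 0 = \<one>" "be 0 = \<one>"
  and o: "!!s. s <= r ==> openin (topo G) ((%x. al x \<otimes> be x) ` {x:model G. norm (P x) < s & norm (0 :: 'v) < s})"
  by (rule split_chart[OF P(1) P0 P(2) z(1,2) model z(3) order_refl z(4) N cN N c0], assumption+, rule that)
 let ?W = "(%x. al x \<otimes> be x) ` {x:model G. norm (P x) < r & norm (0 :: 'v) < r}"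
 have "\<one> = al 0 \<otimes> be 0" unfolding ab(3,4) by simp
 moreover have "0:{x:model G. norm (P x) < r & norm (0 :: 'v) < r}"
  using r P(3)[of 0] subspace_0[OF model] by simp
 ultimately have "\<one>:?W" by blast
 moreover have "?W <= N" using ab(1,2) N(3) by blast
 ultimately show ?thesis by (intro generated_by_neighborhood[OF con o[OF order_refl]] N) auto
qed
end

lemma direct_sum_projections:
 fixes V :: "'v::euclidean_space set"
 assumes "direct_sum V a b"
 obtains Qa Qb where "linear Qa" "linear Qb" "!!x. Qa x:a" "!!x. Qb x:b" "!!x. x:V ==> Qa x + Qb x = x"
  "!!x y. x:a ==> y:b ==> Qa (x + y) = x & Qb (x + y) = y"
proof -
 have s: "subspace a" "subspace b" "a Int b = {0}" and V: "V = {X + Y |X Y. X:a & Y:b}" using assms by (auto simp: direct_sum_def)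
 have l: "linear (%z :: 'v \<times> 'v. fst z + snd z)" by (auto intro!: linearI simp: scaleR_add_right)
 have "inj_on (%z :: 'v \<times> 'v. fst z + snd z) (a \<times> b)"
 proof (rule inj_onI, clarsimp)
  fix x y x' y' assume *: "x:a" "y:b" "x':a" "y':b" "x + y = x' + y'"
  then have "x - x' = y' - y" by (simp add: algebra_simps)
  moreover have "x - x':a" "y' - y:b" using * s subspace_diff by blast+
  ultimately have "x - x':a Int b" by simp
  then have "x = x'" using s(3) by simp
  then show "x = x' & y = y'" using *(5) by simp
 qed
 then obtain g where g: "linear g" "range g <= a \<times> b" "!!z. z:a \<times> b ==> g (fst z + snd z) = z"
  using linear_exists_left_inverse_on[OF l subspace_Times[OF s(1,2)]] by auto
 have r: "fst (g x):a" "snd (g x):b" for x using g(2) by (auto simp: mem_Times_iff image_subset_iff)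
 have eq: "g (x + y) = (x, y)" if "x:a" "y:b" for x y using g(3)[of "(x, y)"] that by simp
 show ?thesis
  by (rule that[of "%x. fst (g x)" "%x. snd (g x)"])
   (use r eq V in "auto intro!: linearI simp: linear_add[OF g(1)] linear_scale[OF g(1)]")
qed

section \<open>Lie groups with nondegenerate Killing form\<close>

context lie
begin

text \<open>Outside the interval the curve is reset to the identity, so that its whole range lies in
  \<open>N\<close>.\<close>

lemma gvel_restrict:
 assumes c: "gvel c X" and d: "0 < d" "!!t. \<bar>t\<bar> < d ==> c t:N" and N: "\<one>:N"
 shows "EX c. gvel c X & range c <= N"
 using gvel_transform[OF c d(1), of "%t. if \<bar>t\<bar> < d then c t else \<one>"] d N
 by (intro exI[of _ "%t. if \<bar>t\<bar> < d then c t else \<one>"]) auto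

text \<open>When \<gg> is the sum of commuting ideals \<open>a\<close> and \<open>b\<close>,
  \<open>fixer b\<close> takes the place of the subgroup integrating \<open>a\<close>: it is closed
  under multiplication and contains the integral curves in the directions of
  \<open>a\<close>.\<close>

definition fixer :: "'v set => 'a set" where
 "fixer b = {g:carrier G. ALL Y:b. Ad G g Y = Y}"

lemma fixer_closed:
 assumes "b <= model G"
 shows "\<one>:fixer b" "g:fixer b ==> h:fixer b ==> g \<otimes> h:fixer b" "g:fixer b ==> inv g:fixer b"
proof -
 show "\<one>:fixer b" using assms by (auto simp: fixer_def Ad_one)
 show "g \<otimes> h:fixer b" if "g:fixer b" "h:fixer b"
  using that assms Ad_mult[of g h] by (auto simp: fixer_def subset_iff)
 show "inv g:fixer b" if "g:fixer b"
  using that assms Ad_inv(2)[of g] by (force simp: fixer_def subset_iff)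
qed

lemma intcurve_fixer:
 assumes c: "intcurve X d c" and b: "b <= model G" "!!Y. Y:b ==> br X Y = 0" and t: "\<bar>t\<bar> < d"
 shows "c t:fixer b"
proof -
 have "Ad G (c t) Y = Y" if Y: "Y:b" for Y
 proof -
  have Ym: "Y:model G" using b Y by blast
  have z: "Ad G g 0 = 0" if "g:carrier G" for g using Ad_add(2)[OF that subspace_0[OF model], of 0] by simp
  have "((%t. Ad G (c t) Y) hvd 0) (at s within {-d<..<d})" if "s:{-d<..<d}" for s
  proof -
   have s: "\<bar>s\<bar> < d" using that by (auto simp: abs_less_iff)
   then show ?thesis
   using has_vector_derivative_at_within[OF intcurve_Ad[OF c s Ym]] b(2)[OF Y] z intcurve_carrier[OF c s] by simp
  qed
  then obtain k where k: "!!s. s:{-d<..<d} ==> Ad G (c s) Y = k"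
   by (rule has_vector_derivative_zero_constant[rotated]) auto
  have "t:{-d<..<d}" "0:{-d<..<d}" using t by (auto simp: abs_less_iff)
  then have "Ad G (c t) Y = Ad G (c 0) Y" using k by metis
  then show ?thesis using intcurveD(3)[OF c] Ad_one[OF Ym] by simp
 qed
 then show ?thesis using intcurve_carrier[OF c t] by (simp add: fixer_def)
qed

lemma fixer_curve:
 assumes "X:model G" "b <= model G" "!!Y. Y:b ==> br X Y = 0"
 shows "EX c. gvel c X & range c <= fixer b"
proof -
 obtain d c where c: "intcurve X d c" using intcurve_exists[OF assms(1)] by blast
 show ?thesis
  by (rule gvel_restrict[OF intcurve_gvel[OF c] intcurveD(1)[OF c] intcurve_fixer[OF c assms(2,3)] fixer_closed(1)[OF assms(2)]])
qed
end

text \<open>A quantitative form of local injectivity at the single point \<open>u\<close>: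
  injectivity on a subspace of finite dimension gives a lower bound for \<open>f'\<close>, half of
  which survives for \<open>f\<close>.\<close>

lemma injective_derivative_bound:
 fixes f :: "'v::euclidean_space => 'w::euclidean_space"
 assumes D: "(f has_derivative f') (at u within S)" and V: "subspace V" "S <= V" "u:S"
  and inj: "!!v. v:V ==> f' v = 0 ==> v = 0"
 obtains e d where "0 < e" "0 < d" "!!x. x:S ==> norm (x - u) < d ==> e * norm (x - u) <= norm (f x - f u)"
proof -
 obtain e where e: "0 < e" "!!v. v:V ==> e * norm v <= norm (f' v)"
  using injective_imp_isometric[OF closed_subspace[OF V(1)] V(1) has_derivative_bounded_linear[OF D]] inj by (auto simp: mult.commute)
 obtain d where d: "0 < d" "!!x. x:S ==> norm (x - u) < d ==> norm (f x - f u - f' (x - u)) <= e / 2 * norm (x - u)"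
  using D e(1) unfolding has_derivative_within_alt by (meson half_gt_zero)
 have "e / 2 * norm (x - u) <= norm (f x - f u)" if x: "x:S" "norm (x - u) < d" for x
 proof -
  have "norm (f' (x - u)) <= norm (f x - f u) + norm (f x - f u - f' (x - u))"
   using norm_triangle_ineq4[of "f x - f u" "f x - f u - f' (x - u)"] by simp
  moreover have "e * norm (x - u) <= norm (f' (x - u))" using e(2) x V by (blast intro: subspace_diff)
  ultimately show ?thesis using d(2)[OF x] by simp
 qed
 then show ?thesis using that[of "e / 2" d] e(1) d(1) by simp
qed

locale killing_lie = lie G for G :: "('a, 'v::euclidean_space) lie_structure" (structure) +
 assumes nondegenerate: "X:model G ==> (!!Y. kp br X Y = 0) ==> X = 0"
begin

lemma centerless: "X:model G ==> (!!Y. Y:model G ==> br X Y = 0) ==> X = 0"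
 by (rule nondegenerate) (simp_all add: kp_def br_model)

lemma Ad_derivative_br: "gvel c X ==> Y:model G ==> ((%t. Ad G (c t) Y) hvd br X Y) (at 0)"
 using Ad_derivative[of c X Y] br_eq[OF gvel_model] by simp

text \<open>The map \<open>Ad_trace\<close> is a substitute for \<open>log Ad\<close>: its derivative \<open>ad_trace\<close> at the identity is injective
 because the Killing form is nondegenerate.\<close>

definition ad_trace :: "'v => 'v" where "ad_trace v = (SUM e:Basis. kp br v e *\<^sub>R e)"
definition Ad_trace :: "'a => 'v" where "Ad_trace g = (SUM e:Basis. (SUM b:Basis. Ad G g (br e b) \<bullet> b) *\<^sub>R e)"

lemma ad_trace: "linear ad_trace" "v:model G ==> ad_trace v = 0 ==> v = 0"
proof -
 have l: "linear (%x. kp br x y)" "linear (kp br y)" for y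
  unfolding kp_def by (auto intro!: linearI simp: bilinear_comm[OF br_bilinear] inner_add_left sum.distrib sum_distrib_left)
 show "linear ad_trace"
  unfolding ad_trace_def
  by (auto intro!: linearI simp: linear_add[OF l(1)] linear_scale[OF l(1)] scaleR_add_left sum.distrib scaleR_sum_right)
 show "v = 0" if v: "v:model G" and z: "ad_trace v = 0"
 proof (rule nondegenerate[OF v])
  fix Y
  have "ad_trace v \<bullet> e = kp br v e" if "e:Basis" for e
   using that by (simp add: ad_trace_def inner_sum_left inner_Basis if_distrib cong: if_cong)
  then have "kp br v e = 0" if "e:Basis" for e using z that by (metis inner_zero_left)
  then show "kp br v Y = 0" using linear_expand[OF l(2), of v Y] by simp
 qed
qed

lemma Ad_trace_smooth:
 assumes "plot G V S p" shows "smooth_on V S (%x. Ad_trace (p x))"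
 unfolding smooth_on_def Ad_trace_def
proof (intro allI Ck_on_sum)
 fix k and e :: 'v
 have "Ck_on V S (%x. Ad G (p x) (br e b) \<bullet> b) k" for b
  using smooth_on_linear_comp[OF bounded_linear_inner_left Ad_smooth[OF assms br_model]] by (simp add: smooth_on_def)
 then have "Ck_on V S (%x. SUM b:Basis. Ad G (p x) (br e b) \<bullet> b) k" by (intro Ck_on_sum) auto
 then show "Ck_on V S (%x. (SUM b:Basis. Ad G (p x) (br e b) \<bullet> b) *\<^sub>R e) k"
  by (rule Ck_on_linear_comp[OF bounded_linear_scaleR_left])
qed auto

lemma Ad_trace_derivative:
 assumes c: "!!Y. Y:model G ==> ((%t. Ad G (c t) Y) hvd br v Y) (at 0)"
 shows "((%t. Ad_trace (c t)) hvd ad_trace v) (at 0)"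
proof -
 have "((%t. Ad G (c t) (br e b)) hvd br v (br e b)) (at 0)" for e b by (rule c[OF br_model])
 note bounded_linear.has_vector_derivative[OF bounded_linear_inner_left this]
 note bounded_linear.has_vector_derivative[OF bounded_linear_scaleR_left has_vector_derivative_sum[OF this]]
 note has_vector_derivative_sum[OF this]
 then show ?thesis unfolding Ad_trace_def ad_trace_def kp_def .
qed

lemma Ad_trace_cong: "(!!Y. Y:model G ==> Ad G g Y = Ad G h Y) ==> Ad_trace g = Ad_trace h"
 by (simp add: Ad_trace_def br_model)

text \<open>The kernel of \<open>Ad\<close> is discrete: its elements have the same
  \<open>Ad_trace\<close> as the identity, and \<open>Ad_trace\<close> has an injective derivative
  there.\<close>

lemma Ad_locally_injective:
 obtains W where "openin (topo G) W" "\<one>:W" "!!g. g:W ==> g:fixer (model G) ==> g = \<one>"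
proof -
 let ?u = "ch \<one>" and ?F = "%u. Ad_trace (th u)"
 obtain F' where F': "!!u. u:ch ` U1 ==> (?F has_derivative F' u) (at u within ch ` U1)"
  by (rule smooth_on_derivative[OF model th(5) Ad_trace_smooth[OF th(4)]]) blast
 have F'v: "F' ?u v = ad_trace v" if v: "v:model G" for v
  using directional_derivative(1)[OF model th(5,6) v F'[OF th(6)]] Ad_trace_derivative[OF Ad_derivative_br[OF gvel_curve[OF v]]]
  unfolding curve_at_one_eq by (rule vector_derivative_unique_at)
 obtain e d where ed: "0 < e" "0 < d" "!!u. u:ch ` U1 ==> norm (u - ?u) < d ==> e * norm (u - ?u) <= norm (?F u - ?F ?u)"
  by (rule injective_derivative_bound[OF F'[OF th(6)] model th(8,6)]) (use F'v ad_trace(2) in auto)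
 have "openin (topo G) {g:U1. ch g:ball ?u d Int model G}"
  by (rule open_chart_preimage[OF chart1]) (auto simp: openin_open)
 moreover have "g = \<one>" if g: "g:{g:U1. ch g:ball ?u d Int model G}" "g:fixer (model G)" for g
 proof -
  have "?F (ch g) = ?F ?u"
   using g th(1)[OF one_U1] by (intro Ad_trace_cong) (simp add: th(1) fixer_def Ad_one)
  moreover have "ch g:ch ` U1" "norm (ch g - ?u) < d" using g by (auto simp: dist_norm norm_minus_commute)
  ultimately have "e * norm (ch g - ?u) <= 0" using ed(3)[of "ch g"] by simp
  then have "norm (ch g - ?u) = 0" using ed(1) norm_ge_zero[of "ch g - ?u"] by (simp add: mult_le_0_iff)
  then show "g = \<one>" using inj_onD[OF chart(6)[OF chart1]] g one_U1 by auto
 qed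
 moreover have "\<one>:{g:U1. ch g:ball ?u d Int model G}" using one_U1 th(7) ed(2) by simp
 ultimately show ?thesis using that by blast
qed
end

section \<open>Images of idempotent endomorphisms\<close>

text \<open>The image of \<open>E\<close> is its set of fixed points. In the coordinates
  \<open>te\<close> the map \<open>E\<close> is the linear projection \<open>Q\<close>, so the image
  is an embedded submanifold modelled on \<open>a\<close>. This gives the factors of a splitting
  their Lie group structure.\<close>

locale retract = lie G for G :: "('a, 'v::euclidean_space) lie_structure" (structure) +
 fixes E :: "'a => 'a" and Q :: "'v => 'v" and a N and te :: "'v => 'a" and ta :: "'a => 'v"
 assumes E: "E:hom G G" "!!g. g:carrier G ==> E (E g) = E g"
  and a: "subspace a" "a <= model G" "linear Q" "!!x. Q x:a" "!!x. x:a ==> Q x = x"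
  and N: "opn (model G) N" "0:N" "!!x. x:N ==> Q x:N"
  and te: "plot G (model G) N te" "openin (topo G) (te ` N)" "te 0 = \<one>" "te ` N <= U1"
  and ta: "!!x. x:N ==> ta (te x) = x" "smooth_on (model G) (ch ` te ` N) (%u. ta (th u))"
  and Ete: "!!x. x:N ==> E (te x) = te (Q x)"
begin

sublocale E: group_hom G G E
 using E(1) group_axioms by (simp add: group_hom_defs)

definition C where "C = E ` carrier G"

lemma C_iff: "x:C \<longleftrightarrow> x:carrier G & E x = x"
 using E(2) by (auto simp: C_def image_iff) metis

lemma C_closed: "\<one>:C" "x:C ==> y:C ==> x \<otimes> y:C" "x:C ==> inv x:C"
 by (auto simp: C_iff)

definition dom where "dom g = {x:C. inv g \<otimes> x:te ` N}"
definition L :: "('a, 'v) lie_structure" where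
 "L = \<lparr>carrier = C, mult = mult G, one = \<one>, topo = subtopology (topo G) C, model = a,
   atlas = {(dom g, %x. ta (inv g \<otimes> x)) |g. g:C}\<rparr>"

lemma L_simps: "carrier L = C" "mult L = mult G" "one L = \<one>" "topo L = subtopology (topo G) C" "model L = a"
  "atlas L = {(dom g, %x. ta (inv g \<otimes> x)) |g. g:C}"
 by (simp_all add: L_def)

lemma te_carrier: "u:N ==> te u:carrier G"
 by (rule plotD(4)[OF te(1)])

lemma one_teN: "\<one>:te ` N"
 using imageI[OF N(2), of te] te(3) by simp

lemma dom:
 assumes g: "g:C"
 shows "x:dom g ==> ta (inv g \<otimes> x):N Int a" "x:dom g ==> g \<otimes> te (ta (inv g \<otimes> x)) = x"
  "u:N Int a ==> g \<otimes> te u:dom g" "u:N ==> ta (inv g \<otimes> (g \<otimes> te u)) = u" "(%x. ta (inv g \<otimes> x)) ` dom g = N Int a"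
  "u:N Int a ==> inv_into (dom g) (%x. ta (inv g \<otimes> x)) u = g \<otimes> te u" "g:dom g"
proof -
 have gc: "g:carrier G" using g by (simp add: C_iff)
 have fw: "ta (inv g \<otimes> x):N Int a & g \<otimes> te (ta (inv g \<otimes> x)) = x" if x: "x:dom g" for x
 proof -
  obtain u where u: "u:N" "inv g \<otimes> x = te u" using x by (auto simp: dom_def)
  have "te u:C" unfolding u(2)[symmetric] using x g C_closed by (simp add: dom_def)
  then have "te (Q u) = te u" using Ete[OF u(1)] by (simp add: C_iff)
  then have "Q u = u" using ta(1)[OF u(1)] ta(1)[OF N(3)[OF u(1)]] by simp
  then have "u:a" using a(4) by metis
  moreover have "g \<otimes> (inv g \<otimes> x) = x" using x gc by (simp add: dom_def C_iff m_assoc[symmetric])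
  ultimately show ?thesis using u ta(1)[OF u(1)] by simp
 qed
 show 1: "ta (inv g \<otimes> x):N Int a" and 2: "g \<otimes> te (ta (inv g \<otimes> x)) = x" if "x:dom g" for x using fw[OF that] by auto
 have can: "inv g \<otimes> (g \<otimes> te u) = te u" if "u:N" for u using gc te_carrier[OF that] by (simp add: m_assoc[symmetric])
 show 4: "ta (inv g \<otimes> (g \<otimes> te u)) = u" if "u:N" for u using can[OF that] ta(1)[OF that] by simp
 show 3: "g \<otimes> te u:dom g" if u: "u:N Int a" for u
 proof -
  have "te u:C" using Ete[of u] a(5)[of u] u te_carrier by (simp add: C_iff)
  then show ?thesis using g u can[of u] C_closed(2) by (auto simp: dom_def)
 qed
 show "(%x. ta (inv g \<otimes> x)) ` dom g = N Int a"
 proof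
  show "N Int a <= (%x. ta (inv g \<otimes> x)) ` dom g"
   by (rule subsetI, rule image_eqI[OF _ 3]) (use 4 in auto)
 qed (use 1 in blast)
 have "inj_on (%x. ta (inv g \<otimes> x)) (dom g)" by (rule inj_on_inverseI[of _ "%u. g \<otimes> te u"]) (rule 2)
 then show "inv_into (dom g) (%x. ta (inv g \<otimes> x)) u = g \<otimes> te u" if "u:N Int a" for u
  by (rule inv_into_f_eq[OF _ 3[OF that]]) (use 4 that in blast)
 show "g:dom g" using g gc one_teN by (simp add: dom_def)
qed

lemma ta_smooth:
 assumes q: "plot G V T q" and qN: "q ` T <= te ` N" shows "smooth_on V T (%x. ta (q x))"
proof -
 have o: "opn (model G) (ch ` te ` N)"
  using chart_image_open[OF chart1 te(2)] te(4) by (simp add: Int_absorb1)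
 have im: "q ` T <= U1" "(%x. ch (q x)) ` T <= ch ` te ` N" using qN te(4) by auto
 have "ch ` te ` N <= model G" using o by (auto simp: openin_open)
 from smooth_on_compose[OF plotD(1,2)[OF q] model this im(2) plot_chart[OF q chart1 im(1)] ta(2)]
 have "smooth_on V T (%x. ta (th (ch (q x))))" .
 then show ?thesis
  by (rule iffD1[OF smooth_on_cong, rotated]) (use im(1) th(1) in "simp add: image_subset_iff")
qed

text \<open>The plots of \<open>L\<close> are the plots of \<open>G\<close> with values in the
  image, one direction here and the other in \<open>plot_out\<close>. Smoothness of the group
  operations of \<open>L\<close> is inherited in this way.\<close>

lemma plot_into: assumes p: "plot G V S p" and pC: "p ` S <= C" shows "plot L V S p"
proof (rule plotI[OF plotD(1,2)[OF p]])
 show "p x:carrier L" if "x:S" for x using pC that by (auto simp: L_simps)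
 fix U ph assume "(U, ph):atlas L"
 then obtain g where g: "g:C" "U = dom g" "ph = (%x. ta (inv g \<otimes> x))" by (auto simp: L_simps)
 have q: "plot G V S (%x. inv g \<otimes> p x)" by (intro plot_mult plot_const plotD(1,2)[OF p] p) (use g in "simp add: C_iff")
 have e: "{x:S. p x:U} = {x:S. inv g \<otimes> p x:te ` N}" using pC by (auto simp: g dom_def)
 show o: "opn V {x:S. p x:U}" unfolding e by (rule plot_preimage[OF q te(2)])
 show "smooth_on V {x:S. p x:U} (%x. ph (p x))"
  unfolding g(3) by (rule ta_smooth[OF plot_subset[OF q o]]) (auto simp: e)
qed

lemma plot_te: assumes "plot G V T (%x. \<one>)" "smooth_on V T u" "u ` T <= N" "h:carrier G" shows "plot G V T (%x. h \<otimes> te (u x))"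
 by (intro plot_mult plot_const plotD(1,2)[OF assms(1)] plot_compose[OF te(1)] assms)

lemma plot_out: assumes p: "plot L V S p" shows "plot G V S p"
proof (rule plot_local[OF plotD(1)[OF p]])
 fix x assume x: "x:S"
 then have g: "p x:C" using plotD(4)[OF p] by (simp add: L_simps)
 let ?T = "{y:S. p y:dom (p x)}"
 have c: "(dom (p x), %y. ta (inv (p x) \<otimes> y)):atlas L" using g by (auto simp: L_simps)
 have "plot G V ?T (%y. p x \<otimes> te (ta (inv (p x) \<otimes> p y)))"
  by (rule plot_te[OF plot_const[OF plotD(1)[OF p] plotD(5)[OF p c] one_closed] plotD(6)[OF p c]])
   (use dom(1)[OF g] g in "auto simp: C_iff")
 then have "plot G V ?T p" by (rule plot_cong[rotated]) (use dom(2)[OF g] in simp)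
 then show "EX T. x:T & T <= S & plot G V T p" using x dom(7)[OF g] by (intro exI[of _ ?T]) simp
qed

lemma plot_E: assumes p: "plot G V S p" shows "plot L V S (%x. E (p x))"
proof (rule plot_into)
 show "plot G V S (%x. E (p x))"
 proof (rule plot_local[OF plotD(1)[OF p]])
  fix x assume x: "x:S"
  then have g: "p x:carrier G" using plotD(4)[OF p] by blast
  have q: "plot G V S (%y. inv (p x) \<otimes> p y)" by (intro plot_mult plot_const plotD(1,2)[OF p] p) (use g in simp)
  let ?T = "{y:S. inv (p x) \<otimes> p y:te ` N}"
  have T: "opn V ?T" by (rule plot_preimage[OF q te(2)])
  have s: "smooth_on V ?T (%y. ta (inv (p x) \<otimes> p y))" by (rule ta_smooth[OF plot_subset[OF q T]]) auto
  have bQ: "bounded_linear Q" using a(3) linear_conv_bounded_linear by blast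
  have "plot G V ?T (%y. E (p x) \<otimes> te (Q (ta (inv (p x) \<otimes> p y))))"
   by (rule plot_te[OF plot_const[OF plotD(1)[OF p] T one_closed] smooth_on_linear_comp[OF bQ s]])
   (use N(3) ta(1) g in auto)
  then have "plot G V ?T (%y. E (p y))"
  proof (rule plot_cong[rotated])
   fix y assume y: "y:?T"
   then obtain u where u: "u:N" "inv (p x) \<otimes> p y = te u" by auto
   have "E (p x \<otimes> (inv (p x) \<otimes> p y)) = E (p x) \<otimes> te (Q u)" unfolding u(2) using g te_carrier[OF u(1)] Ete[OF u(1)] by simp
   moreover have "p x \<otimes> (inv (p x) \<otimes> p y) = p y" using g y plotD(4)[OF p] by (simp add: m_assoc[symmetric])
   ultimately show "E (p x) \<otimes> te (Q (ta (inv (p x) \<otimes> p y))) = E (p y)" using u ta(1) by simp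
  qed
  moreover have "inv (p x) \<otimes> p x:te ` N" using one_teN g by simp
  ultimately show "EX T. x:T & T <= S & plot G V T (%x. E (p x))" using x by (intro exI[of _ ?T]) simp
 qed
qed (use plotD(4)[OF p] in "auto simp: C_def")

lemma smooth_manifold_L: "smooth_manifold L"
proof -
 have o: "openin (topo G) {x:carrier G. inv g \<otimes> x:te ` N}" if "g:C" for g using open_translate[OF te(2)] that by (simp add: C_iff)
 have da: "opn a (N Int a)" using N(1) a(2) by (auto simp: openin_open)
 have pl: "plot G a (N Int a) (%u. g \<otimes> te u)" if "g:C" for g
  by (rule plot_te[OF plot_const[OF a(1) da one_closed] smooth_on_id]) (use that in "auto simp: C_iff")
 have h: "homeomorphic_map (subtopology (topo L) (dom g)) (top_of_set (N Int a)) (%x. ta (inv g \<otimes> x))" if g: "g:C" for g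
 proof -
  have sub: "subtopology (topo L) (dom g) = subtopology (topo G) (dom g)"
   by (simp add: L_simps subtopology_subtopology dom_def Collect_conj_eq Int_absorb1)
  have top: "topspace (subtopology (topo G) (dom g)) = dom g" using topspace by (auto simp: dom_def C_iff)
  have "continuous_map (subtopology (topo G) (dom g)) (top_of_set (N Int a)) (%x. ta (inv g \<otimes> x))"
  proof -
   have gd: "inv g \<otimes> x:U1" "ch (inv g \<otimes> x):ch ` te ` N" if "x:dom g" for x using that te(4) by (auto simp: dom_def)
   have "continuous_map (subtopology (topo G) (dom g)) (topo G) (%x. inv g \<otimes> x)"
   by (intro continuous_mult continuous_map_from_subtopology[OF continuous_id]) (use g topspace in "auto simp: C_iff")
   then have "continuous_map (subtopology (topo G) (dom g)) (subtopology (topo G) U1) (%x. inv g \<otimes> x)"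
   using gd by (auto simp: continuous_map_in_subtopology top)
   from continuous_map_compose[OF this homeomorphic_imp_continuous_map[OF chart(5)[OF chart1]]]
   have 1: "continuous_map (subtopology (topo G) (dom g)) (top_of_set (ch ` te ` N)) (%x. ch (inv g \<otimes> x))"
   using gd by (auto simp: continuous_map_in_subtopology top o_def)
   have 2: "continuous_map (top_of_set (ch ` te ` N)) euclidean (%u. ta (th u))" using smooth_on_continuous[OF ta(2)] by simp
   have "continuous_map (subtopology (topo G) (dom g)) euclidean (%x. ta (th (ch (inv g \<otimes> x))))"
   using continuous_map_compose[OF 1 2] by (simp add: o_def)
   then have "continuous_map (subtopology (topo G) (dom g)) euclidean (%x. ta (inv g \<otimes> x))"
   by (rule continuous_map_eq) (use gd th(1) top in auto)
   then show ?thesis using dom(1)[OF g] by (auto simp: continuous_map_in_subtopology top)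
  qed
  moreover have "continuous_map (top_of_set (N Int a)) (subtopology (topo G) (dom g)) (%u. g \<otimes> te u)"
   using plot_continuous[OF pl[OF g]] dom(3)[OF g] by (auto simp: continuous_map_in_subtopology)
  ultimately have "homeomorphic_maps (subtopology (topo G) (dom g)) (top_of_set (N Int a)) (%x. ta (inv g \<otimes> x)) (%u. g \<otimes> te u)"
   unfolding homeomorphic_maps_def using dom(2,4)[OF g] by (auto simp: top)
  then show ?thesis unfolding sub using homeomorphic_map_maps by blast
 qed
 have tr: "smooth_on a ((%x. ta (inv g \<otimes> x)) ` (dom g Int dom k)) (%u. ta (inv k \<otimes> inv_into (dom g) (%x. ta (inv g \<otimes> x)) u))"
  if g: "g:C" "k:C" for g k
 proof -
  have q: "plot G a (N Int a) (%u. inv k \<otimes> (g \<otimes> te u))"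
   by (rule plot_mult[OF plot_const[OF a(1) da] pl[OF g(1)]]) (use g in "simp add: C_iff")
  let ?T = "{u:N Int a. inv k \<otimes> (g \<otimes> te u):te ` N}"
  have "smooth_on a ?T (%u. ta (inv k \<otimes> (g \<otimes> te u)))"
   by (rule ta_smooth[OF plot_subset[OF q plot_preimage[OF q te(2)]]]) auto
  then have "smooth_on a ?T (%u. ta (inv k \<otimes> inv_into (dom g) (%x. ta (inv g \<otimes> x)) u))"
   using smooth_on_cong[of ?T "%u. ta (inv k \<otimes> (g \<otimes> te u))" "%u. ta (inv k \<otimes> inv_into (dom g) (%x. ta (inv g \<otimes> x)) u)" a] dom(6)[OF g(1)] by simp
  moreover have "(%x. ta (inv g \<otimes> x)) ` (dom g Int dom k) <= ?T"
   using dom(1,2)[OF g(1)] by (auto simp: dom_def[of k])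
  ultimately show ?thesis using smooth_on_subset by blast
 qed
 have "smooth_manifold G" using lie by (simp add: lie_group_def)
 then have "Hausdorff_space (topo L)" "second_countable (topo L)"
  by (auto simp: smooth_manifold_def L_simps Hausdorff_space_subtopology second_countable_subtopology)
 moreover have "openin (topo L) (dom g)" if "g:C" for g
 proof -
  have "dom g = {x:carrier G. inv g \<otimes> x:te ` N} Int C" by (auto simp: dom_def C_iff)
  then show ?thesis using openin_subtopology_Int[OF o[OF that], of C] by (simp add: L_simps)
 qed
 moreover have "(UN (U, ph):atlas L. U) = carrier L"
 proof -
  have "(UN (U, ph):atlas L. U) = (UN g:C. dom g)" by (force simp: L_simps)
  then show ?thesis using dom(7) by (auto simp: dom_def L_simps)
 qed
 moreover have "topspace (topo L) = carrier L" using topspace C_iff by (auto simp: L_simps)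
 ultimately show ?thesis
  unfolding smooth_manifold_def
 proof (intro conjI)
 qed (use a(1) h tr dom(5) da in "auto simp: L_simps")
qed

lemma lie_group_L: "lie_group L"
proof -
 have g: "group L"
 proof (rule groupI)
  show "EX y:carrier L. y \<otimes>\<^bsub>L\<^esub> x = \<one>\<^bsub>L\<^esub>" if "x:carrier L" for x
   using that C_closed(3) by (intro bexI[of _ "inv x"]) (auto simp: L_simps C_iff)
 qed (use C_closed C_iff in "auto simp: L_simps m_assoc")
 have M: "pre_manifold L" by (rule smooth_manifold_pre[OF smooth_manifold_L])
 have M2: "pre_manifold (lie_prod L L)" by (rule pre_manifold_prod[OF M M])
 interpret L: manifold L by standard (rule M)
 interpret L2: manifold "lie_prod L L" by standard (rule M2)
 have i: "inv\<^bsub>L\<^esub> x = inv x" if "x:C" for x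
  by (rule group.inv_equality[OF g]) (use that C_closed C_iff in "auto simp: L_simps")
 have "smooth_map (lie_prod L L) L (%(x, y). x \<otimes>\<^bsub>L\<^esub> y)"
 proof (rule smooth_mapI[OF M2 M])
  show "(%(x, y). x \<otimes>\<^bsub>L\<^esub> y) z:carrier L" if "z:carrier (lie_prod L L)" for z
   using that C_closed by (auto simp: L_simps lie_prod_def)
  fix U ph assume c: "(U, ph):atlas (lie_prod L L)"
  note q = plot_fst_snd[OF M M L2.plot_chart_inverse[OF c]]
  have "plot L (model (lie_prod L L)) (ph ` U) (%u. fst (inv_into U ph u) \<otimes> snd (inv_into U ph u))"
   by (rule plot_into[OF plot_mult[OF plot_out[OF q(1)] plot_out[OF q(2)]]], rule image_subsetI, rule C_closed(2))
   (use plotD(4)[OF q(1)] plotD(4)[OF q(2)] in "simp_all add: L_simps")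
  then show "plot L (model (lie_prod L L)) (ph ` U) (%u. case inv_into U ph u of (x, y) => x \<otimes>\<^bsub>L\<^esub> y)"
   by (simp add: L_simps split_beta)
 qed
 moreover have "smooth_map L L (%x. inv\<^bsub>L\<^esub> x)"
 proof (rule smooth_mapI[OF M M])
  show "inv\<^bsub>L\<^esub> x:carrier L" if "x:carrier L" for x using group.inv_closed[OF g that] .
  fix U ph assume c: "(U, ph):atlas L"
  note q = L.plot_chart_inverse[OF c]
  have "plot L (model L) (ph ` U) (%u. inv (inv_into U ph u))"
   by (rule plot_into[OF plot_inv[OF plot_out[OF q]]]) (use plotD(4)[OF q] C_closed in "auto simp: L_simps")
  then show "plot L (model L) (ph ` U) (%u. inv\<^bsub>L\<^esub> (inv_into U ph u))"
   by (rule plot_cong[rotated]) (use plotD(4)[OF q] i in "auto simp: L_simps")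
 qed
 ultimately show ?thesis using g smooth_manifold_L by (simp add: lie_group_def)
qed
end

section \<open>Splitting a simply connected group\<close>

lemma (in lie) neighborhood_induct:
 assumes "connected_space (topo G)" "openin (topo G) W" "\<one>:W" and g: "g:carrier G"
  and "Pr \<one>" "!!x w. x:carrier G ==> Pr x ==> w:W ==> Pr (x \<otimes> w)"
 shows "Pr g"
proof -
 have "W <= carrier G" using openin_subset[OF assms(2)] topspace by simp
 then have "{g:carrier G. Pr g} = carrier G"
  using assms(5,6) by (intro generated_by_neighborhood[OF assms(1-3)]) auto
 then show ?thesis using g by blast
qed

locale split_lie = killing_lie G for G :: "('a, 'v::euclidean_space) lie_structure" (structure) +
 fixes a b :: "'v set"
 assumes sc: "simply_connected_space (topo G)" and ds: "direct_sum (model G) a b"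
  and comm: "!!X Y. X:a ==> Y:b ==> br X Y = 0" "!!X Y. X:a ==> Y:b ==> br Y X = 0"
begin

lemma ab: "subspace a" "subspace b" "a <= model G" "b <= model G"
proof -
 show s: "subspace a" "subspace b" using ds by (auto simp: direct_sum_def)
 have V: "model G = {X + Y |X Y. X:a & Y:b}" using ds by (simp add: direct_sum_def)
 have "X + 0:model G" if "X:a" for X using that subspace_0[OF s(2)] unfolding V by blast
 then show "a <= model G" by auto
 have "0 + X:model G" if "X:b" for X using that subspace_0[OF s(1)] unfolding V by blast
 then show "b <= model G" by auto
qed

lemma con: "connected_space (topo G)"
 using sc path_connected_imp_connected_space by (auto simp: simply_connected_space_def)

lemma fixer_both:
 assumes g: "g:fixer a" "g:fixer b" shows "g:fixer (model G)"
 unfolding fixer_def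
proof (intro CollectI conjI ballI)
 show gc: "g:carrier G" using g by (simp add: fixer_def)
 fix Y assume "Y:model G"
 then obtain y z where "Y = y + z" "y:a" "z:b" using ds by (auto simp: direct_sum_def)
 then show "Ad G g Y = Y" using Ad_add(1)[OF gc, of y z] g ab by (auto simp: fixer_def)
qed

text \<open>The component of \<open>Ad G g X\<close> in the wrong ideal commutes with both ideals,
  and the algebra has no centre.\<close>

lemma fixer_invariant:
 "g:fixer b ==> X:a ==> Ad G g X:a" "g:fixer a ==> X:b ==> Ad G g X:b"
proof -
 obtain Qa Qb where Q: "linear Qa" "linear Qb" "!!x. Qa x:a" "!!x. Qb x:b" "!!x. x:model G ==> Qa x + Qb x = x"
  by (rule direct_sum_projections[OF ds], rule that)
 have z: "Ad G g 0 = 0" if "g:carrier G" for g using Ad_add(2)[OF that subspace_0[OF model], of 0] by simp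
 show "Ad G g X:a" if g: "g:fixer b" and X: "X:a"
 proof -
  have gc: "g:carrier G" and Xm: "X:model G" using g X ab by (auto simp: fixer_def)
  let ?Z = "Ad G g X"
  have Z: "Qa ?Z + Qb ?Z = ?Z" by (rule Q(5)[OF Ad_model[OF gc Xm]])
  have "Qb ?Z = 0"
  proof (rule centerless)
   show "Qb ?Z:model G" using Q(3,4) ab by blast
   fix Y assume "Y:model G"
   then obtain y z where Y: "Y = y + z" "y:a" "z:b" using ds by (auto simp: direct_sum_def)
   have "Ad G g (br X z) = br ?Z (Ad G g z)" using Ad_br[OF gc Xm] Y ab by blast
   moreover have "br X z = 0" "Ad G g z = z" using comm(1) g Y X by (auto simp: fixer_def)
   ultimately have "br (Qa ?Z + Qb ?Z) z = 0" using z[OF gc] Z by simp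
   then show "br (Qb ?Z) Y = 0"
   using comm(1)[OF Q(3) Y(3)] comm(2)[OF Y(2) Q(4)] by (simp add: Y(1) bilinear_comm[OF br_bilinear])
  qed
  then show ?thesis using Z Q(3,4)[of ?Z] by simp
 qed
 show "Ad G g X:b" if g: "g:fixer a" and X: "X:b"
 proof -
  have gc: "g:carrier G" and Xm: "X:model G" using g X ab by (auto simp: fixer_def)
  let ?Z = "Ad G g X"
  have Z: "Qa ?Z + Qb ?Z = ?Z" by (rule Q(5)[OF Ad_model[OF gc Xm]])
  have "Qa ?Z = 0"
  proof (rule centerless)
   show "Qa ?Z:model G" using Q(3,4) ab by blast
   fix Y assume "Y:model G"
   then obtain y z where Y: "Y = y + z" "y:a" "z:b" using ds by (auto simp: direct_sum_def)
   have "Ad G g (br X y) = br ?Z (Ad G g y)" using Ad_br[OF gc Xm] Y ab by blast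
   moreover have "br X y = 0" "Ad G g y = y" using comm(2) g Y X by (auto simp: fixer_def)
   ultimately have "br (Qa ?Z + Qb ?Z) y = 0" using z[OF gc] Z by simp
   then show "br (Qa ?Z) Y = 0"
   using comm(1)[OF Q(3) Y(3)] comm(2)[OF Y(2) Q(4)] by (simp add: Y(1) bilinear_comm[OF br_bilinear])
  qed
  then show ?thesis using Z Q(3,4)[of ?Z] by simp
 qed
qed

text \<open>Elements of the two stabilizers have commuting adjoint maps, so their commutator lies in
  the kernel of \<open>Ad\<close>, which is discrete.\<close>

lemma fixer_commutator:
 assumes g: "g:fixer b" and h: "h:fixer a" shows "inv (h \<otimes> g) \<otimes> (g \<otimes> h):fixer (model G)"
proof -
 have c: "g:carrier G" "h:carrier G" using g h by (auto simp: fixer_def)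
 have "Ad G (g \<otimes> h) X = Ad G (h \<otimes> g) X" if X: "X:model G" for X
 proof -
  obtain y z where X: "X = y + z" "y:a" "z:b" using ds X by (auto simp: direct_sum_def)
  have m: "y:model G" "z:model G" using X ab by auto
  have "Ad G (g \<otimes> h) y = Ad G (h \<otimes> g) y" "Ad G (g \<otimes> h) z = Ad G (h \<otimes> g) z"
   using fixer_invariant(1)[OF g X(2)] fixer_invariant(2)[OF h X(3)] g h X(2,3)
   by (simp_all add: Ad_mult[OF c m(1)] Ad_mult[OF c m(2)] Ad_mult[OF c(2,1) m(1)] Ad_mult[OF c(2,1) m(2)] fixer_def)
  then show ?thesis using c m by (simp add: X(1) Ad_add(1))
 qed
 then show ?thesis
  using c Ad_inv(2)[of "h \<otimes> g"] by (simp add: fixer_def Ad_mult[of "inv (h \<otimes> g)"] del: inv_mult_group)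
qed

text \<open>Near the identity the two stabilizers meet only in the identity, so small factors
  commute and multiply separately, and the coordinate projections are local homomorphisms. Simple
  connectedness extends both, and their algebraic relations spread from a neighbourhood to the whole
  group.\<close>

theorem split_homs:
 obtains Qa Qb Ps1 Ps2 N te ta W where "retract G Ps1 Qa a N te ta" "retract G Ps2 Qb b N te ta"
  "!!g. g:carrier G ==> Ps1 (Ps2 g) = \<one> & Ps2 (Ps1 g) = \<one> & Ps1 g \<otimes> Ps2 g = g"
  "!!g h. g:carrier G ==> h:carrier G ==> Ps1 g \<otimes> Ps2 h = Ps2 h \<otimes> Ps1 g"
  "openin (topo G) W" "\<one>:W" "!!g. g:W ==> g:fixer b ==> Ps1 g = g" "!!g. g:W ==> g:fixer a ==> Ps2 g = g"
proof -
 obtain Qa Qb where Q: "linear Qa" "linear Qb" "!!x. Qa x:a" "!!x. Qb x:b" "!!x. x:model G ==> Qa x + Qb x = x"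
  "!!x y. x:a ==> y:b ==> Qa (x + y) = x & Qb (x + y) = y"
  by (rule direct_sum_projections[OF ds], rule that)
 have Qab: "x:a ==> Qa x = x & Qb x = 0" "x:b ==> Qb x = x & Qa x = 0" for x
  using Q(6)[of x 0] Q(6)[of 0 x] ab subspace_0 by auto
 have fc: "fixer c <= carrier G" for c by (auto simp: fixer_def)
 have cA: "EX c. gvel c X & range c <= fixer b" if "X:a" for X using fixer_curve[of X b] comm(1)[OF that] ab that by blast
 have cB: "EX c. gvel c X & range c <= fixer a" if "X:b" for X using fixer_curve[of X a] comm(2)[OF _ that] ab that by blast
 define M where "M s = {x:model G. norm (Qa x) < s & norm (Qb x) < s}" for s
 obtain al be ta r where r: "0 < r" and al: "!!x. al x:fixer b" and be: "!!x. be x:fixer a" and z: "al 0 = \<one>" "be 0 = \<one>"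
  and alQ: "!!x y. Qa x = Qa y ==> al x = al y" and beQ: "!!x y. Qb x = Qb y ==> be x = be y"
  and pl: "plot G (model G) (M r) al" "plot G (model G) (M r) be"
  and op: "!!s. s <= r ==> openin (topo G) ((%x. al x \<otimes> be x) ` M s)"
  and ta: "!!x. x:model G ==> norm (Qa x) < r ==> norm (Qb x) < r ==> ta (al x \<otimes> be x) = x"
  and tU: "(%x. al x \<otimes> be x) ` M r <= U1" and sm: "smooth_on (model G) (ch ` (%x. al x \<otimes> be x) ` M r) (%u. ta (th u))"
  by (rule split_chart[OF Q(1-5) ab fc fixer_closed(1,2)[OF ab(4)] cA fc fixer_closed(1,2)[OF ab(3)] cB, folded M_def], assumption+, rule that)
 define te where "te x = al x \<otimes> be x" for x
 note op = op[folded te_def] and ta = ta[folded te_def] and tU = tU[folded te_def] and sm = sm[folded te_def]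
 have c: "al x:carrier G" "be x:carrier G" for x using al be fc by blast+
 have Mr: "opn (model G) (M r)" by (rule plotD(2)[OF pl(1)])
 have zM: "0:M s" if "0 < s" for s using that subspace_0[OF model] by (simp add: M_def linear_0[OF Q(1)] linear_0[OF Q(2)])
 have Mmono: "M s <= M t" if "s <= t" for s t using that by (auto simp: M_def)
 have tate: "ta (te x) = x" if "x:M s" "s <= r" for x s using ta[of x] that by (auto simp: M_def)
 have QM: "Qa x:M s" "Qb x:M s" if "x:M s" for x s
 proof -
  have "norm (Qa x) < s" using that by (simp add: M_def)
  then have "0 < s" using norm_ge_zero[of "Qa x"] by linarith
  then show "Qa x:M s" "Qb x:M s" using that Q(3,4)[of x] Qab(1)[of "Qa x"] Qab(2)[of "Qb x"] ab by (auto simp: M_def)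
 qed
 have small: "EX s>0. s <= r & (ALL x:M s. ALL y:M s. q (x, y):W)"
  if q: "plot G (model G \<times> model G) (M r \<times> M r) q" "q (0, 0) = \<one>" and W: "openin (topo G) W" "\<one>:W" for q W
 proof -
  have "opn (model G \<times> model G) {z:M r \<times> M r. q z:W}" by (rule plot_preimage[OF q(1) W(1)])
  moreover have "(0, 0):{z:M r \<times> M r. q z:W}" using q(2) W(2) zM[OF r] by simp
  ultimately obtain e where e: "0 < e" "ball (0, 0) e Int (model G \<times> model G) <= {z:M r \<times> M r. q z:W}"
   unfolding openin_contains_ball by blast
  define s where "s = min r (e / 4)"
  have "q (x, y):W" if xy: "x:M s" "y:M s" for x y
  proof -
   have n: "norm x < e / 2" if "x:M s" for x
   using that Q(5)[of x] norm_triangle_ineq[of "Qa x" "Qb x"] by (auto simp: M_def s_def)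
   have "norm (x, y) < e" using norm_Pair_le[of x y] n[OF xy(1)] n[OF xy(2)] by simp
   then have "(x, y):ball (0, 0) e Int (model G \<times> model G)" using xy by (simp add: M_def dist_norm norm_Pair)
   then show ?thesis using e(2) by blast
  qed
  then show ?thesis using r e(1) by (intro exI[of _ s]) (auto simp: s_def)
 qed
 have V2: "subspace (model G \<times> model G)" "opn (model G \<times> model G) (M r \<times> M r)" by (intro subspace_Times model openin_Times Mr)+
 have p2: "plot G (model G \<times> model G) (M r \<times> M r) (%z. p (fst z))" "plot G (model G \<times> model G) (M r \<times> M r) (%z. p (snd z))"
  if "plot G (model G) (M r) p" for p
  by (rule plot_compose[OF that V2 smooth_on_linear]; auto intro: bounded_linear_fst bounded_linear_snd)+
 obtain W0 where W0: "openin (topo G) W0" "\<one>:W0" "!!g. g:W0 ==> g:fixer (model G) ==> g = \<one>"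
  by (rule Ad_locally_injective, rule that)
 obtain s1 where s1: "0 < s1" "s1 <= r" "!!x. x:M s1 ==> al x:W0"
  using small[OF p2(1)[OF pl(1)] _ W0(1,2)] z by auto
 obtain s2 where s2: "0 < s2" "s2 <= r" "!!x. x:M s2 ==> be x:W0"
  using small[OF p2(1)[OF pl(2)] _ W0(1,2)] z by auto
 define s where "s = min s1 s2"
 have s: "0 < s" "s <= r" and sW: "!!x. x:M s ==> al x:W0 & be x:W0"
  using s1 s2 Mmono[of s s1] Mmono[of s s2] by (auto simp: s_def)
 have oneW: "\<one>:te ` M t" if "0 < t" for t
  by (rule image_eqI[OF _ zM[OF that]]) (simp add: te_def z)
 \<comment> \<open>The factor from the other stabilizer lies in \<open>W0\<close> and in the kernel
   of \<open>Ad\<close>, so it is the identity.\<close>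
 have A_only: "g = al x" if g: "g:fixer b" "g = te x" "x:M s" for g x
 proof -
  have "be x = inv (al x) \<otimes> g" using c[of x] by (simp add: g(2) te_def m_assoc[symmetric])
  then have "be x:fixer b" using fixer_closed(2,3)[OF ab(4)] al g(1) by simp
  then have "be x = \<one>" using W0(3) sW[OF g(3)] fixer_both[OF be] by blast
  then show ?thesis using c by (simp add: g(2) te_def)
 qed
 have B_only: "g = be x" if g: "g:fixer a" "g = te x" "x:M s" for g x
 proof -
  have "al x = g \<otimes> inv (be x)" using c[of x] by (simp add: g(2) te_def m_assoc)
  then have "al x:fixer a" using fixer_closed(2,3)[OF ab(3)] be g(1) by simp
  then have "al x = \<one>" using W0(3) sW[OF g(3)] fixer_both[OF _ al] by blast
  then show ?thesis using c by (simp add: g(2) te_def)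
 qed
 obtain t1 where t1: "0 < t1" "t1 <= r" "!!x y. x:M t1 ==> y:M t1 ==> al x \<otimes> al y:te ` M s"
  using small[OF plot_mult[OF p2(1)[OF pl(1)] p2(2)[OF pl(1)]] _ op[OF s(2)] oneW[OF s(1)]] z by auto
 obtain t2 where t2: "0 < t2" "t2 <= r" "!!x y. x:M t2 ==> y:M t2 ==> be x \<otimes> be y:te ` M s"
  using small[OF plot_mult[OF p2(1)[OF pl(2)] p2(2)[OF pl(2)]] _ op[OF s(2)] oneW[OF s(1)]] z by auto
 obtain t3 where t3: "0 < t3" "t3 <= r" "!!x y. x:M t3 ==> y:M t3 ==> inv (be y \<otimes> al x) \<otimes> (al x \<otimes> be y):W0"
  using small[OF plot_mult[OF plot_inv[OF plot_mult[OF p2(2)[OF pl(2)] p2(1)[OF pl(1)]]] plot_mult[OF p2(1)[OF pl(1)] p2(2)[OF pl(2)]]] _ W0(1,2)] z by auto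
 \<comment> \<open>\<open>t1\<close> and \<open>t2\<close> keep products of factors of one kind
   inside the chart, \<open>t3\<close> makes commutators small enough to be trivial.\<close>
 define t where "t = Min {s, t1, t2, t3}"
 have t: "0 < t" "t <= r" "t <= s" "t <= t1" "t <= t2" "t <= t3" using s t1 t2 t3 by (auto simp: t_def)
 have com: "al x \<otimes> be y = be y \<otimes> al x" if "x:M t" "y:M t" for x y
 proof -
  have "inv (be y \<otimes> al x) \<otimes> (al x \<otimes> be y) = \<one>"
   using W0(3) t3(3)[of x y] fixer_commutator[OF al be] that Mmono[OF t(6)] by blast
  then show ?thesis using c by (metis inv_solve_left m_closed r_one inv_closed one_closed)
 qed
 have mult: "EX z. z:M s & te x \<otimes> te y = te z & al z = al x \<otimes> al y & be z = be x \<otimes> be y" if xy: "x:M t" "y:M t" for x y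
 proof -
  obtain u where u: "u:M s" "al x \<otimes> al y = te u" using t1(3)[of x y] xy Mmono[OF t(4)] by blast
  obtain v where v: "v:M s" "be x \<otimes> be y = te v" using t2(3)[of x y] xy Mmono[OF t(5)] by blast
  have au: "al x \<otimes> al y = al u" by (rule A_only[OF fixer_closed(2)[OF ab(4) al al] u(2,1)])
  have bv: "be x \<otimes> be y = be v" by (rule B_only[OF fixer_closed(2)[OF ab(3) be be] v(2,1)])
  \<comment> \<open>The coordinates of the product: the \<open>a\<close>-part comes from the product
    of the first factors, the \<open>b\<close>-part from that of the second.\<close>
  let ?z = "Qa u + Qb v"
  have Qz: "Qa ?z = Qa u" "Qb ?z = Qb v" using Q(6)[OF Q(3,4)] by blast+
  have az: "al ?z = al u" "be ?z = be v" by (rule alQ[OF Qz(1)] beQ[OF Qz(2)])+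
  have "?z:M s" using u(1) v(1) Q(3,4) ab Qz subspace_add[OF model] by (auto simp: M_def subset_iff)
  moreover have "te x \<otimes> te y = (al x \<otimes> al y) \<otimes> (be x \<otimes> be y)"
   unfolding te_def using c com[OF xy(2,1)] by (simp add: m_assoc) (simp add: m_assoc[symmetric])
  ultimately show ?thesis using az au bv by (intro exI[of _ ?z]) (simp add: te_def)
 qed
 let ?W = "te ` M t"
 note W = op[OF t(2)] oneW[OF t(1)]
 have plr: "plot G (model G) (M r) te" unfolding te_def by (rule plot_mult[OF pl])
 have "M t = {x:M r. te x:?W}" using Mmono[OF t(2)] tate[OF _ order_refl] tate[OF _ t(2)] by (auto simp: image_iff) metis
 then have oM: "opn (model G) (M t)" using plot_preimage[OF plr W(1)] by simp
 have plt: "plot G (model G) (M t) te" by (rule plot_subset[OF plr oM Mmono[OF t(2)]])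
 have path: "EX gm. pathin (topo G) gm & gm 0 = \<one> & gm 1 = w & (ALL tu:{0..1}. gm tu:?W)" if w: "w:?W" for w
 proof -
  obtain x where x: "x:M t" "w = te x" using w by blast
  have m: "tu *\<^sub>R x:M t" if "tu:{0..1}" for tu
  proof -
   have "tu * norm y < t" if "norm y < t" for y :: 'v
   using mult_left_le_one_le[of "norm y" tu] \<open>tu:{0..1}\<close> that by auto
   then show ?thesis using x(1) that subspace_scale[OF model] by (auto simp: M_def linear_scale[OF Q(1)] linear_scale[OF Q(2)])
  qed
  have "continuous_map (top_of_set {0..1}) (top_of_set (M t)) (%tu. tu *\<^sub>R x)" using m by (auto intro!: continuous_intros)
  from continuous_map_compose[OF this plot_continuous[OF plt]] have "pathin (topo G) (%tu. te (tu *\<^sub>R x))" by (simp add: pathin_def o_def)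
  then show ?thesis using m x(2) z by (intro exI[of _ "%tu. te (tu *\<^sub>R x)"]) (simp add: te_def)
 qed
 have ext: "EX Ps. Ps:hom G G & (ALL x:M t. Ps (te x) = sg x)"
  if sg: "!!x. sg x:carrier G" "!!x y z. x:M t ==> y:M t ==> z:M s ==> al z = al x \<otimes> al y ==> be z = be x \<otimes> be y ==> sg z = sg x \<otimes> sg y" for sg
 proof -
  have "local_hom_axioms G G ?W (%g. sg (ta g))"
  proof (rule local_hom_axioms.intro[OF W path])
   fix v w assume "v:?W" "w:?W"
   then obtain x y where xy: "x:M t" "y:M t" "v = te x" "w = te y" by blast
   obtain z where z: "z:M s" "te x \<otimes> te y = te z" "al z = al x \<otimes> al y" "be z = be x \<otimes> be y" using mult[OF xy(1,2)] by blast
   show "sg (ta (v \<otimes> w)) = sg (ta v) \<otimes> sg (ta w)"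
   using sg(2)[OF xy(1,2) z(1,3,4)] by (simp add: xy(3,4) z(2) tate[OF z(1) s(2)] tate[OF xy(1) t(2)] tate[OF xy(2) t(2)])
  qed (assumption, rule sg(1))
  then interpret lh: local_hom G G ?W "%g. sg (ta g)" by (rule local_hom.intro[OF lie_axioms group_axioms])
  obtain Ps where "Ps:hom G G" "!!w. w:?W ==> Ps w = sg (ta w)" by (rule lh.local_hom_extension[OF sc], rule that)
  then show ?thesis using tate[OF _ t(2)] by auto
 qed
 obtain Ps1 where Ps1: "Ps1:hom G G" "!!x. x:M t ==> Ps1 (te x) = al x" using ext[of al] c(1) by blast
 obtain Ps2 where Ps2: "Ps2:hom G G" "!!x. x:M t ==> Ps2 (te x) = be x" using ext[of be] c(2) by blast
 interpret h1: group_hom G G Ps1 using Ps1(1) group_axioms by (simp add: group_hom_defs)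
 interpret h2: group_hom G G Ps2 using Ps2(1) group_axioms by (simp add: group_hom_defs)
 have teQ: "al x = te (Qa x)" "be x = te (Qb x)" "al (Qa x) = al x" "be (Qa x) = \<one>" "al (Qb x) = \<one>" "be (Qb x) = be x" for x
 proof -
  have q: "Qa (Qa x) = Qa x" "Qb (Qb x) = Qb x" "Qb (Qa x) = Qb 0" "Qa (Qb x) = Qa 0"
   using Qab Q(3,4) linear_0[OF Q(1)] linear_0[OF Q(2)] by auto
  show "al (Qa x) = al x" "be (Qa x) = \<one>" "al (Qb x) = \<one>" "be (Qb x) = be x"
   using alQ[OF q(1)] beQ[OF q(2)] beQ[OF q(3)] alQ[OF q(4)] z by auto
  then show "al x = te (Qa x)" "be x = te (Qb x)" using c[of x] by (auto simp: te_def)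
 qed
 have on: "Ps1 (al x) = al x" "Ps2 (be x) = be x" "Ps1 (be x) = \<one>" "Ps2 (al x) = \<one>" if x: "x:M t" for x
  using Ps1(2)[OF QM(1)[OF x]] Ps1(2)[OF QM(2)[OF x]] Ps2(2)[OF QM(1)[OF x]] Ps2(2)[OF QM(2)[OF x]]
  by (simp_all only: teQ(3-6) teQ(1,2)[symmetric])
 note ind = neighborhood_induct[OF con W]
 have idem: "Ps1 (Ps1 g) = Ps1 g & Ps2 (Ps2 g) = Ps2 g & Ps1 (Ps2 g) = \<one> & Ps2 (Ps1 g) = \<one>" if "g:carrier G" for g
 proof (rule ind[OF that])
  fix g w assume g: "g:carrier G" "Ps1 (Ps1 g) = Ps1 g & Ps2 (Ps2 g) = Ps2 g & Ps1 (Ps2 g) = \<one> & Ps2 (Ps1 g) = \<one>" and "w:?W"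
  then obtain x where x: "x:M t" "w = te x" by blast
  have "w:carrier G" using c by (simp add: x te_def)
  then show "Ps1 (Ps1 (g \<otimes> w)) = Ps1 (g \<otimes> w) & Ps2 (Ps2 (g \<otimes> w)) = Ps2 (g \<otimes> w) & Ps1 (Ps2 (g \<otimes> w)) = \<one> & Ps2 (Ps1 (g \<otimes> w)) = \<one>"
   using g Ps1(2)[OF x(1)] Ps2(2)[OF x(1)] on[OF x(1)] c by (simp add: x(2))
 qed simp
 have com1: "al x \<otimes> Ps2 h = Ps2 h \<otimes> al x" if x: "x:M t" and h: "h:carrier G" for x h
 proof (rule ind[OF h])
  fix h w assume h: "h:carrier G" "al x \<otimes> Ps2 h = Ps2 h \<otimes> al x" and "w:?W"
  then obtain y where y: "y:M t" "w = te y" by blast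
  have "w:carrier G" using c by (simp add: y te_def)
  then have e: "Ps2 (h \<otimes> w) = Ps2 h \<otimes> be y" using h Ps2(2)[OF y(1)] by (simp add: y(2))
  have "al x \<otimes> (Ps2 h \<otimes> be y) = (Ps2 h \<otimes> al x) \<otimes> be y" using h c by (simp add: m_assoc[symmetric])
  also have "... = (Ps2 h \<otimes> be y) \<otimes> al x" using h c com[OF x y(1)] by (simp add: m_assoc)
  finally show "al x \<otimes> Ps2 (h \<otimes> w) = Ps2 (h \<otimes> w) \<otimes> al x" by (simp only: e)
 qed (use c in simp)
 have com2: "Ps1 g \<otimes> Ps2 h = Ps2 h \<otimes> Ps1 g" if g: "g:carrier G" and h: "h:carrier G" for g h
 proof (rule ind[OF g])
  fix g w assume g: "g:carrier G" "Ps1 g \<otimes> Ps2 h = Ps2 h \<otimes> Ps1 g" and "w:?W"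
  then obtain x where x: "x:M t" "w = te x" by blast
  have "w:carrier G" using c by (simp add: x te_def)
  then have e: "Ps1 (g \<otimes> w) = Ps1 g \<otimes> al x" using g Ps1(2)[OF x(1)] by (simp add: x(2))
  have "(Ps1 g \<otimes> al x) \<otimes> Ps2 h = Ps1 g \<otimes> (Ps2 h \<otimes> al x)" using g(1) h c com1[OF x(1) h] by (simp add: m_assoc)
  also have "... = (Ps2 h \<otimes> Ps1 g) \<otimes> al x" using g h c by (simp add: m_assoc[symmetric])
  also have "... = Ps2 h \<otimes> (Ps1 g \<otimes> al x)" using g(1) h c by (simp add: m_assoc)
  finally show "Ps1 (g \<otimes> w) \<otimes> Ps2 h = Ps2 h \<otimes> Ps1 (g \<otimes> w)" by (simp only: e)
 qed (use h in simp)
 have prod: "Ps1 g \<otimes> Ps2 g = g" if g: "g:carrier G" for g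
 proof (rule ind[OF g])
  fix g w assume g: "g:carrier G" "Ps1 g \<otimes> Ps2 g = g" and "w:?W"
  then obtain x where x: "x:M t" "w = te x" by blast
  have "w:carrier G" using c by (simp add: x te_def)
  then have e: "Ps1 (g \<otimes> w) = Ps1 g \<otimes> al x" "Ps2 (g \<otimes> w) = Ps2 g \<otimes> be x" using g Ps1(2)[OF x(1)] Ps2(2)[OF x(1)] by (simp_all add: x(2))
  have "(Ps1 g \<otimes> al x) \<otimes> (Ps2 g \<otimes> be x) = Ps1 g \<otimes> (al x \<otimes> Ps2 g) \<otimes> be x" using g(1) c by (simp add: m_assoc)
  also have "... = (Ps1 g \<otimes> Ps2 g) \<otimes> (al x \<otimes> be x)" unfolding com1[OF x(1) g(1)] using g(1) c by (simp add: m_assoc)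
  finally show "Ps1 (g \<otimes> w) \<otimes> Ps2 (g \<otimes> w) = g \<otimes> w" unfolding e g(2) by (simp only: x(2) te_def)
 qed simp
 have smt: "smooth_on (model G) (ch ` te ` M t) (%u. ta (th u))" "te ` M t <= U1"
  by (rule smooth_on_subset[OF sm image_mono[OF image_mono[OF Mmono[OF t(2)]]] order_refl])
   (rule order_trans[OF image_mono[OF Mmono[OF t(2)]] tU])
 have t0: "te 0 = \<one>" by (simp add: te_def z)
 show ?thesis
 proof (rule that[of Ps1 Qa "M t" te ta Ps2 Qb ?W])
  have f: "!!g. g:carrier G ==> Ps1 (Ps1 g) = Ps1 g" "!!g. g:carrier G ==> Ps2 (Ps2 g) = Ps2 g"
   "!!x. x:a ==> Qa x = x" "!!x. x:b ==> Qb x = x" "!!x. x:M t ==> Ps1 (te x) = te (Qa x)" "!!x. x:M t ==> Ps2 (te x) = te (Qb x)"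
   using idem Qab Ps1(2) Ps2(2) teQ(1,2) by simp_all
  note fs = f Ps1(1) Ps2(1) ab Q(1-4) smt oM plt W t0 zM[OF t(1)] QM tate[OF _ t(2)]
  show "retract G Ps1 Qa a (M t) te ta" by (rule retract.intro[OF lie_axioms], rule retract_axioms.intro) (fact fs)+
  show "retract G Ps2 Qb b (M t) te ta" by (rule retract.intro[OF lie_axioms], rule retract_axioms.intro) (fact fs)+
  show "Ps1 g = g" if g: "g:?W" "g:fixer b" for g
  proof -
   obtain x where x: "x:M t" "g = te x" using g(1) by blast
   have "x:M s" using Mmono[OF t(3)] x(1) by blast
   then show ?thesis using A_only[OF g(2) x(2)] on(1)[OF x(1)] by simp
  qed
  show "Ps2 g = g" if g: "g:?W" "g:fixer a" for g
  proof -
   obtain x where x: "x:M t" "g = te x" using g(1) by blast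
   have "x:M s" using Mmono[OF t(3)] x(1) by blast
   then show ?thesis using B_only[OF g(2) x(2)] on(2)[OF x(1)] by simp
  qed
  show "Ps1 (Ps2 g) = \<one> & Ps2 (Ps1 g) = \<one> & Ps1 g \<otimes> Ps2 g = g" if "g:carrier G" for g using idem[OF that] prod[OF that] by simp
 qed (fact W com2)+
qed
end

lemma (in retract) C_nontrivial:
 assumes "a ~= {0}" shows "C ~= {\<one>}"
proof
 assume C: "C = {\<one>}"
 obtain X where X: "X:a" "X ~= 0" using assms subspace_0[OF a(1)] by auto
 obtain e where e: "0 < e" "ball 0 e Int model G <= N" using N(1,2) unfolding openin_contains_ball by blast
 let ?Y = "(e / (2 * norm X)) *\<^sub>R X"
 have Y: "?Y:a" "?Y ~= 0" "norm ?Y < e" using X e(1) subspace_scale[OF a(1)] by auto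
 then have YN: "?Y:N" using e(2) a(2) by auto
 have "E (te ?Y):C" using te_carrier[OF YN] by (simp add: C_def)
 then have "te ?Y = te 0" using C Ete[OF YN] a(5)[OF Y(1)] te(3) by simp
 then show False using ta(1)[OF YN] ta(1)[OF N(2)] Y(2) by simp
qed

section \<open>Connected Lie subgroups and the splitting of a pair\<close>

locale lie_pair = lie G for G :: "('a, 'v::euclidean_space) lie_structure" (structure) +
 fixes H :: "('a, 'v) lie_structure"
 assumes sub: "lie_subgroup G H" and con_H: "connected_space (topo H)"
begin

sublocale H: lie H
 using sub by (simp add: lie_def lie_axioms_def lie_subgroup_def lie_group_def)

abbreviation "io \<equiv> diff_at_one H G (%x. x)"
abbreviation "alg \<equiv> subgroup_algebra G H"

lemma inclusion: "smooth_map H G (%x. x)" "(%x. x):hom H G" "inj_on io (model H)"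
 using sub by (auto simp: lie_subgroup_def)

sublocale i: group_hom H G "%x. x"
 using inclusion H.group_axioms group_axioms by (simp add: group_hom_defs)

lemma HG: "h:carrier H ==> h:carrier G"
 by (rule i.hom_closed)

lemma gvel_inclusion: "H.gvel c X ==> gvel c (io X)" and alg_subspace: "subspace alg" and alg_model: "X:alg ==> X:model G"
 and io_add: "X:model H ==> Y:model H ==> io (X + Y) = io X + io Y"
proof -
 obtain A where A: "linear A" "!!c X. H.gvel c X ==> gvel (%t. c t) (A X)" "!!X. X:model H ==> io X = A X"
  by (rule gvel_map[OF H.lie_axioms lie_axioms inclusion(1) i.hom_one]) blast
 show g: "H.gvel c X ==> gvel c (io X)" for c X using A(2,3) H.gvel_model by metis
 show "io (X + Y) = io X + io Y" if "X:model H" "Y:model H"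
  using that A(3) subspace_add[OF H.model] by (simp add: linear_add[OF A(1)])
 have "alg = A ` model H" using A(3) by (auto simp: subgroup_algebra_def)
 then show "subspace alg" using linear_subspace_image[OF A(1) H.model] by simp
 show "X:alg ==> X:model G" using g[OF H.gvel_curve] gvel_model by (auto simp: subgroup_algebra_def)
qed

lemma alg_curve:
 assumes "X:alg" obtains d c where "H.intcurve (inv_into (model H) io X) d c" "intcurve X d c"
proof -
 let ?Y = "inv_into (model H) io X"
 have Y: "?Y:model H" "io ?Y = X" using assms unfolding subgroup_algebra_def by (rule inv_into_into, rule f_inv_into_f)
 obtain d c where c: "H.intcurve ?Y d c" using H.intcurve_exists[OF Y(1)] by blast
 show ?thesis by (rule that[OF c]) (use intcurve_map[OF H.lie_axioms lie_axioms inclusion(1,2) c] Y(2) in simp)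
qed
end

text \<open>The point is that the projections map \<open>H\<close> into itself. The elements of
  \<open>H\<close> that \<open>Ps1\<close> maps into \<open>H\<close> are closed under
  multiplication and include curves in the directions of both parts of the Lie algebra of
  \<open>H\<close>, so they exhaust \<open>H\<close>; for \<open>Ps2\<close> the product formula is
  used.\<close>

theorem (in split_lie) split_decomposable:
 assumes H: "lie_subgroup G H" "connected_space (topo H)" and ne: "a ~= {0}" "b ~= {0}"
  and split: "!!X. X:subgroup_algebra G H ==> EX X1:a Int subgroup_algebra G H. EX X2:b Int subgroup_algebra G H. X = X1 + X2"
 shows "decomposable_pair G (carrier H)"
proof -
 obtain Qa Qb Ps1 Ps2 N te ta W where r: "retract G Ps1 Qa a N te ta" "retract G Ps2 Qb b N te ta"
  and Ps: "!!g. g:carrier G ==> Ps1 (Ps2 g) = \<one> & Ps2 (Ps1 g) = \<one> & Ps1 g \<otimes> Ps2 g = g"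
  "!!g h. g:carrier G ==> h:carrier G ==> Ps1 g \<otimes> Ps2 h = Ps2 h \<otimes> Ps1 g"
  and W: "openin (topo G) W" "\<one>:W" "!!g. g:W ==> g:fixer b ==> Ps1 g = g" "!!g. g:W ==> g:fixer a ==> Ps2 g = g"
  by (rule split_homs, rule that)
 interpret R1: retract G Ps1 Qa a N te ta by (rule r)
 interpret R2: retract G Ps2 Qb b N te ta by (rule r)
 interpret lie_pair G H by (rule lie_pair.intro[OF lie_axioms lie_pair_axioms.intro[OF H]])
 define M where "M = {h:carrier H. Ps1 h:carrier H}"
 have M: "\<one>\<^bsub>H\<^esub>:M" "!!x y. x:M ==> y:M ==> x \<otimes>\<^bsub>H\<^esub> y:M"
  using i.hom_one i.hom_closed i.hom_mult H.m_closed H.one_closed by (auto simp: M_def)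
 have curve: "EX c. H.gvel c X & range c <= M" if X: "X:model H" "io X:a \<or> io X:b" for X
 proof -
  obtain d c where c: "H.intcurve X d c" using H.intcurve_exists[OF X(1)] by blast
  have Gc: "intcurve (io X) d (%t. c t)" by (rule intcurve_map[OF H.lie_axioms lie_axioms inclusion(1,2) c])
  obtain e where e: "0 < e" "{-e<..<e} <= {t:{-d<..<d}. c t:W}"
   using opn_line[OF plot_preimage[OF intcurveD(2)[OF Gc] W(1)]] intcurveD(1,3)[OF Gc] W(2) by auto
  have "c t:M" if "\<bar>t\<bar> < e" for t
  proof -
   have "t:{-e<..<e}" using that by (auto simp: abs_less_iff)
   then have t: "t:{-d<..<d}" "c t:W" using e(2) by blast+
   then have td: "\<bar>t\<bar> < d" by (auto simp: abs_less_iff)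
   have ct: "c t:carrier H" "c t:carrier G" using H.intcurve_carrier[OF c td] HG by auto
   show ?thesis
   proof (cases "io X:a")
   case True
   then have "Ps1 (c t) = c t" by (intro W(3)[OF t(2)] intcurve_fixer[OF Gc ab(4) comm(1) td])
   then show ?thesis using ct by (simp add: M_def)
   next
   case False
   then have "io X:b" using X(2) by blast
   then have "Ps2 (c t) = c t" by (intro W(4)[OF t(2)] intcurve_fixer[OF Gc ab(3) comm(2) td])
   then have "Ps1 (c t) = \<one>" using Ps(1)[OF ct(2)] by simp
   then show ?thesis using ct i.hom_one H.one_closed by (simp add: M_def)
   qed
  qed
  then show ?thesis by (rule H.gvel_restrict[OF H.intcurve_gvel[OF c] e(1) _ M(1)])
 qed
 have "M = carrier H"
 proof (rule H.generated_by_curves[OF H(2) _ M])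
  fix X assume X: "X:model H"
  then have "io X:subgroup_algebra G H" by (simp add: subgroup_algebra_def)
  then obtain X1 X2 where Y: "io X1:a" "io X2:b" "X1:model H" "X2:model H" "io X = io X1 + io X2"
   using split unfolding subgroup_algebra_def by blast
  obtain c1 c2 where "H.gvel c1 X1" "range c1 <= M" "H.gvel c2 X2" "range c2 <= M" using curve Y(1-4) by blast
  moreover have "X = X1 + X2"
   using inj_onD[OF inclusion(3), of X "X1 + X2"] X Y(3-5) io_add[OF Y(3,4)] subspace_add[OF H.model Y(3,4)] by simp
  ultimately show "EX c. H.gvel c X & range c <= M"
   using H.gvel_mult M(2) by (intro exI[of _ "%t. c1 t \<otimes>\<^bsub>H\<^esub> c2 t"]) (auto simp: image_subset_iff)
 qed (auto simp: M_def)
 then have H1: "Ps1 h:carrier H" if "h:carrier H" for h using that by (auto simp: M_def)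
 have H2: "Ps2 h:carrier H" if h: "h:carrier H" for h
 proof -
  have iH: "inv (Ps1 h):carrier H" using i.hom_inv[OF H1[OF h]] H.inv_closed[OF H1[OF h]] by simp
  have "Ps2 h = inv (Ps1 h) \<otimes> (Ps1 h \<otimes> Ps2 h)" using HG[OF h] by (simp add: m_assoc[symmetric])
  then show ?thesis using i.hom_mult[OF iH h] H.m_closed[OF iH h] Ps(1)[OF HG[OF h]] by simp
 qed
 define f where "f g = (Ps1 g, Ps2 g)" for g
 let ?P = "lie_prod R1.L R2.L"
 have cP: "carrier ?P = R1.C \<times> R2.C" "x \<otimes>\<^bsub>?P\<^esub> y = (fst x \<otimes> fst y, snd x \<otimes> snd y)" for x y
  by (auto simp: lie_prod_def R1.L_simps R2.L_simps DirProd_def split_beta)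
 have cc: "Ps1 g:R1.C" "Ps2 g:R2.C" if "g:carrier G" for g using that by (auto simp: R1.C_def R2.C_def)
 have fi: "f (x \<otimes> y) = (x, y)" if "x:R1.C" "y:R2.C" for x y
 proof -
  have m: "x:carrier G" "Ps1 x = x" "y:carrier G" "Ps2 y = y" using that by (simp_all add: R1.C_iff R2.C_iff)
  have "Ps1 y = \<one>" "Ps2 x = \<one>" using Ps(1)[OF m(1)] Ps(1)[OF m(3)] m by auto
  then show ?thesis using m by (simp add: f_def)
 qed
 have bij: "bij_betw f (carrier G) (carrier ?P)"
 proof (rule bij_betw_byWitness[where f' = "%z. fst z \<otimes> snd z"])
  show "ALL g:carrier G. fst (f g) \<otimes> snd (f g) = g" using Ps(1) by (simp add: f_def)
  show "ALL z:carrier ?P. f (fst z \<otimes> snd z) = z" using fi by (simp add: cP(1) mem_Times_iff)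
  show "f ` carrier G <= carrier ?P" using cc by (simp add: cP(1) f_def image_subset_iff)
  show "(%z. fst z \<otimes> snd z) ` carrier ?P <= carrier G" by (auto simp: cP(1) R1.C_iff R2.C_iff)
 qed
 have inv: "inv_into (carrier G) f z = fst z \<otimes> snd z" if "z:carrier ?P" for z
  by (rule inv_into_f_eq[OF bij_betw_imp_inj_on[OF bij]]) (use that fi in "auto simp: cP R1.C_iff R2.C_iff")
 have L: "pre_manifold R1.L" "pre_manifold R2.L" by (intro smooth_manifold_pre R1.smooth_manifold_L R2.smooth_manifold_L)+
 note LP = pre_manifold_prod[OF L]
 interpret LP: manifold ?P by standard (rule LP)
 have "lie_iso G ?P f"
  unfolding lie_iso_def
 proof (intro conjI)
  have "f:hom G ?P" using cc by (auto simp: hom_def cP f_def)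
  then show "f:iso G ?P" using bij by (simp add: iso_def)
  show "smooth_map G ?P f"
  proof (rule smooth_mapI[OF manifold.M[OF manifold_axioms] LP])
   show "f x:carrier ?P" if "x:carrier G" for x using cc[OF that] by (simp add: cP f_def)
   fix U ph assume "(U, ph):atlas G"
   note q = plot_chart_inverse[OF this]
   show "plot ?P (model G) (ph ` U) (%u. f (inv_into U ph u))" unfolding f_def by (rule plot_Pair[OF R1.plot_E[OF q] R2.plot_E[OF q]])
  qed
  show "smooth_map ?P G (inv_into (carrier G) f)"
  proof (rule smooth_mapI[OF LP manifold.M[OF manifold_axioms]])
   show "inv_into (carrier G) f z:carrier G" if "z:carrier ?P" for z using that inv[OF that] by (auto simp: cP R1.C_iff R2.C_iff)
   fix U ph assume "(U, ph):atlas ?P"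
   note q = LP.plot_chart_inverse[OF this]
   note q12 = plot_fst_snd[OF L q]
   show "plot G (model ?P) (ph ` U) (%u. inv_into (carrier G) f (inv_into U ph u))"
   by (rule plot_cong[OF _ plot_mult[OF R1.plot_out[OF q12(1)] R2.plot_out[OF q12(2)]]])
   (rule inv[symmetric], rule plotD(4)[OF q])
  qed
 qed
 moreover have "f ` carrier H = (Ps1 ` carrier H) \<times> (Ps2 ` carrier H)"
 proof
  show "Ps1 ` carrier H \<times> Ps2 ` carrier H <= f ` carrier H"
  proof clarify
   fix h k assume hk: "h:carrier H" "k:carrier H"
   have "f (Ps1 h \<otimes> Ps2 k) = (Ps1 h, Ps2 k)" by (rule fi[OF cc(1)[OF HG[OF hk(1)]] cc(2)[OF HG[OF hk(2)]]])
   moreover have "Ps1 h \<otimes> Ps2 k:carrier H" using i.hom_mult[OF H1[OF hk(1)] H2[OF hk(2)]] H.m_closed[OF H1[OF hk(1)] H2[OF hk(2)]] by simp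
   ultimately show "(Ps1 h, Ps2 k):f ` carrier H" by (metis imageI)
  qed
 qed (auto simp: f_def)
 ultimately show ?thesis
  unfolding decomposable_pair_def
  using R1.lie_group_L R2.lie_group_L R1.C_nontrivial[OF ne(1)] R2.C_nontrivial[OF ne(2)] cc HG
  by (intro exI[of _ R1.L] exI[of _ R2.L] exI[of _ f] exI[of _ "Ps1 ` carrier H"] exI[of _ "Ps2 ` carrier H"])
   (auto simp: R1.L_simps R2.L_simps)
qed

section \<open>Compact subgroups of semisimple groups\<close>

lemma (in manifold) continuous_by_charts:
 fixes F :: "'a => 'w::real_normed_vector"
 assumes F: "!!U ph. (U, ph):atlas M ==> continuous_on (ph ` U) (%u. F (inv_into U ph u))"
 shows "continuous_map (topo M) euclidean F"
 unfolding continuous_map_def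
proof (intro conjI allI impI)
 fix O' :: "'w set" assume "openin euclidean O'"
 then have O': "opn UNIV O'" by simp
 show "openin (topo M) {x:topspace (topo M). F x:O'}"
 proof (subst openin_subopen, intro ballI)
  fix x assume "x:{x:topspace (topo M). F x:O'}"
  then have x: "x:carrier M" "F x:O'" by (auto simp: topspace)
  obtain U ph where c: "(U, ph):atlas M" "x:U" using chart_exists[OF x(1)] by blast
  have "opn (model M) {u:ph ` U. F (inv_into U ph u):O'}" by (rule opn_preimage[OF F[OF c(1)] chart(3)[OF c(1)] O' subset_UNIV])
  note o = open_chart_preimage[OF c(1) this]
  have "{y:U. ph y:{u:ph ` U. F (inv_into U ph u):O'}} <= {x:topspace (topo M). F x:O'}"
  proof
   fix y assume "y:{y:U. ph y:{u:ph ` U. F (inv_into U ph u):O'}}"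
   then have "y:U" "F (inv_into U ph (ph y)):O'" by simp_all
   then show "y:{x:topspace (topo M). F x:O'}" using chart(2)[OF c(1)] by (auto simp: topspace chart_inv(1)[OF c(1)])
  qed
  then show "EX T. openin (topo M) T & x:T & T <= {x:topspace (topo M). F x:O'}"
   using o c(2) x(2) by (intro exI[of _ "{y:U. ph y:{u:ph ` U. F (inv_into U ph u):O'}}"]) (simp add: chart_inv(1)[OF c(1)])
 qed
qed auto

lemma (in lie) Ad_continuous: "Y:model G ==> continuous_map (topo G) euclidean (%g. Ad G g Y)"
 by (intro continuous_by_charts smooth_on_continuous[OF Ad_smooth[OF plot_chart_inverse]])

lemma (in lie) semisimple_br:
 assumes ss: "semisimple (model G) (lie_bracket G)"
 shows "semisimple (model G) br" "killing_lie G"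
proof -
 note eq = killing_form_eq_kp[OF model br_bilinear br_model]
 have 1: "killing_form (model G) (lie_bracket G) X Y = kp br X Y" if "X:model G" "Y:model G" for X Y
  by (rule eq[OF _ that]) (simp add: br_eq)
 have 2: "killing_form (model G) br X Y = kp br X Y" if "X:model G" "Y:model G" for X Y by (rule eq[OF _ that]) simp
 show "semisimple (model G) br" using ss unfolding semisimple_def by (simp add: 1 2)
 show "killing_lie G"
  by (rule killing_lie.intro[OF lie_axioms], rule killing_lie_axioms.intro) (use ss 1 in "auto simp: semisimple_def")
qed

section \<open>Compactness of the subgroup\<close>

locale compact_pair = lie_pair G H + killing_lie G
 for G :: "('a, 'v::euclidean_space) lie_structure" (structure) and H :: "('a, 'v) lie_structure" +
 assumes compact_H: "compact_space (topo H)" and ss: "semisimple (model G) br"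
begin

lemma compact_continuous:
 assumes "continuous_map (topo G) euclidean (F :: 'a => 'w::real_normed_vector)" "closedin (topo H) A"
 shows "compact (F ` A)"
proof -
 have "continuous_map (topo H) (topo G) (%x. x)" using inclusion(1) by (simp add: smooth_map_def)
 from continuous_map_compose[OF this assms(1)] have "continuous_map (topo H) euclidean F" by (simp add: o_def)
 moreover have "compactin (topo H) A" using closedin_compact_space[OF compact_H assms(2)] .
 ultimately show ?thesis using image_compactin compactin_euclidean_iff by blast
qed

theorem cartan_involution:
 "br x y = - br y x"
 "EX t. linear t & (ALL x. P (t x) = t x & t (t x) = P x) & (ALL x y. t (br x y) = br (t x) (t y)) &
   (ALL h:carrier H. ALL x:model G. t (Ad G h x) = Ad G h (t x)) & (ALL x. P x ~= 0 --> kp br x (t x) < 0)"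
proof -
 \<comment> \<open>\<open>Ad G h\<close> is extended to the ambient space by the identity on the
   kernel of \<open>P\<close>, so that \<open>H\<close> acts there by invertible linear
   maps.\<close>
 define k where "k h x = Ad G h (P x) + (x - P x)" for h x
 let ?K = "k ` carrier H"
 have kl: "linear (k h)" if "h:carrier G" for h
  using Ad_linear(2)[OF that] P(1) unfolding k_def by (intro linear_compose_add linear_compose_sub linear_ident)
 have Pz: "P (x - P x) = 0" for x using P by (simp add: linear_diff[OF P(1)])
 have kP: "P (k h x) = Ad G h (P x)" "k h (P x) = Ad G h (P x)" if "h:carrier G" for h x
  using that P Pz Ad_model[OF that P(2)] by (auto simp: k_def linear_add[OF P(1)])
 have kk: "k h (k g x) = k (h \<otimes> g) x" if "h:carrier G" "g:carrier G" for h g x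
  using that kP(1)[OF that(2), of x] by (simp add: k_def[of h] Ad_mult[OF that P(2)]) (simp add: k_def Ad_mult[OF that P(2)])
 have k1: "k \<one> = (%x. x)" using Ad_one[OF P(2)] by (auto simp: k_def)
 have km: "br (k h x) (k h y) = k h (br x y)" if h: "h:carrier G" for h x y
 proof -
  have "br (k h x) (k h y) = br (Ad G h (P x)) (Ad G h (P y))" using br_P[of "k h x" "k h y"] br_P(2)[of "P (k h x)" "k h y"] kP[OF h] by simp
  also have "... = Ad G h (br x y)" using Ad_br[OF h P(2) P(2), of x y] by (simp add: br_P)
  finally show ?thesis using P(3)[OF br_model[of x y]] by (simp add: k_def)
 qed
 have "bounded ((%h. Ad G h (P b)) ` carrier H)" for b
  using compact_continuous[OF Ad_continuous[OF P(2)] closedin_topspace] by (simp add: compact_imp_bounded H.topspace)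
 then obtain C where C: "!!b h. h:carrier H ==> norm (Ad G h (P b)) <= C b"
  unfolding bounded_iff by (metis imageI)
 have nk: "norm (k h x) <= (SUM b:Basis. C b + norm (b - P b)) * norm x" if h: "h:carrier H" for h x
 proof -
  have "norm (k h x) <= (SUM b:Basis. norm ((x \<bullet> b) *\<^sub>R k h b))" unfolding linear_expand[OF kl[OF HG[OF h]], of x] by (rule norm_sum)
  also have "... <= (SUM b:Basis. norm x * (C b + norm (b - P b)))"
   unfolding norm_scaleR
   by (intro sum_mono mult_mono) (auto simp: Basis_le_norm k_def intro!: order_trans[OF norm_triangle_ineq] add_right_mono C[OF h])
  finally show ?thesis by (simp add: sum_distrib_left[symmetric] mult.commute)
 qed
 have ki: "EX l:?K. ALL x. f (l x) = x & l (f x) = x" if "f:?K" for f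
 proof -
  from that obtain h where h: "f = k h" "h:carrier H" by (rule imageE)
  then show ?thesis using kk[OF HG[OF h(2)], of "inv h"] kk[of "inv h" h] HG[OF h(2)] k1 i.hom_inv[OF h(2)] H.inv_closed[OF h(2)]
   by (intro bexI[of _ "k (inv h)"]) auto
 qed
 have kc: "(%x. f (l x)):?K" if "f:?K" "l:?K" for f l
 proof -
  from that(1) obtain h where h: "f = k h" "h:carrier H" by (rule imageE)
  from that(2) obtain g where g: "l = k g" "g:carrier H" by (rule imageE)
  have "(%x. f (l x)) = k (h \<otimes> g)" using kk[OF HG[OF h(2)] HG[OF g(2)]] by (auto simp: h(1) g(1))
  moreover have "h \<otimes> g:carrier H" using i.hom_mult[OF h(2) g(2)] H.m_closed[OF h(2) g(2)] by simp
  ultimately show ?thesis by (rule image_eqI)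
 qed
 have id: "(%x. x):?K" using k1 i.hom_one H.one_closed by (metis imageI)
 have l: "linear f" if "f:?K" for f using that kl HG by (elim imageE) simp
 have b: "norm (f x) <= (SUM b:Basis. C b + norm (b - P b)) * norm x" if "f:?K" for f x using that nk by (elim imageE) simp
 have p: "f (P x) = P (f x)" "br (f x) (f y) = f (br x y)" if "f:?K" for f x y using that kP km HG by (elim imageE, simp)+
 note ex = cartan_involution_exists[where V = "model G" and P = P and m = br and K = ?K and C = "SUM b:Basis. C b + norm (b - P b)"]
 note fs = model P br_bilinear br_model br_P leibniz ss l id kc ki b p
 show "br x y = - br y x" by (rule ex(1)) (fact fs)+
 have "EX t. is_cartan_involution P ?K br t" by (rule ex(2)) (fact fs)+
 then obtain t where t: "is_cartan_involution P ?K br t" ..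
 have "t (Ad G h x) = Ad G h (t x)" if h: "h:carrier H" and x: "x:model G" for h x
 proof -
  have "t (k h x) = k h (t x)" "P (t x) = t x" using t h by (auto simp: is_cartan_involution_def)
  then show ?thesis using x P(3) by (simp add: k_def)
 qed
 with t show "EX t. linear t & (ALL x. P (t x) = t x & t (t x) = P x) & (ALL x y. t (br x y) = br (t x) (t y)) &
   (ALL h:carrier H. ALL x:model G. t (Ad G h x) = Ad G h (t x)) & (ALL x. P x ~= 0 --> kp br x (t x) < 0)"
  unfolding is_cartan_involution_def by blast
qed

lemma io_eq_0: "X:model H ==> io X = 0 ==> X = 0"
 using io_add[of 0 0] inj_onD[OF inclusion(3), of X 0] subspace_0[OF H.model] by simp

text \<open>If \<open>Ad (a s)\<close> is close to the identity then, by compactness, it equals \<open>Ad h\<close> for some \<open>h\<close> in \<open>H\<close> close to the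
 identity of \<open>H\<close>; so the velocity is tangent to \<open>H\<close>, although nothing is assumed about \<open>a\<close> itself.\<close>

lemma compact_tangent:
 assumes A: "A:model G" and a: "0 < dl" "!!s. \<bar>s\<bar> < dl ==> a s:carrier H" and a0: "!!Y. Y:model G ==> Ad G (a 0) Y = Y"
  and lim: "!!Y. Y:model G ==> ((%s. Ad G (a s) Y) hvd br A Y) (at 0)"
 shows "A:alg"
proof -
 let ?u = "H.ch \<one>\<^bsub>H\<^esub>" and ?f = "%u. Ad_trace (H.th u)" and ?S = "H.ch ` H.U1"
 have plot: "plot G (model H) ?S H.th" by (rule plot_smooth_map[OF H.M M inclusion(1) H.th(4)])
 obtain f' where f': "!!u. u:?S ==> (?f has_derivative f' u) (at u within ?S)"
  by (rule smooth_on_derivative[OF H.model H.th(5) Ad_trace_smooth[OF plot]]) blast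
 note D = f'[OF H.th(6)]
 have f'v: "f' ?u v = ad_trace (io v)" if v: "v:model H" for v
  using directional_derivative(1)[OF H.model H.th(5,6) v D] Ad_trace_derivative[OF Ad_derivative_br[OF gvel_inclusion[OF H.gvel_curve[OF v]]]]
  unfolding H.curve_at_one_eq by (rule vector_derivative_unique_at)
 have iom: "io v:model G" if "v:model H" for v using gvel_model[OF gvel_inclusion[OF H.gvel_curve[OF that]]] .
 obtain e d where ed: "0 < e" "0 < d" "!!u. u:?S ==> norm (u - ?u) < d ==> e * norm (u - ?u) <= norm (?f u - ?f ?u)"
  by (rule injective_derivative_bound[OF D H.model H.th(8,6)]) (use f'v ad_trace(2) io_eq_0 iom in auto)
 define De where "De g = (SUM b:Basis. norm (Ad G g (P b) - P b))" for g
 have fx: "g:fixer (model G)" if g: "g:carrier G" "De g = 0" for g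
 proof -
  have z: "Ad G g (P b) - P b = 0" if "b:Basis" for b
   using g(2) that unfolding De_def by (subst (asm) sum_nonneg_eq_0_iff) auto
  have "linear (%Y. Ad G g (P Y) - P Y)" by (rule linear_compose_sub[OF Ad_linear(2)[OF g(1)] P(1)])
  then have "Ad G g (P Y) - P Y = 0" for Y using linear_expand[of "%Y. Ad G g (P Y) - P Y" Y] z by simp
  then show ?thesis using g(1) P(3) by (auto simp: fixer_def) metis
 qed
 have key: "EX ep>0. ALL h:carrier H. De h < ep --> (EX u:?S. norm (u - ?u) < ro & Ad_trace h = ?f u)" if ro: "0 < ro" for ro
 proof -
  define O' where "O' = {g:H.U1. H.ch g:ball ?u ro Int model H}"
  have oO: "openin (topo H) O'" unfolding O'_def by (rule H.open_chart_preimage[OF H.chart1]) (auto simp: openin_open)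
  have O1: "\<one>\<^bsub>H\<^esub>:O'" using H.one_U1 H.th(7) ro by (simp add: O'_def)
  define Z where "Z = {z:carrier H. z:fixer (model G)}"
  \<comment> \<open>The neighbourhood \<open>O'\<close> of the identity saturated by the kernel
    \<open>Z\<close> of \<open>Ad\<close>; outside it \<open>De\<close> is positive, and compactness
    bounds it away from 0.\<close>
  define OZ where "OZ = (UN z:Z. {h:carrier H. h \<otimes>\<^bsub>H\<^esub> z:O'})"
  have "openin (topo H) {h:topspace (topo H). h \<otimes>\<^bsub>H\<^esub> z:O'}" if "z:Z" for z
   by (intro openin_continuous_map_preimage[OF _ oO] H.continuous_mult H.continuous_id) (use that in "auto simp: Z_def H.topspace")
  then have "openin (topo H) OZ" unfolding OZ_def by (intro openin_Union) (auto simp: H.topspace)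
  then have cl: "closedin (topo H) (carrier H - OZ)" using H.topspace by (metis closedin_def closedin_diff closedin_topspace)
  have "continuous_map (topo G) euclidean De"
   unfolding De_def by (intro continuous_intros Ad_continuous P(2)) auto
  then have cpt: "compact (De ` (carrier H - OZ))" by (rule compact_continuous[OF _ cl])
  have "0~:De ` (carrier H - OZ)"
  proof
   assume "0:De ` (carrier H - OZ)"
   then obtain h where h: "h:carrier H" "h~:OZ" "De h = 0" by auto
   then have "inv h:Z" using fx[OF HG[OF h(1)]] fixer_closed(3)[OF subset_refl] i.hom_inv[OF h(1)] H.inv_closed[OF h(1)] by (simp add: Z_def)
   moreover have "h \<otimes>\<^bsub>H\<^esub> inv h = \<one>\<^bsub>H\<^esub>" using i.hom_inv[OF h(1)] H.r_inv[OF h(1)] by simp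
   ultimately show False using h(1,2) O1 by (auto simp: OZ_def)
  qed
  then obtain ep where ep: "0 < ep" "ball 0 ep <= - De ` (carrier H - OZ)"
   using compact_imp_closed[OF cpt] open_contains_ball by (metis ComplI open_Compl)
  have "EX u:?S. norm (u - ?u) < ro & Ad_trace h = ?f u" if h: "h:carrier H" "De h < ep" for h
  proof -
   have "0 <= De h" unfolding De_def by (intro sum_nonneg) auto
   then have "De h:ball 0 ep" using h(2) by simp
   then have "h:OZ" using ep(2) h(1) by blast
   then obtain z where z: "z:carrier H" "z:fixer (model G)" "h \<otimes>\<^bsub>H\<^esub> z:O'" by (auto simp: OZ_def Z_def)
   have "Ad G h Y = Ad G (h \<otimes>\<^bsub>H\<^esub> z) Y" if "Y:model G" for Y
   using Ad_mult[OF HG[OF h(1)] HG[OF z(1)] that] i.hom_mult[OF h(1) z(1)] z(2) that by (simp add: fixer_def)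
   then have "Ad_trace h = Ad_trace (h \<otimes>\<^bsub>H\<^esub> z)" by (rule Ad_trace_cong)
   then show ?thesis using z(3) H.th(1) by (intro bexI[of _ "H.ch (h \<otimes>\<^bsub>H\<^esub> z)"]) (auto simp: O'_def dist_norm norm_minus_commute)
  qed
  then show ?thesis using ep(1) by blast
 qed
 let ?w = "ad_trace A" and ?F = "%s. Ad_trace (a s)"
 have F0: "?F 0 = ?f ?u" using a0 H.th(1)[OF H.one_U1] Ad_one by (intro Ad_trace_cong) simp
 have "(?F hvd ?w) (at 0)" by (rule Ad_trace_derivative[OF lim])
 then have "((%s. norm (?F s - ?F 0 - s *\<^sub>R ?w) / norm s) \<longlongrightarrow> 0) (at 0)"
  by (simp add: has_vector_derivative_def has_derivative_at)
 moreover have "norm (?F s - ?F 0 - s *\<^sub>R ?w) / norm s = norm ((1 / s) *\<^sub>R (?F s - ?F 0) - ?w)" if "s ~= 0" for s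
 proof -
  have "(1 / s) *\<^sub>R (?F s - ?F 0) - ?w = (1 / s) *\<^sub>R (?F s - ?F 0 - s *\<^sub>R ?w)" using that by (simp add: scaleR_diff_right)
  then show ?thesis by simp
 qed
 ultimately have "((%s. norm ((1 / s) *\<^sub>R (?F s - ?F 0) - ?w)) \<longlongrightarrow> 0) (at 0)"
  by (elim Lim_transform_eventually) (simp add: eventually_at_filter)
 then have q: "((%s. (1 / s) *\<^sub>R (?F s - ?F 0)) \<longlongrightarrow> ?w) (at 0)" by (rule LIM_zero_cancel[OF tendsto_norm_zero_cancel])
 have De0: "((%s. De (a s)) \<longlongrightarrow> 0) (at 0)"
 proof -
  have "((%s. Ad G (a s) (P b)) \<longlongrightarrow> P b) (at 0)" for b
   using has_vector_derivative_continuous[OF lim[OF P(2)[of b]]] a0[OF P(2)[of b]] by (simp add: isCont_def)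
  then have "((%s. De (a s)) \<longlongrightarrow> (SUM b:Basis. norm (P b - P b))) (at 0)" unfolding De_def by (intro tendsto_intros)
  then show ?thesis by simp
 qed
 \<comment> \<open>The derivative is first approximated by images of tangent vectors of
   \<open>H\<close>; the image is a subspace of finite dimension, hence closed.\<close>
 have "?w:closure (f' ?u ` model H)"
  unfolding closure_approachable
 proof (intro allI impI)
  fix ep :: real assume ep: "0 < ep"
  \<comment> \<open>Chosen so that the linearization error, divided by \<open>e\<close> and
    multiplied by the bound \<open>norm ?w + ep + 1\<close> for the difference quotient, becomes
    \<open>ep / 2\<close>.\<close>
  define kap where "kap = ep * e / (2 * (norm ?w + ep + 1))"
  have kap: "0 < kap" using ep ed(1) by (simp add: kap_def add_pos_nonneg add_nonneg_pos)
  obtain d' where d': "0 < d'" "!!u. u:?S ==> norm (u - ?u) < d' ==> norm (?f u - ?f ?u - f' ?u (u - ?u)) <= kap * norm (u - ?u)"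
   using D kap unfolding has_derivative_within_alt by meson
  obtain ep' where ep': "0 < ep'" "ALL h:carrier H. De h < ep' --> (EX u:?S. norm (u - ?u) < min d d' & Ad_trace h = ?f u)"
   using key[of "min d d'"] ed(2) d'(1) by auto
  have "\<forall>\<^sub>F s in at 0. De (a s) < ep' & dist ((1 / s) *\<^sub>R (?F s - ?F 0)) ?w < ep / 2 & \<bar>s\<bar> < dl & s ~= 0"
   using order_tendstoD(2)[OF De0 ep'(1)] tendstoD[OF q, of "ep / 2"] ep a(1)
   by (intro eventually_conj) (auto simp: eventually_at dist_real_def)
  then obtain s where s: "De (a s) < ep'" "norm ((1 / s) *\<^sub>R (?F s - ?F 0) - ?w) < ep / 2" "\<bar>s\<bar> < dl" "s ~= 0"
   using eventually_happens'[OF at_neq_bot] by (auto simp: dist_norm)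
  have "EX u:?S. norm (u - ?u) < min d d' & ?F s = ?f u" using ep'(2) a(2)[OF s(3)] s(1) by blast
  then obtain u where "u:?S" "norm (u - ?u) < min d d'" "?F s = ?f u" by (elim bexE conjE)
  then have u: "u:?S" "norm (u - ?u) < d" "norm (u - ?u) < d'" "?F s = ?f u" by simp_all
  let ?q = "(1 / s) *\<^sub>R (?F s - ?F 0)" and ?v = "(1 / s) *\<^sub>R (u - ?u)"
  have lf: "linear (f' ?u)" by (rule has_derivative_linear[OF D])
  have um: "u - ?u:model H" using u(1) H.th(7,8) subspace_diff[OF H.model] by blast
  have "norm (?q - f' ?u ?v) = norm (?f u - ?f ?u - f' ?u (u - ?u)) / \<bar>s\<bar>"
  proof -
   have "f' ?u ?v = (1 / s) *\<^sub>R f' ?u (u - ?u)" by (rule linear_scale[OF lf])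
   then have "?q - f' ?u ?v = (1 / s) *\<^sub>R (?f u - ?f ?u - f' ?u (u - ?u))" by (simp only: u(4) F0 scaleR_diff_right)
   then show ?thesis by simp
  qed
  also have "... <= kap * norm (u - ?u) / \<bar>s\<bar>" using d'(2)[OF u(1,3)] by (intro divide_right_mono) auto
  also have "... <= kap * (norm (?f u - ?f ?u) / e) / \<bar>s\<bar>"
   using ed(1) ed(3)[OF u(1,2)] kap by (intro divide_right_mono mult_left_mono) (auto simp: field_simps)
  also have "... = kap / e * norm ?q" by (simp add: u(4) F0)
  also have "... <= kap / e * (norm ?w + ep + 1)"
   using kap ed(1) norm_triangle_ineq[of "?q - ?w" ?w] s(2) ep by (intro mult_left_mono) auto
  also have "... = ep / 2"
  proof -
   have "ep * e / (2 * N) / e * N = ep / 2" if "N ~= 0" for N using ed(1) that by simp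
   moreover have "norm ?w + ep + 1 ~= 0" using ep norm_ge_zero[of ?w] by linarith
   ultimately show ?thesis by (simp only: kap_def)
  qed
  finally have "norm (f' ?u ?v - ?w) < ep" using s(2) norm_triangle_ineq4[of "?q - ?w" "?q - f' ?u ?v"] by simp
  then show "EX y:f' ?u ` model H. dist y ?w < ep" using subspace_scale[OF H.model um] by (auto simp: dist_norm)
 qed
 then have "?w:f' ?u ` model H"
  using closed_subspace[OF linear_subspace_image[OF has_derivative_linear[OF D] H.model]] by simp
 then obtain v where v: "v:model H" "?w = ad_trace (io v)" using f'v by auto
 then have "ad_trace (A - io v) = 0" by (simp add: linear_diff[OF ad_trace(1)])
 then have "A - io v = 0" by (rule ad_trace(2)[OF subspace_diff[OF model A iom[OF v(1)]]])
 then show ?thesis using v(1) by (simp add: subgroup_algebra_def)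
qed
end

section \<open>The Cartan decomposition of the pair\<close>

locale cartan_pair = compact_pair G H
 for G :: "('a, 'v::euclidean_space) lie_structure" (structure) and H :: "('a, 'v) lie_structure" +
 fixes t :: "'v => 'v"
 assumes t: "linear t" "!!x. P (t x) = t x" "!!x. t (t x) = P x" "!!x y. t (br x y) = br (t x) (t y)"
  and t_Ad: "!!h x. h:carrier H ==> x:model G ==> t (Ad G h x) = Ad G h (t x)"
  and t_neg: "!!x. P x ~= 0 ==> kp br x (t x) < 0"
begin

definition "\<kk> = {x:model G. t x = x}"
definition "\<pp> = {x:model G. t x = - x}"
definition "pk x = (1/2) *\<^sub>R (P x + t x)"
definition "pp x = (1/2) *\<^sub>R (P x - t x)"

lemma t_model: "t x:model G" and t_P: "t (P x) = t x"
 using t(2)[of x] P(2)[of "t x"] t(2)[of "t x"] t(3)[of "t x"] t(3)[of x] by metis+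

lemma pk_pp: "linear pk" "linear pp" "pk x:\<kk>" "pp x:\<pp>" "x:model G ==> pk x + pp x = x"
  "x:\<kk> ==> pk x = x & pp x = 0" "x:\<pp> ==> pp x = x & pk x = 0"
proof -
 show "linear pk" "linear pp" unfolding pk_def pp_def
  by (intro linear_compose_scale_right linear_compose_add linear_compose_sub P(1) t(1))+
 show "pk x:\<kk>" "pp x:\<pp>"
  using P(2) t_model model t(3)
  by (auto simp: \<kk>_def \<pp>_def pk_def pp_def linear_scale[OF t(1)] linear_add[OF t(1)] linear_diff[OF t(1)] t_P subspace_add subspace_diff subspace_scale algebra_simps)
 show "x:model G ==> pk x + pp x = x" unfolding pk_def pp_def by (simp add: P(3) scaleR_add_right[symmetric] scaleR_2[symmetric])
 show "x:\<kk> ==> pk x = x & pp x = 0" "x:\<pp> ==> pp x = x & pk x = 0"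
  by (auto simp: \<kk>_def \<pp>_def pk_def pp_def P(3) scaleR_2[symmetric])
qed

lemma kp_sub: "subspace \<kk>" "subspace \<pp>" "\<kk> <= model G" "\<pp> <= model G" "\<kk> Int \<pp> = {0}"
proof -
 show "subspace \<kk>" "subspace \<pp>" unfolding \<kk>_def \<pp>_def subspace_def
  using model by (auto simp: linear_0[OF t(1)] linear_add[OF t(1)] linear_scale[OF t(1)] subspace_0 subspace_add subspace_scale)
 then show "\<kk> Int \<pp> = {0}" using pk_pp(6,7) subspace_0 by (auto, metis)
qed (auto simp: \<kk>_def \<pp>_def)

lemma kp_br: "x:\<kk> ==> y:\<kk> ==> br x y:\<kk>" "x:\<kk> ==> y:\<pp> ==> br x y:\<pp>" "x:\<pp> ==> y:\<kk> ==> br x y:\<pp>" "x:\<pp> ==> y:\<pp> ==> br x y:\<kk>"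
 by (simp_all add: \<kk>_def \<pp>_def t(4) br_model bilinear_lneg[OF br_bilinear] bilinear_rneg[OF br_bilinear])

lemma cartan: "cartan_decomposition (model G) (lie_bracket G) \<kk> \<pp>"
proof -
 have K: "killing_form (model G) (lie_bracket G) X X = kp br X X" if "X:model G" for X
  by (rule killing_form_eq_kp[OF model br_bilinear br_model _ that that]) (simp add: br_eq)
 have n: "kp br X (- X) = - kp br X X" for X unfolding kp_def by (simp add: bilinear_lneg[OF br_bilinear] bilinear_rneg[OF br_bilinear] sum_negf)
 have sum: "model G = {X + Y |X Y. X:\<kk> & Y:\<pp>}"
 proof
  show "model G <= {X + Y |X Y. X:\<kk> & Y:\<pp>}" using pk_pp(3-5) by (smt (verit) mem_Collect_eq subsetI)
 qed (use kp_sub model in "auto simp: subspace_add subset_iff")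
 have b: "lie_bracket G X Y = br X Y" if "X:\<kk> \<or> X:\<pp>" "Y:\<kk> \<or> Y:\<pp>" for X Y
  using that kp_sub(3,4) by (intro br_eq[symmetric]) auto
 have "kp br X X < 0" if "X:\<kk>" "X ~= 0" for X using t_neg[of X] that by (auto simp: \<kk>_def P(3))
 moreover have "kp br X X > 0" if "X:\<pp>" "X ~= 0" for X using t_neg[of X] n[of X] that by (auto simp: \<pp>_def P(3))
 ultimately show ?thesis
  unfolding cartan_decomposition_def direct_sum_def using kp_sub sum K b kp_br by (auto simp: subset_iff)
qed

text \<open>Since \<open>t\<close> commutes with \<open>Ad\<close> on \<open>H\<close>, it commutes
  with \<open>br X\<close>; as an automorphism it also turns \<open>br X\<close> into
  \<open>br (t X)\<close>. So \<open>t X - X\<close> is central.\<close>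

lemma alg_k: "alg <= \<kk>"
proof
 fix X assume X: "X:alg"
 obtain d c where c: "H.intcurve (inv_into (model H) io X) d c" "intcurve X d c" by (rule alg_curve[OF X])
 have Xm: "X:model G" by (rule alg_model[OF X])
 have comm: "t (br X Y) = br X (t Y)" if Y: "Y:model G" for Y
 proof (rule vector_derivative_unique_at)
  have tY: "t Y:model G" by (rule t_model)
  show "((%s. Ad G (c s) (t Y)) hvd br X (t Y)) (at 0)"
   using Ad_derivative[OF intcurve_gvel[OF c(2)] tY] by (simp add: br_eq Xm tY)
  have "((%s. t (Ad G (c s) Y)) hvd t (br X Y)) (at 0)"
   using bounded_linear.has_vector_derivative[OF linear_bounded[OF t(1)] Ad_derivative[OF intcurve_gvel[OF c(2)] Y]] by (simp add: br_eq Xm Y)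
  then show "((%s. Ad G (c s) (t Y)) hvd t (br X Y)) (at 0)"
   by (rule hvd_transform[of _ _ _ "{-d<..<d}"])
   (use intcurveD(1)[OF c(2)] t_Ad[OF H.intcurve_carrier[OF c(1)] Y] in "auto simp: abs_less_iff")
 qed
 have "t X - X = 0"
 proof (rule centerless)
  show "t X - X:model G" using t_model Xm model subspace_diff by blast
  fix Y assume Y: "Y:model G"
  have "br (t X) Y = t (br X (t Y))" using t(3)[of Y] P(3)[OF Y] by (simp add: t(4))
  also have "... = br X Y" using comm[OF t_model] t(3)[of Y] P(3)[OF Y] by simp
  finally show "br (t X - X) Y = 0" by (simp add: bilinear_lsub[OF br_bilinear])
 qed
 then show "X:\<kk>" using Xm by (simp add: \<kk>_def)
qed
end

section \<open>Transfer of representations\<close>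

text \<open>On an interval that is short relative to the size \<open>C\<close> of the coefficients
  of \<open>A\<close>, the maximum of the norm is at most half of itself.\<close>

lemma linear_ode_unique:
 fixes e :: "real => 'v::euclidean_space => 'w::euclidean_space"
 assumes d: "0 < d" and lin: "!!t. \<bar>t\<bar> < d ==> linear (e t)"
  and deriv: "!!t v. \<bar>t\<bar> < d ==> ((%s. e s v) hvd e t (A v)) (at t)" and e0: "!!v. e 0 v = 0"
 obtains tu where "0 < tu" "tu <= d" "!!t v. \<bar>t\<bar> < tu ==> e t v = 0"
proof -
 define C where "C = (SUM b:Basis. SUM b':Basis. \<bar>A b \<bullet> b'\<bar>) + 1"
 have C: "0 < C" unfolding C_def by (intro add_nonneg_pos sum_nonneg) auto
 define tu where "tu = min (d / 2) (1 / (2 * C))"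
 have tu: "0 < tu" "tu < d" "C * tu <= 1/2"
 proof -
  show "0 < tu" "tu < d" using d C by (auto simp: tu_def)
  have "C * tu <= C * (1 / (2 * C))" using C by (intro mult_left_mono) (auto simp: tu_def)
  then show "C * tu <= 1/2" using C by simp
 qed
 let ?I = "{-tu..tu}"
 have I: "\<bar>t\<bar> < d" if "t:?I" for t using that tu(2) by auto
 define S where "S t = (SUM b:Basis. norm (e t b))" for t
 have "isCont (%s. e s b) t" if t: "t:?I" for t b by (rule has_vector_derivative_continuous[OF deriv[OF I[OF t]]])
 then have cont: "continuous_on ?I S" unfolding S_def by (intro continuous_intros continuous_at_imp_continuous_on) simp
 obtain t0 where t0: "t0:?I" "!!t. t:?I ==> S t <= S t0"
  using continuous_attains_sup[OF compact_Icc _ cont] tu(1) by auto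
 have S0: "0 <= S t0" unfolding S_def by (intro sum_nonneg) auto
 have nb: "norm (e s v) <= (SUM b':Basis. \<bar>v \<bullet> b'\<bar>) * S t0" if s: "s:?I" for s v
 proof -
  have "norm (e s v) <= (SUM b':Basis. norm ((v \<bullet> b') *\<^sub>R e s b'))" unfolding linear_expand[OF lin[OF I[OF s]], of v] by (rule norm_sum)
  also have "... <= (SUM b':Basis. \<bar>v \<bullet> b'\<bar> * S t0)"
  proof (intro sum_mono)
   fix b :: 'v assume b: "b:Basis"
   have "norm (e s b) <= S s" unfolding S_def by (rule member_le_sum[OF b]) auto
   then show "norm ((v \<bullet> b) *\<^sub>R e s b) <= \<bar>v \<bullet> b\<bar> * S t0" using t0(2)[OF s] by (simp add: mult_left_mono)
  qed
  finally show ?thesis by (simp add: sum_distrib_right)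
 qed
 have "norm (e t0 b) <= (SUM b':Basis. \<bar>A b \<bullet> b'\<bar>) * S t0 * tu" for b
 proof -
  have "norm (e t0 b - e 0 b) <= ((SUM b':Basis. \<bar>A b \<bullet> b'\<bar>) * S t0) * norm (t0 - 0)"
  proof (rule differentiable_bound[of ?I "%s. e s b" "%s h. h *\<^sub>R e s (A b)"])
   fix s assume s: "s:?I"
   show "((%s. e s b) has_derivative (%h. h *\<^sub>R e s (A b))) (at s within ?I)"
   using has_vector_derivative_at_within[OF deriv[OF I[OF s]]] by (simp add: has_vector_derivative_def)
   show "onorm (%h. h *\<^sub>R e s (A b)) <= (SUM b':Basis. \<bar>A b \<bullet> b'\<bar>) * S t0"
   by (rule onorm_le) (use mult_left_mono[OF nb[OF s, of "A b"]] in "simp add: mult.commute")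
  qed (use t0(1) tu(1) in auto)
  also have "... <= ((SUM b':Basis. \<bar>A b \<bullet> b'\<bar>) * S t0) * tu" using t0(1) S0 by (intro mult_left_mono mult_nonneg_nonneg sum_nonneg) auto
  finally show ?thesis by (simp add: e0)
 qed
 then have "S t0 <= (SUM b:Basis. (SUM b':Basis. \<bar>A b \<bullet> b'\<bar>) * S t0 * tu)" unfolding S_def[of t0] by (intro sum_mono) (simp add: S_def)
 also have "... = (C - 1) * tu * S t0" by (simp add: C_def sum_distrib_left[symmetric] mult_ac)
 also have "... <= 1/2 * S t0" using tu S0 by (intro mult_right_mono) (auto simp: left_diff_distrib)
 finally have "S t0 = 0" using S0 by simp
 then have "e t v = 0" if "\<bar>t\<bar> < tu" for t v using nb[of t v] that by (auto simp: abs_less_iff)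
 then show ?thesis using that tu by simp
qed

text \<open>The groups are compared without a homomorphism between them: only the existence of a
  partner \<open>b\<close> for each \<open>a\<close> is asserted. Partners multiply, and along an
  integral curve they exist because both sides solve the same linear equation.\<close>

lemma Ad_transfer:
 fixes G H :: "('a, 'v::euclidean_space) lie_structure" and K L :: "('b, 'w::euclidean_space) lie_structure"
 assumes p: "lie_pair G H" "lie_pair K L" and T: "linear T" "!!v. v:model G ==> T v:model K"
  and ex: "!!X. X:subgroup_algebra G H ==> EX Z:subgroup_algebra K L. ALL v:model G. T (lie.br G X v) = lie.br K Z (T v)"
  and a: "a:carrier H"
 shows "EX b:carrier L. ALL v:model G. T (Ad G a v) = Ad K b (T v)"
proof -
 interpret G: lie_pair G H by (rule p(1))
 interpret K: lie_pair K L by (rule p(2))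
 have bT: "bounded_linear T" using T(1) linear_conv_bounded_linear by blast
 define N where "N = {a:carrier H. EX b:carrier L. ALL v:model G. T (Ad G a v) = Ad K b (T v)}"
 have one: "\<one>\<^bsub>H\<^esub>:N"
  unfolding N_def using G.i.hom_one K.i.hom_one T(2) G.H.one_closed K.H.one_closed
  by (auto simp: G.Ad_one K.Ad_one intro!: bexI[of _ "\<one>\<^bsub>L\<^esub>"])
 have mult: "x \<otimes>\<^bsub>H\<^esub> y:N" if xy: "x:N" "y:N" for x y
 proof -
  obtain b c where b: "x:carrier H" "b:carrier L" "!!v. v:model G ==> T (Ad G x v) = Ad K b (T v)"
   and c: "y:carrier H" "c:carrier L" "!!v. v:model G ==> T (Ad G y v) = Ad K c (T v)" using xy by (auto simp: N_def)
  have "T (Ad G (x \<otimes>\<^bsub>H\<^esub> y) v) = Ad K (b \<otimes>\<^bsub>L\<^esub> c) (T v)" if v: "v:model G" for v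
   using b c G.HG K.HG G.i.hom_mult[OF b(1) c(1)] K.i.hom_mult[OF b(2) c(2)] v T(2)[OF v] G.Ad_model[OF G.HG[OF c(1)] v]
   by (simp add: G.Ad_mult K.Ad_mult)
  then show ?thesis using b c G.H.m_closed K.H.m_closed by (auto simp: N_def intro!: bexI[of _ "b \<otimes>\<^bsub>L\<^esub> c"])
 qed
 have "N = carrier H"
 proof (rule G.H.generated_by_curves[OF G.con_H _ one mult])
  fix X' assume X': "X':model H"
  let ?X = "diff_at_one H G (%x. x) X'"
  have "?X:subgroup_algebra G H" using X' by (simp add: subgroup_algebra_def)
  then obtain Z where Z: "Z:subgroup_algebra K L" "!!v. v:model G ==> T (G.br ?X v) = K.br Z (T v)" using ex by blast
  obtain d c where c: "G.H.intcurve X' d c" using G.H.intcurve_exists[OF X'] by blast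
  have Gc: "G.intcurve ?X d c" using intcurve_map[OF G.H.lie_axioms G.lie_axioms G.inclusion(1,2) c] .
  obtain d' c' where c': "K.H.intcurve (inv_into (model L) (diff_at_one L K (%x. x)) Z) d' c'" "K.intcurve Z d' c'" by (rule K.alg_curve[OF Z(1)])
  define e where "e s v = T (Ad G (c s) (G.P v)) - Ad K (c' s) (K.P (T (G.P v)))" for s v
  have dd: "0 < min d d'" using G.intcurveD(1)[OF Gc] K.intcurveD(1)[OF c'(2)] by simp
  have KP: "K.P (T (G.P v)) = T (G.P v)" for v using K.P(3) T(2) G.P(2) by blast
  have lin: "linear (e s)" if s: "\<bar>s\<bar> < min d d'" for s
   unfolding e_def
   using linear_compose[OF G.Ad_linear(2)[OF G.intcurve_carrier[OF Gc]] T(1)] s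
   linear_compose[OF linear_compose[OF G.P(1) T(1)] K.Ad_linear(2)[OF K.intcurve_carrier[OF c'(2)]]]
   by (intro linear_compose_sub) (auto simp: o_def)
  have der: "((%s. e s v) hvd e s (G.br ?X v)) (at s)" if s: "\<bar>s\<bar> < min d d'" for s v
  proof -
   have s': "\<bar>s\<bar> < d" "\<bar>s\<bar> < d'" using s by auto
   have "G.br ?X (G.P v) = G.br ?X v" by (rule G.br_P(2))
   moreover have "K.br Z (T (G.P v)) = T (G.br ?X v)" using Z(2)[OF G.P(2)] G.br_P(2) by metis
   moreover have "G.P (G.br ?X v) = G.br ?X v" by (rule G.P(3)[OF G.br_model])
   ultimately show ?thesis
   using has_vector_derivative_diff[OF bounded_linear.has_vector_derivative[OF bT G.intcurve_Ad[OF Gc s'(1) G.P(2)]] K.intcurve_Ad[OF c'(2) s'(2) K.P(2)], of v "T (G.P v)"]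
   unfolding e_def KP by (simp add: KP)
  qed
  have e0: "e 0 v = 0" for v
   using G.intcurveD(3)[OF Gc] K.intcurveD(3)[OF c'(2)] G.Ad_one[OF G.P(2)] K.Ad_one[OF T(2)[OF G.P(2)]] by (simp add: e_def KP)
  obtain tu where tu: "0 < tu" "tu <= min d d'" "!!s v. \<bar>s\<bar> < tu ==> e s v = 0" by (rule linear_ode_unique[where e = e and A = "G.br ?X", OF dd lin der e0], assumption+, rule that)
  have "c s:N" if s: "\<bar>s\<bar> < tu" for s
  proof -
   have sd: "\<bar>s\<bar> < d" "\<bar>s\<bar> < d'" using s tu(2) by auto
   have "T (Ad G (c s) v) = Ad K (c' s) (T v)" if "v:model G" for v
   using tu(3)[OF s, of v] G.P(3)[OF that] KP[of v] by (simp add: e_def)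
   then show ?thesis using G.H.intcurve_carrier[OF c sd(1)] K.H.intcurve_carrier[OF c'(1) sd(2)] by (auto simp: N_def)
  qed
  then show "EX c. G.H.gvel c X' & range c <= N" by (rule G.H.gvel_restrict[OF G.H.intcurve_gvel[OF c] tu(1) _ one])
 qed (auto simp: N_def)
 then show ?thesis using a by (auto simp: N_def)
qed

text \<open>Polarity depends only on the set of linear maps by which the group acts, since it speaks
  of orbits; so the correspondence between \<open>H\<close> and \<open>K\<close> may be a mere
  relation.\<close>

lemma polar_representation_transfer:
 fixes T :: "'v::euclidean_space => 'w::euclidean_space" and T' :: "'w => 'v"
 assumes T: "linear T" "linear T'" "!!x. x:W ==> T x:W' & T' (T x) = x" "!!y. y:W' ==> T' y:W & T (T' y) = y"
  and fwd: "!!h. h:H ==> EX k:K. ALL x:W. T (ro h x) = sg k (T x)" and bwd: "!!k. k:K ==> EX h:H. ALL y:W'. T' (sg k y) = ro h (T' y)"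
  and polar: "polar_representation H ro W"
 shows "polar_representation K sg W'"
proof -
 obtain B S where B: "invariant_scalar_product H ro W B" and S: "subspace S" "S <= W" "!!x. x:W ==> EX h:H. ro h x:S"
  and orth: "!!x v y. x:S ==> v:orbit_tangent H ro x ==> y:S ==> B v y = 0"
  using polar unfolding polar_representation_def by blast
 define B' where "B' x y = B (T' x) (T' y)" for x y
 have z: "T' y = 0 \<longleftrightarrow> y = 0" if "y:W'" for y using T(4)[OF that] linear_0[OF T(1)] linear_0[OF T(2)] by metis
 have bl: "bilinear B" using B by (simp add: invariant_scalar_product_def)
 have "invariant_scalar_product K sg W' B'"
  unfolding invariant_scalar_product_def
 proof (intro conjI ballI impI)
  show "bilinear B'" unfolding bilinear_def B'_def
   by (auto intro!: linearI simp: bilinear_comm[OF bl] linear_comm[OF T(2)])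
  show "B' x y = B' y x" if "x:W'" "y:W'" for x y using that B T(4) by (auto simp: invariant_scalar_product_def B'_def)
  show "0 < B' x x" if "x:W'" "x ~= 0" for x using that B T(4) z by (auto simp: invariant_scalar_product_def B'_def)
  show "B' (sg k x) (sg k y) = B' x y" if k: "k:K" and xy: "x:W'" "y:W'" for k x y
  proof -
   obtain h where "h:H" "!!y. y:W' ==> T' (sg k y) = ro h (T' y)" using bwd[OF k] by blast
   then show ?thesis using xy B T(4) by (simp add: invariant_scalar_product_def B'_def)
  qed
 qed
 moreover have "subspace (T ` S)" by (rule linear_subspace_image[OF T(1) S(1)])
 moreover have "T ` S <= W'" using S(2) T(3) by blast
 moreover have "EX k:K. sg k y:T ` S" if y: "y:W'" for y
 proof -
  obtain h where h: "h:H" "ro h (T' y):S" using S(3) T(4)[OF y] by blast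
  obtain k where "k:K" "ALL x:W. T (ro h x) = sg k (T x)" using fwd[OF h(1)] by blast
  then have "k:K" "sg k y = T (ro h (T' y))" using T(4)[OF y] by auto
  then show ?thesis using h(2) by auto
 qed
 moreover have "B' v y = 0" if x: "x:T ` S" and v: "v:orbit_tangent K sg x" and y: "y:T ` S" for x v y
 proof -
  obtain x0 y0 where xy: "x0:S" "x = T x0" "y0:S" "y = T y0" using x y by blast
  obtain gm where gm: "!!t. gm t:(%k. sg k x) ` K" "gm 0 = x" "(gm hvd v) (at 0)" using v by (auto simp: orbit_tangent_def)
  have xW: "x:W'" "T' x = x0" "T' y = y0" using xy S(2) T(3) by auto
  have "T' (gm t):(%h. ro h x0) ` H" for t
  proof -
   obtain k where k: "k:K" "gm t = sg k x" using gm(1)[of t] by blast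
   then show ?thesis using bwd[OF k(1)] xW by auto
  qed
  moreover have "((%t. T' (gm t)) hvd T' v) (at 0)"
   by (rule bounded_linear.has_vector_derivative[OF linear_bounded[OF T(2)] gm(3)])
  ultimately have "T' v:orbit_tangent H ro x0" unfolding orbit_tangent_def using gm(2) xW by (intro CollectI exI[of _ "%t. T' (gm t)"]) simp
  then show ?thesis using orth[OF xy(1) _ xy(3)] xW by (simp add: B'_def)
 qed
 ultimately show ?thesis unfolding polar_representation_def by blast
qed

lemma polar_isotropy_transfer:
 fixes G H :: "('a, 'v::euclidean_space) lie_structure" and K L :: "('b, 'w::euclidean_space) lie_structure"
 assumes T: "linear T" "linear T'" "!!x. x:model G ==> T x:model K & T' (T x) = x" "!!y. y:model K ==> T' y:model G & T (T' y) = y"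
  and fwd: "!!h. h:carrier H ==> EX k:carrier L. ALL x:model G. T (Ad G h x) = Ad K k (T x)"
  and bwd: "!!k. k:carrier L ==> EX h:carrier H. ALL y:model K. T' (Ad K k y) = Ad G h (T' y)"
  and Adm: "!!k y. k:carrier L ==> y:model K ==> Ad K k y:model K"
  and alg: "subgroup_algebra K L = T ` subgroup_algebra G H" and polar: "polar_isotropy G H"
 shows "polar_isotropy K L"
proof -
 obtain m where m: "direct_sum (model G) (subgroup_algebra G H) m" "!!h x. h:carrier H ==> x:m ==> Ad G h x:m" "polar_representation (carrier H) (Ad G) m"
  using polar by (auto simp: polar_isotropy_def)
 let ?h = "subgroup_algebra G H"
 have s: "subspace ?h" "subspace m" "?h Int m = {0}" and V: "model G = {X + Y |X Y. X:?h & Y:m}" using m(1) by (auto simp: direct_sum_def)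
 have "X + 0:model G" if "X:?h" for X unfolding V using that subspace_0[OF s(2)] by blast
 moreover have "0 + X:model G" if "X:m" for X unfolding V using that subspace_0[OF s(1)] by blast
 ultimately have sub: "X:?h ==> X:model G" "X:m ==> X:model G" for X by auto
 have Tm: "x:m ==> T x:T ` m & T' (T x) = x" "y:T ` m ==> T' y:m & T (T' y) = y" for x y using T(3) sub(2) by auto
 have ds: "direct_sum (model K) (T ` ?h) (T ` m)"
  unfolding direct_sum_def
 proof (intro conjI linear_subspace_image T(1) s)
  have "x = 0" if x: "x:T ` ?h Int T ` m" for x
  proof -
   obtain u v where uv: "u:?h" "x = T u" "v:m" "x = T v" using x by blast
   have "T' (T u) = T' (T v)" by (rule arg_cong[OF trans[OF uv(2)[symmetric] uv(4)]])
   then have "u = v" by (simp only: T(3)[OF sub(1)[OF uv(1)], THEN conjunct2] T(3)[OF sub(2)[OF uv(3)], THEN conjunct2])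
   then have "u:?h Int m" using uv(1,3) by simp
   then show ?thesis using s(3) uv(2) linear_0[OF T(1)] by simp
  qed
  then show "T ` ?h Int T ` m = {0}" using subspace_0[OF linear_subspace_image[OF T(1) s(1)]] subspace_0[OF linear_subspace_image[OF T(1) s(2)]] by blast
  have 1: "y:{X + Y |X Y. X:T ` ?h & Y:T ` m}" if y: "y:model K" for y
  proof -
   obtain u v where uv: "T' y = u + v" "u:?h" "v:m" using T(4)[OF y] V by blast
   then have "y = T u + T v" using T(4)[OF y] linear_add[OF T(1), of u v] by simp
   then show ?thesis using uv by blast
  qed
  have 2: "T u + T v:model K" if "u:?h" "v:m" for u v
   using T(3)[of "u + v"] that V linear_add[OF T(1), of u v] by auto
  show "model K = {X + Y |X Y. X:T ` ?h & Y:T ` m}" by (intro equalityI subsetI 1) (auto intro: 2)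
 qed
 have TmK: "y:model K" if "y:T ` m" for y using that T(3) sub(2) by blast
 have inv: "Ad K k y:T ` m" if k: "k:carrier L" and y: "y:T ` m" for k y
 proof -
  obtain h where h: "h:carrier H" "T' (Ad K k y) = Ad G h (T' y)" using bwd[OF k] TmK[OF y] by blast
  then have "Ad K k y = T (Ad G h (T' y))" using T(4)[OF Adm[OF k TmK[OF y]]] by simp
  then show ?thesis using m(2)[OF h(1)] Tm(2)[OF y] by blast
 qed
 have "polar_representation (carrier L) (Ad K) (T ` m)"
 proof (rule polar_representation_transfer[OF T(1,2) Tm _ _ m(3)])
  show "EX k:carrier L. ALL x:m. T (Ad G h x) = Ad K k (T x)" if h: "h:carrier H" for h using fwd[OF h] sub(2) by meson
  show "EX h:carrier H. ALL y:T ` m. T' (Ad K k y) = Ad G h (T' y)" if k: "k:carrier L" for k using bwd[OF k] TmK by meson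
 qed
 then show ?thesis unfolding polar_isotropy_def alg using ds inv by blast
qed

section \<open>Duality\<close>

text \<open>The lower bound that comes with an injective derivative excludes further elements of the
  kernel near the identity.\<close>

lemma local_injective_hom:
 assumes "lie G" "lie K" and f: "smooth_map G K f" "f:hom G K" and inj: "!!X. X:model G ==> diff_at_one G K f X = 0 ==> X = 0"
 obtains W where "openin (topo G) W" "\<one>\<^bsub>G\<^esub>:W" "!!g. g:W ==> f g = \<one>\<^bsub>K\<^esub> ==> g = \<one>\<^bsub>G\<^esub>"
proof -
 interpret G: lie G by fact
 interpret K: lie K by fact
 interpret h: group_hom G K f using f(2) G.group_axioms K.group_axioms by (simp add: group_hom_defs)
 have q: "plot K (model G) (G.ch ` G.U1) (%u. f (G.th u))" by (rule plot_smooth_map[OF G.M K.M f(1) G.th(4)])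
 let ?u = "G.ch \<one>\<^bsub>G\<^esub>" and ?T = "{u:G.ch ` G.U1. f (G.th u):K.U1}" and ?F = "%u. K.ch (f (G.th u))"
 have T: "opn (model G) ?T" and s: "smooth_on (model G) ?T ?F" using plotD(5,6)[OF q K.chart1] by auto
 have o: "?u:?T" using G.th(6) G.th(1)[OF G.one_U1] h.hom_one K.one_U1 by simp
 obtain F' where F': "!!u. u:?T ==> (?F has_derivative F' u) (at u within ?T)" by (rule smooth_on_derivative[OF G.model T s]) blast
 obtain A where A: "!!c X. G.gvel c X ==> K.gvel (%t. f (c t)) (A X)" "!!X. X:model G ==> diff_at_one G K f X = A X"
  by (rule gvel_map[OF assms(1,2) f(1) h.hom_one]) blast
 have F'v: "F' ?u v = diff_at_one G K f v" if v: "v:model G" for v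
 proof (rule vector_derivative_unique_at[OF directional_derivative(1)[OF G.model T o v F'[OF o]]])
  show "((%t. ?F (?u + t *\<^sub>R v)) hvd diff_at_one G K f v) (at 0)"
   using A(1)[OF G.gvel_curve[OF v]] by (simp add: K.gvel_def A(2)[OF v] G.curve_at_one_eq)
 qed
 have TV: "?T <= model G" using G.th(8) by blast
 obtain e d where ed: "0 < e" "0 < d" "!!u. u:?T ==> norm (u - ?u) < d ==> e * norm (u - ?u) <= norm (?F u - ?F ?u)"
  by (rule injective_derivative_bound[OF F'[OF o] G.model TV o]) (use F'v inj in auto)
 let ?W = "{g:G.U1. G.ch g:ball ?u d Int model G}"
 have "openin (topo G) ?W" by (rule G.open_chart_preimage[OF G.chart1]) (auto simp: openin_open)
 moreover have "g = \<one>\<^bsub>G\<^esub>" if g: "g:?W" "f g = \<one>\<^bsub>K\<^esub>" for g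
 proof -
  have "G.ch g:?T" "norm (G.ch g - ?u) < d" using g K.one_U1 G.th(1) by (auto simp: dist_norm norm_minus_commute)
  then have "e * norm (G.ch g - ?u) <= 0"
   using ed(3)[of "G.ch g"] g G.th(1)[of g] G.th(1)[OF G.one_U1] h.hom_one by simp
  then have "norm (G.ch g - ?u) = 0" using ed(1) norm_ge_zero[of "G.ch g - ?u"] by (simp add: mult_le_0_iff)
  then show ?thesis using inj_onD[OF G.chart(6)[OF G.chart1]] g G.one_U1 by auto
 qed
 moreover have "\<one>\<^bsub>G\<^esub>:?W" using G.one_U1 G.th(7) ed(2) by simp
 ultimately show ?thesis using that by blast
qed

text \<open>A product decomposition is replaced by its two complementary endomorphisms, which live
  on the group itself and can be differentiated there. Of the product form of \<open>H\<close> it is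
  kept that \<open>e1\<close> maps \<open>H\<close> into itself.\<close>

lemma (in lie) product_projections:
 assumes G12: "lie_group G1" "lie_group G2" "carrier G1 ~= {\<one>\<^bsub>G1\<^esub>}" "carrier G2 ~= {\<one>\<^bsub>G2\<^esub>}"
  and f: "lie_iso G (lie_prod G1 G2) f" and H: "H <= carrier G" "\<one>:H" "f ` H = H1 \<times> H2"
 obtains e1 e2 where "smooth_map G G e1" "e1:hom G G" "smooth_map G G e2" "e2:hom G G"
  "!!g. g:carrier G ==> e1 (e1 g) = e1 g & e1 (e2 g) = \<one> & e2 (e1 g) = \<one> & e1 g \<otimes> e2 g = g"
  "!!g h. g:carrier G ==> h:carrier G ==> e1 h \<otimes> e2 g = e2 g \<otimes> e1 h"
  "e1 ` H <= H" "EX g:carrier G. e1 g ~= \<one>" "EX g:carrier G. e2 g ~= \<one>"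
proof -
 interpret G1: lie G1 using G12(1) by (simp add: lie_def lie_axioms_def lie_group_def)
 interpret G2: lie G2 using G12(2) by (simp add: lie_def lie_axioms_def lie_group_def)
 let ?P = "lie_prod G1 G2"
 have P: "carrier ?P = carrier G1 \<times> carrier G2" "(x, y) \<otimes>\<^bsub>?P\<^esub> (x', y') = (x \<otimes>\<^bsub>G1\<^esub> x', y \<otimes>\<^bsub>G2\<^esub> y')" for x y x' y'
  by (auto simp: lie_prod_def DirProd_def)
 have PM: "pre_manifold ?P" by (rule pre_manifold_prod[OF G1.M G2.M])
 have fh: "!!g h. g:carrier G ==> h:carrier G ==> f (g \<otimes> h) = f g \<otimes>\<^bsub>?P\<^esub> f h" and fb: "bij_betw f (carrier G) (carrier G1 \<times> carrier G2)"
  and sm: "smooth_map G ?P f" "smooth_map ?P G (inv_into (carrier G) f)"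
  using f by (auto simp: lie_iso_def iso_def hom_def P(1))
 define k where "k = inv_into (carrier G) f"
 have k: "k z:carrier G" "f (k z) = z" if "z:carrier G1 \<times> carrier G2" for z
  using that fb unfolding k_def bij_betw_def by (auto simp: inv_into_into f_inv_into_f)
 have fc: "fst (f g):carrier G1" "snd (f g):carrier G2" if "g:carrier G" for g using bij_betwE[OF fb] that by (auto simp: mem_Times_iff)
 have inj: "g = h" if "g:carrier G" "h:carrier G" "f g = f h" for g h using fb that by (auto simp: bij_betw_def dest: inj_onD)
 have fm: "f (g \<otimes> h) = (fst (f g) \<otimes>\<^bsub>G1\<^esub> fst (f h), snd (f g) \<otimes>\<^bsub>G2\<^esub> snd (f h))" if "g:carrier G" "h:carrier G" for g h
  using fh[OF that] P(2)[of "fst (f g)" "snd (f g)" "fst (f h)" "snd (f h)"] by simp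
 have f1: "f \<one> = (\<one>\<^bsub>G1\<^esub>, \<one>\<^bsub>G2\<^esub>)"
  using fm[OF one_closed one_closed] fc[OF one_closed] G1.r_cancel_one'[of "fst (f \<one>)" "fst (f \<one>)"] G2.r_cancel_one'[of "snd (f \<one>)" "snd (f \<one>)"]
  by (simp add: prod_eq_iff)
 define e1 where "e1 g = k (fst (f g), \<one>\<^bsub>G2\<^esub>)" for g
 define e2 where "e2 g = k (\<one>\<^bsub>G1\<^esub>, snd (f g))" for g
 have ec: "e1 g:carrier G" "e2 g:carrier G" and fe: "f (e1 g) = (fst (f g), \<one>\<^bsub>G2\<^esub>)" "f (e2 g) = (\<one>\<^bsub>G1\<^esub>, snd (f g))" if "g:carrier G" for g
  using k fc[OF that] by (auto simp: e1_def e2_def)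
 have sme: "smooth_map G G e1" "smooth_map G G e2"
 proof -
  have "plot G (model G) (ph ` U) (%u. e1 (inv_into U ph u)) & plot G (model G) (ph ` U) (%u. e2 (inv_into U ph u))" if "(U, ph):atlas G" for U ph
  proof -
   note q = plot_chart_inverse[OF that]
   note q12 = plot_fst_snd[OF G1.M G2.M plot_smooth_map[OF M PM sm(1) q]]
   note c = G1.plot_const[OF plotD(1,2)[OF q] G1.one_closed] G2.plot_const[OF plotD(1,2)[OF q] G2.one_closed]
   show ?thesis unfolding e1_def e2_def k_def
   using plot_smooth_map[OF PM M sm(2) plot_Pair[OF q12(1) c(2)]] plot_smooth_map[OF PM M sm(2) plot_Pair[OF c(1) q12(2)]] by blast
  qed
  then show "smooth_map G G e1" "smooth_map G G e2" by (intro smooth_mapI[OF M M] ec; blast)+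
 qed
 have n1: "EX g:carrier G. e1 g ~= \<one>"
 proof -
  obtain x where x: "x:carrier G1" "x ~= \<one>\<^bsub>G1\<^esub>" using G12(3) G1.one_closed by blast
  have "(x, \<one>\<^bsub>G2\<^esub>):carrier G1 \<times> carrier G2" using x(1) by simp
  note z = k[OF this]
  have "e1 (k (x, \<one>\<^bsub>G2\<^esub>)) ~= \<one>" using fe(1)[OF z(1)] z(2) f1 x(2) by auto
  then show ?thesis using z(1) by blast
 qed
 have n2: "EX g:carrier G. e2 g ~= \<one>"
 proof -
  obtain x where x: "x:carrier G2" "x ~= \<one>\<^bsub>G2\<^esub>" using G12(4) G2.one_closed by blast
  have "(\<one>\<^bsub>G1\<^esub>, x):carrier G1 \<times> carrier G2" using x(1) by simp
  note z = k[OF this]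
  have "e2 (k (\<one>\<^bsub>G1\<^esub>, x)) ~= \<one>" using fe(2)[OF z(1)] z(2) f1 x(2) by auto
  then show ?thesis using z(1) by blast
 qed
 show ?thesis
 proof (rule that[OF sme(1) _ sme(2) _ _ _ _ n1 n2])
  show "e1:hom G G" by (intro homI ec inj) (simp_all add: ec fe fm fc)
  show "e2:hom G G" by (intro homI ec inj) (simp_all add: ec fe fm fc)
  show "e1 (e1 g) = e1 g & e1 (e2 g) = \<one> & e2 (e1 g) = \<one> & e1 g \<otimes> e2 g = g" if "g:carrier G" for g
   using that by (intro conjI inj) (simp_all add: ec fe fm fc f1)
  show "e1 h \<otimes> e2 g = e2 g \<otimes> e1 h" if "g:carrier G" "h:carrier G" for g h
   using that by (intro inj) (simp_all add: ec fe fm fc)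
  show "e1 ` H <= H"
  proof (rule image_subsetI)
   fix h assume h: "h:H"
   have "f h:H1 \<times> H2" "f \<one>:H1 \<times> H2" using H(2,3) h by blast+
   \<comment> \<open>The image of \<open>H\<close> is a product containing the identity, so a second
     component may be replaced by the trivial one.\<close>
   then have "(fst (f h), \<one>\<^bsub>G2\<^esub>):f ` H" using f1 H(3) by (auto simp: mem_Times_iff)
   then obtain h' where h': "h':H" "f h' = (fst (f h), \<one>\<^bsub>G2\<^esub>)" by auto
   then have "e1 h = h'" using H(1) h by (intro inj) (auto simp: ec fe)
   then show "e1 h:H" using h'(1) by simp
  qed
 qed
qed

text \<open>The two groups are linked only through the linear identification \<open>T\<close> of
  their Lie algebras, and the subgroups \<open>H\<close> and \<open>L\<close> only through
  \<open>T_alg\<close>.\<close>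

locale dual_pair = cartan_pair G H t + K: lie_pair K L
 for G :: "('a, 'v::euclidean_space) lie_structure" (structure) and H :: "('a, 'v) lie_structure" and t :: "'v => 'v"
  and K :: "('b, 'w::euclidean_space) lie_structure" and L :: "('b, 'w) lie_structure" +
 fixes T :: "'v => 'w" and T' :: "'w => 'v"
 assumes T: "linear T" "linear T'" "!!x. x:model G ==> T x:model K & T' (T x) = x" "!!y. y:model K ==> T' y:model G & T (T' y) = y"
  and T_br: "!!x y. x:model G ==> y:model G ==>
   K.br (T x) (T y) = T (br (pk x) (pk y) - br (pp x) (pp y) + (br (pk x) (pp y) + br (pp x) (pk y)))"
  and T_alg: "subgroup_algebra K L = T ` alg"
begin

text \<open>The bracket of the dual algebra, carried to \<open>\<gg>\<close> by \<open>x + iy \<mapsto> x + y\<close>.\<close>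

definition ms where "ms x y = br (pk x) (pk y) - br (pp x) (pp y) + (br (pk x) (pp y) + br (pp x) (pk y))"

lemma anti: "br x y = - br y x"
 by (rule cartan_involution(1))

lemma pk_model: "pk x:model G" "pp x:model G"
 using pk_pp(3,4) kp_sub(3,4) by blast+

lemma ms: "bilinear ms" "ms x y:model G" "ms x y = - ms y x"
  "pk (ms x y) = br (pk x) (pk y) - br (pp x) (pp y)" "pp (ms x y) = br (pk x) (pp y) + br (pp x) (pk y)"
proof -
 show "bilinear ms" unfolding bilinear_def ms_def
  by (auto intro!: linearI simp: linear_add[OF pk_pp(1)] linear_add[OF pk_pp(2)] linear_scale[OF pk_pp(1)] linear_scale[OF pk_pp(2)] bilinear_comm[OF br_bilinear] algebra_simps)
 show "ms x y:model G" unfolding ms_def by (intro subspace_add subspace_diff model br_model)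
 show "ms x y = - ms y x"
  using anti[of "pk x" "pk y"] anti[of "pp x" "pp y"] anti[of "pk x" "pp y"] anti[of "pp x" "pk y"] by (simp add: ms_def)
 have "br (pk x) (pk y) - br (pp x) (pp y):\<kk>" "br (pk x) (pp y) + br (pp x) (pk y):\<pp>"
  using kp_br pk_pp(3,4) kp_sub(1,2) by (auto intro: subspace_diff subspace_add)
 from pk_pp(6)[OF this(1)] pk_pp(7)[OF this(2)]
 show "pk (ms x y) = br (pk x) (pk y) - br (pp x) (pp y)" "pp (ms x y) = br (pk x) (pp y) + br (pp x) (pk y)"
  unfolding ms_def by (auto simp: linear_add[OF pk_pp(1)] linear_add[OF pk_pp(2)])
qed

lemma ms_k: "X:\<kk> ==> v:model G ==> ms X v = br X v"
 using pk_pp(6)[of X] pk_pp(5)[of v] by (simp add: ms_def bilinear_comm[OF br_bilinear] bilinear_radd[OF br_bilinear, symmetric] bilinear_lzero[OF br_bilinear])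

lemma T_ms: "x:model G ==> y:model G ==> K.br (T x) (T y) = T (ms x y)"
 using T_br by (simp add: ms_def)

lemma pk_t: "pk (t x) = pk x" "pp (t x) = - pp x"
 unfolding pk_def pp_def by (simp_all add: t(2,3) add.commute scaleR_diff_right)

lemma t_ms: "t (ms x y) = ms (t x) (t y)"
proof -
 have "t z = pk z - pp z" for z unfolding pk_def pp_def by (simp add: scaleR_diff_right scaleR_add_right scaleR_2[symmetric])
 then have "t (ms x y) = pk (ms x y) - pp (ms x y)" .
 then show ?thesis unfolding ms(4,5) by (simp add: ms_def pk_t bilinear_comm[OF br_bilinear] bilinear_lneg[OF br_bilinear] bilinear_rneg[OF br_bilinear])
qed

text \<open>The components in \<open>\<kk>\<close> and \<open>\<pp>\<close> of a central element of
  the dual algebra are central in \<gg>.\<close>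

lemma ms_centerless:
 assumes x: "x:model G" and z: "!!y. y:model G ==> ms x y = 0" shows "x = 0"
proof -
 have *: "br (pk x) y = 0 & br (pp x) y = 0" if "y:\<kk> \<or> y:\<pp>" for y
  using that
 proof
  assume y: "y:\<kk>"
  have "ms x y = 0" using z y kp_sub(3) by blast
  with ms(4,5)[of x y] show ?thesis using pk_pp(6)[OF y] by (simp add: linear_0[OF pk_pp(1)] linear_0[OF pk_pp(2)] bilinear_rzero[OF br_bilinear])
 next
  assume y: "y:\<pp>"
  have "ms x y = 0" using z y kp_sub(4) by blast
  with ms(4,5)[of x y] show ?thesis using pk_pp(7)[OF y] by (simp add: linear_0[OF pk_pp(1)] linear_0[OF pk_pp(2)] bilinear_rzero[OF br_bilinear])
 qed
 have zz: "br (pk x) y = 0 & br (pp x) y = 0" if "y:model G" for y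
  using *[of "pk y"] *[of "pp y"] pk_pp(3,4)[of y] pk_pp(5)[OF that] bilinear_radd[OF br_bilinear, of _ "pk y" "pp y"] by (metis add.right_neutral)
 have "pk x = 0" by (rule centerless[OF pk_model(1)]) (use zz in blast)
 moreover have "pp x = 0" by (rule centerless[OF pk_model(2)]) (use zz in blast)
 ultimately show ?thesis using pk_pp(5)[OF x] by simp
qed

lemma Ad_fwd: "a:carrier H ==> EX b:carrier L. ALL v:model G. T (Ad G a v) = Ad K b (T v)"
proof (rule Ad_transfer[OF lie_pair_axioms K.lie_pair_axioms T(1)])
 show "EX Z:subgroup_algebra K L. ALL v:model G. T (br X v) = K.br Z (T v)" if X: "X:alg" for X
  using X T_ms[of X] ms_k[of X] alg_k alg_model[OF X] by (intro bexI[of _ "T X"]) (auto simp: T_alg)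
qed (use T(3) in blast)

lemma Ad_bwd: "b:carrier L ==> EX a:carrier H. ALL w:model K. T' (Ad K b w) = Ad G a (T' w)"
proof (rule Ad_transfer[OF K.lie_pair_axioms lie_pair_axioms T(2)])
 show "EX Z:alg. ALL w:model K. T' (K.br Y w) = br Z (T' w)" if Y: "Y:subgroup_algebra K L" for Y
 proof -
  obtain X where X: "X:alg" "Y = T X" using Y T_alg by blast
  have "T' (K.br Y w) = br X (T' w)" if w: "w:model K" for w
   using T_ms[OF alg_model[OF X(1)], of "T' w"] T(4)[OF w] T(3)[OF ms(2)] ms_k[of X "T' w"] alg_k X by auto
  then show ?thesis using X(1) by blast
 qed
qed (use T(4) in blast)

theorem dual_polar: "polar_isotropy G H ==> polar_isotropy K L"
 by (rule polar_isotropy_transfer[OF T Ad_fwd Ad_bwd K.Ad_model[OF K.HG] T_alg])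

text \<open>A projection onto an ideal of \<open>\<gg>\<^sup>*\<close> need not commute with the involution \<open>t\<close>; combined with its conjugate by
 \<open>t\<close> it gives one that does, and this one also is a projection onto an ideal of \<open>\<gg>\<close>.\<close>

lemma invariant_projection:
 assumes pr: "linear pr" "!!x. x:model G ==> pr x:model G" "!!x. x:model G ==> pr (pr x) = pr x"
  and pms: "!!x y. x:model G ==> y:model G ==> pr (ms x y) = ms x (pr y)" and palg: "!!X. X:alg ==> pr X:alg"
  and ne: "u:model G" "pr u ~= 0" "v:model G" "pr v ~= v" and alg0: "alg ~= {0}"
 obtains S where "linear S" "!!x. x:model G ==> S x:model G & S (S x) = S x & S (t x) = t (S x)"
  "!!x y. x:model G ==> y:model G ==> S (ms x y) = ms x (S y)" "!!X. X:alg ==> S X:alg"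
  "EX x:model G. S x ~= 0" "EX x:model G. S x ~= x"
proof -
 have tt: "t (t x) = x" if "x:model G" for x using t(3) P(3)[OF that] by simp
 define q where "q x = t (pr (t x))" for x
 have lq: "linear q" unfolding q_def using linear_compose[OF linear_compose[OF t(1) pr(1)] t(1)] by (simp add: o_def)
 have q: "q x:model G" "q (q x) = q x" if "x:model G" for x
  using t_model by (simp_all add: q_def tt[OF pr(2)[OF t_model]] pr(3)[OF t_model])
 have qms: "q (ms x y) = ms x (q y)" if "x:model G" "y:model G" for x y
  using that by (simp add: q_def t_ms pms t_model tt)
 have pms': "pr (ms x y) = ms (pr x) y" if "x:model G" "y:model G" for x y
  using pms[OF that(2,1)] ms(3)[of x y] ms(3)[of y "pr x"] by (simp add: linear_neg[OF pr(1)])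
 have qms': "q (ms x y) = ms (q x) y" if "x:model G" "y:model G" for x y
  using qms[OF that(2,1)] ms(3)[of x y] ms(3)[of y "q x"] by (simp add: linear_neg[OF lq])
 \<comment> \<open>Both maps are linear over the bracket, so each may be moved to either factor of
   \<open>ms x y\<close>; as there is no centre, this turns into commutation.\<close>
 have comm: "pr (q x) = q (pr x)" if x: "x:model G" for x
 proof -
  have "pr (q x) - q (pr x) = 0"
  proof (rule ms_centerless)
   show "pr (q x) - q (pr x):model G" by (intro subspace_diff model pr(2) q(1) x)
   fix y assume y: "y:model G"
   have "ms (pr (q x)) y = ms (q x) (pr y)" using pms[OF q(1)[OF x] y] pms'[OF q(1)[OF x] y] by simp
   also have "... = q (pr (ms x y))" using qms'[OF x pr(2)[OF y]] pms[OF x y] by simp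
   also have "... = ms (q (pr x)) y" using pms'[OF x y] qms'[OF pr(2)[OF x] y] by simp
   finally show "ms (pr (q x) - q (pr x)) y = 0" by (simp add: bilinear_lsub[OF ms(1)])
  qed
  then show ?thesis by simp
 qed
 have prt: "pr (t x) = t (q x)" "q (t x) = t (pr x)" if "x:model G" for x
  using tt[OF pr(2)[OF t_model]] tt[OF that] by (simp_all add: q_def)
 \<comment> \<open>On \<hh> the involution is the identity, and \<open>pr\<close> maps \<hh> into
   itself, so \<open>pr\<close> and its conjugate coincide there.\<close>
 have qalg: "q X = pr X" if "X:alg" for X
  using subsetD[OF alg_k that] subsetD[OF alg_k palg[OF that]] by (simp add: q_def \<kk>_def)
 show ?thesis
 proof (cases "EX x:model G. pr (q x) ~= 0")
  case True
  show ?thesis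
  proof (rule that[of "%x. pr (q x)"])
   show "linear (%x. pr (q x))" using linear_compose[OF lq pr(1)] by (simp add: o_def)
   show "pr (q x):model G & pr (q (pr (q x))) = pr (q x) & pr (q (t x)) = t (pr (q x))" if x: "x:model G" for x
   proof -
   have "q (pr (q x)) = pr (q x)" using comm[OF q(1)[OF x]] q(2)[OF x] by simp
   moreover have "pr (q (t x)) = t (pr (q x))" using prt(2)[OF x] prt(1)[OF pr(2)[OF x]] comm[OF x] by simp
   ultimately show ?thesis using pr(2,3)[OF q(1)[OF x]] by simp
   qed
   show "pr (q (ms x y)) = ms x (pr (q y))" if "x:model G" "y:model G" for x y
   using that qms[OF that] pms[OF that(1) q(1)[OF that(2)]] by simp
   show "pr (q X):alg" if "X:alg" for X using qalg[OF that] palg that by simp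
   show "EX x:model G. pr (q x) ~= x" using comm[OF ne(3)] pr(3)[OF q(1)[OF ne(3)]] ne(3,4) by (intro bexI[of _ v]) metis+
  qed (use True in blast)
 next
  \<comment> \<open>The product of the two projections vanishes, and the projection onto the
    complement of both ideals is used instead. It is not zero: on \<hh>, which is nonzero, the two
    projections agree and therefore vanish.\<close>
  case False
  then have z: "pr (q x) = 0" "q (pr x) = 0" if "x:model G" for x using that comm[OF that] by auto
  let ?S = "%x. x - pr x - q x"
  obtain X where X: "X:alg" "X ~= 0" using alg0 subspace_0[OF alg_subspace] by auto
  show ?thesis
  proof (rule that[of ?S])
   show "linear ?S" by (intro linear_compose_sub linear_ident pr(1) lq)
   show "?S x:model G & ?S (?S x) = ?S x & ?S (t x) = t (?S x)" if x: "x:model G" for x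
   using x pr q z subspace_diff[OF model] prt[OF x] by (simp add: linear_diff[OF pr(1)] linear_diff[OF lq] linear_diff[OF t(1)])
   show "?S (ms x y) = ms x (?S y)" if "x:model G" "y:model G" for x y
   using pms[OF that] qms[OF that] by (simp add: bilinear_rsub[OF ms(1)])
   show "?S Y:alg" if "Y:alg" for Y using palg[OF that] qalg[OF that] that by (auto intro!: subspace_diff[OF alg_subspace])
   have "pr X = 0" using qalg[OF X(1)] z(1)[OF alg_model[OF X(1)]] pr(3)[OF alg_model[OF X(1)]] by simp
   then show "EX x:model G. ?S x ~= 0" using X qalg[OF X(1)] alg_model by (intro bexI[of _ X]) auto
   have "?S (pr u) = 0" using pr(3)[OF ne(1)] z(2)[OF ne(1)] by simp
   then show "EX x:model G. ?S x ~= x" using ne(2) pr(2)[OF ne(1)] by (intro bexI[of _ "pr u"]) auto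
  qed
 qed
qed
end

text \<open>The curve \<open>e (c s)\<close> stays in \<open>L\<close>, and each of its points acts
  like some \<open>a s\<close> in \<open>H\<close>, chosen without any continuity. Commutation of
  these actions with \<open>t\<close> places the velocity in \<open>\<kk>\<close>, where the two
  brackets agree; then \<open>compact_tangent\<close> applies.\<close>

lemma (in dual_pair) ideal_projection_alg:
 assumes e: "smooth_map K K e" "e:hom K K" "e ` carrier L <= carrier L"
  and A: "!!c X. K.gvel c X ==> K.gvel (%t. e (c t)) (A X)" and X: "X:alg"
 shows "T' (A (T X)):alg"
proof -
 interpret e: group_hom K K e using e(2) K.group_axioms by (simp add: group_hom_defs)
 let ?Y = "T' (A (T X))"
 have "T X:subgroup_algebra K L" using X T_alg by blast
 then obtain d c where c: "K.H.intcurve (inv_into (model L) (diff_at_one L K (%x. x)) (T X)) d c" "K.intcurve (T X) d c" by (rule K.alg_curve)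
 have d: "0 < d" by (rule K.intcurveD(1)[OF c(2)])
 have g: "K.gvel (%s. e (c s)) (A (T X))" by (rule A[OF K.intcurve_gvel[OF c(2)]])
 have Am: "A (T X):model K" by (rule K.gvel_model[OF g])
 have Y: "?Y:model G" "T ?Y = A (T X)" using T(4)[OF Am] by auto
 have "EX a:carrier H. ALL w:model K. T' (Ad K (e (c s)) w) = Ad G a (T' w)" if "\<bar>s\<bar> < d" for s
  using Ad_bwd e(3) K.H.intcurve_carrier[OF c(1) that] by blast
 then obtain a where a: "!!s. \<bar>s\<bar> < d ==> a s:carrier H" "!!s w. \<bar>s\<bar> < d ==> w:model K ==> T' (Ad K (e (c s)) w) = Ad G (a s) (T' w)" by metis
 have aT: "Ad G (a s) v = T' (Ad K (e (c s)) (T v))" if "\<bar>s\<bar> < d" "v:model G" for s v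
  using a(2)[OF that(1), of "T v"] T(3)[OF that(2)] by simp
 have a0: "Ad G (a 0) v = v" if v: "v:model G" for v
  using aT[OF _ v, of 0] d K.intcurveD(3)[OF c(2)] K.Ad_one T(3)[OF v] by simp
 have lim: "((%s. Ad G (a s) v) hvd ms ?Y v) (at 0)" if v: "v:model G" for v
 proof -
  have "((%s. T' (Ad K (e (c s)) (T v))) hvd T' (lie_bracket K (A (T X)) (T v))) (at 0)"
   using T(3)[OF v] by (intro bounded_linear.has_vector_derivative[OF linear_bounded[OF T(2)]] K.Ad_derivative[OF g]) simp
  moreover have "T' (lie_bracket K (A (T X)) (T v)) = ms ?Y v"
   using K.br_eq[OF Am, of "T v"] T_ms[OF Y(1) v] T(3)[OF v] T(3)[OF ms(2)[of ?Y v]] by (simp add: Y(2))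
  ultimately have "((%s. T' (Ad K (e (c s)) (T v))) hvd ms ?Y v) (at 0)" by simp
  then show ?thesis
  proof (rule hvd_transform)
   show "open {-d<..<d}" "0:{-d<..<d}" using d by auto
   fix s assume "s:{-d<..<d}"
   then have "\<bar>s\<bar> < d" by auto
   then show "T' (Ad K (e (c s)) (T v)) = Ad G (a s) v" using aT v by simp
  qed
 qed
 have comm: "t (ms ?Y v) = ms ?Y (t v)" if v: "v:model G" for v
 proof (rule vector_derivative_unique_at)
  have "((%s. t (Ad G (a s) v)) hvd t (ms ?Y v)) (at 0)"
   by (rule bounded_linear.has_vector_derivative[OF linear_bounded[OF t(1)] lim[OF v]])
  then show "((%s. Ad G (a s) (t v)) hvd t (ms ?Y v)) (at 0)"
   by (rule hvd_transform[of _ _ _ "{-d<..<d}"]) (use d t_Ad[OF a(1) v] in "auto simp: abs_less_iff")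
 qed (rule lim[OF t_model])
 have "t ?Y - ?Y = 0"
 proof (rule ms_centerless)
  show "t ?Y - ?Y:model G" by (rule subspace_diff[OF model t_model Y(1)])
  fix v assume "v:model G"
  then have "t (t v) = v" using t(3) P(3) by simp
  then show "ms (t ?Y - ?Y) v = 0" using comm[OF t_model[of v]] t_ms[of ?Y "t v"] by (simp add: bilinear_lsub[OF ms(1)])
 qed
 then have Yk: "?Y:\<kk>" using Y(1) by (simp add: \<kk>_def)
 show ?thesis
 proof (rule compact_tangent[where a = a and dl = d])
  show "?Y:model G" "0 < d" by (fact Y(1) d)+
  show "a s:carrier H" if "\<bar>s\<bar> < d" for s by (rule a(1)[OF that])
  show "Ad G (a 0) v = v" if "v:model G" for v by (rule a0[OF that])
  show "((%s. Ad G (a s) v) hvd br ?Y v) (at 0)" if "v:model G" for v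
   using lim[OF that] ms_k[OF Yk that] by simp
 qed
qed

theorem (in dual_pair) dual_indecomposable:
 assumes sc: "simply_connected_space (topo G)" "simply_connected_space (topo K)" and ind: "indecomposable_pair G (carrier H)" and ne: "carrier H ~= {\<one>}"
 shows "indecomposable_pair K (carrier L)"
proof
 assume "decomposable_pair K (carrier L)"
 then obtain G1 G2 :: "('b, 'w) lie_structure" and f H1 H2 where G12: "lie_group G1" "lie_group G2" "carrier G1 ~= {\<one>\<^bsub>G1\<^esub>}" "carrier G2 ~= {\<one>\<^bsub>G2\<^esub>}"
  "lie_iso K (lie_prod G1 G2) f" and fL: "f ` carrier L = H1 \<times> H2" unfolding decomposable_pair_def by blast
 have L: "carrier L <= carrier K" "\<one>\<^bsub>K\<^esub>:carrier L" using K.HG K.i.hom_one K.H.one_closed by auto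
 obtain e1 e2 where e: "smooth_map K K e1" "e1:hom K K" "smooth_map K K e2" "e2:hom K K"
  and ee: "!!g. g:carrier K ==> e1 (e1 g) = e1 g & e1 (e2 g) = \<one>\<^bsub>K\<^esub> & e2 (e1 g) = \<one>\<^bsub>K\<^esub> & e1 g \<otimes>\<^bsub>K\<^esub> e2 g = g"
  and com: "!!g h. g:carrier K ==> h:carrier K ==> e1 h \<otimes>\<^bsub>K\<^esub> e2 g = e2 g \<otimes>\<^bsub>K\<^esub> e1 h"
  and eL: "e1 ` carrier L <= carrier L" and nt: "EX g:carrier K. e1 g ~= \<one>\<^bsub>K\<^esub>" "EX g:carrier K. e2 g ~= \<one>\<^bsub>K\<^esub>"
  by (rule K.product_projections[OF G12 L fL], rule that)
 interpret e1: group_hom K K e1 using e(2) K.group_axioms by (simp add: group_hom_defs)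
 interpret e2: group_hom K K e2 using e(4) K.group_axioms by (simp add: group_hom_defs)
 note lK = K.lie_axioms
 obtain A1 where A1: "linear A1" "!!c X. K.gvel c X ==> K.gvel (%t. e1 (c t)) (A1 X)" "!!X. X:model K ==> diff_at_one K K e1 X = A1 X"
  by (rule gvel_map[OF lK lK e(1) e1.hom_one], rule that)
 obtain A2 where A2: "!!c X. K.gvel c X ==> K.gvel (%t. e2 (c t)) (A2 X)" "!!X. X:model K ==> diff_at_one K K e2 X = A2 X"
  by (rule gvel_map[OF lK lK e(3) e2.hom_one], rule that)
 have near: "X = Y" if n: "K.gvel c X" "K.gvel (%t. u (b t)) Y" "K.gvel b Z" "!!g. g:carrier K ==> u g = w g" "c = (%t. w (b t))" for c X u b Y Z w
 proof -
  obtain d where d: "0 < d" "!!t. \<bar>t\<bar> < d ==> b t:carrier K" by (rule K.gvel_carrier[OF n(3)], rule that)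
  have "K.gvel c Y" by (rule K.gvel_transform[OF n(2) d(1)]) (use n(4,5) d(2) in simp)
  then show ?thesis by (rule K.gvel_unique[OF n(1)])
 qed
 have cv: "K.gvel (curve_at_one K X) X" if "X:model K" for X by (rule K.gvel_curve[OF that])
 have A1m: "A1 X:model K" if "X:model K" for X by (rule K.gvel_model[OF A1(2)[OF cv[OF that]]])
 have sum: "A1 X + A2 X = X" if X: "X:model K" for X
  by (rule near[OF cv[OF X] K.gvel_mult[OF A1(2) A2(1), OF cv[OF X] cv[OF X]] cv[OF X], symmetric]) (use ee in auto)
 have idem: "A1 (A1 X) = A1 X" if X: "X:model K" for X
  by (rule near[OF A1(2)[OF cv[OF X]] A1(2)[OF A1(2)[OF cv[OF X]]] cv[OF X], symmetric]) (use ee in auto)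
 \<comment> \<open>Conjugation by \<open>e2 g\<close> does not affect the image of
   \<open>e1\<close>, so \<open>g\<close> may be replaced by \<open>e1 g\<close>.\<close>
 have AdA: "A1 (Ad K g Y) = Ad K g (A1 Y)" if g: "g:carrier K" and Y: "Y:model K" for g Y
 proof (rule near[OF A1(2)[OF K.gvel_conj[OF g cv[OF Y]]] K.gvel_conj[OF g A1(2)[OF cv[OF Y]]] cv[OF Y] _ refl])
  fix x assume x: "x:carrier K"
  have c: "e1 g:carrier K" "e2 g:carrier K" "e1 x:carrier K" using g x by simp_all
  have "g \<otimes>\<^bsub>K\<^esub> e1 x = e1 g \<otimes>\<^bsub>K\<^esub> (e2 g \<otimes>\<^bsub>K\<^esub> e1 x)" using ee[OF g] c by (simp add: K.m_assoc[symmetric])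
  also have "... = e1 g \<otimes>\<^bsub>K\<^esub> e1 x \<otimes>\<^bsub>K\<^esub> inv\<^bsub>K\<^esub> (e1 g) \<otimes>\<^bsub>K\<^esub> (e1 g \<otimes>\<^bsub>K\<^esub> e2 g)"
   using com[OF g x] c by (simp add: K.m_assoc K.inv_solve_left) (simp add: K.m_assoc[symmetric])
  finally show "g \<otimes>\<^bsub>K\<^esub> e1 x \<otimes>\<^bsub>K\<^esub> inv\<^bsub>K\<^esub> g = e1 (g \<otimes>\<^bsub>K\<^esub> x \<otimes>\<^bsub>K\<^esub> inv\<^bsub>K\<^esub> g)" using ee[OF g] c g x by (simp add: K.m_assoc)
 qed
 have brA: "A1 (K.br X Y) = K.br X (A1 Y)" if X: "X:model K" and Y: "Y:model K" for X Y
 proof (rule vector_derivative_unique_at)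
  obtain d where d: "0 < d" "!!t. \<bar>t\<bar> < d ==> curve_at_one K X t:carrier K" by (rule K.gvel_carrier[OF cv[OF X]], rule that)
  show "((%t. Ad K (curve_at_one K X t) (A1 Y)) hvd K.br X (A1 Y)) (at 0)"
   using K.Ad_derivative[OF cv[OF X] A1m[OF Y]] by (simp add: K.br_eq X A1m Y)
  have "((%t. A1 (Ad K (curve_at_one K X t) Y)) hvd A1 (K.br X Y)) (at 0)"
   using bounded_linear.has_vector_derivative[OF linear_bounded[OF A1(1)] K.Ad_derivative[OF cv[OF X] Y]] by (simp add: K.br_eq X Y)
  then show "((%t. Ad K (curve_at_one K X t) (A1 Y)) hvd A1 (K.br X Y)) (at 0)"
   by (rule hvd_transform[of _ _ _ "{-d<..<d}"]) (use d AdA[OF _ Y] in "auto simp: abs_less_iff")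
 qed
 have conK: "connected_space (topo K)" using sc(2) path_connected_imp_connected_space by (auto simp: simply_connected_space_def)
 \<comment> \<open>A nontrivial factor must show in the Lie algebra: if \<open>w\<close> has the
   identity as differential, its kernel is trivial near the identity, and this kernel contains the
   image of \<open>u\<close>; by connectedness \<open>u\<close> is trivial.\<close>
 have triv: "u g = \<one>\<^bsub>K\<^esub>" if u: "smooth_map K K u" "u:hom K K" and w: "smooth_map K K w" "w:hom K K" "!!g. g:carrier K ==> w (u g) = \<one>\<^bsub>K\<^esub>"
  and inj: "!!X. X:model K ==> diff_at_one K K w X = X" and g: "g:carrier K" for u w g
 proof -
  interpret u: group_hom K K u using u(2) K.group_axioms by (simp add: group_hom_defs)
  obtain W where W: "openin (topo K) W" "\<one>\<^bsub>K\<^esub>:W" "!!g. g:W ==> w g = \<one>\<^bsub>K\<^esub> ==> g = \<one>\<^bsub>K\<^esub>"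
   by (rule local_injective_hom[OF lK lK w(1,2)]) (use inj in auto)
  have "continuous_map (topo K) (topo K) u" using u(1) unfolding smooth_map_def by (rule conjunct1)
  then have o: "openin (topo K) {g:topspace (topo K). u g:W}" by (rule openin_continuous_map_preimage[OF _ W(1)])
  show ?thesis
   by (rule K.neighborhood_induct[OF conK o _ g]) (use W w(3) in "auto simp: K.topspace")
 qed
 have "EX X:model K. A1 X ~= 0"
 proof (rule ccontr)
  assume "~ ?thesis"
  then have "diff_at_one K K e2 X = X" if "X:model K" for X using sum[OF that] that A2(2) by simp
  from triv[OF e _ this] ee nt(1) show False by blast
 qed
 then obtain U where U: "U:model K" "A1 U ~= 0" by blast
 have "EX X:model K. A1 X ~= X"
 proof (rule ccontr)
  assume "~ ?thesis"
  then have "diff_at_one K K e1 X = X" if "X:model K" for X using that A1(3) by simp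
  from triv[OF e(3,4,1,2) _ this] ee nt(2) show False by blast
 qed
 then obtain U' where U': "U':model K" "A1 U' ~= U'" by blast
 have alg0: "alg ~= {0}"
 proof
  assume a: "alg = {0}"
  have "{\<one>\<^bsub>H\<^esub>} = carrier H"
  proof (rule H.generated_by_curves[OF con_H])
   fix X assume X: "X:model H"
   then have "io X = 0" using a by (auto simp: subgroup_algebra_def)
   then have "X = 0" by (rule io_eq_0[OF X])
   then show "EX c. H.gvel c X & range c <= {\<one>\<^bsub>H\<^esub>}" using H.gvel_const by auto
  qed (use H.one_closed in "simp_all del: i.hom_one")
  then show False using ne i.hom_one by simp
 qed
 define pr where "pr x = T' (A1 (T x))" for x
 have pl: "linear pr" unfolding pr_def using linear_compose[OF linear_compose[OF T(1) A1(1)] T(2)] by (simp add: o_def)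
 have Tpr: "T (pr x) = A1 (T x)" "pr x:model G" if "x:model G" for x using T(3)[OF that] T(4)[OF A1m[of "T x"]] by (auto simp: pr_def)
 have pp: "pr (pr x) = pr x" if "x:model G" for x using Tpr(1)[OF that] idem[of "T x"] T(3)[OF that] by (simp add: pr_def)
 have pms: "pr (ms x y) = ms x (pr y)" if "x:model G" "y:model G" for x y
 proof -
  have "A1 (T (ms x y)) = T (ms x (pr y))" using brA[of "T x" "T y"] T(3) that T_ms[OF that] T_ms[OF that(1) Tpr(2)[OF that(2)]] Tpr(1)[OF that(2)] by simp
  then show ?thesis using T(3)[OF ms(2)] by (simp add: pr_def)
 qed
 have palg: "pr X:alg" if "X:alg" for X unfolding pr_def by (rule ideal_projection_alg[OF e(1,2) eL A1(2) that])
 have u: "T' U:model G" "pr (T' U) ~= 0" "T' U':model G" "pr (T' U') ~= T' U'"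
 proof -
  show "T' U:model G" "T' U':model G" using T(4) U U' by auto
  show "pr (T' U) ~= 0" using T(4)[OF U(1)] T(4)[OF A1m[OF U(1)]] U(2) linear_0[OF T(1)] by (auto simp: pr_def)
  show "pr (T' U') ~= T' U'" using T(4)[OF U'(1)] T(4)[OF A1m[OF U'(1)]] U'(2) by (metis pr_def)
 qed
 obtain S where S: "linear S" "!!x. x:model G ==> S x:model G & S (S x) = S x & S (t x) = t (S x)"
  "!!x y. x:model G ==> y:model G ==> S (ms x y) = ms x (S y)" "!!X. X:alg ==> S X:alg"
  "EX x:model G. S x ~= 0" "EX x:model G. S x ~= x"
  by (rule invariant_projection[OF pl Tpr(2) pp pms palg u alg0], assumption+, rule that)
 have Spk: "S (pk x) = pk (S x)" "S (pp x) = pp (S x)" if "x:model G" for x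
  using S(2)[OF that] that by (simp_all add: pk_def pp_def P(3) linear_scale[OF S(1)] linear_add[OF S(1)] linear_diff[OF S(1)])
 \<comment> \<open>The bracket of \<gg> is recovered from \<open>ms\<close> and the projections
   \<open>pk\<close> and \<open>pp\<close>; as \<open>S\<close> commutes with these, it is linear
   over \<open>br\<close> as well.\<close>
 have br_ms: "br x y = ms (pk x) y + ms (pp x) (pk y) - ms (pp x) (pp y)" if x: "x:model G" and y: "y:model G" for x y
 proof -
  have pkk: "pk (pk z) = pk z" "pp (pk z) = 0" "pp (pp z) = pp z" "pk (pp z) = 0" for z
   using pk_pp(6)[OF pk_pp(3)] pk_pp(7)[OF pk_pp(4)] by auto
  have "ms (pp x) (pk y) = br (pp x) (pk y)" "ms (pp x) (pp y) = - br (pp x) (pp y)"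
   by (simp_all add: ms_def pkk bilinear_lzero[OF br_bilinear] bilinear_rzero[OF br_bilinear])
  moreover have "br x y = br (pk x) y + br (pp x) y" using bilinear_ladd[OF br_bilinear, of "pk x" "pp x" y] pk_pp(5)[OF x] by simp
  moreover have "br (pp x) y = br (pp x) (pk y) + br (pp x) (pp y)"
   using bilinear_radd[OF br_bilinear, of "pp x" "pk y" "pp y"] pk_pp(5)[OF y] by simp
  ultimately show ?thesis using ms_k[OF pk_pp(3)[of x] y] by simp
 qed
 have Sbr: "S (br x y) = br x (S y)" if "x:model G" "y:model G" for x y
  using that S(2)[OF that(2)] by (simp add: br_ms linear_add[OF S(1)] linear_diff[OF S(1)] S(3) pk_model Spk)
 define a where "a = {x:model G. S x = x}"
 define b where "b = {x:model G. S x = 0}"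
 have s: "subspace a" "subspace b" unfolding a_def b_def subspace_def using model
  by (auto simp: linear_0[OF S(1)] linear_add[OF S(1)] linear_scale[OF S(1)] subspace_0 subspace_add subspace_scale)
 have dec: "S x:a" "x - S x:b" if "x:model G" for x
  using S(2)[OF that] that subspace_diff[OF model] by (auto simp: a_def b_def linear_diff[OF S(1)])
 have "x:{X + Y |X Y. X:a & Y:b}" if "x:model G" for x using dec[OF that] by force
 moreover have "X + Y:model G" if "X:a" "Y:b" for X Y using that subspace_add[OF model] by (simp add: a_def b_def)
 ultimately have "model G = {X + Y |X Y. X:a & Y:b}" by (intro equalityI subsetI) auto
 moreover have "a Int b = {0}" using subspace_0[OF s(1)] subspace_0[OF s(2)] by (auto simp: a_def b_def)
 ultimately have ds: "direct_sum (model G) a b" using s by (simp add: direct_sum_def)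
 \<comment> \<open>Taken in one order the bracket is annihilated by \<open>S\<close>, in the other
   it is fixed by \<open>S\<close>; antisymmetry leaves only 0.\<close>
 have c1: "br X Y = 0" if "X:a" "Y:b" for X Y
 proof -
  have m: "X:model G" "Y:model G" "S X = X" "S Y = 0" using that by (auto simp: a_def b_def)
  have "S (br X Y) = 0" "S (br Y X) = br Y X" using Sbr[OF m(1,2)] Sbr[OF m(2,1)] m by (auto simp: bilinear_rzero[OF br_bilinear])
  then show ?thesis using anti[of X Y] by (simp add: linear_neg[OF S(1)])
 qed
 have c2: "br Y X = 0" if "X:a" "Y:b" for X Y unfolding anti[of Y X] c1[OF that] by simp
 have "split_lie G a b"
  by (rule split_lie.intro[OF killing_lie_axioms], rule split_lie_axioms.intro[OF sc(1) ds]) (fact c1 c2)+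
 then interpret sl: split_lie G a b .
 have "decomposable_pair G (carrier H)"
 proof (rule sl.split_decomposable[OF sub con_H])
  obtain x y where "x:model G" "S x ~= 0" "y:model G" "S y ~= y" using S(5,6) by blast
  then show "a ~= {0}" "b ~= {0}" using dec by auto
  show "EX X1:a Int alg. EX X2:b Int alg. X = X1 + X2" if X: "X:alg" for X
   using dec[OF alg_model[OF X]] S(4)[OF X] X subspace_diff[OF alg_subspace X S(4)[OF X]] by (intro bexI[of _ "S X"] bexI[of _ "X - S X"]) auto
 qed
 then show False using ind by blast
qed

theorem proposition4p1:
  fixes G H :: "('a, 'v::euclidean_space) lie_structure"
  assumes "lie_group G"
    and "simply_connected_space (topo G)"
    and "semisimple (model G) (lie_bracket G)"
    and "lie_subgroup G H"
    and "compact_space (topo H)"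
    and "connected_space (topo H)"
    and "indecomposable_pair G (carrier H)"
    and "polar_isotropy G H"
  shows "\<exists>k p. cartan_decomposition (model G) (lie_bracket G) k p \<and>
           subgroup_algebra G H \<subseteq> k \<and>
           (\<forall>(Gs :: ('b, 'w::euclidean_space) lie_structure) (Hs :: ('b, 'w) lie_structure) F.
              lie_group Gs \<and> simply_connected_space (topo Gs) \<and>
              lie_algebra_iso (k \<times> p) (complexified_bracket (lie_bracket G))
                (model Gs) (lie_bracket Gs) F \<and>
              lie_subgroup Gs Hs \<and> connected_space (topo Hs) \<and>
              subgroup_algebra Gs Hs = F ` (subgroup_algebra G H \<times> {0})
              \<longrightarrow> polar_isotropy Gs Hs \<and>
                  (carrier H \<noteq> {\<one>\<^bsub>G\<^esub>} \<longrightarrow> indecomposable_pair Gs (carrier Hs)))"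
proof -
 have lG: "lie G" using assms(1) by (simp add: lie_def lie_axioms_def lie_group_def)
 note ss = lie.semisimple_br[OF lG assms(3)]
 interpret compact_pair G H
  by (rule compact_pair.intro[OF lie_pair.intro[OF lG lie_pair_axioms.intro[OF assms(4,6)]] ss(2) compact_pair_axioms.intro[OF assms(5) ss(1)]])
 obtain t where t: "linear t" "!!x. P (t x) = t x" "!!x. t (t x) = P x" "!!x y. t (br x y) = br (t x) (t y)"
  "!!h x. h:carrier H ==> x:model G ==> t (Ad G h x) = Ad G h (t x)" "!!x. P x ~= 0 ==> kp br x (t x) < 0"
  using cartan_involution(2) by blast
 interpret cartan_pair G H t by (rule cartan_pair.intro[OF compact_pair_axioms cartan_pair_axioms.intro[OF t]])
 have "polar_isotropy Gs Hs & (carrier H ~= {\<one>\<^bsub>G\<^esub>} --> indecomposable_pair Gs (carrier Hs))"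
  if Gs: "lie_group Gs" "simply_connected_space (topo Gs)" and iso: "lie_algebra_iso (\<kk> \<times> \<pp>) (complexified_bracket (lie_bracket G)) (model Gs) (lie_bracket Gs) F"
   and Hs: "lie_subgroup Gs Hs" "connected_space (topo Hs)" "subgroup_algebra Gs Hs = F ` (alg \<times> {0})"
  for Gs Hs :: "('b, 'w) lie_structure" and F
 proof -
  have lK: "lie Gs" using Gs(1) by (simp add: lie_def lie_axioms_def lie_group_def)
  interpret K: lie_pair Gs Hs by (rule lie_pair.intro[OF lK lie_pair_axioms.intro[OF Hs(1,2)]])
  have F: "linear F" "bij_betw F (\<kk> \<times> \<pp>) (model Gs)"
   "!!X Y. X:\<kk> \<times> \<pp> ==> Y:\<kk> \<times> \<pp> ==> F (complexified_bracket (lie_bracket G) X Y) = lie_bracket Gs (F X) (F Y)"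
   using iso by (auto simp: lie_algebra_iso_def)
  \<comment> \<open>As a vector space, \<open>\<kk> + i\<pp>\<close> is identified with \<gg> by
    dropping \<open>i\<close>, so that both brackets live on one space.\<close>
  define T where "T x = F (pk x, pp x)" for x
  have Tl: "linear T" unfolding T_def
   by (auto intro!: linearI simp: linear_add[OF pk_pp(1)] linear_add[OF pk_pp(2)] linear_scale[OF pk_pp(1)] linear_scale[OF pk_pp(2)]
   linear_add[OF F(1), symmetric] linear_scale[OF F(1), symmetric])
  have m: "(pk x, pp x):\<kk> \<times> \<pp>" for x using pk_pp(3,4) by simp
  have Tm: "T x:model Gs" for x using bij_betwE[OF F(2)] m by (auto simp: T_def)
  have "inj_on T (model G)"
  proof (rule inj_onI)
   fix x y assume xy: "x:model G" "y:model G" "T x = T y"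
   have "(pk x, pp x) = (pk y, pp y)" by (rule inj_onD[OF bij_betw_imp_inj_on[OF F(2)] _ m m]) (use xy(3) in "simp add: T_def")
   then show "x = y" using pk_pp(5)[OF xy(1)] pk_pp(5)[OF xy(2)] by (metis Pair_inject)
  qed
  then obtain T' where T': "range T' <= model G" "linear T'" "ALL x:model G. T' (T x) = x"
   using linear_exists_left_inverse_on[OF Tl model] by blast
  have TT: "T' y:model G & T (T' y) = y" if y: "y:model Gs" for y
  proof -
   obtain u w where uw: "u:\<kk>" "w:\<pp>" "y = F (u, w)" using y unfolding bij_betw_imp_surj_on[OF F(2), symmetric] by auto
   have x: "u + w:model G" using uw kp_sub(3,4) by (auto intro: subspace_add[OF model])
   have "T (u + w) = y" using pk_pp(6)[OF uw(1)] pk_pp(7)[OF uw(2)] by (simp add: T_def uw(3) linear_add[OF pk_pp(1)] linear_add[OF pk_pp(2)])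
   then show ?thesis using T'(3) x by auto
  qed
  have km: "pk x:model G" "pp x:model G" for x using pk_pp(3,4) kp_sub(3,4) by blast+
  have Tbr: "K.br (T x) (T y) = T (br (pk x) (pk y) - br (pp x) (pp y) + (br (pk x) (pp y) + br (pp x) (pk y)))" (is "_ = T (?u + ?w)") for x y
  proof -
   have "?u:\<kk>" "?w:\<pp>" using kp_br pk_pp(3,4) kp_sub(1,2) by (auto intro: subspace_diff subspace_add)
   from pk_pp(6)[OF this(1)] pk_pp(7)[OF this(2)] have "T (?u + ?w) = F (?u, ?w)"
   by (simp add: T_def linear_add[OF pk_pp(1)] linear_add[OF pk_pp(2)])
   then show ?thesis using F(3)[OF m m, of x y] by (simp add: complexified_bracket_def br_eq km K.br_eq Tm) (simp add: T_def)
  qed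
  have Talg: "subgroup_algebra Gs Hs = T ` alg"
   unfolding Hs(3) using alg_k pk_pp(6) by (force simp: T_def image_iff)
  interpret dual_pair G H t Gs Hs T T'
   by (rule dual_pair.intro[OF cartan_pair_axioms K.lie_pair_axioms dual_pair_axioms.intro[OF Tl T'(2) _ TT Tbr Talg]]) (use Tm T'(3) in auto)
  show ?thesis using dual_polar[OF assms(8)] dual_indecomposable[OF assms(2) Gs(2) assms(7)] by blast
 qed
 then show ?thesis using cartan alg_k by (intro exI[of _ \<kk>] exI[of _ \<pp>]) blast
qed
end
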